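(* Let $Z$ be a two-dimensional topological manifold with countable base and $\Delta$ a one-dimensional foliation on $Z$ such that each connected component of $\partial Z$ is a leaf of $\Delta$, and each leaf of $\Delta$ is homeomorphic to $\mathbb{R}$ and is a closed subset of $Z$. Suppose that the family of singular leaves of $\Delta$ is locally finite, and each leaf of $\Delta$ contained in $\operatorname{Int} Z$ admits a cross section. Then each leaf of $\Delta$ contained in $\partial Z$ also admits a cross section, and $(Z,\Delta)$ is a striped surface.
   Context: Let $p:Z\to Z/\Delta$ be the map sending a point to the leaf containing it. For $a<b$ and $J=[a,b)$ or $J=(a,b)$, a continuous map $\gamma:J\to Z$ with $\gamma(a)\in\partial Z$ whenever $a\in J$ is a cross section of $\Delta$ if $p\circ\gamma$ is injective (distinct parameters go to distinct leaves); a leaf $\omega$ admits a cross section if some cross section has image meeting $\omega$. A leaf $\omega\subset \operatorname{Int} Z$ is regular if there is a saturated neighbourhood $U$ of $\omega$ (a union of leaves) such that $(\overline{U},U)$ is foliated homeomorphic (leaves to leaves) to $(\mathbb{R}\times[-1,1],\mathbb{R}\times(-1,1))$ foliated by horizontal lines, with $\omega$ going to $\mathbb{R}\times 0$; a leaf $\omega\subset\partial Z$ is regular if there is such $U$ with $(\overline{U},U)$ foliated homeomorphic to $(\mathbb{R}\times[0,1],\mathbb{R}\times[0,1))$ with $\omega$ going to $\mathbb{R}\times 0$. Non-regular leaves are singular. A strip is $S\subset\mathbb{R}^2$ with $\mathbb{R}\times(u,v)\subset S\subset\mathbb{R}\times[u,v]$ for some $u<v$, $S$ open in $\mathbb{R}\times[u,v]$;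 its boundary $\partial S=S\cap(\mathbb{R}\times\{u,v\})$ is a disjoint union of open intervals (boundary intervals); its canonical foliation consists of the lines $\mathbb{R}\times\{t\}$, $t\in(u,v)$, and the boundary intervals. A striped atlas on $Z$ is a quotient map $q:\bigsqcup_{\lambda\in\Lambda}S_\lambda\to Z$ from an at most countable disjoint union of strips, together with two disjoint families $\{X_\gamma\}_{\gamma\in\Gamma}$, $\{Y_\gamma\}_{\gamma\in\Gamma}$ of mutually distinct boundary intervals such that $q$ is injective off $\bigcup_\gamma(X_\gamma\cup Y_\gamma)$, $q(X_\gamma)=q(Y_\gamma)$, and $q|_{X_\gamma}$, $q|_{Y_\gamma}$ are embeddings with closed images. $(Z,\Delta)$ is a striped surface if it has a striped atlas whose induced foliation (images of leaves of the canonical foliations of the strips) is $\Delta$. *)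

theory Defs
  imports "HOL-Analysis.Analysis"
begin

definition half_plane :: "(real \<times> real) set" where
  "half_plane = {p. 0 \<le> snd p}"

definition surface_with_boundary :: "'a topology \<Rightarrow> bool" where
  "surface_with_boundary Z \<longleftrightarrow> Hausdorff_space Z \<and> second_countable Z \<and>
     (\<forall>z\<in>topspace Z. \<exists>U V. openin Z U \<and> z \<in> U \<and>
        openin (subtopology euclidean half_plane) V \<and>
        subtopology Z U homeomorphic_space subtopology (euclidean :: (real \<times> real) topology) V)"

definition manifold_interior :: "'a topology \<Rightarrow> 'a set" where
  "manifold_interior Z = {z \<in> topspace Z. \<exists>U V. openin Z U \<and> z \<in> U \<and>
        open (V :: (real \<times> real) set) \<and>
        subtopology Z U homeomorphic_space subtopology euclidean V}"

definition manifold_boundary :: "'a topology \<Rightarrow> 'a set" where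
  "manifold_boundary Z = topspace Z - manifold_interior Z"

definition induced_partition :: "'a topology \<Rightarrow> 'a set set \<Rightarrow> 'a set \<Rightarrow> 'a set set" where
  "induced_partition Z \<Delta> A =
     {C. \<exists>\<omega>\<in>\<Delta>. C \<in> connected_components_of (subtopology Z (\<omega> \<inter> A))}"

definition foliation :: "'a topology \<Rightarrow> 'a set set \<Rightarrow> bool" where
  "foliation Z \<Delta> \<longleftrightarrow>
     (\<forall>\<omega>\<in>\<Delta>. \<omega> \<noteq> {} \<and> connectedin Z \<omega>) \<and> \<Union>\<Delta> = topspace Z \<and> pairwise disjnt \<Delta> \<and>
     (\<forall>z\<in>topspace Z. \<exists>U h J. openin Z U \<and> z \<in> U \<and>
        (J = {-1<..<(1::real)} \<or> J = {0..<(1::real)}) \<and>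
        homeomorphic_map (subtopology Z U)
          (subtopology (euclidean :: (real \<times> real) topology) ({-1<..<1} \<times> J)) h \<and>
        (\<lambda>C. h ` C) ` induced_partition Z \<Delta> U = {{-1<..<1} \<times> {t} | t. t \<in> J})"

definition saturated :: "'a set set \<Rightarrow> 'a set \<Rightarrow> bool" where
  "saturated \<Delta> U \<longleftrightarrow> (\<forall>\<omega>\<in>\<Delta>. \<omega> \<inter> U \<noteq> {} \<longrightarrow> \<omega> \<subseteq> U)"

definition cross_section :: "'a topology \<Rightarrow> 'a set set \<Rightarrow> real set \<Rightarrow> (real \<Rightarrow> 'a) \<Rightarrow> bool" where
  "cross_section Z \<Delta> J \<gamma> \<longleftrightarrow>
     (\<exists>a b. a < b \<and> ((J = {a..<b} \<and> \<gamma> a \<in> manifold_boundary Z) \<or> J = {a<..<b})) \<and>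
     continuous_map (subtopology euclideanreal J) Z \<gamma> \<and>
     (\<forall>s\<in>J. \<forall>t\<in>J. s \<noteq> t \<longrightarrow> \<not> (\<exists>\<omega>\<in>\<Delta>. \<gamma> s \<in> \<omega> \<and> \<gamma> t \<in> \<omega>))"

definition admits_cross_section :: "'a topology \<Rightarrow> 'a set set \<Rightarrow> 'a set \<Rightarrow> bool" where
  "admits_cross_section Z \<Delta> \<omega> \<longleftrightarrow> (\<exists>J \<gamma>. cross_section Z \<Delta> J \<gamma> \<and> \<gamma> ` J \<inter> \<omega> \<noteq> {})"

definition regular_leaf :: "'a topology \<Rightarrow> 'a set set \<Rightarrow> 'a set \<Rightarrow> bool" where
  "regular_leaf Z \<Delta> \<omega> \<longleftrightarrow> \<omega> \<in> \<Delta> \<and>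
     ((\<omega> \<subseteq> manifold_interior Z \<and>
       (\<exists>U h. U \<subseteq> topspace Z \<and> saturated \<Delta> U \<and> \<omega> \<subseteq> Z interior_of U \<and>
          homeomorphic_map (subtopology Z (Z closure_of U))
            (subtopology (euclidean :: (real \<times> real) topology) (UNIV \<times> {-1..1})) h \<and>
          h ` U = UNIV \<times> {-1<..<1} \<and>
          (\<lambda>C. h ` C) ` induced_partition Z \<Delta> (Z closure_of U) = {UNIV \<times> {t} | t. t \<in> {-1..1}} \<and>
          h ` \<omega> = UNIV \<times> {0}))
    \<or> (\<omega> \<subseteq> manifold_boundary Z \<and>
       (\<exists>U h. U \<subseteq> topspace Z \<and> saturated \<Delta> U \<and> \<omega> \<subseteq> Z interior_of U \<and>
          homeomorphic_map (subtopology Z (Z closure_of U))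
            (subtopology (euclidean :: (real \<times> real) topology) (UNIV \<times> {0..1})) h \<and>
          h ` U = UNIV \<times> {0..<1} \<and>
          (\<lambda>C. h ` C) ` induced_partition Z \<Delta> (Z closure_of U) = {UNIV \<times> {t} | t. t \<in> {0..1}} \<and>
          h ` \<omega> = UNIV \<times> {0})))"

definition singular_leaves :: "'a topology \<Rightarrow> 'a set set \<Rightarrow> 'a set set" where
  "singular_leaves Z \<Delta> = {\<omega> \<in> \<Delta>. \<not> regular_leaf Z \<Delta> \<omega>}"

definition strip :: "(real \<times> real) set \<Rightarrow> bool" where
  "strip S \<longleftrightarrow> (\<exists>u v. u < v \<and> UNIV \<times> {u<..<v} \<subseteq> S \<and> S \<subseteq> UNIV \<times> {u..v} \<and>
      openin (subtopology euclidean (UNIV \<times> {u..v})) S)"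

definition strip_lo :: "(real \<times> real) set \<Rightarrow> real" where
  "strip_lo S = Inf (snd ` S)"

definition strip_hi :: "(real \<times> real) set \<Rightarrow> real" where
  "strip_hi S = Sup (snd ` S)"

definition strip_boundary :: "(real \<times> real) set \<Rightarrow> (real \<times> real) set" where
  "strip_boundary S = S \<inter> (UNIV \<times> {strip_lo S, strip_hi S})"

definition boundary_intervals :: "(real \<times> real) set \<Rightarrow> (real \<times> real) set set" where
  "boundary_intervals S = connected_components_of (subtopology euclidean (strip_boundary S))"

definition canonical_foliation :: "(real \<times> real) set \<Rightarrow> (real \<times> real) set set" where
  "canonical_foliation S =
     {UNIV \<times> {t} | t. t \<in> {strip_lo S<..<strip_hi S}} \<union> boundary_intervals S"

definition strips_union :: "nat set \<Rightarrow> (nat \<Rightarrow> (real \<times> real) set) \<Rightarrow> (nat \<times> (real \<times> real)) topology" where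
  "strips_union \<Lambda> S = sum_topology (\<lambda>i. subtopology euclidean (S i)) \<Lambda>"

definition all_boundary_intervals :: "nat set \<Rightarrow> (nat \<Rightarrow> (real \<times> real) set) \<Rightarrow> (nat \<times> (real \<times> real)) set set" where
  "all_boundary_intervals \<Lambda> S = {{i} \<times> I | i I. i \<in> \<Lambda> \<and> I \<in> boundary_intervals (S i)}"

definition striped_atlas ::
  "'a topology \<Rightarrow> nat set \<Rightarrow> (nat \<Rightarrow> (real \<times> real) set) \<Rightarrow> (nat \<times> (real \<times> real) \<Rightarrow> 'a)
    \<Rightarrow> nat set \<Rightarrow> (nat \<Rightarrow> (nat \<times> (real \<times> real)) set) \<Rightarrow> (nat \<Rightarrow> (nat \<times> (real \<times> real)) set) \<Rightarrow> bool" where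
  "striped_atlas Z \<Lambda> S q \<Gamma> X Y \<longleftrightarrow>
     (\<forall>i\<in>\<Lambda>. strip (S i)) \<and>
     quotient_map (strips_union \<Lambda> S) Z q \<and>
     (\<forall>\<gamma>\<in>\<Gamma>. X \<gamma> \<in> all_boundary_intervals \<Lambda> S \<and> Y \<gamma> \<in> all_boundary_intervals \<Lambda> S) \<and>
     inj_on X \<Gamma> \<and> inj_on Y \<Gamma> \<and> X ` \<Gamma> \<inter> Y ` \<Gamma> = {} \<and>
     inj_on q (topspace (strips_union \<Lambda> S) - (\<Union>\<gamma>\<in>\<Gamma>. X \<gamma> \<union> Y \<gamma>)) \<and>
     (\<forall>\<gamma>\<in>\<Gamma>. q ` X \<gamma> = q ` Y \<gamma> \<and>
        embedding_map (subtopology (strips_union \<Lambda> S) (X \<gamma>)) Z q \<and>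
        embedding_map (subtopology (strips_union \<Lambda> S) (Y \<gamma>)) Z q \<and>
        closedin Z (q ` X \<gamma>) \<and> closedin Z (q ` Y \<gamma>))"

definition atlas_foliation ::
  "nat set \<Rightarrow> (nat \<Rightarrow> (real \<times> real) set) \<Rightarrow> (nat \<times> (real \<times> real) \<Rightarrow> 'a) \<Rightarrow> 'a set set" where
  "atlas_foliation \<Lambda> S q = {q ` ({i} \<times> L) | i L. i \<in> \<Lambda> \<and> L \<in> canonical_foliation (S i)}"

definition striped_surface :: "'a topology \<Rightarrow> 'a set set \<Rightarrow> bool" where
  "striped_surface Z \<Delta> \<longleftrightarrow>
     (\<exists>\<Lambda> S q \<Gamma> X Y. striped_atlas Z \<Lambda> S q \<Gamma> X Y \<and> atlas_foliation \<Lambda> S q = \<Delta>)"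

end

theory Submission
  imports Defs
begin

text \<open>Call a leaf special if it is singular or lies in the boundary. A leaf that is not special has closed product
  neighbourhoods, hence is separated from every other leaf. It follows that a short transversal arc issuing from a
  special leaf meets every leaf at most once. One can therefore add a locally finite family of regular leaves to the
  special ones so that each component of the complement is the saturation of one transversal arc, i.e. has leaf space
  (0,1). Along the leaves of such a component put a positive density of finite total mass that extends continuously to
  the adjacent special leaves; if m is the mass of a leaf and g the mass before a point, then ln g - ln (m - g)
  maps every leaf homeomorphically onto the real line and sends the adjacent special leaves to intervals in the boundary
  of the strip. Each special leaf in the interior is approached from exactly two sides, and this gives the
  gluing. The transversal arcs at the boundary are the cross sections of the boundary leaves.\<close>


section \<open>Open embeddings and one-dimensional monotonicity\<close>

text \<open>A piece is a line bundle over an interval and hence trivial, but an arbitrary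
  trivialization need not extend to the cut leaves at its ends; measuring each leaf by the mass
  before a point is canonical enough to extend. Two obstacles shape the bookkeeping. Several cut
  leaves may lie at the same end of the leaf parameter, so there each of them may fill only a
  subinterval of (0, total mass), and the boundary of the strip is an open subset of a line. And one
  piece may approach a cut leaf from both sides, so a point of the surface does not determine a
  point of the strip; statements about an end are therefore made for a chart together with a side,
  or obtained as limits from regular leaves. The density is a series over a countable family of
  boxes with factors \<open>(1/2)^k\<close>, which make convergence uniform; only its primitive
  along the leaves appears, so no integration is used. Strict positivity comes from demanding that
  the inner halves of the boxes cover. The formula \<open>ln g - ln (m - g)\<close> is the logit of
  the relative mass \<open>g / m\<close>.\<close>

definition open_embedding :: "'a topology => (real \<times> real) set => (real \<times> real => 'a) => bool" where
  "open_embedding Z A c \<longleftrightarrow> continuous_map (top_of_set A) Z c \<and> inj_on c A \<and>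
     (\<forall>B. openin (top_of_set A) B --> openin Z (c ` B))"

lemma open_embeddingD:
  assumes "open_embedding Z A c"
  shows "continuous_map (top_of_set A) Z c" "inj_on c A"
    "\<And>B. openin (top_of_set A) B ==> openin Z (c ` B)" "openin Z (c ` A)"
  using assms by (auto simp: open_embedding_def)

lemma open_embedding_subset:
  assumes "open_embedding Z A c" "openin (top_of_set A) B"
  shows "open_embedding Z B c"
proof -
  have BA: "B \<subseteq> A"
    using assms(2) openin_imp_subset by blast
  show ?thesis
    unfolding open_embedding_def
  proof (intro conjI allI impI)
    show "continuous_map (top_of_set B) Z c"
      using assms(1) BA continuous_map_from_subtopology_mono open_embeddingD(1) by blast
    show "inj_on c B"
      by (rule inj_on_subset[OF open_embeddingD(2)[OF assms(1)] BA])
    show "openin Z (c ` D)" if "openin (top_of_set B) D" for D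
      using assms that openin_trans open_embeddingD(3) by blast
  qed
qed

lemma open_embedding_homeomorphic_map:
  assumes "open_embedding Z A c"
  shows "homeomorphic_map (top_of_set A) (subtopology Z (c ` A)) c"
proof (rule bijective_open_imp_homeomorphic_map)
  show "continuous_map (top_of_set A) (subtopology Z (c ` A)) c"
    using assms by (simp add: continuous_map_in_subtopology open_embedding_def)
  show "open_map (top_of_set A) (subtopology Z (c ` A)) c"
    unfolding open_map_def
    by (metis assms image_mono open_embeddingD(3) openin_imp_subset subset_openin_subtopology)
  have "c ` A \<subseteq> topspace Z"
    using assms openin_subset open_embeddingD(4) by blast
  then show "c ` topspace (top_of_set A) = topspace (subtopology Z (c ` A))" by auto
  show "inj_on c (topspace (top_of_set A))"
    using assms by (simp add: open_embedding_def)
qed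

lemma open_embedding_inverse:
  assumes "open_embedding Z A c"
  shows "continuous_map (subtopology Z (c ` A)) (top_of_set A) (inv_into A c)"
proof -
  have "homeomorphic_map (top_of_set A) (subtopology Z (c ` A)) c" by (rule open_embedding_homeomorphic_map[OF assms])
  then obtain g where g: "homeomorphic_maps (top_of_set A) (subtopology Z (c ` A)) c g"
    using homeomorphic_map_maps by blast
  then have "continuous_map (subtopology Z (c ` A)) (top_of_set A) g"
    by (simp add: homeomorphic_maps_def)
  moreover have "g p = inv_into A c p" if "p \<in> topspace (subtopology Z (c ` A))" for p
  proof -
    from that obtain a where "a \<in> A" "p = c a" by auto
    then show ?thesis
      using g assms by (auto simp: homeomorphic_maps_def open_embedding_def)
  qed
  ultimately show ?thesis
    using continuous_map_eq by blast
qed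

lemma open_embedding_reparam:
  assumes "open_embedding Z A c" "homeomorphism B (\<psi> ` B) \<psi> \<psi>'" "openin (top_of_set A) (\<psi> ` B)"
  shows "open_embedding Z B (\<lambda>b. c (\<psi> b))"
  unfolding open_embedding_def
proof (intro conjI allI impI)
  have sub: "\<psi> ` B \<subseteq> A"
    using assms(3) openin_imp_subset by blast
  have cont: "continuous_on B \<psi>"
    using assms(2) homeomorphism_cont1 by blast
  show "continuous_map (top_of_set B) Z (\<lambda>b. c (\<psi> b))"
    using continuous_map_compose[of "top_of_set B" "top_of_set A" \<psi> Z c, unfolded comp_def] cont sub
      open_embeddingD(1)[OF assms(1)]
    by (auto simp: continuous_map_in_subtopology)
  have "inj_on \<psi> B"
    by (metis assms(2) homeomorphism_apply1 inj_on_inverseI)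
  then show "inj_on (\<lambda>b. c (\<psi> b)) B"
    using open_embeddingD(2)[OF assms(1)] sub unfolding inj_on_def by blast
  show "openin Z ((\<lambda>b. c (\<psi> b)) ` D)" if "openin (top_of_set B) D" for D
  proof -
    have "openin (top_of_set (\<psi> ` B)) (\<psi> ` D)"
      using assms(2) homeomorphism_imp_open_map that by blast
    then have "openin (top_of_set A) (\<psi> ` D)"
      using assms(3) openin_trans by blast
    then show ?thesis
      using open_embeddingD(3)[OF assms(1)] by (metis image_image)
  qed
qed

lemma continuous_map_nbhd:
  fixes f :: "'b::metric_space => 'a"
  assumes "continuous_map (top_of_set A) Z f" "a \<in> A" "openin Z N" "f a \<in> N"
  obtains r where "r > 0" "\<And>b. b \<in> A ==> dist b a < r ==> f b \<in> N"
proof -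
  have "openin (top_of_set A) {x \<in> topspace (top_of_set A). f x \<in> N}"
    using assms openin_continuous_map_preimage by blast
  then obtain U where "open U" "{x \<in> A. f x \<in> N} = A \<inter> U"
    by (auto simp: openin_open)
  moreover from this obtain r where "r > 0" "ball a r \<subseteq> U"
    using assms by (metis (no_types, lifting) Int_iff mem_Collect_eq openE)
  ultimately show ?thesis
    using that[of r] by (auto simp: dist_commute set_eq_iff subset_iff)
qed

lemma dist_pair_le: "dist (x::real, t::real) (x0, t0) \<le> \<bar>x - x0\<bar> + \<bar>t - t0\<bar>"
  using sqrt_sum_squares_le_sum_abs[of "x - x0" "t - t0"] by (simp add: dist_prod_def dist_real_def)

lemma continuous_map_nbhd2:
  assumes "continuous_map (top_of_set A) Z f" "(x0, t0) \<in> A" "openin Z N" "f (x0, t0) \<in> N"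
  obtains r where "r > 0"
    "\<And>(x::real) t::real. (x, t) \<in> A ==> \<bar>x - x0\<bar> < r ==> \<bar>t - t0\<bar> < r ==> f (x, t) \<in> N"
proof -
  obtain r where r: "r > 0" "\<And>b. b \<in> A ==> dist b (x0, t0) < r ==> f b \<in> N"
    using continuous_map_nbhd[OF assms] by blast
  show ?thesis
  proof (rule that[of "r/2"])
    fix x t assume "(x, t) \<in> A" "\<bar>x - x0\<bar> < r/2" "\<bar>t - t0\<bar> < r/2"
    then show "f (x, t) \<in> N" using r(2)[of "(x, t)"] dist_pair_le[of x t x0 t0] by linarith
  qed (use r in simp)
qed

text \<open>Invariance of domain, read in charts around the image points: followed by the inverse of
  a chart, \<open>f\<close> becomes locally an injective continuous map between subsets of the
  plane. Since \<open>B\<close> and the chart domains are open, this serves interior points only;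
  half discs at an edge need another argument.\<close>

lemma continuous_inj_imp_open_embedding:
  assumes B: "open B" and f: "continuous_map (top_of_set B) Z f" "inj_on f B"
    and ch: "\<And>b. b \<in> B ==> \<exists>A c. open A \<and> open_embedding Z A c \<and> f b \<in> c ` A"
  shows "open_embedding Z B f"
  unfolding open_embedding_def
proof (intro conjI allI impI f)
  fix D assume D: "openin (top_of_set B) D"
  then have "open D" "D \<subseteq> B"
    using B openin_open_eq by blast+
  show "openin Z (f ` D)"
  proof (subst openin_subopen, clarify)
    fix b assume b: "b \<in> D"
    then obtain A c where A: "open A" "open_embedding Z A c" "f b \<in> c ` A"
      using ch \<open>D \<subseteq> B\<close> by blast
    define D' where "D' = {b \<in> D. f b \<in> c ` A}"
    have "openin (top_of_set B) D'"
      unfolding D'_def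
      by (rule openin_continuous_map_preimage_gen[OF f(1) D open_embeddingD(4)[OF A(2)]])
    then have oD: "open D'" using B openin_open_eq by blast
    have "D' \<subseteq> B" using \<open>D \<subseteq> B\<close> by (auto simp: D'_def)
    have cf: "continuous_map (top_of_set D') (subtopology Z (c ` A)) f"
      unfolding continuous_map_in_subtopology
      using continuous_map_from_subtopology_mono[OF f(1) \<open>D' \<subseteq> B\<close>] by (auto simp: D'_def)
    have "continuous_map (top_of_set D') (top_of_set A) (inv_into A c \<circ> f)"
      using continuous_map_compose[OF cf open_embedding_inverse[OF A(2)]] .
    then have co: "continuous_on D' (inv_into A c \<circ> f)"
      by (simp add: continuous_map_in_subtopology)
    have eq: "c (inv_into A c (f x)) = f x" if "x \<in> D'" for x
      using that by (simp add: D'_def f_inv_into_f)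
    have "inj_on (inv_into A c \<circ> f) D'"
    proof (rule inj_onI)
      fix x y assume xy: "x \<in> D'" "y \<in> D'" "(inv_into A c \<circ> f) x = (inv_into A c \<circ> f) y"
      have "f x = c ((inv_into A c \<circ> f) x)" using eq[OF xy(1)] by simp
      also have "\<dots> = f y" using eq[OF xy(2)] by (simp only: xy(3)) simp
      finally have "f x = f y" .
      then show "x = y" using xy \<open>D' \<subseteq> B\<close> inj_onD[OF f(2)] by blast
    qed
    then have op: "open ((inv_into A c \<circ> f) ` D')"
      using invariance_of_domain[OF co oD] by blast
    moreover have "(inv_into A c \<circ> f) ` D' \<subseteq> A"
      by (auto simp: D'_def intro!: inv_into_into)
    ultimately have "openin Z (c ` ((inv_into A c \<circ> f) ` D'))"
      by (meson A(1,2) open_embeddingD(3) openin_open_eq)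
    moreover have "c ` ((inv_into A c \<circ> f) ` D') = f ` D'"
      using eq by (simp add: image_image)
    ultimately show "\<exists>T. openin Z T \<and> f b \<in> T \<and> T \<subseteq> f ` D"
      using b A(3) by (intro exI[of _ "f ` D'"]) (auto simp: D'_def)
  qed
qed

text \<open>The pairs \<open>x < y\<close> in an interval form a convex set, so a pair on which
  \<open>f\<close> increases can be moved linearly to one on which it decreases without the two
  points ever meeting. This treats open, closed and half-open intervals at once.\<close>

lemma continuous_inj_strict_monotone:
  fixes f :: "real => real"
  assumes S: "is_interval S" and f: "continuous_on S f" "inj_on f S"
  shows "(\<forall>x\<in>S. \<forall>y\<in>S. x < y --> f x < f y) \<or> (\<forall>x\<in>S. \<forall>y\<in>S. x < y --> f y < f x)"
proof (rule ccontr)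
  assume "\<not> ?thesis"
  then obtain a b c d where ab: "a \<in> S" "b \<in> S" "a < b" "\<not> f a < f b"
    and cd: "c \<in> S" "d \<in> S" "c < d" "\<not> f d < f c" by blast
  have "f a \<noteq> f b" "f c \<noteq> f d"
    using ab cd f(2) by (auto simp: inj_on_def)
  with ab cd have fab: "f b < f a" "f c < f d" by auto
  \<comment> \<open>The increment of \<open>f\<close> over the moving pair, which is
    \<open>(a, b)\<close> at time 0 and \<open>(c, d)\<close> at time 1. By injectivity a zero would
    force the two moved points to coincide.\<close>
  let ?h = "\<lambda>u. f ((1 - u) * b + u * d) - f ((1 - u) * a + u * c)"
  have inS: "(1 - u) * x + u * y \<in> S" if "u \<in> {0..1}" "x \<in> S" "y \<in> S" for u x y
  proof -
    have "convex S" using S by (simp add: is_interval_convex)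
    then have "(1 - u) *\<^sub>R x + u *\<^sub>R y \<in> S"
      using that convexD[of S x y "1-u" u] by auto
    then show ?thesis by simp
  qed
  have "continuous_on {0..1} ?h"
    by (intro continuous_intros continuous_on_compose2[OF f(1)]) (use inS ab cd in auto)
  moreover have "?h 0 \<le> 0" "0 \<le> ?h 1" using fab by auto
  ultimately obtain u where u: "0 \<le> u" "u \<le> 1" "?h u = 0"
    using IVT'[of ?h 0 0 1] by auto
  then have "(1 - u) * b + u * d = (1 - u) * a + u * c"
    using inS[of u] ab cd f(2) by (auto simp: inj_on_def)
  then have e: "(1 - u) * (b - a) + u * (d - c) = 0" by algebra
  have "0 \<le> (1 - u) * (b - a)" "0 \<le> u * (d - c)" using u ab cd by auto
  with e have "(1 - u) * (b - a) = 0" "u * (d - c) = 0" by linarith+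
  then show False using ab cd by auto
qed

text \<open>If two values agree, the function has an extremum strictly between the two points, and
  near an interior extremum it cannot be injective. Later this makes the projection of a boundary
  interval to its leaf globally injective.\<close>

lemma locally_inj_imp_inj:
  fixes f :: "real => real"
  assumes S: "is_interval S" and f: "continuous_on S f"
    and loc: "\<And>x. x \<in> S ==> \<exists>r>0. inj_on f {y \<in> S. \<bar>y - x\<bar> < r}"
  shows "inj_on f S"
proof (rule ccontr)
  assume "\<not> inj_on f S"
  then obtain a b where ab: "a \<in> S" "b \<in> S" "a < b" "f a = f b"
    by (metis inj_on_def linorder_less_linear)
  have sub: "{a..b} \<subseteq> S"
    using S ab by (meson atLeastAtMost_iff is_interval_1 subsetI)
  have seg: "closed_segment a b = {a..b}" "open_segment a b = {a<..<b}"
    using ab by (auto simp: closed_segment_eq_real_ivl open_segment_eq_real_ivl)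
  obtain z where z: "z \<in> {a<..<b}"
     "(\<forall>w \<in> {a..b}. f w \<le> f z) \<or> (\<forall>w \<in> {a..b}. f z \<le> f w)"
    using continuous_IVT_local_extremum[of a b f] ab continuous_on_subset[OF f sub] seg by auto
  then have "z \<in> S" using sub by auto
  then obtain r where r: "r > 0" "inj_on f {y \<in> S. \<bar>y - z\<bar> < r}" using loc by blast
  define l where "l = max ((a + z) / 2) (z - r/2)"
  define u where "u = min ((b + z) / 2) (z + r/2)"
  have lu: "l < z" "z < u" "a < l" "u < b" "\<bar>l - z\<bar> < r" "\<bar>u - z\<bar> < r"
    using z(1) r(1) unfolding l_def u_def by (auto simp: max_def min_def abs_if field_simps)
  have lS: "{l..u} \<subseteq> {y \<in> S. \<bar>y - z\<bar> < r}"
    using lu sub by auto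
  then have "inj_on f {l..u}" using r(2) inj_on_subset by blast
  moreover have "continuous_on {l..u} f"
    using f lS continuous_on_subset by blast
  ultimately have "(f l < f z \<and> f z < f u) \<or> (f u < f z \<and> f z < f l)"
    using continuous_inj_imp_mono[of l z u f] lu by blast
  moreover have "l \<in> {a..b}" "u \<in> {a..b}" using lu by auto
  ultimately show False using z(2) by force
qed

text \<open>The intermediate value theorem applied to two vertical lines through nearby points.\<close>
lemma fibrewise_increasing_open:
  fixes f :: "real \<times> real => real"
  assumes X: "open X" "is_interval X" and f: "continuous_on (X \<times> I) f"
    and mono: "\<And>x y t. x \<in> X ==> y \<in> X ==> t \<in> I ==> x < y ==> f (x, t) < f (y, t)"
    and D: "openin (top_of_set (X \<times> I)) D"
  shows "openin (top_of_set (UNIV \<times> I)) ((\<lambda>p. (f p, snd p)) ` D)"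
proof (subst openin_subopen, clarify)
  fix x0 t0 assume p: "(x0, t0) \<in> D"
  then have x0: "x0 \<in> X" and t0: "t0 \<in> I" using D openin_imp_subset by blast+
  obtain D' where D': "open D'" "D = (X \<times> I) \<inter> D'"
    using D by (auto simp: openin_open)
  obtain r0 where r0: "r0 > 0" "ball (x0, t0) r0 \<subseteq> D'"
    using D' p by (meson IntD2 open_contains_ball)
  obtain r1 where r1: "r1 > 0" "ball x0 r1 \<subseteq> X" using X x0 open_contains_ball by blast
  define r where "r = min (r0/2) (r1/2)"
  have r: "r > 0" "r \<le> r0/2" "r < r1" using r0 r1 by (auto simp: r_def)
  have xin: "y \<in> X" if "\<bar>y - x0\<bar> \<le> r" for y
    using that r r1 by (auto simp: subset_eq dist_real_def)
  have Din: "(y, t) \<in> D" if "\<bar>y - x0\<bar> < r" "\<bar>t - t0\<bar> < r" "t \<in> I" for y t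
  proof -
    have "dist (y, t) (x0, t0) < r0" using dist_pair_le[of y t x0 t0] that r by linarith
    then have "(y, t) \<in> D'" using r0(2) by (auto simp: subset_eq dist_commute)
    then show ?thesis using xin[of y] that D'(2) by auto
  qed
  define a b where "a = x0 - r/2" and "b = x0 + r/2"
  have ab: "a \<in> X" "b \<in> X" "a < x0" "x0 < b"
    using xin[of a] xin[of b] r by (auto simp: a_def b_def)
  have fa: "f (a, t0) < f (x0, t0)" "f (x0, t0) < f (b, t0)"
    using mono ab x0 t0 by auto
  define e where "e = min (f (x0, t0) - f (a, t0)) (f (b, t0) - f (x0, t0)) / 2"
  have e: "e > 0" using fa by (simp add: e_def)
  have ca: "\<exists>d>0. \<forall>t\<in>I. \<bar>t - t0\<bar> < d --> \<bar>f (y, t) - f (y, t0)\<bar> < e" if "y \<in> X" for y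
  proof -
    have "continuous_on I (\<lambda>t. f (y, t))"
      by (intro continuous_on_compose2[OF f] continuous_intros) (use that in auto)
    then show ?thesis using t0 e unfolding continuous_on_iff dist_real_def by blast
  qed
  obtain d1 where d1: "d1 > 0" "\<And>t. t\<in>I ==> \<bar>t - t0\<bar> < d1 ==> \<bar>f (a, t) - f (a, t0)\<bar> < e"
    using ca[OF ab(1)] by blast
  obtain d2 where d2: "d2 > 0" "\<And>t. t\<in>I ==> \<bar>t - t0\<bar> < d2 ==> \<bar>f (b, t) - f (b, t0)\<bar> < e"
    using ca[OF ab(2)] by blast
  define d where "d = min (min d1 d2) r"
  let ?T = "{f (x0, t0) - e<..<f (x0, t0) + e} \<times> ({t0 - d<..<t0 + d} \<inter> I)"
  have "openin (top_of_set (UNIV \<times> I)) ?T"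
  proof -
    have "?T = (UNIV \<times> I) \<inter> ({f (x0, t0) - e<..<f (x0, t0) + e} \<times> {t0 - d<..<t0 + d})" by auto
    then show ?thesis by (metis openin_open_Int open_Times open_greaterThanLessThan)
  qed
  moreover have "(f (x0, t0), t0) \<in> ?T" using e d1 d2 r t0 by (auto simp: d_def)
  moreover have "?T \<subseteq> (\<lambda>p. (f p, snd p)) ` D"
  proof clarify
    fix y t assume y: "y \<in> {f (x0, t0) - e<..<f (x0, t0) + e}" and t: "t \<in> {t0 - d<..<t0 + d}" "t \<in> I"
    then have tt: "\<bar>t - t0\<bar> < d1" "\<bar>t - t0\<bar> < d2" "\<bar>t - t0\<bar> < r" by (auto simp: d_def)
    have e2: "2 * e \<le> f (x0, t0) - f (a, t0)" "2 * e \<le> f (b, t0) - f (x0, t0)"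
      by (auto simp: e_def)
    have yy: "f (x0, t0) - e < y" "y < f (x0, t0) + e" using y by auto
    have 1: "f (a, t) \<le> y" using d1(2)[OF t(2) tt(1)] yy e2 by linarith
    have 2: "y \<le> f (b, t)" using d2(2)[OF t(2) tt(2)] yy e2 by linarith
    have "continuous_on {a..b} (\<lambda>x. f (x, t))"
      by (intro continuous_on_compose2[OF f] continuous_intros)
        (use xin t r in \<open>auto simp: a_def b_def abs_if\<close>)
    then obtain x where x: "a \<le> x" "x \<le> b" "f (x, t) = y"
      using IVT'[of "\<lambda>x. f (x, t)" a y b] 1 2 ab by auto
    then have "(x, t) \<in> D" using Din[of x t] tt t r by (auto simp: a_def b_def abs_if)
    then show "(y, t) \<in> (\<lambda>p. (f p, snd p)) ` D" using x by force
  qed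
  ultimately show "\<exists>T. openin (top_of_set (UNIV \<times> I)) T \<and> (f (x0, t0), snd (x0, t0)) \<in> T \<and>
      T \<subseteq> (\<lambda>p. (f p, snd p)) ` D" by auto
qed

section \<open>Foliated charts and ribbons\<close>

abbreviation OI :: "real set" where "OI \<equiv> {-1<..<1}"
abbreviation UI :: "real set" where "UI \<equiv> {0<..<1}"

definition leaf_of :: "'a set set => 'a => 'a set" where
  "leaf_of \<Delta> z = (THE w. w \<in> \<Delta> \<and> z \<in> w)"

lemma leaf_of_eq:
  assumes "pairwise disjnt \<Delta>" "w \<in> \<Delta>" "z \<in> w"
  shows "leaf_of \<Delta> z = w"
  unfolding leaf_of_def using assms by (intro the_equality) (auto simp: pairwise_def disjnt_def)

lemma affine_image:
  fixes t0 :: real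
  assumes r: "0 < r"
  shows "(\<lambda>t. t0 + r * t) ` OI = {t0 - r<..<t0 + r}" "(\<lambda>t. t0 + r * t) ` {0..<1} = {t0..<t0 + r}"
proof -
  have y: "y = t0 + r * ((y - t0) / r)" for y using r by simp
  have "t0 - r < t0 + r * t \<longleftrightarrow> -1 < t" "t0 + r * t < t0 + r \<longleftrightarrow> t < 1" "t0 \<le> t0 + r * t \<longleftrightarrow> 0 \<le> t" for t
    using r mult_less_cancel_left_pos[OF r, of "-1" t] by (auto simp: zero_le_mult_iff)
  then show "(\<lambda>t. t0 + r * t) ` OI = {t0 - r<..<t0 + r}" "(\<lambda>t. t0 + r * t) ` {0..<1} = {t0..<t0 + r}"
    by (auto, (metis y greaterThanLessThan_iff atLeastLessThan_iff image_eqI)+)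
qed

text \<open>The last clause is the form in which the subspace topology of the leaves enters: a leaf
  may return to the chart, but its plaques do not accumulate at one of them. The height range
  \<open>J\<close> is a parameter so that discs in the interior and half discs at the boundary are
  treated together.\<close>

definition fchart :: "'a topology => 'a set set => (real \<times> real => 'a) => real set => bool" where
  "fchart Z \<Delta> C J \<longleftrightarrow> open_embedding Z (OI \<times> J) C \<and>
     (\<forall>x\<in>OI. \<forall>t\<in>J. leaf_of \<Delta> (C (x, t)) = leaf_of \<Delta> (C (0, t))) \<and>
     (\<forall>t0\<in>J. \<exists>d>0. \<forall>t\<in>J. t \<noteq> t0 --> \<bar>t - t0\<bar> < d --> leaf_of \<Delta> (C (0, t)) \<noteq> leaf_of \<Delta> (C (0, t0)))"

lemma fchart_affine:
  assumes C: "fchart Z \<Delta> C J" and r: "r > 0" and x0: "{x0 - r<..<x0 + r} \<subseteq> OI"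
    and J': "openin (top_of_set J) ((\<lambda>t. t0 + r * t) ` J')"
  shows "fchart Z \<Delta> (\<lambda>p. C (x0 + r * fst p, t0 + r * snd p)) J'"
proof -
  let ?\<psi> = "\<lambda>p. (x0 + r * fst p, t0 + r * snd p)"
  let ?\<psi>' = "\<lambda>p. ((fst p - x0) / r, (snd p - t0) / r)"
  have im: "?\<psi> ` (OI \<times> J') = {x0 - r<..<x0 + r} \<times> ((\<lambda>t. t0 + r * t) ` J')"
  proof -
    show ?thesis unfolding affine_image(1)[OF r, symmetric] by force
  qed
  have J'im: "t0 + r * t \<in> J" if "t \<in> J'" for t
    using J' that openin_imp_subset by blast
  have xim: "x0 + r * x \<in> OI" if "x \<in> OI" for x
  proof -
    have "- r < r * x" "r * x < r" using that r mult_strict_left_mono[of "-1" x r] mult_strict_left_mono[of x 1 r] by auto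
    then show ?thesis using x0 by (auto simp: subset_iff)
  qed
  have "homeomorphism (OI \<times> J') (?\<psi> ` (OI \<times> J')) ?\<psi> ?\<psi>'"
    unfolding homeomorphism_def using r
    by (auto intro!: continuous_intros simp: image_image)
  moreover have "openin (top_of_set (OI \<times> J)) (?\<psi> ` (OI \<times> J'))"
    unfolding im using J' x0 by (intro openin_Times) (auto simp: openin_open_eq)
  ultimately have oe: "open_embedding Z (OI \<times> J') (\<lambda>p. C (?\<psi> p))"
    using C open_embedding_reparam unfolding fchart_def by blast
  have lf: "leaf_of \<Delta> (C (x0 + r * x, t0 + r * t)) = leaf_of \<Delta> (C (0, t0 + r * t))"
    if "x \<in> OI" "t \<in> J'" for x t
    using C xim[OF that(1)] J'im[OF that(2)] unfolding fchart_def by blast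
  have "\<exists>d>0. \<forall>t\<in>J'. t \<noteq> s --> \<bar>t - s\<bar> < d -->
      leaf_of \<Delta> (C (x0 + r * 0, t0 + r * t)) \<noteq> leaf_of \<Delta> (C (x0 + r * 0, t0 + r * s))" if s: "s \<in> J'" for s
  proof -
    obtain d where d: "d > 0" "\<And>t. t \<in> J ==> t \<noteq> t0 + r * s ==> \<bar>t - (t0 + r * s)\<bar> < d ==>
        leaf_of \<Delta> (C (0, t)) \<noteq> leaf_of \<Delta> (C (0, t0 + r * s))"
      using C J'im[OF s] unfolding fchart_def by blast
    show ?thesis
    proof (intro exI[of _ "d / r"] conjI ballI impI)
      fix t assume t: "t \<in> J'" "t \<noteq> s" "\<bar>t - s\<bar> < d / r"
      have "\<bar>t0 + r * t - (t0 + r * s)\<bar> = r * \<bar>t - s\<bar>" using r by (simp add: abs_mult flip: right_diff_distrib)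
      also have "\<dots> < d" using t r by (simp add: field_simps)
      finally have "leaf_of \<Delta> (C (0, t0 + r * t)) \<noteq> leaf_of \<Delta> (C (0, t0 + r * s))"
        using d(2)[OF J'im[OF t(1)]] t r by simp
      then show "leaf_of \<Delta> (C (x0 + r * 0, t0 + r * t)) \<noteq> leaf_of \<Delta> (C (x0 + r * 0, t0 + r * s))"
        using lf[of 0 t] lf[of 0 s] t s by simp
    qed (use d r in auto)
  qed
  moreover have "leaf_of \<Delta> (C (x0 + r * x, t0 + r * t)) = leaf_of \<Delta> (C (x0 + r * 0, t0 + r * t))"
    if "x \<in> OI" "t \<in> J'" for x t
    using lf[OF that] lf[of 0 t] that by simp
  ultimately show ?thesis
    using oe unfolding fchart_def by auto
qed

text \<open>The boundary is an abstract set \<open>Bd\<close>, recognized by the shape of a centred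
  chart, so that the arguments about leaves need not return to manifold charts.\<close>

locale foliated_surface =
  fixes Z :: "'a topology" and \<Delta> :: "'a set set" and Bd :: "'a set"
  assumes haus: "Hausdorff_space Z" and sc: "second_countable Z"
    and cover: "\<Union>\<Delta> = topspace Z" and disj: "pairwise disjnt \<Delta>"
    and leaf_ne: "\<And>w. w \<in> \<Delta> ==> w \<noteq> {}"
    and leaf_conn: "\<And>w. w \<in> \<Delta> ==> connectedin Z w"
    and leaf_closed: "\<And>w. w \<in> \<Delta> ==> closedin Z w"
    and leaf_line: "\<And>w. w \<in> \<Delta> ==> subtopology Z w homeomorphic_space euclideanreal"
    and charts: "\<And>z. z \<in> topspace Z ==> \<exists>C J. ((z \<notin> Bd \<and> J = {-1<..<1}) \<or> (z \<in> Bd \<and> J = {0..<1})) \<and>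
        fchart Z \<Delta> C J \<and> C (0, 0) = z"
begin

abbreviation lf :: "'a => 'a set" where "lf \<equiv> leaf_of \<Delta>"

lemma lf_eq: "w \<in> \<Delta> ==> z \<in> w ==> lf z = w"
  by (rule leaf_of_eq[OF disj])

lemma lf_in: assumes "z \<in> topspace Z" shows "lf z \<in> \<Delta>" "z \<in> lf z"
proof -
  obtain w where "w \<in> \<Delta>" "z \<in> w" using assms cover by blast
  then show "lf z \<in> \<Delta>" "z \<in> lf z" using lf_eq by auto
qed

lemma leaf_sub: "w \<in> \<Delta> ==> w \<subseteq> topspace Z" using cover by blast

definition sat :: "'a set => 'a set" where
  "sat A = {p \<in> topspace Z. \<exists>a\<in>A. lf a = lf p}"

lemma sat_sub: "sat A \<subseteq> topspace Z" by (auto simp: sat_def)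

lemma sub_sat: "A \<subseteq> topspace Z ==> A \<subseteq> sat A" by (auto simp: sat_def)

lemma saturatedD: "saturated \<Delta> U ==> p \<in> U ==> p \<in> topspace Z ==> q \<in> topspace Z ==> lf q = lf p ==> q \<in> U"
  unfolding saturated_def using lf_in(1)[of p] lf_in(2)[of p] lf_in(2)[of q] by blast

lemma saturatedI: "(\<And>p q. p \<in> U ==> p \<in> topspace Z ==> q \<in> topspace Z ==> lf q = lf p ==> q \<in> U) ==> saturated \<Delta> U"
proof -
  assume *: "\<And>p q. p \<in> U ==> p \<in> topspace Z ==> q \<in> topspace Z ==> lf q = lf p ==> q \<in> U"
  show ?thesis
    unfolding saturated_def
  proof (intro ballI impI subsetI)
    fix w q assume w: "w \<in> \<Delta>" "w \<inter> U \<noteq> {}" and q: "q \<in> w"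
    then obtain p where p: "p \<in> w" "p \<in> U" by blast
    have "lf q = lf p" using lf_eq[OF w(1) p(1)] lf_eq[OF w(1) q] by simp
    then show "q \<in> U" using * leaf_sub[OF w(1)] p q by blast
  qed
qed

lemma saturated_sat: "saturated \<Delta> (sat A)"
  by (rule saturatedI) (auto simp: sat_def)

lemma fchart_dest:
  assumes "fchart Z \<Delta> C J"
  shows "continuous_map (top_of_set (OI \<times> J)) Z C" "inj_on C (OI \<times> J)"
    "\<And>B. openin (top_of_set (OI \<times> J)) B ==> openin Z (C ` B)"
    "\<And>x t. x \<in> OI ==> t \<in> J ==> lf (C (x, t)) = lf (C (0, t))"
    "\<And>x t. x \<in> OI ==> t \<in> J ==> C (x, t) \<in> topspace Z"
proof -
  show 1: "continuous_map (top_of_set (OI \<times> J)) Z C" and "inj_on C (OI \<times> J)"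
    "\<And>B. openin (top_of_set (OI \<times> J)) B ==> openin Z (C ` B)"
    "\<And>x t. x \<in> OI ==> t \<in> J ==> lf (C (x, t)) = lf (C (0, t))"
    using assms unfolding fchart_def open_embedding_def by blast+
  show "C (x, t) \<in> topspace Z" if "x \<in> OI" "t \<in> J" for x t
    using continuous_map_image_subset_topspace[OF 1] that by auto
qed

lemma fchart_slab_open:
  assumes "fchart Z \<Delta> C J"
  shows "openin Z (C ` (OI \<times> (J \<inter> {a<..<b})))"
proof (rule fchart_dest(3)[OF assms])
  have "OI \<times> (J \<inter> {a<..<b}) = (OI \<times> J) \<inter> (UNIV \<times> {a<..<b})" by auto
  then show "openin (top_of_set (OI \<times> J)) (OI \<times> (J \<inter> {a<..<b}))"
    by (simp add: openin_open_Int open_Times)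
qed

text \<open>A slab so thin that it contains no further plaque of the leaf through its centre serves
  as \<open>N\<close>; this is where the isolation clause of \<open>fchart\<close> is used.\<close>

lemma plaque_openin_leaf:
  assumes C: "fchart Z \<Delta> C J" and J: "0 \<in> J"
  obtains N where "openin Z N" "N \<inter> lf (C (0, 0)) = C ` (OI \<times> {0})"
proof -
  obtain d where d: "d > 0" "\<And>t. t \<in> J ==> t \<noteq> 0 ==> \<bar>t\<bar> < d ==> lf (C (0, t)) \<noteq> lf (C (0, 0))"
    using C J unfolding fchart_def by (metis diff_zero)
  let ?N = "C ` (OI \<times> (J \<inter> {-d<..<d}))"
  have "?N \<inter> lf (C (0, 0)) = C ` (OI \<times> {0})"
  proof (intro equalityI subsetI)
    fix p assume p: "p \<in> ?N \<inter> lf (C (0, 0))"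
    then obtain x t where xt: "x \<in> OI" "t \<in> J" "\<bar>t\<bar> < d" "p = C (x, t)" by auto
    have "lf (C (0, t)) = lf p" using fchart_dest(4)[OF C xt(1,2)] xt(4) by simp
    also have "lf p = lf (C (0, 0))"
      using p lf_in(1)[OF fchart_dest(5)[OF C, of 0 0]] J by (intro lf_eq) auto
    finally have "t = 0" using d xt by blast
    then show "p \<in> C ` (OI \<times> {0})" using xt by auto
  next
    fix p assume "p \<in> C ` (OI \<times> {0})"
    then obtain x where x: "x \<in> OI" "p = C (x, 0)" by auto
    then have "lf p = lf (C (0, 0))" using fchart_dest(4)[OF C x(1) J] by simp
    then have "p \<in> lf (C (0, 0))" using x(2) lf_in(2)[OF fchart_dest(5)[OF C x(1) J]] by simp
    then show "p \<in> ?N \<inter> lf (C (0, 0))" using x J d by auto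
  qed
  then show ?thesis using that fchart_slab_open[OF C] by blast
qed

text \<open>Within one leaf the points interior to the saturation form an open set, and so do the
  remaining points, because a plaque with one interior point is interior as a whole. A connected
  leaf that meets \<open>A\<close> is therefore interior throughout.\<close>

lemma sat_open:
  assumes A: "openin Z A"
  shows "openin Z (sat A)"
proof -
  let ?I = "Z interior_of (sat A)"
  have AI: "A \<subseteq> ?I"
    by (simp add: A interior_of_maximal openin_subset sub_sat)
  \<comment> \<open>Transport along a plaque: for all small heights the column through the interior
    point lies in the saturation, and each row of the slab follows its point in that column.\<close>
  have plaque: "p \<in> ?I" if C: "fchart Z \<Delta> C J" "C (0, 0) = p" "0 \<in> J" and x: "x \<in> OI" "C (x, 0) \<in> ?I" for C J p x
  proof -
    obtain r where r: "r > 0" "\<And>x' t. (x', t) \<in> OI \<times> J ==> \<bar>x' - x\<bar> < r ==> \<bar>t - 0\<bar> < r ==> C (x', t) \<in> ?I"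
      using continuous_map_nbhd2[OF fchart_dest(1)[OF C(1)], of x 0 ?I] x C by auto
    have "C ` (OI \<times> (J \<inter> {-r<..<r})) \<subseteq> sat A"
    proof clarify
      fix x' t assume t: "x' \<in> OI" "t \<in> J" "t \<in> {-r<..<r}"
      then have "C (x, t) \<in> sat A"
        using r(2)[of x t] r(1) x interior_of_subset[of Z "sat A"] by auto
      moreover have "lf (C (x', t)) = lf (C (x, t))" using fchart_dest(4)[OF C(1)] t x by metis
      ultimately show "C (x', t) \<in> sat A"
        using saturatedD[OF saturated_sat] fchart_dest(5)[OF C(1)] t x by meson
    qed
    then have "C ` (OI \<times> (J \<inter> {-r<..<r})) \<subseteq> ?I"
      using fchart_slab_open[OF C(1)] by (simp add: interior_of_maximal)
    then show ?thesis using C r by auto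
  qed
  have "sat A \<subseteq> ?I"
  proof
    fix p assume p: "p \<in> sat A"
    define w where "w = lf p"
    have pt: "p \<in> topspace Z" using p sat_sub by blast
    have w: "w \<in> \<Delta>" "p \<in> w" using pt lf_in by (auto simp: w_def)
    obtain a where a: "a \<in> A" "lf a = w" using p by (auto simp: sat_def w_def)
    then have aw: "a \<in> w" using lf_in A openin_subset by blast
    have 1: "openin (subtopology Z w) (?I \<inter> w)"
      by (simp add: openin_subtopology_Int)
    have "openin (subtopology Z w) (w - ?I)"
    proof (subst openin_subopen, clarify)
      fix z assume z: "z \<in> w" "z \<notin> ?I"
      then have zt: "z \<in> topspace Z" using leaf_sub w by blast
      obtain C J where C: "fchart Z \<Delta> C J" "C (0, 0) = z" "0 \<in> J"
        using charts[OF zt] by force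
      obtain N where N: "openin Z N" "N \<inter> lf z = C ` (OI \<times> {0})"
        using plaque_openin_leaf[OF C(1,3)] C(2) by blast
      have "lf z = w" using lf_eq w z by blast
      have "N \<inter> w \<subseteq> w - ?I"
      proof
        fix p assume p: "p \<in> N \<inter> w"
        then obtain x where "x \<in> OI" "p = C (x, 0)" using N(2) \<open>lf z = w\<close> by blast
        then show "p \<in> w - ?I" using plaque[OF C] z p by blast
      qed
      moreover have "z \<in> N \<inter> w" using N(2) C(2) \<open>lf z = w\<close> by force
      ultimately show "\<exists>T. openin (subtopology Z w) T \<and> z \<in> T \<and> T \<subseteq> w - ?I"
        using N(1) openin_subtopology_Int by blast
    qed
    moreover have "w - ?I = topspace (subtopology Z w) - (?I \<inter> w)"
      using leaf_sub[OF w(1)] by auto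
    ultimately have "closedin (subtopology Z w) (?I \<inter> w)"
      using openin_subset[OF 1] unfolding closedin_def by argo
    moreover have "connected_space (subtopology Z w)"
      using leaf_conn[OF w(1)] connectedin_def by blast
    ultimately have "?I \<inter> w = {} \<or> ?I \<inter> w = topspace (subtopology Z w)"
      using 1 connected_space_clopen_in by blast
    then show "p \<in> ?I" using aw a AI w pt by auto
  qed
  then show ?thesis
    by (metis interior_of_subset openin_interior_of subset_antisym)
qed

text \<open>The saturation of the interior is open and still contained in \<open>U\<close>, hence
  contained in the interior.\<close>

lemma saturated_interior: assumes "saturated \<Delta> U" shows "saturated \<Delta> (Z interior_of U)"
proof (rule saturatedI)
  fix p q assume p: "p \<in> Z interior_of U" "p \<in> topspace Z" "q \<in> topspace Z" "lf q = lf p"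
  have "sat (Z interior_of U) \<subseteq> U"
    using saturatedD[OF assms] interior_of_subset[of Z U] interior_of_subset_topspace[of Z U]
    unfolding sat_def by fastforce
  then have "sat (Z interior_of U) \<subseteq> Z interior_of U"
    by (simp add: interior_of_maximal sat_open)
  then show "q \<in> Z interior_of U" using p by (force simp: sat_def)
qed

lemma locally_finite_avoid:
  assumes "locally_finite_in Z \<L>" "\<L> \<subseteq> \<Delta>" "z \<in> topspace Z"
  obtains N where "openin Z N" "z \<in> N" "N \<inter> \<Union>\<L> \<subseteq> lf z"
proof -
  obtain V where V: "openin Z V" "z \<in> V" "finite {U \<in> \<L>. U \<inter> V \<noteq> {}}"
    using assms unfolding locally_finite_in_def by blast
  let ?F = "{U \<in> \<L>. U \<inter> V \<noteq> {}} - {lf z}"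
  have cl: "closedin Z (\<Union>?F)"
    using V(3) assms(2) leaf_closed by (intro closedin_Union) auto
  have "z \<notin> \<Union>?F" using lf_eq assms by auto
  then show ?thesis
    using V openin_diff[OF V(1) cl] by (intro that[of "V - \<Union>?F"]) auto
qed

lemma isolated_chart:
  assumes \<L>: "locally_finite_in Z \<L>" "\<L> \<subseteq> \<Delta>" and z: "z \<in> topspace Z" and N0: "openin Z N0" "z \<in> N0"
  obtains C J where "(z \<notin> Bd \<and> J = OI) \<or> (z \<in> Bd \<and> J = {0..<1})" "fchart Z \<Delta> C J" "C (0, 0) = z"
    "C ` (OI \<times> J) \<subseteq> N0" "\<And>x t. x \<in> OI ==> t \<in> J ==> t \<noteq> 0 ==> lf (C (x, t)) \<noteq> lf z"
    "\<And>x t. x \<in> OI ==> t \<in> J ==> t \<noteq> 0 ==> C (x, t) \<notin> \<Union>\<L>"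
proof -
  obtain C J where CJ: "(z \<notin> Bd \<and> J = OI) \<or> (z \<in> Bd \<and> J = {0..<1})" and C: "fchart Z \<Delta> C J" "C (0, 0) = z"
    using charts[OF z] by blast
  have J0: "0 \<in> J" using CJ by auto
  obtain N where N: "openin Z N" "z \<in> N" "N \<inter> \<Union>\<L> \<subseteq> lf z"
    using locally_finite_avoid[OF \<L> z] by blast
  obtain r where r: "r > 0" "\<And>x t. (x, t) \<in> OI \<times> J ==> \<bar>x - 0\<bar> < r ==> \<bar>t - 0\<bar> < r ==> C (x, t) \<in> N0 \<inter> N"
    using continuous_map_nbhd2[OF fchart_dest(1)[OF C(1)], of 0 0 "N0 \<inter> N"] N N0 C J0 by auto
  obtain d where d: "d > 0" "\<And>t. t \<in> J ==> t \<noteq> 0 ==> \<bar>t\<bar> < d ==> lf (C (0, t)) \<noteq> lf (C (0, 0))"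
    using C(1) J0 unfolding fchart_def by (metis diff_zero)
  \<comment> \<open>The bound \<open>r\<close> keeps the chart in \<open>N0\<close> and off the
    other leaves of the family, \<open>d\<close> keeps away further plaques of the leaf of
    \<open>z\<close>, and 1 keeps the rescaled chart inside the original domain.\<close>
  define s where "s = min (min r d) 1"
  have s: "0 < s" "s \<le> r" "s \<le> d" "s \<le> 1" using r d by (auto simp: s_def)
  let ?C = "\<lambda>p. C (0 + s * fst p, 0 + s * snd p)"
  have sJ: "openin (top_of_set J) ((\<lambda>t. 0 + s * t) ` J)"
  proof -
    have "(\<lambda>t. 0 + s * t) ` J = J \<inter> {-s<..<s}"
    proof -
      have "OI \<inter> {-s<..<s} = {0 - s<..<0 + s}" "{0..<1} \<inter> {-s<..<s} = {0..<0 + s}" using s by auto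
      then show ?thesis using CJ affine_image[OF s(1), of 0] by metis
    qed
    then show ?thesis by (simp add: openin_open_Int)
  qed
  have in1: "s * x \<in> OI" "\<bar>s * x\<bar> < s" if "\<bar>x\<bar> < 1" for x
  proof -
    have "\<bar>s * x\<bar> = s * \<bar>x\<bar>" using s by (simp add: abs_mult)
    also have "\<dots> < s * 1" using that s by (intro mult_strict_left_mono) auto
    finally show "\<bar>s * x\<bar> < s" by simp
    then show "s * x \<in> OI" using s by auto
  qed
  have inJ: "s * t \<in> J" "\<bar>s * t\<bar> < s" if "t \<in> J" for t
    using sJ openin_imp_subset that in1[of t] CJ by (fastforce)+
  have C': "fchart Z \<Delta> ?C J"
  proof (rule fchart_affine[OF C(1) s(1) _ sJ])
    show "{0 - s<..<0 + s} \<subseteq> OI" using s by auto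
  qed
  have in2: "C (s * x, s * t) \<in> N0 \<inter> N" if "x \<in> OI" "t \<in> J" for x t
  proof -
    have "\<bar>x\<bar> < 1" using that by auto
    then show ?thesis using r(2)[of "s * x" "s * t"] in1[of x] inJ[OF that(2)] s by auto
  qed
  have ne: "lf (?C (x, t)) \<noteq> lf z" if "x \<in> OI" "t \<in> J" "t \<noteq> 0" for x t
  proof -
    have "lf (?C (x, t)) = lf (C (0, s * t))"
    proof -
      have "\<bar>x\<bar> < 1" using that by auto
      then show ?thesis
        using fchart_dest(4)[OF C(1) in1(1)[of x] inJ(1)[OF that(2)]] by simp
    qed
    also have "\<dots> \<noteq> lf (C (0, 0))"
    proof (rule d(2)[OF inJ(1)[OF that(2)]])
      show "s * t \<noteq> 0" using that s by simp
      show "\<bar>s * t\<bar> < d" using inJ(2)[OF that(2)] s by linarith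
    qed
    finally show ?thesis using C by simp
  qed
  show ?thesis
  proof (rule that[of J ?C])
    show "fchart Z \<Delta> ?C J" by (rule C')
    show "?C ` (OI \<times> J) \<subseteq> N0" using in2 by auto
    show "lf (?C (x, t)) \<noteq> lf z" if "x \<in> OI" "t \<in> J" "t \<noteq> 0" for x t by (rule ne[OF that])
    show "?C (x, t) \<notin> \<Union>\<L>" if "x \<in> OI" "t \<in> J" "t \<noteq> 0" for x t
    proof
      assume "?C (x, t) \<in> \<Union>\<L>"
      then have "?C (x, t) \<in> lf z" using N(3) in2[OF that(1,2)] by auto
      then have "lf (?C (x, t)) = lf z" using lf_eq lf_in(1)[OF z] by blast
      then show False using ne[OF that] by blast
    qed
  qed (use CJ C in auto)
qed

end

text \<open>Closedness of the slabs is the decisive clause: it separates every leaf of the ribbon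
  from the leaves outside, so the leaf space cannot branch there. Being an open embedding would not
  exclude branching. Only slabs bounded away from the heights \<open>-1\<close> and
  \<open>1\<close>, which are not in the domain, are required to be closed.\<close>

definition ribbon :: "'a topology => 'a set set => (real \<times> real => 'a) => bool" where
  "ribbon Z \<D> k \<longleftrightarrow> open_embedding Z (UNIV \<times> OI) k \<and> (\<forall>t\<in>OI. k ` (UNIV \<times> {t}) \<in> \<D>) \<and>
     (\<forall>a b. -1 < a --> b < 1 --> closedin Z (k ` (UNIV \<times> {a..b})))"

text \<open>\<open>Sp\<close> is a parameter because the locale is used twice: for the singular and
  boundary leaves, and again after the cut leaves have been added to them.\<close>

locale ribboned_surface = foliated_surface +
  fixes Sp :: "'a set set"
  assumes Sp_leaves: "Sp \<subseteq> \<Delta>" and Sp_lf: "locally_finite_in Z Sp" and Bd_Sp: "Bd \<subseteq> \<Union>Sp"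
    and ribbons: "\<And>w. w \<in> \<Delta> - Sp ==> \<exists>k. ribbon Z (\<Delta> - Sp) k \<and> k ` (UNIV \<times> {0}) = w"
begin

lemma ribbon_dest:
  assumes "ribbon Z (\<Delta> - Sp) k"
  shows "continuous_map (top_of_set (UNIV \<times> OI)) Z k" "inj_on k (UNIV \<times> OI)"
    "\<And>B. open B ==> B \<subseteq> UNIV \<times> OI ==> openin Z (k ` B)"
    "\<And>a b. -1 < a ==> b < 1 ==> closedin Z (k ` (UNIV \<times> {a..b}))"
    "\<And>y t. t \<in> OI ==> k (y, t) \<in> topspace Z"
    "\<And>y t. t \<in> OI ==> lf (k (y, t)) = k ` (UNIV \<times> {t})"
    "\<And>y t. t \<in> OI ==> lf (k (y, t)) \<in> \<Delta> - Sp"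
proof -
  have o: "open_embedding Z (UNIV \<times> OI) k" using assms by (simp add: ribbon_def)
  show 1: "continuous_map (top_of_set (UNIV \<times> OI)) Z k" and "inj_on k (UNIV \<times> OI)"
    using o by (auto simp: open_embedding_def)
  show "openin Z (k ` B)" if "open B" "B \<subseteq> UNIV \<times> OI" for B
    using open_embeddingD(3)[OF o] that by (simp add: open_subset)
  show "\<And>a b. -1 < a ==> b < 1 ==> closedin Z (k ` (UNIV \<times> {a..b}))"
    using assms by (auto simp: ribbon_def)
  show "k (y, t) \<in> topspace Z" if "t \<in> OI" for y t
    using continuous_map_image_subset_topspace[OF 1] that by auto
  show 2: "lf (k (y, t)) = k ` (UNIV \<times> {t})" if "t \<in> OI" for y t
    using assms that by (intro lf_eq) (auto simp: ribbon_def)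
  show "lf (k (y, t)) \<in> \<Delta> - Sp" if "t \<in> OI" for y t
    unfolding 2[OF that] using assms that by (auto simp: ribbon_def)
qed

lemma ribbon_lf_iff:
  assumes k: "ribbon Z (\<Delta> - Sp) k" and st: "s \<in> OI" "t \<in> OI"
  shows "lf (k (x, s)) = lf (k (y, t)) \<longleftrightarrow> s = t"
proof
  assume "lf (k (x, s)) = lf (k (y, t))"
  then have "k (x, s) \<in> k ` (UNIV \<times> {t})"
    using ribbon_dest(5,6)[OF k] st lf_in by metis
  then obtain y' where "k (x, s) = k (y', t)" by auto
  then show "s = t" using inj_onD[OF ribbon_dest(2)[OF k], of "(x, s)" "(y', t)"] st by auto
qed (use ribbon_dest(6)[OF k] st in auto)

lemma ribbon_saturated:
  assumes k: "ribbon Z (\<Delta> - Sp) k" and A: "A \<subseteq> OI"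
  shows "saturated \<Delta> (k ` (UNIV \<times> A))"
proof (rule saturatedI)
  fix p q assume p: "p \<in> k ` (UNIV \<times> A)" "p \<in> topspace Z" "q \<in> topspace Z" "lf q = lf p"
  then obtain y t where yt: "p = k (y, t)" "t \<in> A" by auto
  then have "q \<in> k ` (UNIV \<times> {t})" using p ribbon_dest(6)[OF k] A lf_in(2)[OF p(3)] by auto
  then show "q \<in> k ` (UNIV \<times> A)" using yt by auto
qed

lemma ribbon_at:
  assumes "z \<in> topspace Z" "lf z \<notin> Sp"
  obtains k y where "ribbon Z (\<Delta> - Sp) k" "k (y, 0) = z"
proof -
  obtain k where "ribbon Z (\<Delta> - Sp) k" "k ` (UNIV \<times> {0}) = lf z"
    using ribbons[of "lf z"] lf_in(1)[OF assms(1)] assms by auto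
  moreover from this obtain y where "k (y, 0) = z" using lf_in(2)[OF assms(1)] by force
  ultimately show ?thesis using that by blast
qed

text \<open>This is the Hausdorff property of the leaf space at a regular leaf, expressed by nested
  slabs of one ribbon. If \<open>z'\<close> lies in the ribbon at height \<open>v\<close>, slabs of
  half-width \<open>\<bar>v\<bar>/2\<close> miss it; if it lies outside, any slab does.\<close>

lemma leaf_separation:
  assumes z: "z \<in> topspace Z" "lf z \<notin> Sp" and z': "z' \<in> topspace Z" "lf z' \<noteq> lf z"
  obtains P K where "openin Z P" "closedin Z K" "P \<subseteq> K" "z \<in> P" "z' \<notin> K" "saturated \<Delta> P" "saturated \<Delta> K"
    "\<And>p. p \<in> K ==> lf p \<notin> Sp"
proof -
  obtain k y where k: "ribbon Z (\<Delta> - Sp) k" "k (y, 0) = z" using ribbon_at[OF z] by blast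
  have "\<exists>a. 0 < a \<and> a < 1 \<and> z' \<notin> k ` (UNIV \<times> {-a..a})"
  proof (cases "z' \<in> k ` (UNIV \<times> OI)")
    case True
    then obtain y' v where v: "z' = k (y', v)" "v \<in> OI" by auto
    have "v \<noteq> 0" using v z' k ribbon_lf_iff[OF k(1), of v 0 y' y] by auto
    have "z' \<notin> k ` (UNIV \<times> {-(\<bar>v\<bar>/2)..\<bar>v\<bar>/2})"
    proof
      assume "z' \<in> k ` (UNIV \<times> {-(\<bar>v\<bar>/2)..\<bar>v\<bar>/2})"
      then obtain y'' v' where v': "z' = k (y'', v')" "v' \<in> {-(\<bar>v\<bar>/2)..\<bar>v\<bar>/2}" by auto
      then have "v' \<in> OI" using v by auto
      then have "v' = v" using ribbon_lf_iff[OF k(1), of v v' y' y''] v v' by auto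
      then show False using v' \<open>v \<noteq> 0\<close> by auto
    qed
    then show ?thesis using v \<open>v \<noteq> 0\<close> by (intro exI[of _ "\<bar>v\<bar>/2"]) auto
  next
    case False
    then show ?thesis by (intro exI[of _ "1/2"]) force
  qed
  then obtain a where a: "0 < a" "a < 1" "z' \<notin> k ` (UNIV \<times> {-a..a})" by blast
  show ?thesis
  proof (rule that[of "k ` (UNIV \<times> {-a<..<a})" "k ` (UNIV \<times> {-a..a})"])
    show "openin Z (k ` (UNIV \<times> {- a<..<a}))"
      using a by (intro ribbon_dest(3)[OF k(1)]) (auto intro!: open_Times)
    show "closedin Z (k ` (UNIV \<times> {- a..a}))" using a by (intro ribbon_dest(4)[OF k(1)]) auto
    show "saturated \<Delta> (k ` (UNIV \<times> {- a<..<a}))" "saturated \<Delta> (k ` (UNIV \<times> {- a..a}))"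
      using a by (auto intro!: ribbon_saturated[OF k(1)])
    show "lf p \<notin> Sp" if "p \<in> k ` (UNIV \<times> {- a..a})" for p
      using that a ribbon_dest(7)[OF k(1)] by auto
    show "z \<in> k ` (UNIV \<times> {- a<..<a})" using a k by force
  qed (use a in auto)
qed

end

section \<open>Transversal arcs issuing from a special leaf\<close>

context ribboned_surface
begin

text \<open>One side of a special leaf. The bottom row is only required to be attained continuously,
  since a single side of an interior leaf is not open in the surface; the embedding and isolation
  clauses concern positive heights.\<close>

definition half_chart :: "(real \<times> real => 'a) => bool" where
  "half_chart C \<longleftrightarrow> continuous_map (top_of_set (OI \<times> {0..<1})) Z C \<and> open_embedding Z (OI \<times> UI) C \<and>
     (\<forall>x\<in>OI. \<forall>t\<in>UI. lf (C (x, t)) = lf (C (0, t))) \<and>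
     (\<forall>t0\<in>UI. \<exists>d>0. \<forall>t\<in>UI. t \<noteq> t0 --> \<bar>t - t0\<bar> < d --> lf (C (0, t)) \<noteq> lf (C (0, t0))) \<and>
     (\<forall>t\<in>UI. lf (C (0, t)) \<notin> Sp) \<and> lf (C (0, 0)) \<in> Sp"

lemma half_chart_dest:
  assumes "half_chart C"
  shows "continuous_map (top_of_set (OI \<times> {0..<1})) Z C" "open_embedding Z (OI \<times> UI) C"
    "\<And>x t. x \<in> OI ==> t \<in> UI ==> lf (C (x, t)) = lf (C (0, t))"
    "\<And>t. t \<in> UI ==> lf (C (0, t)) \<notin> Sp" "lf (C (0, 0)) \<in> Sp"
    "\<And>x t. x \<in> OI ==> t \<in> {0..<1} ==> C (x, t) \<in> topspace Z"
proof -
  show 1: "continuous_map (top_of_set (OI \<times> {0..<1})) Z C" and "open_embedding Z (OI \<times> UI) C"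
    "\<And>x t. x \<in> OI ==> t \<in> UI ==> lf (C (x, t)) = lf (C (0, t))"
    "\<And>t. t \<in> UI ==> lf (C (0, t)) \<notin> Sp" "lf (C (0, 0)) \<in> Sp"
    using assms unfolding half_chart_def by blast+
  show "C (x, t) \<in> topspace Z" if "x \<in> OI" "t \<in> {0..<1}" for x t
    using continuous_map_image_subset_topspace[OF 1] that by auto
qed

lemma half_chart_line:
  assumes "half_chart C"
  shows "continuous_map (top_of_set {0..<1}) Z (\<lambda>t. C (0, t))"
proof -
  have "continuous_map (top_of_set {0..<1}) (top_of_set (OI \<times> {0..<1})) (\<lambda>t. (0::real, t::real))"
    by (auto simp: continuous_map_in_subtopology intro!: continuous_intros)
  from continuous_map_compose[OF this half_chart_dest(1)[OF assms]] show ?thesis by (simp add: comp_def)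
qed

text \<open>A height function taking two values would take all values between them, among them
  values arbitrarily close to \<open>f a\<close>; these would be further plaques of the same leaf,
  which isolation excludes.\<close>

lemma half_chart_plaque_const:
  assumes C: "half_chart C" and A: "connected A" and f: "continuous_on A f" "\<And>a. a \<in> A ==> f a \<in> UI"
    and same: "\<And>a b. a \<in> A ==> b \<in> A ==> lf (C (0, f a)) = lf (C (0, f b))"
    and ab: "a \<in> A" "b \<in> A"
  shows "f a = f b"
proof -
  have no: "\<not> f a < f b" if ab: "a \<in> A" "b \<in> A" for a b
  proof
    assume lt: "f a < f b"
    have "connected (f ` A)" using A f connected_continuous_image by blast
    then have sub: "{f a..f b} \<subseteq> f ` A" using ab connected_contains_Icc[of "f ` A"] by blast
    obtain d where d: "d > 0" "\<And>t. t\<in>UI ==> t \<noteq> f a ==> \<bar>t - f a\<bar> < d ==> lf (C (0, t)) \<noteq> lf (C (0, f a))"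
      using C f(2)[OF ab(1)] unfolding half_chart_def by blast
    define t where "t = f a + min (d/2) (f b - f a)"
    have "t \<in> {f a..f b}" using lt d(1) by (auto simp: t_def)
    then obtain c where c: "c \<in> A" "t = f c" using sub by blast
    have "t \<noteq> f a" "\<bar>t - f a\<bar> < d" using lt d(1) by (auto simp: t_def)
    then have "lf (C (0, t)) \<noteq> lf (C (0, f a))" using d(2)[of t] f(2)[OF c(1)] c(2) by simp
    then show False using same[OF c(1) ab(1)] c(2) by simp
  qed
  show ?thesis using no[OF ab] no[OF ab(2,1)] by simp
qed

text \<open>In a ribbon the height tells leaves apart, while in the half chart this is still to be
  shown. The transfer works by writing chart heights near \<open>t\<close> as a function of ribbon
  heights.\<close>

lemma half_chart_local_inj:
  assumes C: "half_chart C" and t: "t \<in> UI"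
  obtains n where "n > 0" "\<And>s1 s2. s1 \<in> UI ==> s2 \<in> UI ==> \<bar>s1 - t\<bar> < n ==> \<bar>s2 - t\<bar> < n ==>
      lf (C (0, s1)) = lf (C (0, s2)) ==> s1 = s2"
proof -
  let ?A = "OI \<times> UI"
  let ?N = "C ` ?A"
  let ?c = "inv_into ?A C"
  have oe: "open_embedding Z ?A C" by (rule half_chart_dest(2)[OF C])
  have Tt: "C (0, t) \<in> topspace Z" using half_chart_dest(6)[OF C, of 0 t] t by auto
  obtain k y0 where k: "ribbon Z (\<Delta> - Sp) k" "k (y0, 0) = C (0, t)"
    using ribbon_at[OF Tt half_chart_dest(4)[OF C t]] by blast
  have "k (y0, 0) \<in> ?N" using k(2) t by auto
  then obtain r0 where r0: "r0 > 0" "\<And>y v. (y, v) \<in> UNIV \<times> OI ==> \<bar>y - y0\<bar> < r0 ==> \<bar>v - 0\<bar> < r0 ==> k (y, v) \<in> ?N"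
    using continuous_map_nbhd2[OF ribbon_dest(1)[OF k(1)], of y0 0 ?N] open_embeddingD(4)[OF oe] by auto
  define r where "r = min r0 1"
  have r: "0 < r" "r \<le> r0" "r \<le> 1" using r0 by (auto simp: r_def)
  define D where "D = {y0 - r<..<y0 + r} \<times> {-r<..<r}"
  have D: "D \<subseteq> UNIV \<times> OI" "open D" using r by (auto simp: D_def open_Times)
  have kD: "k p \<in> ?N" if "p \<in> D" for p
    using r0(2)[of "fst p" "snd p"] that r by (auto simp: D_def)
  \<comment> \<open>The chart height of a ribbon point. It is constant along ribbon leaves by
    \<open>half_chart_plaque_const\<close>, so it depends on the ribbon height alone, and the ribbon
    height is determined by the leaf.\<close>
  define S where "S p = snd (?c (k p))" for p
  have cS: "continuous_on D S"
  proof -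
    have "continuous_map (top_of_set D) (subtopology Z ?N) k"
      unfolding continuous_map_in_subtopology
      using continuous_map_from_subtopology_mono[OF ribbon_dest(1)[OF k(1)] D(1)] kD by auto
    from continuous_map_compose[OF this open_embedding_inverse[OF oe]]
    have "continuous_on D (\<lambda>p. ?c (k p))" by (simp add: continuous_map_in_subtopology comp_def)
    then show ?thesis unfolding S_def by (intro continuous_intros)
  qed
  have Sc: "?c (k p) \<in> ?A" "C (?c (k p)) = k p" if "p \<in> D" for p
    using kD[OF that] by (rule inv_into_into, rule f_inv_into_f)
  have Sr: "S p \<in> UI" if "p \<in> D" for p
    using Sc(1)[OF that] by (simp add: S_def mem_Times_iff)
  have lS: "lf (C (0, S p)) = lf (k p)" if "p \<in> D" for p
  proof -
    obtain x s where xs: "?c (k p) = (x, s)" by fastforce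
    then have "x \<in> OI" "s \<in> UI" using Sc(1)[OF that] by auto
    then have "lf (C (x, s)) = lf (C (0, s))" by (rule half_chart_dest(3)[OF C])
    then show ?thesis using Sc(2)[OF that] xs by (simp add: S_def)
  qed
  have const: "S (y, v) = S (y0, v)" if "(y, v) \<in> D" for y v
  proof (rule half_chart_plaque_const[OF C, of "{y0 - r<..<y0 + r}" "\<lambda>y. S (y, v)"])
    have v: "v \<in> {-r<..<r}" using that by (auto simp: D_def)
    have vD: "(a, v) \<in> D" if "a \<in> {y0 - r<..<y0 + r}" for a using that v by (simp add: D_def)
    show "connected {y0 - r<..<y0 + r}" by simp
    show "continuous_on {y0 - r<..<y0 + r} (\<lambda>y. S (y, v))"
      by (intro continuous_on_compose2[OF cS] continuous_intros) (use vD in auto)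
    show "S (a, v) \<in> UI" if "a \<in> {y0 - r<..<y0 + r}" for a by (rule Sr[OF vD[OF that]])
    show "lf (C (0, S (a, v))) = lf (C (0, S (b, v)))" if "a \<in> {y0 - r<..<y0 + r}" "b \<in> {y0 - r<..<y0 + r}" for a b
      using lS[OF vD[OF that(1)]] lS[OF vD[OF that(2)]] ribbon_lf_iff[OF k(1), of v v a b] v r by auto
    show "y \<in> {y0 - r<..<y0 + r}" "y0 \<in> {y0 - r<..<y0 + r}" using that r by (auto simp: D_def)
  qed
  have "openin Z (k ` D)" using ribbon_dest(3)[OF k(1)] D by blast
  moreover have "C (0, t) \<in> k ` D" unfolding k(2)[symmetric] using r by (intro imageI) (auto simp: D_def)
  ultimately obtain n where n: "n > 0" "\<And>s. s \<in> {0..<1} ==> dist s t < n ==> C (0, s) \<in> k ` D"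
    using continuous_map_nbhd[OF half_chart_line[OF C], of t "k ` D"] t by auto
  have key: "\<exists>v. v \<in> {-r<..<r} \<and> s = S (y0, v) \<and> lf (C (0, s)) = lf (k (y0, v))" if s: "s \<in> UI" "\<bar>s - t\<bar> < n" for s
  proof -
    obtain y v where yv: "(y, v) \<in> D" "C (0, s) = k (y, v)" using n(2)[of s] s by (auto simp: dist_real_def)
    have "?c (C (0, s)) = (0, s)" using open_embeddingD(2)[OF oe] s by (intro inv_into_f_f) auto
    then have "S (y, v) = s" unfolding S_def yv(2)[symmetric] by simp
    then have 1: "s = S (y0, v)" using const[OF yv(1)] by simp
    have v: "v \<in> {-r<..<r}" using yv(1) by (auto simp: D_def)
    then have "lf (k (y, v)) = lf (k (y0, v))" using ribbon_lf_iff[OF k(1), of v v y y0] r by auto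
    then show ?thesis using 1 v yv(2) by metis
  qed
  show ?thesis
  proof (rule that[OF n(1)])
    fix s1 s2 assume s: "s1 \<in> UI" "s2 \<in> UI" "\<bar>s1 - t\<bar> < n" "\<bar>s2 - t\<bar> < n"
      and l: "lf (C (0, s1)) = lf (C (0, s2))"
    obtain v1 where v1: "v1 \<in> {-r<..<r}" "s1 = S (y0, v1)" "lf (C (0, s1)) = lf (k (y0, v1))" using key s by blast
    obtain v2 where v2: "v2 \<in> {-r<..<r}" "s2 = S (y0, v2)" "lf (C (0, s2)) = lf (k (y0, v2))" using key s by blast
    have "v1 = v2" using l v1 v2 ribbon_lf_iff[OF k(1), of v1 v2 y0 y0] r by auto
    then show "s1 = s2" using v1 v2 by simp
  qed
qed

text \<open>Only the leaf through the arc has to be the central leaf of the ribbon; the point itself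
  need not be \<open>k (y0, 0)\<close>. Hence one ribbon can measure heights at two different
  crossings of the same leaf.\<close>

lemma half_chart_height:
  assumes C: "half_chart C" and t: "t \<in> UI" and k: "ribbon Z (\<Delta> - Sp) k" "lf (C (0, t)) = lf (k (y0, 0))"
    and \<epsilon>: "\<epsilon> > 0"
  obtains n u where "n > 0" "n \<le> \<epsilon>" "{t - n..t + n} \<subseteq> UI" "continuous_on {t - n..t + n} u" "u t = 0"
    "\<And>s. s \<in> {t - n..t + n} ==> u s \<in> OI \<and> lf (C (0, s)) = lf (k (y0, u s))"
    "(\<forall>x\<in>{t - n..t + n}. \<forall>y\<in>{t - n..t + n}. x < y --> u x < u y) \<or>
     (\<forall>x\<in>{t - n..t + n}. \<forall>y\<in>{t - n..t + n}. x < y --> u y < u x)"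
proof -
  let ?A = "UNIV \<times> OI"
  have oe: "open_embedding Z ?A k" using k by (simp add: ribbon_def)
  have Tt: "C (0, t) \<in> topspace Z" using half_chart_dest(6)[OF C, of 0 t] t by auto
  have lfT: "lf (C (0, t)) = k ` (UNIV \<times> {0})" using k ribbon_dest(6)[OF k(1), of 0 y0] by simp
  then have "C (0, t) \<in> k ` ?A" using lf_in(2)[OF Tt] by force
  then obtain e where e: "e > 0" "\<And>s. s \<in> {0..<1} ==> dist s t < e ==> C (0, s) \<in> k ` ?A"
    using continuous_map_nbhd[OF half_chart_line[OF C], of t "k ` ?A"] open_embeddingD(4)[OF oe] t by auto
  obtain n1 where n1: "n1 > 0" "\<And>s1 s2. s1 \<in> UI ==> s2 \<in> UI ==> \<bar>s1 - t\<bar> < n1 ==> \<bar>s2 - t\<bar> < n1 ==>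
      lf (C (0, s1)) = lf (C (0, s2)) ==> s1 = s2"
    using half_chart_local_inj[OF C t] by blast
  define n where "n = min (min (min e n1) (min t (1 - t))) \<epsilon> / 2"
  have n: "n > 0" "n < e" "n < n1" "n < t" "n < 1 - t" "n \<le> \<epsilon>" using e(1) n1(1) t \<epsilon> by (auto simp: n_def)
  let ?I = "{t - n..t + n}"
  have I: "?I \<subseteq> UI" using n by auto
  have kin: "C (0, s) \<in> k ` ?A" if "s \<in> ?I" for s
    using e(2)[of s] that I n by (fastforce simp: dist_real_def)
  define u where "u s = snd (inv_into ?A k (C (0, s)))" for s
  have cu: "continuous_on ?I u"
  proof -
    have "?I \<subseteq> {0..<1}" using I by auto
    then have "continuous_map (top_of_set ?I) (subtopology Z (k ` ?A)) (\<lambda>s. C (0, s))"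
      unfolding continuous_map_in_subtopology
      using continuous_map_from_subtopology_mono[OF half_chart_line[OF C], of ?I] kin by auto
    from continuous_map_compose[OF this open_embedding_inverse[OF oe]]
    have "continuous_on ?I (\<lambda>s. inv_into ?A k (C (0, s)))" by (simp add: continuous_map_in_subtopology comp_def)
    then show ?thesis unfolding u_def by (intro continuous_intros)
  qed
  have us: "u s \<in> OI \<and> lf (C (0, s)) = lf (k (y0, u s))" if "s \<in> ?I" for s
  proof -
    have 1: "inv_into ?A k (C (0, s)) \<in> ?A" "k (inv_into ?A k (C (0, s))) = C (0, s)"
      using kin[OF that] by (rule inv_into_into, rule f_inv_into_f)
    then have "u s \<in> OI" unfolding u_def by (metis mem_Times_iff)
    moreover have "lf (k (fst (inv_into ?A k (C (0, s))), u s)) = lf (k (y0, u s))"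
      using ribbon_lf_iff[OF k(1)] \<open>u s \<in> OI\<close> by blast
    ultimately show ?thesis using 1(2) by (simp add: u_def)
  qed
  have tI: "t \<in> ?I" using n by auto
  have ut: "u t = 0" using us[OF tI] k(2) ribbon_lf_iff[OF k(1), of "u t" 0 y0 y0] by auto
  have "inj_on u ?I"
  proof (rule inj_onI)
    fix a b assume ab: "a \<in> ?I" "b \<in> ?I" "u a = u b"
    then have "lf (C (0, a)) = lf (C (0, b))" using us[OF ab(1)] us[OF ab(2)] by simp
    moreover have "a \<in> UI" "b \<in> UI" using ab I by blast+
    moreover have "\<bar>a - t\<bar> < n1" "\<bar>b - t\<bar> < n1" using ab n by auto
    ultimately show "a = b" using n1(2) by blast
  qed
  then have "(\<forall>x\<in>?I. \<forall>y\<in>?I. x < y --> u x < u y) \<or> (\<forall>x\<in>?I. \<forall>y\<in>?I. x < y --> u y < u x)"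
    using continuous_inj_strict_monotone[OF _ cu] by (simp add: is_interval_cc)
  then show ?thesis using that[OF n(1) n(6) I cu ut us] by blast
qed

text \<open>Given a point outside the saturation, each point of \<open>A\<close> has slabs
  separating its leaf from that point; by compactness finitely many of the closed saturated slabs
  cover the saturation.\<close>

lemma closedin_sat_compact:
  assumes A: "compactin Z A" "\<And>a. a \<in> A ==> lf a \<notin> Sp"
  shows "closedin Z (sat A)"
proof -
  have At: "A \<subseteq> topspace Z" using A compactin_subset_topspace by blast
  have "openin Z (topspace Z - sat A)"
  proof (subst openin_subopen, clarify)
    fix z assume z: "z \<in> topspace Z" "z \<notin> sat A"
    have "\<exists>P K. openin Z P \<and> closedin Z K \<and> P \<subseteq> K \<and> a \<in> P \<and> z \<notin> K \<and> saturated \<Delta> K" if aA: "a \<in> A" for a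
    proof -
      have "lf z \<noteq> lf a" using z aA by (auto simp: sat_def)
      moreover have "a \<in> topspace Z" using aA At by blast
      ultimately obtain P K where "openin Z P" "closedin Z K" "P \<subseteq> K" "a \<in> P" "z \<notin> K" "saturated \<Delta> K"
        using leaf_separation[OF _ A(2)[OF aA] z(1)] by metis
      then show ?thesis by blast
    qed
    then obtain P K where PK: "\<And>a. a \<in> A ==> openin Z (P a) \<and> closedin Z (K a) \<and> P a \<subseteq> K a \<and> a \<in> P a \<and> z \<notin> K a \<and> saturated \<Delta> (K a)"
      by metis
    have "\<exists>\<F>. finite \<F> \<and> \<F> \<subseteq> P ` A \<and> A \<subseteq> \<Union>\<F>"
      using compactinD[OF A(1), of "P ` A"] PK by blast
    then obtain F where F: "finite F" "F \<subseteq> A" "A \<subseteq> \<Union>(P ` F)"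
      by (metis (no_types, lifting) finite_subset_image)
    have cl: "closedin Z (\<Union>(K ` F))" using F PK by (intro closedin_Union) auto
    have "sat A \<subseteq> \<Union>(K ` F)"
    proof
      fix p assume "p \<in> sat A"
      then obtain a where a: "a \<in> A" "lf a = lf p" "p \<in> topspace Z" by (auto simp: sat_def)
      then obtain f where f: "f \<in> F" "a \<in> P f" using F by blast
      then have "a \<in> K f" "saturated \<Delta> (K f)" using PK F by blast+
      then have "p \<in> K f" using saturatedD[of "K f" a p] a At by auto
      then show "p \<in> \<Union>(K ` F)" using f by blast
    qed
    moreover have "z \<notin> \<Union>(K ` F)" using F PK by blast
    ultimately show "\<exists>T. openin Z T \<and> z \<in> T \<and> T \<subseteq> topspace Z - sat A"
      using z cl by (intro exI[of _ "topspace Z - \<Union>(K ` F)"]) auto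
  qed
  then show ?thesis using sat_sub closedin_def by blast
qed

lemma half_chart_arc_compact:
  assumes C: "half_chart C" and pq: "0 < p" "q < 1"
  shows "compactin Z ((\<lambda>t. C (0, t)) ` {p..q})"
proof (rule image_compactin[OF _ half_chart_line[OF C]])
  show "compactin (top_of_set {0..<1}) {p..q}"
    using pq by (auto simp: compactin_subtopology)
qed

text \<open>Two points of the arc on a common leaf that are closest to each other cannot form a fold,
  so the leaves through the arc between them form a clopen set, and that set would contain the special leaf.\<close>
lemma half_chart_inj:
  assumes C: "half_chart C"
  shows "inj_on (\<lambda>t. lf (C (0, t))) UI"
proof (rule ccontr)
  let ?T = "\<lambda>t. C (0, t)"
  have topT: "?T t \<in> topspace Z" if "t \<in> {0..<1}" for t using half_chart_dest(6)[OF C, of 0 t] that by auto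
  assume "\<not> ?thesis"
  then obtain a b where ab: "0 < a" "a < b" "b < 1" "lf (?T a) = lf (?T b)"
    unfolding inj_on_def by (metis greaterThanLessThan_iff linorder_less_linear)
  \<comment> \<open>Pairs of distinct parameters in \<open>[a, b]\<close> on a common leaf. The set
    is closed: local injectivity prevents a collapse to the diagonal, and leaf separation makes
    limits of points on common leaves lie on a common leaf. Hence some pair has smallest
    distance.\<close>
  define E where "E = {(p, q). a \<le> p \<and> p < q \<and> q \<le> b \<and> lf (?T p) = lf (?T q)}"
  have "closed E"
    unfolding closed_sequential_limits
  proof (intro allI impI, elim conjE)
    fix x l assume x: "\<forall>n. x n \<in> E" "x \<longlonglongrightarrow> l"
    obtain p q where l: "l = (p, q)" by fastforce
    have lim: "(\<lambda>n. fst (x n)) \<longlonglongrightarrow> p" "(\<lambda>n. snd (x n)) \<longlonglongrightarrow> q"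
      using tendsto_fst[OF x(2)] tendsto_snd[OF x(2)] l by auto
    have xn: "a \<le> fst (x n)" "fst (x n) < snd (x n)" "snd (x n) \<le> b" "lf (?T (fst (x n))) = lf (?T (snd (x n)))" for n
      using x(1) unfolding E_def by (auto simp: case_prod_beta dest: spec[of _ n])
    have pq: "a \<le> p" "p \<le> q" "q \<le> b"
      using LIMSEQ_le_const[OF lim(1), of a] LIMSEQ_le_const2[OF lim(2), of b] LIMSEQ_le[OF lim] xn less_imp_le by blast+
    have p01: "p \<in> UI" "q \<in> UI" using pq ab by auto
    have "p \<noteq> q"
    proof
      assume "p = q"
      obtain \<eta> where \<eta>: "\<eta> > 0" "\<And>s1 s2. s1 \<in> UI ==> s2 \<in> UI ==> \<bar>s1 - p\<bar> < \<eta> ==> \<bar>s2 - p\<bar> < \<eta> ==>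
        lf (?T s1) = lf (?T s2) ==> s1 = s2" using half_chart_local_inj[OF C p01(1)] by blast
      have "eventually (\<lambda>n. \<bar>fst (x n) - p\<bar> < \<eta>) sequentially" "eventually (\<lambda>n. \<bar>snd (x n) - p\<bar> < \<eta>) sequentially"
        using lim \<eta>(1) \<open>p = q\<close> unfolding tendsto_iff dist_real_def by auto
      then have "eventually (\<lambda>n. \<bar>fst (x n) - p\<bar> < \<eta> \<and> \<bar>snd (x n) - p\<bar> < \<eta>) sequentially" by eventually_elim auto
      then obtain n where n: "\<bar>fst (x n) - p\<bar> < \<eta>" "\<bar>snd (x n) - p\<bar> < \<eta>"
        using eventually_happens trivial_limit_sequentially by blast
      have "fst (x n) \<in> UI" "snd (x n) \<in> UI" using xn(1-3)[of n] ab by auto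
      then show False using \<eta>(2) n xn(2,4)[of n] by (metis less_irrefl)
    qed
    moreover have "lf (?T p) = lf (?T q)"
    proof (rule ccontr)
      assume ne: "lf (?T p) \<noteq> lf (?T q)"
      have pt: "?T p \<in> topspace Z" "?T q \<in> topspace Z" using p01 topT by auto
      obtain P K where PK: "openin Z P" "closedin Z K" "P \<subseteq> K" "?T p \<in> P" "?T q \<notin> K" "saturated \<Delta> P"
        using leaf_separation[OF pt(1) half_chart_dest(4)[OF C p01(1)] pt(2)] ne by metis
      obtain r1 where r1: "r1 > 0" "\<And>s. s \<in> {0..<1} ==> dist s p < r1 ==> ?T s \<in> P"
        using continuous_map_nbhd[OF half_chart_line[OF C], of p P] PK p01 by auto
      obtain r2 where r2: "r2 > 0" "\<And>s. s \<in> {0..<1} ==> dist s q < r2 ==> ?T s \<in> topspace Z - K"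
        using continuous_map_nbhd[OF half_chart_line[OF C], of q "topspace Z - K"] PK p01 pt by auto
      have "eventually (\<lambda>n. dist (fst (x n)) p < r1) sequentially" "eventually (\<lambda>n. dist (snd (x n)) q < r2) sequentially"
        using lim r1(1) r2(1) unfolding tendsto_iff by auto
      then have "eventually (\<lambda>n. dist (fst (x n)) p < r1 \<and> dist (snd (x n)) q < r2) sequentially" by eventually_elim auto
      then obtain n where n: "dist (fst (x n)) p < r1" "dist (snd (x n)) q < r2"
        using eventually_happens trivial_limit_sequentially by blast
      have x01: "fst (x n) \<in> {0..<1}" "snd (x n) \<in> {0..<1}" using xn(1-3)[of n] ab by auto
      have "?T (fst (x n)) \<in> P" by (rule r1(2)[OF x01(1) n(1)])
      then have "?T (snd (x n)) \<in> P"
        using saturatedD[OF PK(6) _ topT[OF x01(1)] topT[OF x01(2)] xn(4)[of n, symmetric]] by blast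
      then show False using r2(2)[OF x01(2) n(2)] PK(3) by blast
    qed
    ultimately show "l \<in> E" using pq unfolding l E_def by auto
  qed
  moreover have "bounded E"
  proof (rule bounded_subset)
    show "bounded ({a..b} \<times> {a..b})" by (simp add: bounded_Times)
    show "E \<subseteq> {a..b} \<times> {a..b}" by (auto simp: E_def)
  qed
  ultimately have "compact E" by (simp add: compact_eq_bounded_closed)
  moreover have "E \<noteq> {}" using ab by (auto simp: E_def)
  moreover have "continuous_on E (\<lambda>e. snd e - fst e)" by (intro continuous_intros)
  ultimately obtain e where e: "e \<in> E" "\<And>e'. e' \<in> E ==> snd e - fst e \<le> snd e' - fst e'"
    using continuous_attains_inf[of E "\<lambda>e. snd e - fst e"] by blast
  obtain p q where epq: "e = (p, q)" by fastforce
  have pq: "a \<le> p" "p < q" "q \<le> b" "lf (?T p) = lf (?T q)" using e(1) by (auto simp: E_def epq)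
  have min: "q - p \<le> q' - p'" if "p \<le> p'" "p' < q'" "q' \<le> q" "lf (?T p') = lf (?T q')" for p' q'
    using e(2)[of "(p', q')"] that pq by (auto simp: E_def epq)
  have p01: "p \<in> UI" "q \<in> UI" using pq ab by auto
  obtain k y0 where k: "ribbon Z (\<Delta> - Sp) k" "k (y0, 0) = ?T p"
  proof -
    have "p \<in> {0..<1}" using p01(1) by simp
    then show ?thesis using ribbon_at[OF topT half_chart_dest(4)[OF C p01(1)]] that by blast
  qed
  have kp: "lf (?T p) = lf (k (y0, 0))" and kq: "lf (?T q) = lf (k (y0, 0))" using k pq by auto
  \<comment> \<open>Heights near \<open>p\<close> and near \<open>q\<close> are measured in the same
    ribbon. The bound \<open>(q - p)/2\<close> keeps the inner pieces of the two parameter intervals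
    on either side of the midpoint.\<close>
  have "(q - p)/2 > 0" using pq by simp
  then obtain \<eta> u where u: "\<eta> > 0" "\<eta> \<le> (q - p)/2" "{p - \<eta>..p + \<eta>} \<subseteq> UI" "continuous_on {p - \<eta>..p + \<eta>} u" "u p = 0"
    "\<And>s. s \<in> {p - \<eta>..p + \<eta>} ==> u s \<in> OI \<and> lf (C (0, s)) = lf (k (y0, u s))"
    "(\<forall>x\<in>{p - \<eta>..p + \<eta>}. \<forall>y\<in>{p - \<eta>..p + \<eta>}. x < y --> u x < u y) \<or>
     (\<forall>x\<in>{p - \<eta>..p + \<eta>}. \<forall>y\<in>{p - \<eta>..p + \<eta>}. x < y --> u y < u x)"
    using half_chart_height[OF C p01(1) k(1) kp, of "(q-p)/2"] by blast
  obtain h w where w: "h > 0" "h \<le> (q - p)/2" "{q - h..q + h} \<subseteq> UI" "continuous_on {q - h..q + h} w" "w q = 0"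
    "\<And>s. s \<in> {q - h..q + h} ==> w s \<in> OI \<and> lf (C (0, s)) = lf (k (y0, w s))"
    "(\<forall>x\<in>{q - h..q + h}. \<forall>y\<in>{q - h..q + h}. x < y --> w x < w y) \<or>
     (\<forall>x\<in>{q - h..q + h}. \<forall>y\<in>{q - h..q + h}. x < y --> w y < w x)"
    using half_chart_height[OF C p01(2) k(1) kq, of "(q-p)/2"] \<open>(q - p)/2 > 0\<close> by blast
  have ivt: "\<exists>x. a \<le> x \<and> x \<le> b \<and> f x = v" if "a \<le> b" "continuous_on {a..b} f"
    "f a \<le> v \<and> v \<le> f b \<or> f b \<le> v \<and> v \<le> f a" for a b v and f :: "real => real"
    using that IVT'[of f a v b] IVT2'[of f b v a] by blast
  let ?p' = "p + \<eta>" and ?q' = "q - h"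
  have cu: "continuous_on {p..?p'} u" "continuous_on {?q'..q} w"
    using u(1,4) w(1,4) by (auto elim!: continuous_on_subset)
  have pq'in: "?p' \<in> {p - \<eta>..p + \<eta>}" "?q' \<in> {q - h..q + h}" using u(1) w(1) by auto
  have pqin: "p \<in> {p - \<eta>..p + \<eta>}" "q \<in> {q - h..q + h}" "p < ?p'" "?q' < q" using u(1) w(1) by auto
  have up': "u ?p' \<noteq> 0"
  proof -
    have "u p < u ?p' \<or> u ?p' < u p" using u(7) pqin(1,3) pq'in(1) by blast
    then show ?thesis using u(5) by auto
  qed
  have wq': "w ?q' \<noteq> 0"
  proof -
    have "w ?q' < w q \<or> w q < w ?q'" using w(7) pqin(2,4) pq'in(2) by blast
    then show ?thesis using w(5) by auto
  qed
  \<comment> \<open>Every height of absolute value at most \<open>v0\<close> is attained on an inner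
    piece of the arc whenever its sign is the one with which that piece leaves the common
    leaf.\<close>
  define v0 where "v0 = min \<bar>u ?p'\<bar> \<bar>w ?q'\<bar>"
  have v0: "v0 > 0" "v0 < 1" using up' wq' u(6)[OF pq'in(1)] by (auto simp: v0_def)
  have cov_p: "\<exists>s\<in>{p..?p'}. u s = v" if "\<bar>v\<bar> \<le> v0" "v * u ?p' \<ge> 0" for v
  proof -
    have "\<bar>v\<bar> \<le> \<bar>u ?p'\<bar>" using that(1) by (simp add: v0_def)
    then have "0 \<le> v \<and> v \<le> u ?p' \<or> u ?p' \<le> v \<and> v \<le> 0" using that(2) up' by (auto simp: zero_le_mult_iff)
    then show ?thesis using ivt[of p ?p' u v] u(1,5) cu(1) unfolding Bex_def atLeastAtMost_iff by auto
  qed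
  have cov_q: "\<exists>s\<in>{?q'..q}. w s = v" if "\<bar>v\<bar> \<le> v0" "v * w ?q' \<ge> 0" for v
  proof -
    have "\<bar>v\<bar> \<le> \<bar>w ?q'\<bar>" using that(1) by (simp add: v0_def)
    then have "0 \<le> v \<and> v \<le> w ?q' \<or> w ?q' \<le> v \<and> v \<le> 0" using that(2) wq' by (auto simp: zero_le_mult_iff)
    then show ?thesis using ivt[of ?q' q w v] w(1,5) cu(2) unfolding Bex_def atLeastAtMost_iff by auto
  qed
  show False
  proof (cases "u ?p' * w ?q' > 0")
    \<comment> \<open>Both inner pieces leave the leaf to the same side of the ribbon. A height
      attained on both gives a closer pair on one leaf, against minimality.\<close>
    case True
    define v where "v = sgn (u ?p') * v0"
    have v: "\<bar>v\<bar> = v0" "v * u ?p' \<ge> 0" "v * w ?q' \<ge> 0" "v \<noteq> 0"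
      using True v0 up' by (auto simp: v_def abs_mult sgn_if zero_less_mult_iff mult_le_0_iff)
    obtain s where s: "s \<in> {p..?p'}" "u s = v" using cov_p[of v] v by auto
    obtain s' where s': "s' \<in> {?q'..q}" "w s' = v" using cov_q[of v] v by auto
    have sp: "s \<noteq> p" and sq: "s' \<noteq> q" using s s' v u(5) w(5) by auto
    have "s \<in> {p - \<eta>..p + \<eta>}" "s' \<in> {q - h..q + h}" using s(1) s'(1) u(1) w(1) by auto
    then have "lf (?T s) = lf (?T s')" using u(6)[of s] w(6)[of s'] s(2) s'(2) by simp
    show False
    proof (cases "s < s'")
      case True
      then have "q - p \<le> s' - s" using min[of s s'] s s' \<open>lf (?T s) = lf (?T s')\<close> by auto
      then show False using sp sq s s' by auto
    next
      \<comment> \<open>The inner pieces have at most the midpoint in common, so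
        \<open>s = s'\<close> is that midpoint. Half the height then gives two parameters strictly
        on either side of it.\<close>
      case False
      then have "s = s'" "s = p + \<eta>" "s' = q - h" "\<eta> = (q-p)/2" using s s' u(2) w(2) by (auto simp: field_simps)
      obtain r where r: "r \<in> {p..?p'}" "u r = v/2" using cov_p[of "v/2"] v v0 by auto
      obtain r' where r': "r' \<in> {?q'..q}" "w r' = v/2" using cov_q[of "v/2"] v v0 by auto
      have rne: "r \<noteq> p" "r' \<noteq> q" "r \<noteq> s" "r' \<noteq> s'" using r r' s s' v u(5) w(5) by auto
      have "r \<in> {p - \<eta>..p + \<eta>}" "r' \<in> {q - h..q + h}" using r(1) r'(1) u(1) w(1) by auto
      then have "lf (?T r) = lf (?T r')" using u(6)[of r] w(6)[of r'] r(2) r'(2) by simp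
      moreover have "r < r'" using r r' rne \<open>s = s'\<close> \<open>s = p + \<eta>\<close> \<open>s' = q - h\<close> by auto
      ultimately have "q - p \<le> r' - r" using min[of r r'] r r' by auto
      then show False using rne r r' by auto
    qed
  next
    \<comment> \<open>The pieces leave to opposite sides, so together they sweep a full slab around
      the common leaf. The saturation of the closed arc is then this open slab together with the
      open saturation of the interior of the arc: it is open as well as closed.\<close>
    case False
    then have neg: "u ?p' * w ?q' < 0" using up' wq' by (simp add: linorder_not_less order_less_le)
    define M where "M = sat (?T ` {p..q})"
    have sub01: "{p..q} \<subseteq> UI" using p01 by auto
    have cl: "closedin Z M"
      unfolding M_def
    proof (rule closedin_sat_compact)
      show "compactin Z (?T ` {p..q})" using half_chart_arc_compact[OF C] p01 by auto
      show "lf a \<notin> Sp" if "a \<in> ?T ` {p..q}" for a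
        using that half_chart_dest(4)[OF C] sub01 by blast
    qed
    let ?K = "k ` (UNIV \<times> {-v0<..<v0})"
    have KM: "?K \<subseteq> M"
    proof clarify
      fix y v assume v: "v \<in> {-v0<..<v0}"
      have vOI: "v \<in> OI" using v v0 by auto
      have va: "\<bar>v\<bar> \<le> v0" using v by auto
      have "v * u ?p' \<ge> 0 \<or> v * w ?q' \<ge> 0"
        using neg by (auto simp: zero_le_mult_iff mult_less_0_iff)
      then have "\<exists>s\<in>{p..q}. lf (?T s) = lf (k (y0, v))"
      proof
        assume "v * u ?p' \<ge> 0"
        then obtain s where s: "s \<in> {p..?p'}" "u s = v" using cov_p[OF va] by blast
        moreover have "s \<in> {p - \<eta>..p + \<eta>}" using s u(1) by auto
        ultimately have "lf (?T s) = lf (k (y0, v))" using u(6)[of s] by auto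
        then show ?thesis using s u(2) pq by (intro bexI[of _ s]) auto
      next
        assume "v * w ?q' \<ge> 0"
        then obtain s where s: "s \<in> {?q'..q}" "w s = v" using cov_q[OF va] by blast
        moreover have "s \<in> {q - h..q + h}" using s w(1) by auto
        ultimately have "lf (?T s) = lf (k (y0, v))" using w(6)[of s] by auto
        then show ?thesis using s w(2) pq by (intro bexI[of _ s]) auto
      qed
      moreover have "lf (k (y0, v)) = lf (k (y, v))" using ribbon_lf_iff[OF k(1) vOI vOI] by blast
      ultimately show "k (y, v) \<in> M" using ribbon_dest(5)[OF k(1) vOI] unfolding M_def sat_def by force
    qed
    have oK: "openin Z ?K" using v0 by (intro ribbon_dest(3)[OF k(1)]) (auto intro!: open_Times)
    let ?S = "sat (C ` (OI \<times> {p<..<q}))"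
    have "openin Z (C ` (OI \<times> {p<..<q}))"
    proof (rule open_embeddingD(3)[OF half_chart_dest(2)[OF C]])
      show "openin (top_of_set (OI \<times> UI)) (OI \<times> {p<..<q})"
        using p01 by (intro open_subset) (auto intro!: open_Times)
    qed
    then have oS: "openin Z ?S" by (rule sat_open)
    have SM: "?S \<subseteq> M"
    proof
      fix z assume "z \<in> ?S"
      then obtain x s where xs: "x \<in> OI" "s \<in> {p<..<q}" "lf (C (x, s)) = lf z" "z \<in> topspace Z" by (auto simp: sat_def)
      then have "lf (?T s) = lf z" using half_chart_dest(3)[OF C xs(1), of s] p01 by auto
      then show "z \<in> M" using xs unfolding M_def sat_def by force
    qed
    have "M \<subseteq> ?S \<union> ?K"
    proof
      fix z assume "z \<in> M"
      then obtain s where s: "s \<in> {p..q}" "lf (?T s) = lf z" "z \<in> topspace Z" by (auto simp: M_def sat_def)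
      show "z \<in> ?S \<union> ?K"
      proof (cases "s \<in> {p<..<q}")
        case True
        then have "?T s \<in> C ` (OI \<times> {p<..<q})" by auto
        then show ?thesis using s unfolding sat_def by blast
      next
        case False
        then have "s = p \<or> s = q" using s by auto
        then have "lf z = lf (k (y0, 0))" using s kp kq by metis
        then have "z \<in> k ` (UNIV \<times> {0})" using lf_in(2)[OF s(3)] ribbon_dest(6)[OF k(1), of 0 y0] by simp
        then show ?thesis using v0 by force
      qed
    qed
    then have "M = ?S \<union> ?K" using SM KM by blast
    then have op: "openin Z M" using oS oK by auto
    have "connectedin Z (?T ` {0..<1})"
      by (rule connectedin_continuous_map_image[OF half_chart_line[OF C]]) (simp add: connectedin_subtopology)
    moreover have "?T ` {0..<1} \<inter> M \<noteq> {}"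
    proof -
      have "?T p \<in> M" using topT[of p] p01 pq unfolding M_def sat_def by force
      moreover have "?T p \<in> ?T ` {0..<1}" using p01 by auto
      ultimately show ?thesis by blast
    qed
    ultimately have "?T ` {0..<1} \<subseteq> M"
      using connectedin_clopen_cases[of Z "?T ` {0..<1}" M] op cl unfolding disjnt_def by argo
    then have "?T 0 \<in> M" by auto
    then obtain s where "s \<in> {p..q}" "lf (?T s) = lf (?T 0)" by (auto simp: M_def sat_def)
    then show False using half_chart_dest(4)[OF C, of s] half_chart_dest(5)[OF C] sub01 by auto
  qed
qed

text \<open>Since \<open>z\<close> is separated from the special leaf, leaves with parameters near 0
  stay away from it. What remains is the saturation of the compact arc over \<open>[e, 1/2]\<close>,
  which is closed, so only its last leaf can be new.\<close>

lemma half_chart_frontier: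
  assumes C: "half_chart C" and z: "z \<in> Z closure_of (sat (C ` (OI \<times> {0<..<1/2})))" "lf z \<notin> Sp"
    and nz: "z \<notin> sat (C ` (OI \<times> {0<..<1/2}))"
  shows "lf z = lf (C (0, 1/2))"
proof (rule ccontr)
  let ?T = "\<lambda>t. C (0, t)"
  let ?S = "sat (C ` (OI \<times> {0<..<1/2}))"
  assume ne: "lf z \<noteq> lf (C (0, 1/2))"
  have zt: "z \<in> topspace Z" using z(1) closure_of_subset_topspace by fastforce
  have T0: "?T 0 \<in> topspace Z" using half_chart_dest(6)[OF C, of 0 0] by simp
  have "lf (?T 0) \<noteq> lf z" using half_chart_dest(5)[OF C] z(2) by auto
  then obtain P K where PK: "openin Z P" "closedin Z K" "P \<subseteq> K" "z \<in> P" "?T 0 \<notin> K" "saturated \<Delta> P"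
    using leaf_separation[OF zt z(2) T0] by metis
  obtain r where r: "r > 0" "\<And>s. s \<in> {0..<1} ==> dist s 0 < r ==> ?T s \<in> topspace Z - K"
    using continuous_map_nbhd[OF half_chart_line[OF C], of 0 "topspace Z - K"] PK T0 by auto
  define e where "e = min (r/2) (1/2)"
  have e: "0 < e" "e < r" "e \<le> 1/2" using r(1) by (auto simp: e_def)
  define M where "M = sat (?T ` {e..1/2})"
  have M: "closedin Z M"
    unfolding M_def
  proof (rule closedin_sat_compact)
    show "compactin Z (?T ` {e..1/2})" using half_chart_arc_compact[OF C, of e "1/2"] e by auto
    show "lf a \<notin> Sp" if "a \<in> ?T ` {e..1/2}" for a using that half_chart_dest(4)[OF C] e by force
  qed
  have "z \<notin> M"
  proof
    assume "z \<in> M"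
    then obtain s where s: "s \<in> {e..1/2}" "lf (?T s) = lf z" by (auto simp: M_def sat_def)
    have "s \<noteq> 1/2"
    proof
      assume "s = 1/2"
      then show False using ne s(2) by blast
    qed
    then have "?T s \<in> C ` (OI \<times> {0<..<1/2})" using s e by auto
    then show False using nz s zt unfolding sat_def by blast
  qed
  then have "openin Z (P - M)" "z \<in> P - M" using PK M by auto
  then obtain w where w: "w \<in> ?S" "w \<in> P - M" using z(1) unfolding in_closure_of by meson
  then obtain x s where xs: "x \<in> OI" "s \<in> {0<..<1/2}" "lf (C (x, s)) = lf w" "w \<in> topspace Z" by (auto simp: sat_def)
  then have s01: "s \<in> UI" by auto
  have ls: "lf (?T s) = lf w" using half_chart_dest(3)[OF C xs(1) s01] xs(3) by simp
  show False
  proof (cases "e \<le> s")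
    case True
    then have "w \<in> M" using ls xs unfolding M_def sat_def by force
    then show False using w by blast
  next
    case False
    have "?T s \<in> P" using saturatedD[OF PK(6), of w "?T s"] w ls xs half_chart_dest(6)[OF C, of 0 s] s01 by auto
    moreover have "?T s \<in> topspace Z - K" using r(2)[of s] s01 False e by auto
    ultimately show False using PK by blast
  qed
qed

lemma half_chart_upper:
  assumes C: "fchart Z \<Delta> C J" and J: "J = OI \<or> J = {0..<1}" and z: "lf (C (0, 0)) \<in> Sp"
    and iso: "\<And>x t. x \<in> OI ==> t \<in> J ==> t \<noteq> 0 ==> C (x, t) \<notin> \<Union>Sp"
  shows "half_chart C"
  unfolding half_chart_def
proof (intro conjI ballI)
  have sub: "OI \<times> {0..<1} \<subseteq> OI \<times> J" using J by auto
  show "continuous_map (top_of_set (OI \<times> {0..<1})) Z C"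
    using continuous_map_from_subtopology_mono[OF fchart_dest(1)[OF C] sub] .
  have "OI \<times> UI \<subseteq> OI \<times> J" using J by auto
  then have "openin (top_of_set (OI \<times> J)) (OI \<times> UI)" by (intro open_subset) (auto intro!: open_Times)
  then show "open_embedding Z (OI \<times> UI) C"
    using C open_embedding_subset unfolding fchart_def by blast
  show "lf (C (x, t)) = lf (C (0, t))" if "x \<in> OI" "t \<in> UI" for x t
  proof -
    have "t \<in> J" using that J by auto
    then show ?thesis by (rule fchart_dest(4)[OF C that(1)])
  qed
  show "\<exists>d>0. \<forall>t\<in>UI. t \<noteq> t0 --> \<bar>t - t0\<bar> < d --> lf (C (0, t)) \<noteq> lf (C (0, t0))" if "t0 \<in> UI" for t0
  proof -
    have "t0 \<in> J" using that J by auto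
    then obtain d where "d > 0" "\<forall>t\<in>J. t \<noteq> t0 --> \<bar>t - t0\<bar> < d --> lf (C (0, t)) \<noteq> lf (C (0, t0))"
      using C unfolding fchart_def by blast
    moreover have "UI \<subseteq> J" using J by auto
    ultimately show ?thesis by blast
  qed
  show "lf (C (0, t)) \<notin> Sp" if "t \<in> UI" for t
  proof -
    have tJ: "t \<in> J" "t \<noteq> 0" using that J by auto
    then show ?thesis using iso[of 0 t] lf_in(2)[OF fchart_dest(5)[OF C, of 0 t]] by auto
  qed
  show "lf (C (0, 0)) \<in> Sp" by (rule z)
qed

text \<open>Turns the lower side of a chart into the upper one, so that one-sided statements need be
  proved only for positive heights.\<close>

lemma fchart_reflect:
  assumes C: "fchart Z \<Delta> C OI"
  shows "fchart Z \<Delta> (\<lambda>p. C (fst p, - snd p)) OI"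
proof -
  let ?\<psi> = "\<lambda>p::real\<times>real. (fst p, - snd p)"
  have im: "?\<psi> ` (OI \<times> OI) = OI \<times> OI"
  proof (intro equalityI subsetI)
    fix p :: "real \<times> real" assume "p \<in> OI \<times> OI"
    then show "p \<in> ?\<psi> ` (OI \<times> OI)" by (intro image_eqI[of _ _ "?\<psi> p"]) auto
  qed auto
  have "homeomorphism (OI \<times> OI) (?\<psi> ` (OI \<times> OI)) ?\<psi> ?\<psi>"
    unfolding homeomorphism_def im by (intro conjI continuous_intros im) auto
  then have 1: "open_embedding Z (OI \<times> OI) (\<lambda>p. C (?\<psi> p))"
    using C open_embedding_reparam[of Z "OI \<times> OI" C "OI \<times> OI" ?\<psi> ?\<psi>] im unfolding fchart_def by auto
  show ?thesis
    unfolding fchart_def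
  proof (intro conjI ballI)
    show "open_embedding Z (OI \<times> OI) (\<lambda>p. C (?\<psi> p))" by (rule 1)
    show "lf (C (fst (x, t), - snd (x, t))) = lf (C (fst (0, t), - snd (0, t)))" if "x \<in> OI" "t \<in> OI" for x t :: real
      using fchart_dest(4)[OF C, of x "-t"] that by auto
    fix t0 :: real assume t0: "t0 \<in> OI"
    then have "- t0 \<in> OI" by auto
    then obtain d where d: "d > 0" "\<And>t. t\<in>OI ==> t \<noteq> -t0 ==> \<bar>t - (-t0)\<bar> < d ==> lf (C (0, t)) \<noteq> lf (C (0, -t0))"
      using C unfolding fchart_def by metis
    show "\<exists>d>0. \<forall>t\<in>OI. t \<noteq> t0 --> \<bar>t - t0\<bar> < d --> lf (C (fst (0, t), - snd (0, t))) \<noteq> lf (C (fst (0, t0), - snd (0, t0)))"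
    proof (intro exI[of _ d] conjI ballI impI d(1))
      fix t assume "t \<in> OI" "t \<noteq> t0" "\<bar>t - t0\<bar> < d"
      then show "lf (C (fst (0, t), - snd (0, t))) \<noteq> lf (C (fst (0, t0), - snd (0, t0)))"
        using d(2)[of "-t"] by auto
    qed
  qed
qed

end

section \<open>Cutting along a locally finite family of leaves\<close>

lemma scale_image_OI: assumes "0 < r" shows "(*) r ` OI = {-r<..<r::real}"
  using affine_image(1)[OF assms, of 0] by simp

text \<open>Squeezing the heights puts the central column into a neighbourhood of one point of
  \<open>l\<close> that meets no leaf of \<open>\<Sigma>\<close>. Controlling one point per leaf is
  enough, since rows of the ribbon are whole leaves.\<close>

lemma (in foliated_surface) ribbon_shrink:
  assumes \<Sigma>: "\<Sigma> \<subseteq> \<Delta>" "locally_finite_in Z \<Sigma>" and l: "l \<in> \<Delta> - \<Sigma>"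
    and k: "ribbon Z \<Delta> k" "k ` (UNIV \<times> {0}) = l"
  shows "\<exists>k'. ribbon Z (\<Delta> - \<Sigma>) k' \<and> k' ` (UNIV \<times> {0}) = l"
proof -
  have oe: "open_embedding Z (UNIV \<times> OI) k" using k by (simp add: ribbon_def)
  have zw: "k (0, 0) \<in> l" using k(2) by force
  then have zt: "k (0, 0) \<in> topspace Z" and lz: "lf (k (0, 0)) = l" using l leaf_sub lf_eq by blast+
  obtain N where N: "openin Z N" "k (0, 0) \<in> N" "N \<inter> \<Union>\<Sigma> \<subseteq> l"
    using locally_finite_avoid[OF \<Sigma>(2,1) zt] lz by blast
  have NS: "N \<inter> \<Union>\<Sigma> = {}"
  proof (rule ccontr)
    assume "N \<inter> \<Union>\<Sigma> \<noteq> {}"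
    then obtain w l' where w: "w \<in> N" "w \<in> l'" "l' \<in> \<Sigma>" by blast
    then have "w \<in> l" using N(3) by blast
    then have "l' = l" using lf_eq[of l w] lf_eq[of l' w] w l \<Sigma>(1) by blast
    then show False using w l by blast
  qed
  obtain r0 where r0: "r0 > 0" "\<And>y v. (y, v) \<in> UNIV \<times> OI ==> \<bar>y - 0\<bar> < r0 ==> \<bar>v - 0\<bar> < r0 ==> k (y, v) \<in> N"
    using continuous_map_nbhd2[OF open_embeddingD(1)[OF oe], of 0 0 N] N by auto
  define r where "r = min r0 1"
  have r: "0 < r" "r \<le> r0" "r \<le> 1" using r0 by (auto simp: r_def)
  let ?\<psi> = "\<lambda>p::real\<times>real. (fst p, r * snd p)"
  have imA: "?\<psi> ` (UNIV \<times> A) = UNIV \<times> ((*) r ` A)" for A by force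
  have rOI: "r * t \<in> {-r<..<r}" "r * t \<in> OI" if "t \<in> OI" for t
  proof -
    show "r * t \<in> {-r<..<r}" using scale_image_OI[OF r(1)] that by blast
    then have "-r < r * t" "r * t < r" unfolding greaterThanLessThan_iff by blast+
    then show "r * t \<in> OI" using r(3) unfolding greaterThanLessThan_iff by linarith
  qed
  let ?k = "\<lambda>p. k (?\<psi> p)"
  have img: "?k ` (UNIV \<times> A) = k ` (UNIV \<times> ((*) r ` A))" for A
    unfolding imA[symmetric] by (simp add: image_image)
  have "ribbon Z (\<Delta> - \<Sigma>) ?k"
    unfolding ribbon_def
  proof (intro conjI ballI allI impI)
    show "open_embedding Z (UNIV \<times> OI) ?k"
    proof (rule open_embedding_reparam[OF oe])
      show "homeomorphism (UNIV \<times> OI) (?\<psi> ` (UNIV \<times> OI)) ?\<psi> (\<lambda>p. (fst p, snd p / r))"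
        unfolding homeomorphism_def using r
        by (auto intro!: continuous_intros simp: image_image)
      show "openin (top_of_set (UNIV \<times> OI)) (?\<psi> ` (UNIV \<times> OI))"
        unfolding imA scale_image_OI[OF r(1)] using r by (intro open_subset) (auto intro!: open_Times)
    qed
    fix t :: real assume t: "t \<in> OI"
    have "k ` (UNIV \<times> {r * t}) \<in> \<Delta>" using k(1) rOI[OF t] unfolding ribbon_def by blast
    moreover have "k ` (UNIV \<times> {r * t}) \<notin> \<Sigma>"
    proof
      assume "k ` (UNIV \<times> {r * t}) \<in> \<Sigma>"
      moreover have "k (0, r * t) \<in> N"
      proof (rule r0(2))
        have "-r < r * t" "r * t < r" using rOI(1)[OF t] unfolding greaterThanLessThan_iff by blast+
        then show "\<bar>r * t - 0\<bar> < r0" using r(2) by linarith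
        show "(0, r * t) \<in> UNIV \<times> OI" using rOI(2)[OF t] by blast
      qed (use r0(1) in simp)
      moreover have "k (0, r * t) \<in> k ` (UNIV \<times> {r * t})" by auto
      ultimately show False using NS by blast
    qed
    ultimately show "?k ` (UNIV \<times> {t}) \<in> \<Delta> - \<Sigma>" unfolding img by simp
  next
    fix a b :: real assume ab: "-1 < a" "b < 1"
    have im: "(*) r ` {a..b} = {r * a..r * b}" using r by simp
    have "-1 < r * a" "r * b < 1"
    proof -
      have "r * (-1) < r * a" "r * b < r * 1" using mult_strict_left_mono[OF ab(1) r(1)] mult_strict_left_mono[OF ab(2) r(1)] by blast+
      then show "-1 < r * a" "r * b < 1" using r(3) by linarith+
    qed
    then show "closedin Z (?k ` (UNIV \<times> {a..b}))"
      unfolding img im using k(1) unfolding ribbon_def by blast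
  qed
  moreover have "?k ` (UNIV \<times> {0}) = l" unfolding img using k(2) by simp
  ultimately show ?thesis by blast
qed

lemma (in ribboned_surface) ribboned_surface_larger:
  assumes \<Sigma>: "\<Sigma> \<subseteq> \<Delta>" "locally_finite_in Z \<Sigma>" "Sp \<subseteq> \<Sigma>"
  shows "ribboned_surface Z \<Delta> Bd \<Sigma>"
proof
  show "\<Sigma> \<subseteq> \<Delta>" "locally_finite_in Z \<Sigma>" by (fact \<Sigma>)+
  show "Bd \<subseteq> \<Union>\<Sigma>" using Bd_Sp \<Sigma>(3) by blast
  fix w assume w: "w \<in> \<Delta> - \<Sigma>"
  then obtain k where "ribbon Z (\<Delta> - Sp) k" "k ` (UNIV \<times> {0}) = w" using ribbons \<Sigma>(3) by blast
  moreover from this have "ribbon Z \<Delta> k" by (auto simp: ribbon_def)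
  ultimately show "\<exists>k. ribbon Z (\<Delta> - \<Sigma>) k \<and> k ` (UNIV \<times> {0}) = w"
    using ribbon_shrink[OF \<Sigma>(1,2) w] by blast
qed

section \<open>Ribs, their frontier leaves, and the choice of the cut leaves\<close>

context ribboned_surface
begin

text \<open>A chart whose leaf space is an interval: unlike in \<open>fchart\<close>, different
  heights belong to different leaves globally and not only nearby.\<close>

definition rib :: "(real \<times> real => 'a) => bool" where
  "rib c \<longleftrightarrow> open_embedding Z (OI \<times> UI) c \<and> (\<forall>x\<in>OI. \<forall>t\<in>UI. lf (c (x, t)) = lf (c (0, t))) \<and>
     inj_on (\<lambda>t. lf (c (0, t))) UI \<and> (\<forall>t\<in>UI. lf (c (0, t)) \<notin> Sp)"

definition ribsat :: "(real \<times> real => 'a) => 'a set" where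
  "ribsat c = sat (c ` (OI \<times> UI))"

text \<open>Only the regular leaves of the frontier have to be listed. \<open>L\<close> is a finite
  stock of candidates for cutting and may be larger than necessary.\<close>

definition frontier_leaves :: "(real \<times> real => 'a) => 'a set set => bool" where
  "frontier_leaves c L \<longleftrightarrow> finite L \<and> L \<subseteq> \<Delta> \<and>
     (\<forall>z \<in> Z closure_of (ribsat c). lf z \<notin> Sp --> z \<in> ribsat c \<or> lf z \<in> L)"

lemma rib_dest:
  assumes "rib c"
  shows "open_embedding Z (OI \<times> UI) c" "\<And>x t. x \<in> OI ==> t \<in> UI ==> lf (c (x, t)) = lf (c (0, t))"
    "inj_on (\<lambda>t. lf (c (0, t))) UI" "\<And>t. t \<in> UI ==> lf (c (0, t)) \<notin> Sp"
    "\<And>x t. x \<in> OI ==> t \<in> UI ==> c (x, t) \<in> topspace Z"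
proof -
  show 1: "open_embedding Z (OI \<times> UI) c" and "\<And>x t. x \<in> OI ==> t \<in> UI ==> lf (c (x, t)) = lf (c (0, t))"
    "inj_on (\<lambda>t. lf (c (0, t))) UI" "\<And>t. t \<in> UI ==> lf (c (0, t)) \<notin> Sp"
    using assms unfolding rib_def by blast+
  show "c (x, t) \<in> topspace Z" if "x \<in> OI" "t \<in> UI" for x t
    using continuous_map_image_subset_topspace[OF open_embeddingD(1)[OF 1]] that by auto
qed

lemma rib_slab_sat:
  assumes c: "rib c" and A: "A \<subseteq> UI" and p: "p \<in> topspace Z"
  shows "p \<in> sat (c ` (OI \<times> A)) \<longleftrightarrow> (\<exists>t\<in>A. lf (c (0, t)) = lf p)"
proof
  assume "p \<in> sat (c ` (OI \<times> A))"
  then obtain x t where xt: "x \<in> OI" "t \<in> A" "lf (c (x, t)) = lf p" by (auto simp: sat_def)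
  then have "t \<in> UI" using A by blast
  then show "\<exists>t\<in>A. lf (c (0, t)) = lf p" using rib_dest(2)[OF c xt(1), of t] xt by metis
next
  assume "\<exists>t\<in>A. lf (c (0, t)) = lf p"
  then obtain t where "t \<in> A" "lf (c (0, t)) = lf p" by blast
  moreover from this have "c (0, t) \<in> c ` (OI \<times> A)" by auto
  ultimately show "p \<in> sat (c ` (OI \<times> A))" using p unfolding sat_def by blast
qed

lemma ribsat_iff: "rib c ==> p \<in> ribsat c \<longleftrightarrow> p \<in> topspace Z \<and> (\<exists>t\<in>UI. lf (c (0, t)) = lf p)"
  unfolding ribsat_def using rib_slab_sat[of c "UI" p] sat_sub by blast

lemma rib_slab_sat_open:
  assumes c: "rib c" and A: "A \<subseteq> UI" "open A"
  shows "openin Z (sat (c ` (OI \<times> A)))"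
proof (rule sat_open, rule open_embeddingD(3)[OF rib_dest(1)[OF c]])
  show "openin (top_of_set (OI \<times> UI)) (OI \<times> A)"
    using A by (intro open_subset) (auto intro!: open_Times)
qed

lemma ribsat_open: "rib c ==> openin Z (ribsat c)"
  unfolding ribsat_def by (rule rib_slab_sat_open) auto

lemma ribsat_sub: "ribsat c \<subseteq> topspace Z" unfolding ribsat_def by (rule sat_sub)

lemma ribsat_saturated: "saturated \<Delta> (ribsat c)" unfolding ribsat_def by (rule saturated_sat)

text \<open>The middle half of a ribbon is taken because slabs are closed only away from the extreme
  heights; its candidates are the leaves at heights \<open>1/2\<close> and
  \<open>-1/2\<close>.\<close>

lemma rib_of_ribbon:
  assumes z: "z \<in> topspace Z" "lf z \<notin> Sp"
  shows "\<exists>c L. rib c \<and> frontier_leaves c L \<and> z \<in> ribsat c"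
proof -
  obtain k y0 where k: "ribbon Z (\<Delta> - Sp) k" "k (y0, 0) = z" using ribbon_at[OF z] by blast
  let ?\<psi> = "\<lambda>p::real\<times>real. (fst p, snd p - 1/2)"
  let ?c = "\<lambda>p. k (?\<psi> p)"
  have im: "?\<psi> ` (OI \<times> UI) = OI \<times> {-(1/2)<..<1/2}"
  proof (intro equalityI subsetI)
    fix p :: "real \<times> real" assume "p \<in> OI \<times> {-(1/2)<..<1/2}"
    then show "p \<in> ?\<psi> ` (OI \<times> UI)" by (intro image_eqI[of _ _ "(fst p, snd p + 1/2)"]) auto
  qed auto
  have t2: "t - 1/2 \<in> OI" if "t \<in> UI" for t :: real using that by auto
  have rib: "rib ?c"
    unfolding rib_def
  proof (intro conjI ballI)
    have oe: "open_embedding Z (UNIV \<times> OI) k" using k by (simp add: ribbon_def)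
    show "open_embedding Z (OI \<times> UI) ?c"
    proof (rule open_embedding_reparam[OF oe])
      show "homeomorphism (OI \<times> UI) (?\<psi> ` (OI \<times> UI)) ?\<psi> (\<lambda>p. (fst p, snd p + 1/2))"
        unfolding homeomorphism_def by (auto intro!: continuous_intros simp: image_image)
      show "openin (top_of_set (UNIV \<times> OI)) (?\<psi> ` (OI \<times> UI))"
        unfolding im by (intro open_subset) (auto intro!: open_Times)
    qed
    show "lf (?c (x, t)) = lf (?c (0, t))" if "x \<in> OI" "t \<in> UI" for x t
      using ribbon_lf_iff[OF k(1) t2[OF that(2)] t2[OF that(2)], of x 0] by simp
    show "inj_on (\<lambda>t. lf (?c (0, t))) UI"
    proof (rule inj_onI)
      fix s t :: real assume st: "s \<in> UI" "t \<in> UI" "lf (?c (0, s)) = lf (?c (0, t))"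
      then show "s = t" using ribbon_lf_iff[OF k(1) t2[OF st(1)] t2[OF st(2)], of 0 0] by simp
    qed
    show "lf (?c (0, t)) \<notin> Sp" if "t \<in> UI" for t
      using ribbon_dest(7)[OF k(1) t2[OF that]] by simp
  qed
  have rs: "ribsat ?c \<subseteq> k ` (UNIV \<times> {-(1/2)<..<1/2})"
  proof
    fix p assume "p \<in> ribsat ?c"
    then obtain t where t: "t \<in> UI" "lf (k (0, t - 1/2)) = lf p" "p \<in> topspace Z"
      using ribsat_iff[OF rib] by auto
    then have "p \<in> k ` (UNIV \<times> {t - 1/2})"
      using ribbon_dest(6)[OF k(1) t2[OF t(1)], of 0] lf_in(2)[OF t(3)] by simp
    then show "p \<in> k ` (UNIV \<times> {-(1/2)<..<1/2})" using t(1) by auto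
  qed
  have "frontier_leaves ?c {k ` (UNIV \<times> {1/2}), k ` (UNIV \<times> {-1/2})}"
    unfolding frontier_leaves_def
  proof (intro conjI ballI impI)
    show "{k ` (UNIV \<times> {1/2}), k ` (UNIV \<times> {-1/2})} \<subseteq> \<Delta>"
      using k(1) unfolding ribbon_def by auto
    fix p assume p: "p \<in> Z closure_of ribsat ?c"
    have "closedin Z (k ` (UNIV \<times> {-1/2..1/2}))" by (rule ribbon_dest(4)[OF k(1)]) auto
    moreover have "ribsat ?c \<subseteq> k ` (UNIV \<times> {-1/2..1/2})" using rs by fastforce
    ultimately have "p \<in> k ` (UNIV \<times> {-1/2..1/2})" using p closure_of_minimal by blast
    then obtain y v where yv: "p = k (y, v)" "v \<in> {-1/2..1/2}" by auto
    then have vO: "v \<in> OI" by auto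
    show "p \<in> ribsat ?c \<or> lf p \<in> {k ` (UNIV \<times> {1/2}), k ` (UNIV \<times> {-1/2})}"
    proof (cases "v = 1/2 \<or> v = -1/2")
      case True
      then show ?thesis using yv ribbon_dest(6)[OF k(1) vO, of y] by auto
    next
      case False
      have "v + 1/2 \<in> UI" using False yv by auto
      moreover have "lf (?c (0, v + 1/2)) = lf p" using ribbon_lf_iff[OF k(1) vO vO, of 0 y] yv by simp
      moreover have "p \<in> topspace Z" using yv ribbon_dest(5)[OF k(1) vO] by simp
      ultimately show ?thesis using ribsat_iff[OF rib] by blast
    qed
  qed auto
  moreover have "z \<in> ribsat ?c"
  proof -
    have "lf (?c (0, 1/2)) = lf z" using ribbon_lf_iff[OF k(1), of 0 0 0 y0] k(2) by simp
    moreover have "(1/2::real) \<in> UI" by simp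
    ultimately show ?thesis using z ribsat_iff[OF rib, of z] by blast
  qed
  ultimately show ?thesis using rib by blast
qed

text \<open>Halving the height makes \<open>half_chart_frontier\<close> applicable: besides special
  leaves, only the leaf at chart height \<open>1/2\<close> can be in the frontier.\<close>

lemma rib_of_half_chart:
  assumes C: "half_chart C"
  shows "\<exists>c L. rib c \<and> frontier_leaves c L \<and> ribsat c = sat (C ` (OI \<times> {0<..<1/2}))"
proof -
  let ?\<psi> = "\<lambda>p::real\<times>real. (fst p, snd p / 2)"
  let ?c = "\<lambda>p. C (?\<psi> p)"
  have im: "?\<psi> ` (OI \<times> UI) = OI \<times> {0<..<1/2}"
  proof (intro equalityI subsetI)
    fix p :: "real \<times> real" assume "p \<in> OI \<times> {0<..<1/2}"
    then show "p \<in> ?\<psi> ` (OI \<times> UI)" by (intro image_eqI[of _ _ "(fst p, snd p * 2)"]) auto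
  qed auto
  have t2: "t / 2 \<in> UI" if "t \<in> UI" for t :: real using that by auto
  have rib: "rib ?c"
    unfolding rib_def
  proof (intro conjI ballI)
    show "open_embedding Z (OI \<times> UI) ?c"
    proof (rule open_embedding_reparam[OF half_chart_dest(2)[OF C]])
      show "homeomorphism (OI \<times> UI) (?\<psi> ` (OI \<times> UI)) ?\<psi> (\<lambda>p. (fst p, snd p * 2))"
        unfolding homeomorphism_def by (auto intro!: continuous_intros simp: image_image)
      show "openin (top_of_set (OI \<times> UI)) (?\<psi> ` (OI \<times> UI))"
        unfolding im by (intro open_subset) (auto intro!: open_Times)
    qed
    show "lf (?c (x, t)) = lf (?c (0, t))" if "x \<in> OI" "t \<in> UI" for x t
      using half_chart_dest(3)[OF C that(1) t2[OF that(2)]] by simp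
    show "inj_on (\<lambda>t. lf (?c (0, t))) UI"
    proof (rule inj_onI)
      fix s t :: real assume st: "s \<in> UI" "t \<in> UI" "lf (?c (0, s)) = lf (?c (0, t))"
      then show "s = t" using inj_onD[OF half_chart_inj[OF C], of "s/2" "t/2"] t2[OF st(1)] t2[OF st(2)] by simp
    qed
    show "lf (?c (0, t)) \<notin> Sp" if "t \<in> UI" for t
      using half_chart_dest(4)[OF C t2[OF that]] by simp
  qed
  have rs: "ribsat ?c = sat (C ` (OI \<times> {0<..<1/2}))"
    unfolding ribsat_def im[symmetric] by (simp add: image_image)
  have "frontier_leaves ?c {lf (C (0, 1/2))}"
    unfolding frontier_leaves_def rs
    using half_chart_frontier[OF C] lf_in(1)[OF half_chart_dest(6)[OF C, of 0 "1/2"]] by auto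
  then show ?thesis using rib rs by blast
qed

text \<open>The finiteness of \<open>F\<close> is the source of the local finiteness of the cut
  leaves. Near a regular leaf one rib suffices; near a special leaf each side needs its own.\<close>

lemma local_ribs:
  assumes z: "z \<in> topspace Z"
  shows "\<exists>N F. openin Z N \<and> z \<in> N \<and> finite F \<and> (\<forall>c\<in>F. rib c \<and> (\<exists>L. frontier_leaves c L)) \<and> N - \<Union>Sp \<subseteq> \<Union>(ribsat ` F)"
proof (cases "lf z \<in> Sp")
  case False
  then obtain c L where "rib c" "frontier_leaves c L" "z \<in> ribsat c" using rib_of_ribbon[OF z] by blast
  then show ?thesis using ribsat_open by (intro exI[of _ "ribsat c"] exI[of _ "{c}"]) auto
next
  case True
  have "openin Z (topspace Z)" by simp
  then obtain C J where J: "(z \<notin> Bd \<and> J = OI) \<or> (z \<in> Bd \<and> J = {0..<1})" and C: "fchart Z \<Delta> C J" "C (0, 0) = z"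
    and iso: "\<And>x t. x \<in> OI ==> t \<in> J ==> t \<noteq> 0 ==> C (x, t) \<notin> \<Union>Sp"
    using isolated_chart[OF Sp_lf Sp_leaves z _ z] by metis
  have J': "J = OI \<or> J = {0..<1}" using J by blast
  have l0: "lf (C (0, 0)) \<in> Sp" using C True by simp
  have h: "half_chart C" by (rule half_chart_upper[OF C(1) J' l0 iso])
  obtain c1 L1 where c1: "rib c1" "frontier_leaves c1 L1" "ribsat c1 = sat (C ` (OI \<times> {0<..<1/2}))"
    using rib_of_half_chart[OF h] by blast
  let ?N = "C ` (OI \<times> (J \<inter> {-1/2<..<1/2}))"
  have N: "openin Z ?N" by (rule fchart_slab_open[OF C(1)])
  have zN: "z \<in> ?N" unfolding C(2)[symmetric] using J' by (intro imageI) auto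
  have CinSp: "C (x, 0) \<in> \<Union>Sp" if "x \<in> OI" for x
  proof -
    have "0 \<in> J" using J' by auto
    then have "lf (C (x, 0)) \<in> Sp" "C (x, 0) \<in> topspace Z" using fchart_dest(4,5)[OF C(1) that] l0 by auto
    then show ?thesis using lf_in(2) by blast
  qed
  have up: "C (x, t) \<in> ribsat c1" if "x \<in> OI" "t \<in> {0<..<1/2}" for x t
  proof -
    have "C ` (OI \<times> {0<..<1/2}) \<subseteq> topspace Z" using half_chart_dest(6)[OF h] by auto
    then show ?thesis unfolding c1(3) using sub_sat that by blast
  qed
  show ?thesis
  proof (cases "J = OI")
    case False
    then have JJ: "J = {0..<1}" using J' by blast
    have "?N - \<Union>Sp \<subseteq> ribsat c1"
    proof
      fix p assume p: "p \<in> ?N - \<Union>Sp"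
      then obtain x t where xt: "x \<in> OI" "t \<in> J" "t \<in> {-1/2<..<1/2}" "p = C (x, t)" by blast
      then have "t \<noteq> 0" using CinSp p by auto
      then show "p \<in> ribsat c1" using up[OF xt(1), of t] xt JJ by auto
    qed
    then show ?thesis using N zN c1 by (intro exI[of _ ?N] exI[of _ "{c1}"]) auto
  next
    case True
    let ?C = "\<lambda>p. C (fst p, - snd p)"
    have C': "fchart Z \<Delta> ?C OI" using fchart_reflect C(1) True by auto
    have h': "half_chart ?C"
    proof (rule half_chart_upper[OF C'])
      show "lf (?C (0, 0)) \<in> Sp" using l0 by simp
      show "?C (x, t) \<notin> \<Union>Sp" if "x \<in> OI" "t \<in> OI" "t \<noteq> 0" for x t
        using iso[OF that(1), of "-t"] that True by auto
    qed simp
    obtain c2 L2 where c2: "rib c2" "frontier_leaves c2 L2" "ribsat c2 = sat (?C ` (OI \<times> {0<..<1/2}))"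
      using rib_of_half_chart[OF h'] by blast
    have dn: "C (x, t) \<in> ribsat c2" if "x \<in> OI" "t \<in> {-1/2<..<0}" for x t
    proof -
      have "?C ` (OI \<times> {0<..<1/2}) \<subseteq> topspace Z" using half_chart_dest(6)[OF h'] by auto
      moreover have "C (x, t) \<in> ?C ` (OI \<times> {0<..<1/2})" using that by (intro image_eqI[of _ _ "(x, -t)"]) auto
      ultimately show ?thesis unfolding c2(3) using sub_sat by blast
    qed
    have "?N - \<Union>Sp \<subseteq> ribsat c1 \<union> ribsat c2"
    proof
      fix p assume p: "p \<in> ?N - \<Union>Sp"
      then obtain x t where xt: "x \<in> OI" "t \<in> J" "t \<in> {-1/2<..<1/2}" "p = C (x, t)" by blast
      then have "t \<noteq> 0" using CinSp p by auto
      then show "p \<in> ribsat c1 \<union> ribsat c2" using up[OF xt(1), of t] dn[OF xt(1), of t] xt by fastforce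
    qed
    then show ?thesis using N zN c1 c2 by (intro exI[of _ ?N] exI[of _ "{c1, c2}"]) auto
  qed
qed

text \<open>Countability lets the ribs be numbered, so that cuts can be made in order of index.
  Passing to a countable subcover keeps the property that finitely many ribs suffice near each
  point.\<close>

lemma countable_ribs:
  obtains \<R> where "countable \<R>" "\<And>c. c \<in> \<R> ==> rib c \<and> (\<exists>L. frontier_leaves c L)"
    "\<And>z. z \<in> topspace Z ==> \<exists>N F. openin Z N \<and> z \<in> N \<and> finite F \<and> F \<subseteq> \<R> \<and> N - \<Union>Sp \<subseteq> \<Union>(ribsat ` F)"
proof -
  obtain N F where NF: "\<And>z. z \<in> topspace Z ==> openin Z (N z) \<and> z \<in> N z \<and> finite (F z) \<and>
      (\<forall>c\<in>F z. rib c \<and> (\<exists>L. frontier_leaves c L)) \<and> N z - \<Union>Sp \<subseteq> \<Union>(ribsat ` F z)"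
    using local_ribs by metis
  have "Lindelof_space Z" using sc second_countable_imp_Lindelof_space by blast
  moreover have "topspace Z \<subseteq> \<Union>(N ` topspace Z)" using NF by blast
  ultimately obtain \<V> where V: "countable \<V>" "\<V> \<subseteq> N ` topspace Z" "topspace Z \<subseteq> \<Union>\<V>"
    unfolding Lindelof_space_alt using NF by (metis (no_types, lifting) imageE)
  then obtain D where D: "countable D" "D \<subseteq> topspace Z" "\<V> = N ` D"
    using countable_subset_image by metis
  show ?thesis
  proof (rule that[of "\<Union>(F ` D)"])
    show "countable (\<Union>(F ` D))" using D NF by (intro countable_UN) (auto intro: countable_finite)
    show "rib c \<and> (\<exists>L. frontier_leaves c L)" if "c \<in> \<Union>(F ` D)" for c using that D NF by blast
    show "\<exists>N F'. openin Z N \<and> z \<in> N \<and> finite F' \<and> F' \<subseteq> \<Union>(F ` D) \<and> N - \<Union>Sp \<subseteq> \<Union>(ribsat ` F')" if z: "z \<in> topspace Z" for z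
    proof -
      obtain d where d: "d \<in> D" "z \<in> N d" using V(3) D(3) z by blast
      then show ?thesis using NF[of d] D(2) by (intro exI[of _ "N d"] exI[of _ "F d"]) auto
    qed
  qed
qed

text \<open>A leaf outside \<open>\<Sigma>\<close> is a connected set missing
  \<open>\<Sigma>\<close>, so it stays within one component. A small chart around a point outside
  \<open>\<Sigma>\<close> is another such set, which gives openness.\<close>

lemma component_leaf_open:
  assumes \<Sigma>: "\<Sigma> \<subseteq> \<Delta>" "locally_finite_in Z \<Sigma>" and W: "W \<in> connected_components_of (subtopology Z (topspace Z - \<Union>\<Sigma>))"
  shows "saturated \<Delta> W" "openin Z W"
proof -
  let ?Y = "topspace Z - \<Union>\<Sigma>"
  have WY: "W \<subseteq> ?Y" using connected_components_of_subset[OF W] by auto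
  have max: "S \<subseteq> W" if "connectedin Z S" "S \<subseteq> ?Y" "S \<inter> W \<noteq> {}" for S
    using connected_components_of_maximal[OF W, of S] that by (auto simp: connectedin_subtopology disjnt_def)
  show "saturated \<Delta> W"
    unfolding saturated_def
  proof (intro ballI impI)
    fix w assume w: "w \<in> \<Delta>" "w \<inter> W \<noteq> {}"
    then obtain p where p: "p \<in> w" "p \<in> W" by blast
    have "w \<notin> \<Sigma>" using p WY by blast
    then have "w \<inter> \<Union>\<Sigma> = {}" using lf_eq[OF w(1)] lf_eq \<Sigma>(1) by blast
    then have "w \<subseteq> ?Y" using leaf_sub[OF w(1)] by blast
    then show "w \<subseteq> W" using max[OF leaf_conn[OF w(1)]] w(2) by blast
  qed
  show "openin Z W"
  proof (subst openin_subopen, clarify)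
    fix z assume zW: "z \<in> W"
    then have z: "z \<in> topspace Z" "lf z \<notin> \<Sigma>" using WY lf_in by blast+
    obtain C J where J: "(z \<notin> Bd \<and> J = OI) \<or> (z \<in> Bd \<and> J = {0..<1})" and C: "fchart Z \<Delta> C J" "C (0, 0) = z"
      and iso: "\<And>x t. x \<in> OI ==> t \<in> J ==> t \<noteq> 0 ==> C (x, t) \<notin> \<Union>\<Sigma>"
      using isolated_chart[OF \<Sigma>(2,1) z(1) openin_topspace z(1)] by metis
    have J0: "0 \<in> J" "convex J" using J by auto
    let ?N = "C ` (OI \<times> J)"
    have "connectedin Z ?N"
      using J0 by (intro connectedin_continuous_map_image[OF fchart_dest(1)[OF C(1)]])
        (auto simp: connectedin_subtopology intro!: convex_connected convex_Times)
    moreover have "?N \<subseteq> ?Y"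
    proof clarify
      fix x t assume xt: "x \<in> OI" "t \<in> J"
      have "C (x, t) \<notin> \<Union>\<Sigma>"
      proof (cases "t = 0")
        case True
        have "lf (C (x, t)) = lf z" using fchart_dest(4)[OF C(1) xt] True C(2) by simp
        show ?thesis
        proof
          assume "C (x, t) \<in> \<Union>\<Sigma>"
          then obtain w where w: "w \<in> \<Sigma>" "C (x, t) \<in> w" by blast
          then have "lf z = w" using lf_eq[of w "C (x, t)"] \<Sigma>(1) \<open>lf (C (x, t)) = lf z\<close> by blast
          then show False using w(1) z(2) by blast
        qed
      qed (use iso xt in blast)
      then show "C (x, t) \<in> topspace Z - \<Union>\<Sigma>" using fchart_dest(5)[OF C(1) xt] by blast
    qed
    moreover have zN: "z \<in> ?N" unfolding C(2)[symmetric] using J0 by (intro imageI) auto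
    ultimately have "?N \<subseteq> W" using max zW by blast
    moreover have "openin Z ?N" by (rule fchart_dest(3)[OF C(1)]) simp
    ultimately show "\<exists>T. openin Z T \<and> z \<in> T \<and> T \<subseteq> W" using zN by blast
  qed
qed

text \<open>The parameters whose leaves lie in \<open>W\<close> form an open interval, since a gap
  would disconnect \<open>W\<close> into the saturations of the arcs before and after it. Rescaling
  that interval to \<open>UI\<close> gives the rib.\<close>

lemma subrib:
  assumes c: "rib c" and W: "openin Z W" "saturated \<Delta> W" "connectedin Z W" "W \<noteq> {}" "W \<subseteq> ribsat c"
  shows "\<exists>c'. rib c' \<and> ribsat c' = W"
proof -
  have Wt: "W \<subseteq> topspace Z" using W(1) openin_subset by blast
  define A where "A = {t \<in> UI. c (0, t) \<in> W}"
  have cA: "c (0, t) \<in> topspace Z" if "t \<in> UI" for t using rib_dest(5)[OF c, of 0 t] that by simp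
  have WA: "\<exists>t\<in>A. lf (c (0, t)) = lf p" if p: "p \<in> W" for p
  proof -
    obtain t where t: "t \<in> UI" "lf (c (0, t)) = lf p" using p W(5) ribsat_iff[OF c] by blast
    then have "c (0, t) \<in> W" using saturatedD[OF W(2) p] p Wt cA by blast
    then show ?thesis using t by (auto simp: A_def)
  qed
  have A01: "A \<subseteq> UI" by (auto simp: A_def)
  have Ane: "A \<noteq> {}" using WA W(4) by blast
  have "continuous_map (top_of_set UI) (top_of_set (OI \<times> UI)) (\<lambda>t. (0::real, t::real))"
    by (auto simp: continuous_map_in_subtopology intro!: continuous_intros)
  from continuous_map_compose[OF this open_embeddingD(1)[OF rib_dest(1)[OF c]]]
  have line: "continuous_map (top_of_set UI) Z (\<lambda>t. c (0, t))" by (simp add: comp_def)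
  have "openin (top_of_set UI) A"
    unfolding A_def using openin_continuous_map_preimage[OF line W(1)] by simp
  then have Aop: "open A" by (simp add: openin_open_eq)
  have "r \<in> A" if pq: "p \<in> A" "q \<in> A" "p \<le> r" "r \<le> q" for p q r
  proof (rule ccontr)
    assume nr: "r \<notin> A"
    then have r: "p < r" "r < q" "r \<in> UI" using pq A01 by (auto simp: order_less_le)
    let ?U = "sat (c ` (OI \<times> {0<..<r}))" and ?V = "sat (c ` (OI \<times> {r<..<1}))"
    have 1: "openin Z ?U" "openin Z ?V" using r by (auto intro!: rib_slab_sat_open[OF c])
    have rs: "{0<..<r} \<subseteq> UI" "{r<..<1} \<subseteq> UI" using r by auto
    have 2: "W \<subseteq> ?U \<union> ?V"
    proof
      fix w assume w: "w \<in> W"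
      obtain t where t: "t \<in> A" "lf (c (0, t)) = lf w" using WA[OF w] by blast
      have "t \<noteq> r" using nr t by blast
      then have "t \<in> {0<..<r} \<or> t \<in> {r<..<1}" using t(1) A01 by (auto simp: subset_iff)
      then have "w \<in> ?U \<or> w \<in> ?V"
        using rib_slab_sat[OF c rs(1)] rib_slab_sat[OF c rs(2)] w Wt t(2) by blast
      then show "w \<in> ?U \<union> ?V" by blast
    qed
    have 3: "?U \<inter> ?V \<inter> W = {}"
    proof (rule ccontr)
      assume "?U \<inter> ?V \<inter> W \<noteq> {}"
      then obtain w where w: "w \<in> ?U" "w \<in> ?V" "w \<in> topspace Z" using Wt by blast
      have "\<exists>s\<in>{0<..<r}. lf (c (0, s)) = lf w" "\<exists>t\<in>{r<..<1}. lf (c (0, t)) = lf w"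
        using rib_slab_sat[OF c rs(1)] rib_slab_sat[OF c rs(2)] w by blast+
      then obtain s t where st: "s \<in> {0<..<r}" "t \<in> {r<..<1}" "lf (c (0, s)) = lf (c (0, t))" by auto
      then have "s = t" using inj_onD[OF rib_dest(3)[OF c], of s t] r by auto
      then show False using st by auto
    qed
    have 4: "?U \<inter> W \<noteq> {}" "?V \<inter> W \<noteq> {}"
    proof -
      have "p \<in> UI" "q \<in> UI" using pq A01 by blast+
      then have pr: "p \<in> {0<..<r}" "q \<in> {r<..<1}" "c (0, p) \<in> topspace Z" "c (0, q) \<in> topspace Z" using r cA by auto
      have "c (0, p) \<in> ?U"
        using rib_slab_sat[OF c rs(1) pr(3)] pr(1) by blast
      then show "?U \<inter> W \<noteq> {}" using pq(1) by (auto simp: A_def)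
      have "c (0, q) \<in> ?V"
        using rib_slab_sat[OF c rs(2) pr(4)] pr(2) by blast
      then show "?V \<inter> W \<noteq> {}" using pq(2) by (auto simp: A_def)
    qed
    show False using W(3) 1 2 3 4 unfolding connectedin by blast
  qed
  then have Aint: "is_interval A" unfolding is_interval_1 by blast
  define a b where "a = Inf A" and "b = Sup A"
  have bdd: "bdd_below A" "bdd_above A" using A01 by (meson bdd_below_mono bdd_below_Ioo bdd_above_mono bdd_above_Ioo)+
  have Aab: "A = {a<..<b}"
  proof (intro equalityI subsetI)
    fix x assume x: "x \<in> A"
    then obtain e where e: "e > 0" "ball x e \<subseteq> A" using Aop open_contains_ball by blast
    then have "x - e/2 \<in> A" "x + e/2 \<in> A" by (auto simp: subset_iff dist_real_def)
    then have "a \<le> x - e/2" "x + e/2 \<le> b" using bdd by (auto simp: a_def b_def intro: cInf_lower cSup_upper)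
    then show "x \<in> {a<..<b}" using e(1) by auto
  next
    fix x assume x: "x \<in> {a<..<b}"
    obtain p where "p \<in> A" "p < x" using x cInf_lessD[OF Ane] by (auto simp: a_def)
    moreover obtain q where "q \<in> A" "x < q" using x less_cSupD[OF Ane] by (auto simp: b_def)
    ultimately show "x \<in> A" using Aint unfolding is_interval_1 by (meson less_imp_le)
  qed
  have ab: "a < b" using Ane Aab by auto
  let ?h = "\<lambda>t. a + (b - a) * t"
  let ?\<psi> = "\<lambda>p::real\<times>real. (fst p, ?h (snd p))"
  let ?c = "\<lambda>p. c (?\<psi> p)"
  have him: "?h ` UI = A"
    unfolding Aab
  proof (intro equalityI subsetI)
    fix y assume "y \<in> {a<..<b}"
    then show "y \<in> ?h ` UI" using ab by (intro image_eqI[of _ _ "(y - a) / (b - a)"]) (auto simp: field_simps)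
  next
    fix y assume "y \<in> ?h ` UI"
    then obtain t where t: "y = a + (b - a) * t" "t \<in> UI" by (rule imageE)
    have "(b - a) * t < (b - a) * 1" using t ab by (intro mult_strict_left_mono) auto
    moreover have "0 < (b - a) * t" using t ab by (intro mult_pos_pos) auto
    ultimately show "y \<in> {a<..<b}" unfolding t(1) greaterThanLessThan_iff by (simp add: algebra_simps)
  qed
  have hA: "?h t \<in> A" "?h t \<in> UI" if "t \<in> UI" for t using him that A01 by blast+
  have im: "?\<psi> ` (OI \<times> UI) = OI \<times> A" unfolding him[symmetric] by force
  have rib: "rib ?c"
    unfolding rib_def
  proof (intro conjI ballI)
    show "open_embedding Z (OI \<times> UI) ?c"
    proof (rule open_embedding_reparam[OF rib_dest(1)[OF c]])
      show "homeomorphism (OI \<times> UI) (?\<psi> ` (OI \<times> UI)) ?\<psi> (\<lambda>p. (fst p, (snd p - a) / (b - a)))"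
        unfolding homeomorphism_def using ab by (auto intro!: continuous_intros simp: image_image)
      show "openin (top_of_set (OI \<times> UI)) (?\<psi> ` (OI \<times> UI))"
        unfolding im using A01 Aop by (intro open_subset) (auto intro!: open_Times)
    qed
    show "lf (?c (x, t)) = lf (?c (0, t))" if "x \<in> OI" "t \<in> UI" for x t
      using rib_dest(2)[OF c that(1) hA(2)[OF that(2)]] by simp
    show "inj_on (\<lambda>t. lf (?c (0, t))) UI"
    proof (rule inj_onI)
      fix s t :: real assume st: "s \<in> UI" "t \<in> UI" "lf (?c (0, s)) = lf (?c (0, t))"
      then have "?h s = ?h t" using inj_onD[OF rib_dest(3)[OF c], of "?h s" "?h t"] hA(2)[OF st(1)] hA(2)[OF st(2)] by auto
      then show "s = t" using ab by simp
    qed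
    show "lf (?c (0, t)) \<notin> Sp" if "t \<in> UI" for t
      using rib_dest(4)[OF c hA(2)[OF that]] by simp
  qed
  have "ribsat ?c = W"
  proof (intro equalityI subsetI)
    fix p assume "p \<in> ribsat ?c"
    then obtain t where t: "t \<in> UI" "lf (c (0, ?h t)) = lf p" "p \<in> topspace Z" using ribsat_iff[OF rib] by auto
    have "c (0, ?h t) \<in> W" using hA(1)[OF t(1)] by (simp add: A_def)
    then show "p \<in> W" using saturatedD[OF W(2)] t Wt by (metis subsetD)
  next
    fix p assume p: "p \<in> W"
    then obtain s where s: "s \<in> A" "lf (c (0, s)) = lf p" using WA by blast
    then obtain t where "t \<in> UI" "s = ?h t" using him by blast
    then show "p \<in> ribsat ?c" using ribsat_iff[OF rib, of p] s p Wt by auto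
  qed
  then show ?thesis using rib by blast
qed

text \<open>Only those frontier leaves are cut that avoid all earlier ribbons; hence a ribbon meets at most finitely
  many cut leaves, and a component of the complement is trapped in the first ribbon that it meets.\<close>
theorem cut_leaves_exist:
  obtains \<Sigma> where "\<Sigma> \<subseteq> \<Delta>" "locally_finite_in Z \<Sigma>" "Sp \<subseteq> \<Sigma>"
    "\<And>W. W \<in> connected_components_of (subtopology Z (topspace Z - \<Union>\<Sigma>)) ==> \<exists>c. rib c \<and> ribsat c = W"
proof -
  obtain \<R> where \<R>: "countable \<R>" "\<And>c. c \<in> \<R> ==> rib c \<and> (\<exists>L. frontier_leaves c L)"
    "\<And>z. z \<in> topspace Z ==> \<exists>N F. openin Z N \<and> z \<in> N \<and> finite F \<and> F \<subseteq> \<R> \<and> N - \<Union>Sp \<subseteq> \<Union>(ribsat ` F)"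
    using countable_ribs by blast
  obtain fr where fr: "\<And>c. c \<in> \<R> ==> frontier_leaves c (fr c)" using \<R>(2) by metis
  define idx where "idx = to_nat_on \<R>"
  have idx: "inj_on idx \<R>" unfolding idx_def using \<R>(1) by (rule inj_on_to_nat_on)
  define \<Sigma> where "\<Sigma> = Sp \<union> {L \<in> \<Delta>. \<exists>c\<in>\<R>. L \<in> fr c \<and> (\<forall>c'\<in>\<R>. idx c' < idx c --> L \<inter> ribsat c' = {})}"
  have S1: "\<Sigma> \<subseteq> \<Delta>" "Sp \<subseteq> \<Sigma>" using Sp_leaves by (auto simp: \<Sigma>_def)
  have S2: "locally_finite_in Z \<Sigma>"
    unfolding locally_finite_in_def
  proof (intro conjI ballI)
    show "\<Union>\<Sigma> \<subseteq> topspace Z" using S1 leaf_sub by blast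
    fix z assume z: "z \<in> topspace Z"
    obtain V where V: "openin Z V" "z \<in> V" "finite {U \<in> Sp. U \<inter> V \<noteq> {}}"
      using Sp_lf z unfolding locally_finite_in_def by blast
    obtain N F where N: "openin Z N" "z \<in> N" "finite F" "F \<subseteq> \<R>" "N - \<Union>Sp \<subseteq> \<Union>(ribsat ` F)"
      using \<R>(3)[OF z] by blast
    \<comment> \<open>A newly cut leaf that meets \<open>N\<close> meets some rib of
      \<open>F\<close>; as it avoids all ribs before the one that contributed it, that rib has an
      index no larger than one occurring in \<open>F\<close>.\<close>
    define G where "G = {c \<in> \<R>. \<exists>c'\<in>F. idx c \<le> idx c'}"
    have "finite (idx ` G)"
    proof (rule finite_subset)
      show "idx ` G \<subseteq> (\<Union>c'\<in>F. {..idx c'})" by (auto simp: G_def)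
      show "finite (\<Union>c'\<in>F. {..idx c'})" using N(3) by auto
    qed
    moreover have "inj_on idx G" using idx by (rule inj_on_subset) (auto simp: G_def)
    ultimately have G: "finite G" using finite_image_iff by blast
    have "{U \<in> \<Sigma>. U \<inter> (V \<inter> N) \<noteq> {}} \<subseteq> {U \<in> Sp. U \<inter> V \<noteq> {}} \<union> \<Union>(fr ` G)"
    proof
      fix U assume U: "U \<in> {U \<in> \<Sigma>. U \<inter> (V \<inter> N) \<noteq> {}}"
      show "U \<in> {U \<in> Sp. U \<inter> V \<noteq> {}} \<union> \<Union>(fr ` G)"
      proof (cases "U \<in> Sp")
        case True
        then show ?thesis using U by blast
      next
        case False
        then obtain c where c: "U \<in> \<Delta>" "c \<in> \<R>" "U \<in> fr c" "\<And>c'. c'\<in>\<R> ==> idx c' < idx c ==> U \<inter> ribsat c' = {}"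
          using U by (auto simp: \<Sigma>_def)
        obtain w where w: "w \<in> U" "w \<in> N" using U by blast
        have "w \<notin> \<Union>Sp" using False c(1) w(1) lf_eq Sp_leaves by blast
        then obtain c' where c': "c' \<in> F" "w \<in> ribsat c'" using N(5) w by blast
        then have "\<not> idx c' < idx c" using c(4)[of c'] N(4) w by blast
        then have "c \<in> G" using c' c(2) by (auto simp: G_def not_less)
        then show ?thesis using c(3) by blast
      qed
    qed
    moreover have "finite (\<Union>(fr ` G))" using G fr unfolding frontier_leaves_def G_def by auto
    ultimately have "finite {U \<in> \<Sigma>. U \<inter> (V \<inter> N) \<noteq> {}}" using V(3) finite_subset by blast
    then show "\<exists>V. openin Z V \<and> z \<in> V \<and> finite {U \<in> \<Sigma>. U \<inter> V \<noteq> {}}"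
      using V N by (intro exI[of _ "V \<inter> N"]) auto
  qed
  have S3: "\<exists>c. rib c \<and> ribsat c = W" if W: "W \<in> connected_components_of (subtopology Z (topspace Z - \<Union>\<Sigma>))" for W
  proof -
    have Wne: "W \<noteq> {}" using W nonempty_connected_components_of by blast
    have WY: "W \<subseteq> topspace Z - \<Union>\<Sigma>" using connected_components_of_subset[OF W] by auto
    have Wc: "connectedin Z W" using connectedin_connected_components_of[OF W] by (simp add: connectedin_subtopology)
    have Wcov: "\<exists>c\<in>\<R>. w \<in> ribsat c" if "w \<in> W" for w
    proof -
      have "w \<in> topspace Z" "w \<notin> \<Union>Sp" using that WY S1 by blast+
      then show ?thesis using \<R>(3)[of w] by blast
    qed
    define I where "I = {idx c | c. c \<in> \<R> \<and> W \<inter> ribsat c \<noteq> {}}"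
    have "I \<noteq> {}" using Wne Wcov by (fastforce simp: I_def)
    then have "(LEAST n. n \<in> I) \<in> I" by (metis LeastI ex_in_conv)
    then obtain c where c: "c \<in> \<R>" "W \<inter> ribsat c \<noteq> {}" "idx c = (LEAST n. n \<in> I)"
      unfolding I_def mem_Collect_eq by metis
    have least: "W \<inter> ribsat c' = {}" if "c' \<in> \<R>" "idx c' < idx c" for c'
      using that c(3) not_less_Least[of "idx c'" "\<lambda>n. n \<in> I"] by (auto simp: I_def)
    have rc: "rib c" using \<R>(2) c by blast
    \<comment> \<open>\<open>c\<close> is the first rib that \<open>W\<close> meets. A frontier leaf
      of \<open>c\<close> inside \<open>W\<close> is not cut, so it meets an earlier rib and by
      saturation lies in it, against the choice of \<open>c\<close>.\<close>
    have "W \<inter> Z frontier_of (ribsat c) = {}"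
    proof (rule ccontr)
      assume "W \<inter> Z frontier_of (ribsat c) \<noteq> {}"
      then obtain z where z: "z \<in> W" "z \<in> Z closure_of ribsat c" "z \<notin> Z interior_of ribsat c"
        by (auto simp: frontier_of_def)
      have zn: "z \<notin> ribsat c" using z(3) ribsat_open[OF rc] by (simp add: interior_of_openin)
      have zt: "z \<in> topspace Z" "lf z \<notin> \<Sigma>" using z(1) WY lf_in by blast+
      have "lf z \<in> fr c" using fr[OF c(1)] z(2) zn zt S1(2) unfolding frontier_leaves_def by blast
      moreover have "lf z \<in> \<Delta>" using lf_in zt by blast
      ultimately obtain c' where c': "c' \<in> \<R>" "idx c' < idx c" "lf z \<inter> ribsat c' \<noteq> {}"
        using zt(2) c(1) unfolding \<Sigma>_def by blast
      then have "lf z \<subseteq> ribsat c'" using ribsat_saturated[of c'] \<open>lf z \<in> \<Delta>\<close> unfolding saturated_def by blast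
      then show False using least[OF c'(1,2)] z(1) lf_in(2)[OF zt(1)] by blast
    qed
    then have "W \<subseteq> ribsat c"
      using connectedin_Int_frontier_of[OF Wc, of "ribsat c"] c(2) by blast
    then show ?thesis using subrib[OF rc] component_leaf_open[OF S1(1) S2 W] Wc Wne by blast
  qed
  show ?thesis using that[OF S1(1) S2 S1(2) S3] by blast
qed

end

section \<open>The leaf parameter of a piece\<close>

locale cut_strip = ribboned_surface +
  fixes c :: "real \<times> real => 'a"
  assumes rib: "rib c"
begin

definition W :: "'a set" where "W = ribsat c"

definition tau :: "'a => real" where "tau p = (THE t. t \<in> UI \<and> lf (c (0, t)) = lf p)"

lemma W_sub: "W \<subseteq> topspace Z" and W_sat: "saturated \<Delta> W"
  unfolding W_def using ribsat_sub ribsat_saturated by auto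

lemma c_top: "t \<in> UI ==> x \<in> OI ==> c (x, t) \<in> topspace Z"
  using rib_dest(5)[OF rib] by blast

lemma lf_c: "x \<in> OI ==> t \<in> UI ==> lf (c (x, t)) = lf (c (0, t))" by (rule rib_dest(2)[OF rib])

lemma tauI: assumes "p \<in> topspace Z" "t \<in> UI" "lf p = lf (c (0, t))" shows "p \<in> W" "tau p = t"
proof -
  show "p \<in> W" unfolding W_def ribsat_iff[OF rib] using assms by auto
  show "tau p = t" unfolding tau_def
  proof (rule the_equality)
    fix s assume "s \<in> UI \<and> lf (c (0, s)) = lf p"
    then show "s = t" using inj_onD[OF rib_dest(3)[OF rib], of s t] assms by simp
  qed (use assms in simp)
qed

lemma tau: assumes "p \<in> W" shows "tau p \<in> UI" "lf p = lf (c (0, tau p))"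
proof -
  obtain t where t: "t \<in> UI" "lf (c (0, t)) = lf p" "p \<in> topspace Z" using assms unfolding W_def ribsat_iff[OF rib] by blast
  then have "tau p = t" using tauI(2) by simp
  then show "tau p \<in> UI" "lf p = lf (c (0, tau p))" using t by auto
qed

lemma tau_eq_iff: "p \<in> W ==> q \<in> W ==> tau p = tau q \<longleftrightarrow> lf p = lf q"
proof -
  assume p: "p \<in> W" and q: "q \<in> W"
  have "tau q = tau p" if "lf p = lf q"
    using tauI(2)[of q "tau p"] tau[OF p] q W_sub that by auto
  then show ?thesis using tau(2)[OF p] tau(2)[OF q] by metis
qed

lemma tau_c: "x \<in> OI ==> t \<in> UI ==> tau (c (x, t)) = t" "x \<in> OI ==> t \<in> UI ==> c (x, t) \<in> W"
  using tauI[OF c_top, of t x t] lf_c[of x t] by blast+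

lemma W_lf: "p \<in> W ==> lf p \<notin> Sp"
  using tau[of p] rib_dest(4)[OF rib, of "tau p"] by simp

lemma W_not_Sp: "p \<in> W ==> p \<notin> \<Union>Sp"
proof
  assume p: "p \<in> W" "p \<in> \<Union>Sp"
  then obtain w where "w \<in> Sp" "p \<in> w" by blast
  then show False using W_lf[OF p(1)] lf_eq[of w p] Sp_leaves by auto
qed

lemma tau_cont: "continuous_map (subtopology Z W) euclideanreal tau"
  unfolding continuous_map_def
proof (intro conjI allI impI)
  fix A :: "real set" assume "openin euclideanreal A"
  then have A: "open A" by simp
  have "{x \<in> topspace (subtopology Z W). tau x \<in> A} = sat (c ` (OI \<times> (A \<inter> UI)))"
  proof (intro set_eqI iffI)
    fix p assume "p \<in> {x \<in> topspace (subtopology Z W). tau x \<in> A}"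
    then have p: "p \<in> W" "tau p \<in> A" "p \<in> topspace Z" by auto
    then show "p \<in> sat (c ` (OI \<times> (A \<inter> UI)))"
      using rib_slab_sat[OF rib _ p(3), of "A \<inter> UI"] tau[OF p(1)] by auto
  next
    fix p assume p: "p \<in> sat (c ` (OI \<times> (A \<inter> UI)))"
    then have pt: "p \<in> topspace Z" using sat_sub by blast
    then obtain t where "t \<in> A \<inter> UI" "lf (c (0, t)) = lf p" using rib_slab_sat[OF rib _ pt, of "A \<inter> UI"] p by auto
    then show "p \<in> {x \<in> topspace (subtopology Z W). tau x \<in> A}" using tauI[OF pt, of t] pt by auto
  qed
  moreover have "openin Z (sat (c ` (OI \<times> (A \<inter> UI))))" using A by (intro rib_slab_sat_open[OF rib]) auto
  ultimately show "openin (subtopology Z W) {x \<in> topspace (subtopology Z W). tau x \<in> A}"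
    by (intro subset_openin_subtopology) auto
qed auto

text \<open>A coordinate is chosen on each leaf separately, without continuity from leaf to leaf;
  its use across leaves is through the order alone. Letting the column \<open>x = 0\<close> precede
  the column \<open>x = 1/2\<close> orients all leaves coherently.\<close>

definition rho_spec :: "('a => real) => bool" where
  "rho_spec r \<longleftrightarrow> (\<forall>t\<in>UI. continuous_map (subtopology Z (lf (c (0, t)))) euclideanreal r \<and>
     inj_on r (lf (c (0, t))) \<and> r (c (0, t)) < r (c (1/2, t)))"

lemma rho_exists: "\<exists>r. rho_spec r"
proof -
  have "\<exists>r. continuous_map (subtopology Z (lf (c (0, t)))) euclideanreal r \<and>
     inj_on r (lf (c (0, t))) \<and> r (c (0, t)) < r (c (1/2, t))" if t: "t \<in> UI" for t
  proof -
    let ?l = "lf (c (0, t))"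
    have l: "?l \<in> \<Delta>" using lf_in(1) c_top[OF t, of 0] by simp
    obtain f g where fg: "homeomorphic_maps (subtopology Z ?l) euclideanreal f g"
      using leaf_line[OF l] unfolding homeomorphic_space_def by blast
    then have f: "continuous_map (subtopology Z ?l) euclideanreal f" by (simp add: homeomorphic_maps_def)
    have inj: "inj_on f ?l"
      using homeomorphic_imp_injective_map[OF homeomorphic_maps_imp_map[OF fg]] leaf_sub[OF l]
      by (simp add: Int_absorb1)
    have "c (0, t) \<noteq> c (1/2, t)"
      using inj_onD[OF open_embeddingD(2)[OF rib_dest(1)[OF rib]], of "(0, t)" "(1/2, t)"] t by auto
    moreover have "c (0, t) \<in> ?l" "c (1/2, t) \<in> ?l"
      using lf_in(2)[OF c_top[OF t, of 0]] lf_in(2)[OF c_top[OF t, of "1/2"]] lf_c[of "1/2" t] t by auto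
    ultimately have ne: "f (c (0, t)) \<noteq> f (c (1/2, t))" using inj by (auto simp: inj_on_def)
    show ?thesis
    proof (cases "f (c (0, t)) < f (c (1/2, t))")
      case True
      then show ?thesis using f inj by blast
    next
      case False
      have "continuous_map (subtopology Z ?l) euclideanreal (\<lambda>x. - f x)" using f by (rule continuous_map_minus)
      moreover have "inj_on (\<lambda>x. - f x) ?l" using inj by (auto simp: inj_on_def)
      ultimately show ?thesis using False ne by (intro exI[of _ "\<lambda>x. - f x"]) auto
    qed
  qed
  then obtain R where R: "\<And>t. t \<in> UI ==> continuous_map (subtopology Z (lf (c (0, t)))) euclideanreal (R t) \<and>
     inj_on (R t) (lf (c (0, t))) \<and> R t (c (0, t)) < R t (c (1/2, t))" by metis
  define r where "r p = R (tau p) p" for p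
  have rR: "r p = R t p" if "t \<in> UI" "p \<in> lf (c (0, t))" for p t
  proof -
    have l: "lf (c (0, t)) \<in> \<Delta>" using lf_in(1) c_top[OF that(1), of 0] by simp
    then have "lf p = lf (c (0, t))" "p \<in> topspace Z" using lf_eq that(2) leaf_sub by blast+
    then show ?thesis unfolding r_def using tauI(2)[OF _ that(1)] by simp
  qed
  have "rho_spec r"
    unfolding rho_spec_def
  proof (intro ballI conjI)
    fix t assume t: "t \<in> UI"
    show "continuous_map (subtopology Z (lf (c (0, t)))) euclideanreal r"
    proof (rule continuous_map_eq[where f = "R t"])
      show "continuous_map (subtopology Z (lf (c (0, t)))) euclideanreal (R t)" using R[OF t] by blast
      show "R t p = r p" if "p \<in> topspace (subtopology Z (lf (c (0, t))))" for p
        using rR[OF t, of p] that by simp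
    qed
    have "inj_on (R t) (lf (c (0, t)))" using R[OF t] by blast
    then show "inj_on r (lf (c (0, t)))" using inj_on_cong[of "lf (c (0, t))" r "R t"] rR[OF t] by blast
    have "c (0, t) \<in> lf (c (0, t))" "c (1/2, t) \<in> lf (c (0, t))"
      using lf_in(2)[OF c_top[OF t, of 0]] lf_in(2)[OF c_top[OF t, of "1/2"]] lf_c[of "1/2" t] t by auto
    then have "r (c (0, t)) = R t (c (0, t))" "r (c (1/2, t)) = R t (c (1/2, t))" using rR[OF t] by blast+
    then show "r (c (0, t)) < r (c (1/2, t))" using R[OF t] by simp
  qed
  then show ?thesis by blast
qed

definition rho :: "'a => real" where "rho = (SOME r. rho_spec r)"

lemma rho: "rho_spec rho" unfolding rho_def using rho_exists by (rule someI_ex)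

lemma rho_inj: assumes "p \<in> W" "q \<in> W" "tau p = tau q" "rho p = rho q" shows "p = q"
proof -
  have "inj_on rho (lf (c (0, tau p)))" using rho tau(1)[OF assms(1)] unfolding rho_spec_def by blast
  moreover have "p \<in> lf (c (0, tau p))" "q \<in> lf (c (0, tau p))"
    using tau(2)[OF assms(1)] tau(2)[OF assms(2)] assms lf_in(2)[of p] lf_in(2)[of q] W_sub by auto
  ultimately show ?thesis using assms(4) by (simp add: inj_on_def)
qed

lemma rho_path_cont:
  assumes f: "continuous_map (top_of_set A) Z f" and A: "\<And>a. a \<in> A ==> f a \<in> W \<and> tau (f a) = t" and t: "t \<in> UI"
  shows "continuous_on A (\<lambda>a. rho (f a))"
proof -
  have in_l: "f a \<in> lf (c (0, t))" if "a \<in> A" for a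
    using A[OF that] tau(2)[of "f a"] lf_in(2)[of "f a"] W_sub by auto
  have "continuous_map (top_of_set A) (subtopology Z (lf (c (0, t)))) f"
    unfolding continuous_map_in_subtopology using f in_l by auto
  moreover have "continuous_map (subtopology Z (lf (c (0, t)))) euclideanreal rho"
    using rho t unfolding rho_spec_def by blast
  ultimately have "continuous_map (top_of_set A) euclideanreal (rho \<circ> f)" by (rule continuous_map_compose)
  then show ?thesis by (simp add: comp_def)
qed

text \<open>Along an injective path in one leaf \<open>rho\<close> is strictly monotone, and a
  single comparison at \<open>a\<close> and \<open>b\<close> fixes the direction.\<close>

lemma rho_path_monotone:
  fixes f :: "real => 'a"
  assumes f: "continuous_map (top_of_set A) Z f" "inj_on f A" and A: "is_interval A" "\<And>a. a \<in> A ==> f a \<in> W \<and> tau (f a) = t"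
    and t: "t \<in> UI" and ab: "a \<in> A" "b \<in> A" "a < b" "rho (f a) < rho (f b)"
    and xy: "x \<in> A" "y \<in> A" "x < y"
  shows "rho (f x) < rho (f y)"
proof -
  have "inj_on (\<lambda>a. rho (f a)) A"
  proof (rule inj_onI)
    fix x y assume "x \<in> A" "y \<in> A" "rho (f x) = rho (f y)"
    then show "x = y" using rho_inj[of "f x" "f y"] A(2) inj_onD[OF f(2)] by simp
  qed
  then have "(\<forall>x\<in>A. \<forall>y\<in>A. x < y --> rho (f x) < rho (f y)) \<or> (\<forall>x\<in>A. \<forall>y\<in>A. x < y --> rho (f y) < rho (f x))"
    using continuous_inj_strict_monotone[OF A(1) rho_path_cont[OF f(1) A(2) t]] by blast
  then show ?thesis using ab xy by (meson less_asym)
qed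

end

text \<open>Ribbons provide the planar charts for invariance of domain, so away from
  \<open>Sp\<close> continuity and injectivity already give an open embedding.\<close>

lemma (in ribboned_surface) regular_open_embedding:
  assumes "open B" "continuous_map (top_of_set B) Z f" "inj_on f B" "\<And>b. b \<in> B ==> lf (f b) \<notin> Sp"
  shows "open_embedding Z B f"
proof (rule continuous_inj_imp_open_embedding[OF assms(1-3)])
  fix b assume b: "b \<in> B"
  then have "f b \<in> topspace Z" using continuous_map_image_subset_topspace[OF assms(2)] by auto
  then obtain k y where "ribbon Z (\<Delta> - Sp) k" "k (y, 0) = f b" using ribbon_at assms(4)[OF b] by blast
  then show "\<exists>A c. open A \<and> open_embedding Z A c \<and> f b \<in> c ` A"
    by (intro exI[of _ "UNIV \<times> OI"] exI[of _ k]) (auto simp: ribbon_def open_Times intro!: image_eqI[of _ _ "(y, 0)"])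
qed

lemma open_embedding_pull:
  assumes k: "open_embedding Z A k" and f: "continuous_map (top_of_set B) Z f" "\<And>b. b \<in> B ==> f b \<in> k ` A"
  shows "continuous_on B (\<lambda>b. inv_into A k (f b))" "\<And>b. b \<in> B ==> inv_into A k (f b) \<in> A"
    "\<And>b. b \<in> B ==> k (inv_into A k (f b)) = f b"
proof -
  have "continuous_map (top_of_set B) (subtopology Z (k ` A)) f"
    unfolding continuous_map_in_subtopology using f by auto
  from continuous_map_compose[OF this open_embedding_inverse[OF k]]
  show "continuous_on B (\<lambda>b. inv_into A k (f b))" by (simp add: continuous_map_in_subtopology comp_def)
  show "inv_into A k (f b) \<in> A" "k (inv_into A k (f b)) = f b" if "b \<in> B" for b
    using f(2)[OF that] by (auto intro: inv_into_into f_inv_into_f)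
qed

section \<open>Product coordinates over intervals of leaf parameters\<close>

context cut_strip
begin

lemma c_line: assumes "x \<in> OI" shows "continuous_map (top_of_set UI) Z (\<lambda>t. c (x, t))"
proof -
  have "continuous_map (top_of_set UI) (top_of_set (OI \<times> UI)) (\<lambda>t. (x, t))"
    using assms by (auto simp: continuous_map_in_subtopology intro!: continuous_intros)
  from continuous_map_compose[OF this open_embeddingD(1)[OF rib_dest(1)[OF rib]]]
  show ?thesis by (simp add: comp_def)
qed

text \<open>Local triviality of the projection \<open>tau\<close> with whole leaves as fibres; the
  fibre coordinate is in addition required to follow the order of \<open>rho\<close>.\<close>

definition trivialization :: "real => real => (real \<times> real => 'a) => bool" where
  "trivialization t0 d k \<longleftrightarrow> 0 < d \<and> {t0 - d<..<t0 + d} \<subseteq> UI \<and> open_embedding Z (UNIV \<times> {t0 - d<..<t0 + d}) k \<and>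
     (\<forall>t\<in>{t0 - d<..<t0 + d}. (\<forall>y. k (y, t) \<in> W \<and> tau (k (y, t)) = t) \<and>
       (\<forall>p\<in>W. tau p = t --> (\<exists>y. p = k (y, t))) \<and> (\<forall>y y'. y < y' --> rho (k (y, t)) < rho (k (y', t))))"

lemma trivialization_exists:
  assumes t0: "t0 \<in> UI"
  obtains d \<kappa> where "trivialization t0 d \<kappa>"
proof -
  have z: "c (0, t0) \<in> topspace Z" "lf (c (0, t0)) \<notin> Sp" using c_top[OF t0] rib_dest(4)[OF rib t0] by auto
  obtain k y00 where k: "ribbon Z (\<Delta> - Sp) k" "k (y00, 0) = c (0, t0)" using ribbon_at[OF z] by blast
  let ?A = "UNIV \<times> OI"
  have oe: "open_embedding Z ?A k" using k by (simp add: ribbon_def)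
  have "c (0, t0) \<in> k ` ?A" unfolding k(2)[symmetric] by (intro imageI) auto
  then obtain d0 where d0: "d0 > 0" "\<And>t. t \<in> UI ==> dist t t0 < d0 ==> c (0, t) \<in> k ` ?A"
    using continuous_map_nbhd[OF c_line[of 0] t0 open_embeddingD(4)[OF oe]] by auto
  define d1 where "d1 = min d0 (min t0 (1 - t0))"
  have d1: "d1 > 0" "d1 \<le> d0" "d1 \<le> t0" "d1 \<le> 1 - t0" using d0 t0 by (auto simp: d1_def)
  define D where "D = {t0 - d1<..<t0 + d1}"
  have DU: "D \<subseteq> UI" using d1 by (auto simp: D_def)
  have t0D: "t0 \<in> D" using d1 by (auto simp: D_def)
  have in0: "c (0, t) \<in> k ` ?A" if "t \<in> D" for t
  proof -
    have "dist t t0 < d0" using that d1 by (auto simp: D_def dist_real_def)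
    then show ?thesis using d0(2) that DU by blast
  qed
  have in1: "c (1/2, t) \<in> k ` ?A" if "t \<in> D" for t
  proof -
    have t: "t \<in> UI" using that DU by blast
    have "lf (c (1/2, t)) = lf (c (0, t))" using lf_c[of "1/2" t] t by simp
    then show ?thesis using saturatedD[OF ribbon_saturated[OF k(1), of OI] in0[OF that]] c_top[OF t] by auto
  qed
  have cl: "continuous_map (top_of_set D) Z (\<lambda>t. c (0, t))" "continuous_map (top_of_set D) Z (\<lambda>t. c (1/2, t))"
    using continuous_map_from_subtopology_mono[OF c_line DU] by auto
  define h0 h1 where "h0 t = inv_into ?A k (c (0, t))" and "h1 t = inv_into ?A k (c (1/2, t))" for t
  have h0: "continuous_on D h0" "\<And>t. t \<in> D ==> h0 t \<in> ?A" "\<And>t. t \<in> D ==> k (h0 t) = c (0, t)"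
    unfolding h0_def using open_embedding_pull[OF oe cl(1) in0] by auto
  have h1: "continuous_on D h1" "\<And>t. t \<in> D ==> h1 t \<in> ?A" "\<And>t. t \<in> D ==> k (h1 t) = c (1/2, t)"
    unfolding h1_def using open_embedding_pull[OF oe cl(2) in1] by auto
  \<comment> \<open>Ribbon height of the leaf with parameter \<open>t\<close>. It is never inverted:
    openness of the resulting coordinates comes from \<open>regular_open_embedding\<close>.\<close>
  define v where "v t = snd (h0 t)" for t
  have vO: "v t \<in> OI" if "t \<in> D" for t using h0(2)[OF that] by (auto simp: v_def mem_Times_iff)
  have hh0: "h0 t = (fst (h0 t), v t)" for t by (simp add: v_def)
  have lfk: "lf (k (y, v t)) = lf (c (0, t))" if "t \<in> D" for y t
  proof -
    have "k (fst (h0 t), v t) = c (0, t)" using h0(3)[OF that] hh0 by simp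
    then show ?thesis using ribbon_lf_iff[OF k(1) vO[OF that] vO[OF that], of y "fst (h0 t)"] by simp
  qed
  have hh1: "h1 t = (fst (h1 t), v t)" if "t \<in> D" for t
  proof -
    have s: "snd (h1 t) \<in> OI" using h1(2)[OF that] by (auto simp: mem_Times_iff)
    have "t \<in> UI" using that DU by blast
    then have "lf (k (fst (h1 t), snd (h1 t))) = lf (c (0, t))" using h1(3)[OF that] lf_c[of "1/2" t] by simp
    then have "lf (k (fst (h1 t), snd (h1 t))) = lf (k (0, v t))" using lfk[OF that] by simp
    then have "snd (h1 t) = v t" using ribbon_lf_iff[OF k(1) s vO[OF that]] by blast
    then show ?thesis by (metis prod.collapse)
  qed
  \<comment> \<open>Signed distance, in the ribbon, between the two columns that orient the leaves.
    It has no zero on the interval \<open>D\<close>, so its sign \<open>e\<close> is constant there,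
    and multiplying the leaf coordinate by \<open>e\<close> adapts the ribbon to the order of
    \<open>rho\<close>.\<close>
  define g where "g t = fst (h1 t) - fst (h0 t)" for t
  have cg: "continuous_on D g" unfolding g_def using h0 h1 by (intro continuous_intros) auto
  have gne: "g t \<noteq> 0" if "t \<in> D" for t
  proof
    assume "g t = 0"
    then have "h1 t = h0 t" using hh1[OF that] hh0[of t] by (simp add: g_def)
    then have eq: "c (0, t) = c (1/2, t)" using h0(3)[OF that] h1(3)[OF that] by simp
    have "t \<in> UI" using that DU by blast
    then show False using inj_onD[OF open_embeddingD(2)[OF rib_dest(1)[OF rib]] eq] by auto
  qed
  define e where "e = sgn (g t0)"
  have e: "e = 1 \<or> e = -1" "e * g t0 > 0" "e * e = 1" using gne[OF t0D] by (auto simp: e_def sgn_if)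
  have ceg: "continuous_on D (\<lambda>t. e * g t)" using cg by (intro continuous_intros)
  have ep: "0 < e * g t" if t: "t \<in> D" for t
  proof (rule ccontr)
    assume "\<not> 0 < e * g t"
    then have neg: "e * g t < 0" using gne[OF t] e by auto
    have "connected ((\<lambda>t. e * g t) ` D)" using ceg by (intro connected_continuous_image) (auto simp: D_def)
    then have "0 \<in> (\<lambda>t. e * g t) ` D" using connectedD_interval[of "(\<lambda>t. e * g t) ` D" "e * g t" "e * g t0" 0] neg e(2) t t0D by auto
    then show False using gne e by auto
  qed
  define \<kappa> where "\<kappa> q = k (e * fst q, v (snd q))" for q
  have cv: "continuous_on D v" unfolding v_def using h0(1) by (intro continuous_intros)
  have c\<kappa>: "continuous_map (top_of_set (UNIV \<times> D)) Z \<kappa>"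
  proof -
    have "continuous_on (UNIV \<times> D) (\<lambda>q. (e * fst q, v (snd q)))"
      by (intro continuous_intros continuous_on_compose2[OF cv]) auto
    then have "continuous_map (top_of_set (UNIV \<times> D)) (top_of_set ?A) (\<lambda>q. (e * fst q, v (snd q)))"
      using vO by (auto simp: continuous_map_in_subtopology)
    from continuous_map_compose[OF this open_embeddingD(1)[OF oe]] show ?thesis by (simp add: comp_def \<kappa>_def[abs_def])
  qed
  have \<kappa>W: "\<kappa> (y, t) \<in> W" "tau (\<kappa> (y, t)) = t" if "t \<in> D" for y t
    using tauI[of "\<kappa> (y, t)" t] lfk[OF that, of "e * y"] ribbon_dest(5)[OF k(1) vO[OF that]] DU that
    by (auto simp: \<kappa>_def)
  have inj\<kappa>: "inj_on \<kappa> (UNIV \<times> D)"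
  proof (rule inj_onI, clarify)
    fix y t y' t' assume t: "t \<in> D" "t' \<in> D" and eq: "\<kappa> (y, t) = \<kappa> (y', t')"
    have tt: "t = t'" using \<kappa>W(2)[OF t(1), of y] \<kappa>W(2)[OF t(2), of y'] eq by simp
    have "(e * y, v t) = (e * y', v t')"
      using inj_onD[OF ribbon_dest(2)[OF k(1)], of "(e * y, v t)" "(e * y', v t')"] eq vO t by (auto simp: \<kappa>_def)
    then show "y = y' \<and> t = t'" using tt e by auto
  qed
  have oe\<kappa>: "open_embedding Z (UNIV \<times> D) \<kappa>"
    using W_lf \<kappa>W by (intro regular_open_embedding c\<kappa> inj\<kappa>) (auto simp: D_def open_Times)
  have onto: "\<exists>y. p = \<kappa> (y, t)" if t: "t \<in> D" and p: "p \<in> W" "tau p = t" for p t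
  proof -
    have "lf p = lf (k (0, v t))" using tau(2)[OF p(1)] p(2) lfk[OF t] by simp
    then have "p \<in> k ` (UNIV \<times> {v t})" using ribbon_dest(6)[OF k(1) vO[OF t], of 0] lf_in(2)[of p] p W_sub by auto
    then obtain y where y: "p = k (y, v t)" by auto
    have "e * (e * y) = y" using e(3) by (metis mult.assoc mult_1)
    then have "p = \<kappa> (e * y, t)" unfolding \<kappa>_def fst_conv snd_conv y by (rule arg_cong[where f = "\<lambda>u. k (u, v t)", OF sym])
    then show ?thesis by blast
  qed
  have mono: "rho (\<kappa> (y, t)) < rho (\<kappa> (y', t))" if t: "t \<in> D" and y: "y < y'" for y y' t
  proof (rule rho_path_monotone[of UNIV "\<lambda>y. \<kappa> (y, t)" t "e * fst (h0 t)" "e * fst (h1 t)"])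
    have "continuous_map (top_of_set UNIV) (top_of_set (UNIV \<times> D)) (\<lambda>y. (y, t))"
      using t by (auto simp: continuous_map_in_subtopology intro!: continuous_intros)
    from continuous_map_compose[OF this c\<kappa>] show "continuous_map (top_of_set UNIV) Z (\<lambda>y. \<kappa> (y, t))" by (simp add: comp_def)
    show "inj (\<lambda>y. \<kappa> (y, t))" using inj_onD[OF inj\<kappa>] t by (intro injI) auto
    show "t \<in> UI" using t DU by blast
    have "0 < e * g t" by (rule ep[OF t])
    then show "e * fst (h0 t) < e * fst (h1 t)" by (simp add: g_def right_diff_distrib)
    have ee: "e * (e * x) = x" for x using e(3) by (metis mult.assoc mult_1)
    have "\<kappa> (e * fst (h0 t), t) = c (0, t)" "\<kappa> (e * fst (h1 t), t) = c (1/2, t)"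
      using h0(3)[OF t] h1(3)[OF t] hh0[of t] hh1[OF t] by (simp_all add: \<kappa>_def ee)
    then show "rho (\<kappa> (e * fst (h0 t), t)) < rho (\<kappa> (e * fst (h1 t), t))"
      using rho t DU unfolding rho_spec_def by auto
  qed (use \<kappa>W t y in auto)
  have "trivialization t0 d1 \<kappa>"
    unfolding trivialization_def D_def[symmetric] using d1(1) DU oe\<kappa> \<kappa>W onto mono by auto
  then show ?thesis by (rule that)
qed

text \<open>Although \<open>rho\<close> is not continuous across leaves, inside a trivialization its
  order is the order of a continuous coordinate.\<close>

lemma order_open:
  fixes A :: "'b::metric_space set"
  assumes pq: "continuous_map (top_of_set A) Z p" "continuous_map (top_of_set A) Z q"
    and W: "\<And>a. a \<in> A ==> p a \<in> W \<and> q a \<in> W \<and> tau (p a) = tau (q a)"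
  shows "openin (top_of_set A) {a \<in> A. rho (p a) < rho (q a)}"
proof (subst openin_subopen, clarify)
  fix a0 assume a0: "a0 \<in> A" "rho (p a0) < rho (q a0)"
  define t0 where "t0 = tau (p a0)"
  have t0: "t0 \<in> UI" using tau W[OF a0(1)] by (auto simp: t0_def)
  obtain \<delta> k where k: "trivialization t0 \<delta> k" using trivialization_exists[OF t0] by blast
  let ?I = "{t0 - \<delta><..<t0 + \<delta>}"
  let ?K = "k ` (UNIV \<times> ?I)"
  have oe: "open_embedding Z (UNIV \<times> ?I) k" and d: "\<delta> > 0" using k by (auto simp: trivialization_def)
  have k1: "tau (k (y, t)) = t" if "t \<in> ?I" for y t using k that by (auto simp: trivialization_def)
  have k2: "\<exists>y. w = k (y, t)" if "t \<in> ?I" "w \<in> W" "tau w = t" for w t using k that by (auto simp: trivialization_def)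
  have k3: "rho (k (y, t)) < rho (k (y', t)) \<longleftrightarrow> y < y'" if "t \<in> ?I" for y y' t
    using k that unfolding trivialization_def by (metis less_asym linorder_less_linear)
  have inK: "w \<in> ?K \<longleftrightarrow> tau w \<in> ?I" if wW: "w \<in> W" for w
  proof
    assume "tau w \<in> ?I"
    then obtain y where "w = k (y, tau w)" using k2[of "tau w" w] wW by blast
    then show "w \<in> ?K" using \<open>tau w \<in> ?I\<close> by blast
  qed (use k1 in auto)
  define A1 where "A1 = {a \<in> A. p a \<in> ?K}"
  have A1: "openin (top_of_set A) A1" "A1 \<subseteq> A"
    unfolding A1_def using openin_continuous_map_preimage[OF pq(1) open_embeddingD(4)[OF oe]] by auto
  have a0A: "a0 \<in> A1" using a0 inK W[OF a0(1)] d by (auto simp: A1_def t0_def)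
  have K: "p a \<in> ?K" "q a \<in> ?K" if "a \<in> A1" for a
    using that W[of a] inK[of "p a"] inK[of "q a"] by (auto simp: A1_def)
  have cp: "continuous_map (top_of_set A1) Z p" "continuous_map (top_of_set A1) Z q"
    using continuous_map_from_subtopology_mono[OF pq(1) A1(2)] continuous_map_from_subtopology_mono[OF pq(2) A1(2)] by auto
  let ?hp = "\<lambda>a. inv_into (UNIV \<times> ?I) k (p a)" and ?hq = "\<lambda>a. inv_into (UNIV \<times> ?I) k (q a)"
  have hp: "continuous_on A1 ?hp" "\<And>a. a \<in> A1 ==> ?hp a \<in> UNIV \<times> ?I" "\<And>a. a \<in> A1 ==> k (?hp a) = p a"
    using open_embedding_pull[OF oe cp(1) K(1)] by auto
  have hq: "continuous_on A1 ?hq" "\<And>a. a \<in> A1 ==> ?hq a \<in> UNIV \<times> ?I" "\<And>a. a \<in> A1 ==> k (?hq a) = q a"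
    using open_embedding_pull[OF oe cp(2) K(2)] by auto
  have iff: "rho (p a) < rho (q a) \<longleftrightarrow> fst (?hp a) < fst (?hq a)" if a: "a \<in> A1" for a
  proof -
    obtain y t where yt: "?hp a = (y, t)" "t \<in> ?I" using hp(2)[OF a] by blast
    obtain y' t' where yt': "?hq a = (y', t')" "t' \<in> ?I" using hq(2)[OF a] by blast
    have pa: "p a = k (y, t)" and qa: "q a = k (y', t')" using hp(3)[OF a] hq(3)[OF a] yt yt' by auto
    have "t = t'" using W[of a] a A1(2) k1[OF yt(2), of y] k1[OF yt'(2), of y'] unfolding pa qa by auto
    then show ?thesis using k3[OF yt(2), of y y'] yt(1) yt'(1) unfolding pa[symmetric] qa[symmetric]
      by (metis fst_conv pa qa)
  qed
  have "openin (top_of_set A1) {a \<in> A1. fst (?hq a) - fst (?hp a) \<in> {0<..}}"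
  proof -
    have "continuous_on A1 (\<lambda>a. fst (?hq a) - fst (?hp a))" using hp(1) hq(1) by (intro continuous_intros) auto
    from continuous_openin_preimage_gen[OF this open_greaterThan[of 0]] show ?thesis
      by (simp only: vimage_def Int_def mem_Collect_eq)
  qed
  then have "openin (top_of_set A) {a \<in> A1. fst (?hq a) - fst (?hp a) \<in> {0<..}}" using A1(1) openin_trans by blast
  moreover have "{a \<in> A1. fst (?hq a) - fst (?hp a) \<in> {0<..}} = {a \<in> A1. rho (p a) < rho (q a)}" using iff by auto
  ultimately show "\<exists>T. openin (top_of_set A) T \<and> a0 \<in> T \<and> T \<subseteq> {a \<in> A. rho (p a) < rho (q a)}"
    using a0 a0A A1(2) by (intro exI[of _ "{a \<in> A1. rho (p a) < rho (q a)}"]) auto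
qed

text \<open>Both strict orders are open conditions, and as the two points never coincide they
  exhaust the connected set \<open>A\<close>.\<close>

lemma order_const:
  fixes A :: "'b::metric_space set"
  assumes A: "connected A" and pq: "continuous_map (top_of_set A) Z p" "continuous_map (top_of_set A) Z q"
    and W: "\<And>a. a \<in> A ==> p a \<in> W \<and> q a \<in> W \<and> tau (p a) = tau (q a) \<and> p a \<noteq> q a"
    and a: "a \<in> A" "rho (p a) < rho (q a)" and b: "b \<in> A"
  shows "rho (p b) < rho (q b)"
proof (rule ccontr)
  assume "\<not> ?thesis"
  then have "rho (q b) < rho (p b)" using rho_inj[of "p b" "q b"] W[OF b] by (auto simp: not_less order_le_less)
  then have ne: "{a \<in> A. rho (p a) < rho (q a)} \<noteq> {}" "{a \<in> A. rho (q a) < rho (p a)} \<noteq> {}"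
    "{a \<in> A. rho (p a) < rho (q a)} \<inter> {a \<in> A. rho (q a) < rho (p a)} = {}" using a b by auto
  have "openin (top_of_set A) {a \<in> A. rho (p a) < rho (q a)}" using order_open[OF pq] W by blast
  moreover have "openin (top_of_set A) {a \<in> A. rho (q a) < rho (p a)}" using order_open[OF pq(2,1)] W by auto
  moreover have "A \<subseteq> {a \<in> A. rho (p a) < rho (q a)} \<union> {a \<in> A. rho (q a) < rho (p a)}"
  proof
    fix a assume a: "a \<in> A"
    then have "rho (p a) \<noteq> rho (q a)" using rho_inj[of "p a" "q a"] W[OF a] by blast
    then show "a \<in> {a \<in> A. rho (p a) < rho (q a)} \<union> {a \<in> A. rho (q a) < rho (p a)}" using a by auto
  qed
  ultimately show False using A ne unfolding connected_openin by blast
qed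

end

section \<open>Boxes at the ends of a piece\<close>

context ribboned_surface
begin

lemma lindelof_cover:
  assumes S: "S \<subseteq> topspace Z" and N: "\<And>z. z \<in> S ==> openin Z (N z) \<and> z \<in> N z"
  obtains D where "countable D" "D \<subseteq> S" "S \<subseteq> \<Union>(N ` D)"
proof -
  have L: "Lindelof_space (subtopology Z S)"
    using sc second_countable_subtopology second_countable_imp_Lindelof_space by blast
  let ?U = "(\<lambda>z. N z \<inter> S) ` S"
  have "\<forall>U\<in>?U. openin (subtopology Z S) U" using N openin_subtopology_Int by blast
  moreover have "topspace (subtopology Z S) \<subseteq> \<Union>?U" using N by auto
  ultimately obtain \<V> where V: "countable \<V>" "\<V> \<subseteq> ?U" "topspace (subtopology Z S) \<subseteq> \<Union>\<V>"
    using L unfolding Lindelof_space_alt by meson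
  then obtain D where D: "countable D" "D \<subseteq> S" "\<V> = (\<lambda>z. N z \<inter> S) ` D"
    using countable_subset_image by metis
  have "S \<subseteq> \<Union>(N ` D)" using V(3) S unfolding D(3) by auto
  then show ?thesis using that D by blast
qed

definition cut_chart :: "(real \<times> real => 'a) => real set => bool" where
  "cut_chart C J \<longleftrightarrow> fchart Z \<Delta> C J \<and> (J = OI \<or> J = {0..<1}) \<and> lf (C (0, 0)) \<in> Sp \<and>
     (\<forall>x\<in>OI. \<forall>t\<in>J. t \<noteq> 0 --> C (x, t) \<notin> \<Union>Sp)"

text \<open>The sign selects the chart heights \<open>s * u\<close> with \<open>u > 0\<close>; a
  half disc at the boundary has no side \<open>-1\<close>.\<close>

definition chart_side :: "real set => real => bool" where
  "chart_side J s \<longleftrightarrow> s = 1 \<or> (s = -1 \<and> J = OI)"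

lemma cut_chart_exists:
  assumes "z \<in> \<Union>Sp"
  obtains C J where "cut_chart C J" "C (0, 0) = z" "z \<in> Bd \<longleftrightarrow> J = {0..<1}"
proof -
  have z: "z \<in> topspace Z" "lf z \<in> Sp" using assms Sp_leaves leaf_sub lf_eq by blast+
  have OIne: "OI \<noteq> {0..<1}"
  proof
    assume "OI = {0..<1}"
    moreover have "(-1/2 :: real) \<in> OI" by simp
    ultimately have "(-1/2 :: real) \<in> {0..<1}" by blast
    then show False by simp
  qed
  obtain C J where "(z \<notin> Bd \<and> J = OI) \<or> (z \<in> Bd \<and> J = {0..<1})" "fchart Z \<Delta> C J" "C (0, 0) = z"
    "\<And>x t. x \<in> OI ==> t \<in> J ==> t \<noteq> 0 ==> C (x, t) \<notin> \<Union>Sp"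
    using isolated_chart[OF Sp_lf Sp_leaves z(1) openin_topspace z(1)] by metis
  then show ?thesis using that[of C J] z OIne unfolding cut_chart_def by blast
qed

lemma cut_chart_dest:
  assumes "cut_chart C J"
  shows "fchart Z \<Delta> C J" "J = OI \<or> J = {0..<1}" "0 \<in> J" "open_embedding Z (OI \<times> J) C" "J \<subseteq> OI"
    "\<And>x t. x \<in> OI ==> t \<in> J ==> C (x, t) \<in> topspace Z"
    "\<And>x t. x \<in> OI ==> t \<in> J ==> C (x, t) \<in> \<Union>Sp \<longleftrightarrow> t = 0"
proof -
  show C: "fchart Z \<Delta> C J" and J: "J = OI \<or> J = {0..<1}" using assms by (auto simp: cut_chart_def)
  then show J0: "0 \<in> J" and "J \<subseteq> OI" by auto
  show "open_embedding Z (OI \<times> J) C" using C by (simp add: fchart_def)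
  show top: "C (x, t) \<in> topspace Z" if "x \<in> OI" "t \<in> J" for x t by (rule fchart_dest(5)[OF C that])
  show "C (x, t) \<in> \<Union>Sp \<longleftrightarrow> t = 0" if xt: "x \<in> OI" "t \<in> J" for x t
  proof
    assume "C (x, t) \<in> \<Union>Sp"
    then show "t = 0" using assms xt unfolding cut_chart_def by blast
  next
    assume t: "t = 0"
    have "lf (C (x, 0)) = lf (C (0, 0))" by (rule fchart_dest(4)[OF C xt(1) J0])
    then have "lf (C (x, t)) \<in> Sp" using assms t by (simp add: cut_chart_def)
    then show "C (x, t) \<in> \<Union>Sp" using lf_in(2)[OF top[OF xt]] by blast
  qed
qed

lemma chart_side_mult: "chart_side J s ==> J = OI \<or> J = {0..<1} ==> u \<in> {0..<1} ==> s * u \<in> J"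
proof -
  assume *: "chart_side J s" "J = OI \<or> J = {0..<1}" "u \<in> {0..<1}"
  show ?thesis
  proof (cases "s = 1")
    case True
    then have "s * u \<in> {0..<1}" "{0..<1} \<subseteq> OI" using *(3) by auto
    then show ?thesis using *(2) by blast
  next
    case False
    then have "s = -1" "J = OI" using *(1) unfolding chart_side_def by blast+
    then show ?thesis using *(3) by auto
  qed
qed

lemma cut_chart_half:
  assumes C: "cut_chart C J" and m: "chart_side J m"
  shows "half_chart (\<lambda>p. C (fst p, m * snd p))"
proof -
  have iso: "C (x, t) \<notin> \<Union>Sp" if "x \<in> OI" "t \<in> J" "t \<noteq> 0" for x t
    using C that unfolding cut_chart_def by blast
  have l: "lf (C (0, 0)) \<in> Sp" using C by (simp add: cut_chart_def)
  show ?thesis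
  proof (cases "m = 1")
    case True
    then show ?thesis using half_chart_upper[OF cut_chart_dest(1,2)[OF C] l iso] by simp
  next
    case False
    then have s: "m = -1" "J = OI" using m by (auto simp: chart_side_def)
    have "half_chart (\<lambda>p. C (fst p, - snd p))"
    proof (rule half_chart_upper)
      show "fchart Z \<Delta> (\<lambda>p. C (fst p, - snd p)) OI" using fchart_reflect cut_chart_dest(1)[OF C] s by auto
      show "lf (C (fst (0, 0), - snd (0, 0))) \<in> Sp" using l by simp
      show "C (fst (x, t), - snd (x, t)) \<notin> \<Union>Sp" if "x \<in> OI" "t \<in> OI" "t \<noteq> 0" for x t
        using iso[OF that(1), of "-t"] that s by auto
    qed simp
    then show ?thesis using s by simp
  qed
qed

end

locale cut_component = cut_strip +
  assumes comp: "ribsat c \<in> connected_components_of (subtopology Z (topspace Z - \<Union>Sp))"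
begin

lemma W_max:
  assumes "connectedin Z S" "S \<inter> \<Union>Sp = {}" "S \<inter> W \<noteq> {}"
  shows "S \<subseteq> W"
proof -
  have "S \<subseteq> topspace Z" using assms(1) connectedin_subset_topspace by blast
  then have "connectedin (subtopology Z (topspace Z - \<Union>Sp)) S"
    using assms by (auto simp: connectedin_subtopology)
  then show ?thesis
    using connected_components_of_maximal[OF comp] assms(3) unfolding W_def disjnt_def by blast
qed

text \<open>Relatively open in the closed unit interval, so that an interval around 0 or 1 includes
  that end.\<close>

definition Iv :: "real => real => real set" where "Iv t0 d = {t \<in> {0..1}. \<bar>t - t0\<bar> < d}"

text \<open>A cut leaf has no leaf parameter of its own, so a box reaching it is tied to a chart
  \<open>C\<close> on the side \<open>s\<close>: \<open>e\<close> adapts the orientation of rows,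
  and \<open>d\<close> translates leaf parameters into chart heights, with height 0 for the cut
  leaf.\<close>

definition end_form :: "(real \<times> real => 'a) => real => real => (real \<times> real => 'a) => real set => real => real => (real => real) => bool" where
  "end_form B t0 \<delta> C J s e d \<longleftrightarrow> cut_chart C J \<and> chart_side J s \<and> (e = 1 \<or> e = -1) \<and>
     (\<forall>t\<in>Iv t0 \<delta>. 0 \<le> d t \<and> d t < 1 \<and> (d t = 0 \<longleftrightarrow> t = t0)) \<and>
     (\<forall>x\<in>OI. \<forall>t\<in>Iv t0 \<delta>. B (x, t) = C (e * x, s * d t))"

text \<open>The local charts of the future strip: the height is the leaf parameter, the first
  coordinate follows the order of \<open>rho\<close>, and a box centred at 0 or 1 reaches onto a cut
  leaf. The bounds on \<open>\<delta>\<close> keep a box from touching any end other than its own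
  centre.\<close>

definition box :: "(real \<times> real => 'a) => real => real => bool" where
  "box B t0 \<delta> \<longleftrightarrow> 0 < \<delta> \<and> \<delta> \<le> 1 \<and> t0 \<in> {0..1} \<and> (t0 = 0 \<or> t0 = 1 \<or> (\<delta> \<le> t0 \<and> t0 + \<delta> \<le> 1)) \<and>
     continuous_map (top_of_set (OI \<times> Iv t0 \<delta>)) Z B \<and>
     (\<forall>x\<in>OI. \<forall>t\<in>Iv t0 \<delta> \<inter> UI. B (x, t) \<in> W \<and> tau (B (x, t)) = t) \<and>
     (\<forall>t\<in>Iv t0 \<delta> \<inter> UI. \<forall>x\<in>OI. \<forall>x'\<in>OI. x < x' --> rho (B (x, t)) < rho (B (x', t))) \<and>
     (t0 \<notin> UI --> (\<exists>C J s e d. end_form B t0 \<delta> C J s e d))"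

lemma box_dest:
  assumes "box B t0 \<delta>"
  shows "0 < \<delta>" "\<delta> \<le> 1" "t0 \<in> {0..1}" "t0 = 0 \<or> t0 = 1 \<or> (\<delta> \<le> t0 \<and> t0 + \<delta> \<le> 1)"
    "continuous_map (top_of_set (OI \<times> Iv t0 \<delta>)) Z B"
    "\<And>x t. x \<in> OI ==> t \<in> Iv t0 \<delta> ==> t \<in> UI ==> B (x, t) \<in> W"
    "\<And>x t. x \<in> OI ==> t \<in> Iv t0 \<delta> ==> t \<in> UI ==> tau (B (x, t)) = t"
    "\<And>x x' t. x \<in> OI ==> x' \<in> OI ==> t \<in> Iv t0 \<delta> ==> t \<in> UI ==> x < x' ==> rho (B (x, t)) < rho (B (x', t))"
    "\<And>x t. x \<in> OI ==> t \<in> Iv t0 \<delta> ==> B (x, t) \<in> topspace Z"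
    "t0 \<notin> UI ==> \<exists>C J s e d. end_form B t0 \<delta> C J s e d"
proof -
  show "0 < \<delta>" "\<delta> \<le> 1" "t0 \<in> {0..1}" "t0 = 0 \<or> t0 = 1 \<or> (\<delta> \<le> t0 \<and> t0 + \<delta> \<le> 1)"
    and ct: "continuous_map (top_of_set (OI \<times> Iv t0 \<delta>)) Z B"
    and "\<And>x t. x \<in> OI ==> t \<in> Iv t0 \<delta> ==> t \<in> UI ==> B (x, t) \<in> W"
    "\<And>x t. x \<in> OI ==> t \<in> Iv t0 \<delta> ==> t \<in> UI ==> tau (B (x, t)) = t"
    "\<And>x x' t. x \<in> OI ==> x' \<in> OI ==> t \<in> Iv t0 \<delta> ==> t \<in> UI ==> x < x' ==> rho (B (x, t)) < rho (B (x', t))"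
    "t0 \<notin> UI ==> \<exists>C J s e d. end_form B t0 \<delta> C J s e d"
    using assms unfolding box_def by blast+
  show "B (x, t) \<in> topspace Z" if "x \<in> OI" "t \<in> Iv t0 \<delta>" for x t
    using continuous_map_image_subset_topspace[OF ct] that by auto
qed

lemma box_end:
  assumes "box B t0 d" "t \<in> Iv t0 d" "t \<notin> UI"
  shows "t = t0" "t0 \<notin> UI"
  using box_dest(1-4)[OF assms(1)] assms(2,3) unfolding Iv_def by auto

lemma Iv_UI: "Iv t0 d \<inter> UI = UI \<inter> {t0 - d<..<t0 + d}"
  by (auto simp: Iv_def)

lemma Iv_open: "openin (top_of_set {0..1}) (Iv t0 d)"
proof -
  have "Iv t0 d = {0..1} \<inter> {t0 - d<..<t0 + d}" by (auto simp: Iv_def)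
  then show ?thesis by (simp add: openin_open_Int)
qed

lemma box_inj:
  assumes B: "box B t0 d" and "x \<in> OI" "x' \<in> OI" "t \<in> Iv t0 d" "t \<in> UI" "B (x, t) = B (x', t)"
  shows "x = x'"
proof (rule ccontr)
  assume "x \<noteq> x'"
  then show False using box_dest(8)[OF B assms(2,3,4,5)] box_dest(8)[OF B assms(3,2,4,5)] assms(6) by fastforce
qed

lemma box_open_embedding:
  assumes B: "box B t0 d"
  shows "open_embedding Z (OI \<times> (Iv t0 d \<inter> UI)) B"
proof (rule regular_open_embedding)
  show "open (OI \<times> (Iv t0 d \<inter> UI))" unfolding Iv_UI by (auto intro!: open_Times)
  show "continuous_map (top_of_set (OI \<times> (Iv t0 d \<inter> UI))) Z B"
    by (rule continuous_map_from_subtopology_mono[OF box_dest(5)[OF B]]) auto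
  show "inj_on B (OI \<times> (Iv t0 d \<inter> UI))"
  proof (rule inj_onI, clarify)
    fix x t x' t' assume a: "x \<in> OI" "x' \<in> OI" "t \<in> Iv t0 d" "t \<in> UI" "t' \<in> Iv t0 d" "t' \<in> UI" and eq: "B (x, t) = B (x', t')"
    have tt: "t = t'" using box_dest(7)[OF B a(1,3,4)] box_dest(7)[OF B a(2,5,6)] eq by simp
    then show "x = x' \<and> t = t'" using box_inj[OF B a(1-4)] eq by blast
  qed
  show "lf (B b) \<notin> Sp" if "b \<in> OI \<times> (Iv t0 d \<inter> UI)" for b
    using W_lf box_dest(6)[OF B] that by auto
qed

lemma trivialization_box:
  assumes t0: "t0 \<in> UI" and tr: "trivialization t0 \<delta> k"
  shows "box (\<lambda>q. k (y + fst q, snd q)) t0 \<delta>"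
proof -
  let ?I = "{t0 - \<delta><..<t0 + \<delta>}"
  have tr1: "0 < \<delta>" "?I \<subseteq> UI" "open_embedding Z (UNIV \<times> ?I) k"
    "\<And>t y. t \<in> ?I ==> k (y, t) \<in> W" "\<And>t y. t \<in> ?I ==> tau (k (y, t)) = t"
    "\<And>t y y'. t \<in> ?I ==> y < y' ==> rho (k (y, t)) < rho (k (y', t))"
    using tr unfolding trivialization_def by blast+
  have d: "\<delta> \<le> t0" "t0 + \<delta> \<le> 1"
  proof -
    show "\<delta> \<le> t0"
    proof (rule ccontr)
      assume "\<not> \<delta> \<le> t0"
      then have "0 \<in> ?I" using t0 tr1(1) by auto
      then have "0 \<in> UI" using tr1(2) by blast
      then show False by simp
    qed
    show "t0 + \<delta> \<le> 1"
    proof (rule ccontr)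
      assume "\<not> t0 + \<delta> \<le> 1"
      then have "1 \<in> ?I" using t0 tr1(1) by auto
      then have "1 \<in> UI" using tr1(2) by blast
      then show False by simp
    qed
  qed
  have Iv: "Iv t0 \<delta> = ?I" using d by (auto simp: Iv_def)
  let ?B = "\<lambda>q. k (y + fst q, snd q)"
  show ?thesis
    unfolding box_def Iv
  proof (intro conjI ballI impI)
    show "0 < \<delta>" "\<delta> \<le> 1" "t0 \<in> {0..1}" "t0 = 0 \<or> t0 = 1 \<or> \<delta> \<le> t0 \<and> t0 + \<delta> \<le> 1" using tr1(1) d t0 by auto
    have "continuous_map (top_of_set (OI \<times> ?I)) (top_of_set (UNIV \<times> ?I)) (\<lambda>q. (y + fst q, snd q))"
      by (auto simp: continuous_map_in_subtopology intro!: continuous_intros)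
    from continuous_map_compose[OF this open_embeddingD(1)[OF tr1(3)]]
    show "continuous_map (top_of_set (OI \<times> ?I)) Z ?B" by (simp add: comp_def)
    show "\<exists>C J s e d. end_form ?B t0 \<delta> C J s e d" if "t0 \<notin> UI" using that t0 by blast
  qed (use tr1 in auto)
qed

lemma interior_box_exists:
  assumes p: "p \<in> W"
  obtains B d where "box B (tau p) d" "B (0, tau p) = p"
proof -
  have t0: "tau p \<in> UI" using tau[OF p] by simp
  obtain d k where tr: "trivialization (tau p) d k" using trivialization_exists[OF t0] by blast
  have "tau p \<in> {tau p - d<..<tau p + d}" using tr unfolding trivialization_def by simp
  then obtain y where y: "p = k (y, tau p)" using tr p unfolding trivialization_def by blast
  show ?thesis using that[OF trivialization_box[OF t0 tr, of y]] y by simp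
qed

text \<open>Towards a cut leaf the leaf parameter runs to an end of the unit interval, because regular leaves are
  separated from all other leaves.\<close>
lemma side_no_interior_limit:
  assumes D: "half_chart D" and DW: "\<And>u. u \<in> UI ==> D (0, u) \<in> W" and l: "l \<in> UI"
  shows "\<not> (\<forall>r>0. \<exists>u0\<in>UI. \<forall>u\<in>UI. u \<le> u0 --> \<bar>tau (D (0, u)) - l\<bar> < r)"
proof
  assume lim: "\<forall>r>0. \<exists>u0\<in>UI. \<forall>u\<in>UI. u \<le> u0 --> \<bar>tau (D (0, u)) - l\<bar> < r"
  have z: "c (0, l) \<in> topspace Z" "lf (c (0, l)) \<notin> Sp" using c_top[OF l] rib_dest(4)[OF rib l] by auto
  have D0: "D (0, 0) \<in> topspace Z" using half_chart_dest(6)[OF D, of 0 0] by simp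
  have "lf (D (0, 0)) \<noteq> lf (c (0, l))" using half_chart_dest(5)[OF D] z(2) by metis
  then obtain P K where PK: "openin Z P" "closedin Z K" "P \<subseteq> K" "c (0, l) \<in> P" "D (0, 0) \<notin> K" "saturated \<Delta> P"
    using leaf_separation[OF z D0] by metis
  have "continuous_map (top_of_set UI) Z (\<lambda>t. c (0, t))" by (rule c_line) simp
  then obtain r where r: "r > 0" "\<And>s. s \<in> UI ==> dist s l < r ==> c (0, s) \<in> P"
    using continuous_map_nbhd[OF _ l PK(1)] PK(4) by blast
  obtain r' where r': "r' > 0" "\<And>u. u \<in> {0..<1} ==> dist u 0 < r' ==> D (0, u) \<in> topspace Z - K"
    using continuous_map_nbhd[OF half_chart_line[OF D], of 0 "topspace Z - K"] PK D0 by auto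
  obtain u0 where u0: "u0 \<in> UI" "\<And>u. u \<in> UI ==> u \<le> u0 ==> \<bar>tau (D (0, u)) - l\<bar> < r" using lim r(1) by blast
  define u where "u = min u0 (r'/2)"
  have u: "u \<in> UI" "u \<le> u0" "dist u 0 < r'" using u0(1) r'(1) by (auto simp: u_def min_def)
  have "c (0, tau (D (0, u))) \<in> P" using r(2) u0(2)[OF u(1,2)] tau(1)[OF DW[OF u(1)]] by (simp add: dist_real_def)
  moreover have "c (0, tau (D (0, u))) \<in> topspace Z" "D (0, u) \<in> topspace Z"
    using c_top[OF tau(1)[OF DW[OF u(1)]]] DW[OF u(1)] W_sub by auto
  ultimately have "D (0, u) \<in> P" using saturatedD[OF PK(6)] tau(2)[OF DW[OF u(1)]] by blast
  moreover have "D (0, u) \<in> topspace Z - K" using r'(2) u by auto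
  ultimately show False using PK(3) by blast
qed

text \<open>Along a half chart inside \<open>W\<close> the leaf parameter is strictly monotone in
  the chart height by \<open>half_chart_inj\<close>, and it runs to 0 or 1. Hence chart height can
  be exchanged for leaf parameter up to and including the cut leaf.\<close>

lemma end_box_exists:
  assumes C: "cut_chart C J" "chart_side J n" and CW: "\<And>u. u \<in> UI ==> C (0, n * u) \<in> W"
  obtains B t0 \<delta> \<epsilon> d h where "box B t0 \<delta>" "t0 \<notin> UI" "end_form B t0 \<delta> C J n \<epsilon> d"
    "continuous_on {0..<1/2} h" "\<And>u. u \<in> {0..<1/2} ==> h u \<in> Iv t0 \<delta> \<and> d (h u) = u"
    "\<And>t. t \<in> Iv t0 \<delta> ==> d t \<in> {0..<1/2} \<and> h (d t) = t" "h 0 = t0" "continuous_on (Iv t0 \<delta>) d"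
proof -
  define D where "D = (\<lambda>p. C (fst p, n * snd p))"
  have D: "half_chart D" unfolding D_def by (rule cut_chart_half[OF C])
  have DW0: "D (0, u) \<in> W" if "u \<in> UI" for u using CW[OF that] by (simp add: D_def)
  have lfD: "lf (D (x, u)) = lf (D (0, u))" if "x \<in> OI" "u \<in> UI" for x u by (rule half_chart_dest(3)[OF D that])
  have DW: "D (x, u) \<in> W" "tau (D (x, u)) = tau (D (0, u))" if "x \<in> OI" "u \<in> UI" for x u
  proof -
    have t: "D (x, u) \<in> topspace Z" using half_chart_dest(6)[OF D that(1), of u] that(2) by simp
    have "D (0, u) \<in> topspace Z" using DW0[OF that(2)] W_sub by blast
    then show w: "D (x, u) \<in> W" using saturatedD[OF W_sat DW0[OF that(2)] _ t lfD[OF that]] by blast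
    show "tau (D (x, u)) = tau (D (0, u))" using tau_eq_iff[OF w DW0[OF that(2)]] lfD[OF that] by blast
  qed
  define th where "th u = tau (D (0, u))" for u
  have thU: "th u \<in> UI" if "u \<in> UI" for u unfolding th_def using tau(1)[OF DW0[OF that]] .
  have cth: "continuous_on UI th"
  proof -
    have "continuous_map (top_of_set UI) Z (\<lambda>u. D (0, u))"
      by (rule continuous_map_from_subtopology_mono[OF half_chart_line[OF D]]) auto
    then have "continuous_map (top_of_set UI) (subtopology Z W) (\<lambda>u. D (0, u))"
      unfolding continuous_map_in_subtopology using DW0 by auto
    from continuous_map_compose[OF this tau_cont] show ?thesis by (simp add: comp_def th_def[abs_def])
  qed
  have "inj_on th UI"
  proof (rule inj_onI)
    fix a b assume ab: "a \<in> UI" "b \<in> UI" "th a = th b"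
    then have "lf (D (0, a)) = lf (D (0, b))" using tau_eq_iff[OF DW0[OF ab(1)] DW0[OF ab(2)]] by (simp add: th_def)
    then show "a = b" using inj_onD[OF half_chart_inj[OF D]] ab by blast
  qed
  then have mono: "(\<forall>x\<in>UI. \<forall>y\<in>UI. x < y --> th x < th y) \<or> (\<forall>x\<in>UI. \<forall>y\<in>UI. x < y --> th y < th x)"
    using continuous_inj_strict_monotone[OF _ cth] by (simp add: is_interval_oo)
  \<comment> \<open>The leaf parameter runs to 0 if it increases with the chart height and to 1
    otherwise. The function \<open>e\<close> measures its distance from that end, with value 0 on
    the cut leaf.\<close>
  define t0 where "t0 = (if \<forall>x\<in>UI. \<forall>y\<in>UI. x < y --> th x < th y then 0 else 1::real)"
  have t0: "t0 = 0 \<or> t0 = 1" by (simp add: t0_def)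
  define e where "e u = (if u = 0 then 0 else \<bar>th u - t0\<bar>)" for u
  have eU: "e u \<in> UI" if "u \<in> UI" for u using thU[OF that] that t0 by (auto simp: e_def)
  have emonoU: "e x < e y" if "x \<in> UI" "y \<in> UI" "x < y" for x y
  proof (cases "\<forall>x\<in>UI. \<forall>y\<in>UI. x < y --> th x < th y")
    case True
    then have "t0 = 0" by (simp add: t0_def)
    then show ?thesis using True that thU[OF that(1)] thU[OF that(2)] by (auto simp: e_def)
  next
    case False
    then have 1: "t0 = 1" by (simp only: t0_def if_False)
    have "th y < th x" using mono False that by blast
    then show ?thesis using 1 that thU[OF that(1)] thU[OF that(2)] by (auto simp: e_def)
  qed
  have emono: "e x < e y" if "x \<in> {0..<1}" "y \<in> {0..<1}" "x < y" for x y
  proof (cases "x = 0")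
    case True
    then show ?thesis using eU[of y] that by (auto simp: e_def)
  next
    case False
    then show ?thesis using emonoU that by auto
  qed
  \<comment> \<open>A positive infimum \<open>m\<close> of the distances would make the leaf
    parameter converge to an interior value, which \<open>side_no_interior_limit\<close> excludes.
    The factor \<open>1 - 2 * t0\<close> is 1 at the end 0 and \<open>-1\<close> at the end 1, so it
    points inwards at either end.\<close>
  have esmall: "\<exists>u\<in>UI. e u < r" if r: "r > 0" for r
  proof (rule ccontr)
    assume "\<not> (\<exists>u\<in>UI. e u < r)"
    then have ge: "r \<le> e u" if "u \<in> UI" for u using that by (simp add: not_less)
    define m where "m = Inf (e ` UI)"
    have bdd: "bdd_below (e ` UI)" using ge by (meson bdd_below.I2)
    have "(1/2::real) \<in> UI" by simp
    then have UIne: "UI \<noteq> {}" by blast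
    have m1: "r \<le> m" unfolding m_def using UIne ge by (intro cInf_greatest) auto
    have m2: "m \<le> e u" if "u \<in> UI" for u unfolding m_def using bdd that by (intro cInf_lower) auto
    have "m < 1" using m2[of "1/2"] eU[of "1/2"] by auto
    define l where "l = t0 + (1 - 2 * t0) * m"
    have l: "l \<in> UI" using \<open>m < 1\<close> m1 r t0 by (auto simp: l_def)
    have the: "th u = t0 + (1 - 2 * t0) * e u" if "u \<in> UI" for u
      using thU[OF that] that t0 by (auto simp: e_def)
    have "\<forall>s>0. \<exists>u0\<in>UI. \<forall>u\<in>UI. u \<le> u0 --> \<bar>tau (D (0, u)) - l\<bar> < s"
    proof (intro allI impI)
      fix s :: real assume s: "s > 0"
      have "\<exists>x\<in>e ` UI. x < m + s" using UIne s cInf_lessD[of "e ` UI" "m + s"] by (auto simp: m_def)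
      then obtain u0 where u0: "u0 \<in> UI" "e u0 < m + s" by blast
      show "\<exists>u0\<in>UI. \<forall>u\<in>UI. u \<le> u0 --> \<bar>tau (D (0, u)) - l\<bar> < s"
      proof (intro bexI[of _ u0] ballI impI u0(1))
        fix u assume u: "u \<in> UI" "u \<le> u0"
        have "e u \<le> e u0" using emonoU[OF u(1) u0(1)] u(2) by (cases "u = u0") auto
        then have "\<bar>e u - m\<bar> < s" using m2[OF u(1)] u0(2) by linarith
        moreover have "\<bar>th u - l\<bar> = \<bar>e u - m\<bar>" using the[OF u(1)] t0 by (auto simp: l_def)
        ultimately show "\<bar>tau (D (0, u)) - l\<bar> < s" by (simp add: th_def)
      qed
    qed
    then show False using side_no_interior_limit[OF D DW0 l] by blast
  qed
  have ce: "continuous_on {0..1/2} e"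
    unfolding continuous_on_iff dist_real_def
  proof (intro ballI allI impI)
    fix x r :: real assume x: "x \<in> {0..1/2}" and r: "r > 0"
    show "\<exists>d>0. \<forall>x'\<in>{0..1/2}. \<bar>x' - x\<bar> < d --> \<bar>e x' - e x\<bar> < r"
    proof (cases "x = 0")
      case True
      obtain u where u: "u \<in> UI" "e u < r" using esmall[OF r] by blast
      show ?thesis
      proof (intro exI[of _ u] conjI ballI impI)
        fix x' assume x': "x' \<in> {0..1/2::real}" "\<bar>x' - x\<bar> < u"
        have "e x' < e u" using emono[of x' u] x' u True by auto
        moreover have "0 \<le> e x'" by (simp add: e_def)
        ultimately show "\<bar>e x' - e x\<bar> < r" using u(2) True by (simp add: e_def)
      qed (use u in auto)
    next
      case False
      then have xU: "x \<in> UI" using x by auto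
      have "continuous_on UI (\<lambda>u. \<bar>th u - t0\<bar>)" using cth by (intro continuous_intros)
      then obtain d where d: "d > 0" "\<And>x'. x' \<in> UI ==> \<bar>x' - x\<bar> < d ==> \<bar>\<bar>th x' - t0\<bar> - \<bar>th x - t0\<bar>\<bar> < r"
        using xU r unfolding continuous_on_iff dist_real_def by metis
      show ?thesis
      proof (intro exI[of _ "min d x"] conjI ballI impI)
        fix x' assume x': "x' \<in> {0..1/2}" "\<bar>x' - x\<bar> < min d x"
        then have "x' \<in> UI" "\<bar>x' - x\<bar> < d" using x by auto
        then show "\<bar>e x' - e x\<bar> < r" using d(2)[of x'] xU by (simp add: e_def)
      qed (use d xU in auto)
    qed
  qed
  define \<delta> where "\<delta> = e (1/2)"
  have \<delta>: "0 < \<delta>" "\<delta> < 1" using eU[of "1/2"] by (auto simp: \<delta>_def)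
  have einj: "inj_on e {0..1/2}"
  proof (rule inj_onI)
    fix a b assume ab: "a \<in> {0..1/2::real}" "b \<in> {0..1/2}" "e a = e b"
    then show "a = b" using emono[of a b] emono[of b a] by (cases a b rule: linorder_cases) auto
  qed
  have e0: "e 0 = 0" by (simp add: e_def)
  have eimg: "e ` {0..1/2} = {0..\<delta>}"
  proof (intro equalityI subsetI)
    fix y assume "y \<in> e ` {0..1/2}"
    then obtain u where u: "y = e u" "u \<in> {0..1/2}" by blast
    have "e u \<le> \<delta>"
    proof (cases "u < 1/2")
      case True
      then show ?thesis using emono[of u "1/2"] u by (auto simp: \<delta>_def)
    next
      case False
      then have "u = 1/2" using u by auto
      then show ?thesis unfolding \<delta>_def by (metis order_refl)
    qed
    moreover have "0 \<le> e u" by (simp add: e_def)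
    ultimately show "y \<in> {0..\<delta>}" using u by simp
  next
    fix y assume "y \<in> {0..\<delta>}"
    then obtain u where "0 \<le> u" "u \<le> 1/2" "e u = y" using IVT'[of e 0 y "1/2"] ce e0 by (auto simp: \<delta>_def)
    then show "y \<in> e ` {0..1/2}" by force
  qed
  \<comment> \<open>The closed range up to \<open>1/2\<close> is used because a continuous injection
    of a compact set has a continuous inverse. This is the origin of the range
    \<open>u < 1/2\<close> of all lifts of chart sides to a strip.\<close>
  define E where "E = inv_into {0..1/2} e"
  have E1: "E (e u) = u" if "u \<in> {0..1/2}" for u unfolding E_def using einj that by simp
  have E2: "E y \<in> {0..1/2}" "e (E y) = y" if "y \<in> {0..\<delta>}" for y
    unfolding E_def using that eimg by (metis inv_into_into, metis f_inv_into_f)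
  have cE: "continuous_on {0..\<delta>} E"
    using continuous_on_inv[OF ce compact_Icc, of E] E1 eimg by simp
  define d where "d t = E \<bar>t - t0\<bar>" for t
  define h where "h u = t0 + (1 - 2 * t0) * e u" for u
  have cd: "continuous_on (Iv t0 \<delta>) d"
    unfolding d_def by (intro continuous_on_compose2[OF cE] continuous_intros) (auto simp: Iv_def)
  have dt: "d t \<in> {0..<1/2}" "e (d t) = \<bar>t - t0\<bar>" "h (d t) = t" if "t \<in> Iv t0 \<delta>" for t
  proof -
    have t: "\<bar>t - t0\<bar> \<in> {0..\<delta>}" "\<bar>t - t0\<bar> < \<delta>" "t \<in> {0..1}" using that by (auto simp: Iv_def)
    show 1: "e (d t) = \<bar>t - t0\<bar>" unfolding d_def by (rule E2(2)[OF t(1)])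
    have "d t \<in> {0..1/2}" unfolding d_def by (rule E2(1)[OF t(1)])
    moreover have "d t \<noteq> 1/2" using 1 t(2) unfolding \<delta>_def by (metis less_irrefl)
    ultimately show "d t \<in> {0..<1/2}" by auto
    show "h (d t) = t" unfolding h_def 1 using t0 t(3) by auto
  qed
  have hu: "h u \<in> Iv t0 \<delta>" "d (h u) = u" if "u \<in> {0..<1/2}" for u
  proof -
    have "0 \<le> e u" "e u < \<delta>" using emono[of u "1/2"] that by (auto simp: \<delta>_def e_def)
    moreover have "\<bar>h u - t0\<bar> = e u" using t0 \<open>0 \<le> e u\<close> by (auto simp: h_def)
    ultimately show "h u \<in> Iv t0 \<delta>" "d (h u) = u"
      using t0 \<delta> E1[of u] that by (auto simp: Iv_def d_def h_def)
  qed
  have ch: "continuous_on {0..<1/2} h"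
    unfolding h_def by (intro continuous_intros continuous_on_subset[OF ce]) auto
  have h0: "h 0 = t0" by (simp add: h_def e0)
  have dzero: "d t = 0 \<longleftrightarrow> t = t0" if "t \<in> Iv t0 \<delta>" for t
    using dt(3)[OF that] h0 dt(2)[OF that] E1[of 0] e0 by (auto simp: d_def)
  have thd: "th (d t) = t" "d t \<in> UI" if t: "t \<in> Iv t0 \<delta>" "t \<in> UI" for t
  proof -
    have "t \<noteq> t0" using t(2) t0 by auto
    then show dU: "d t \<in> UI" using dt(1)[OF t(1)] dzero[OF t(1)] by auto
    have "th (d t) = t0 + (1 - 2 * t0) * e (d t)" using thU[OF dU] dU t0 by (auto simp: e_def)
    then show "th (d t) = t" using dt(3)[OF t(1)] by (simp add: h_def)
  qed
  have cD: "continuous_map (top_of_set (OI \<times> UI)) Z D"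
    by (rule continuous_map_from_subtopology_mono[OF half_chart_dest(1)[OF D]]) auto
  have Dv: "continuous_map (top_of_set UI) Z (\<lambda>u. D (x, u))" if "x \<in> OI" for x
  proof -
    have "continuous_map (top_of_set UI) (top_of_set (OI \<times> UI)) (\<lambda>u. (x, u))"
      using that by (auto simp: continuous_map_in_subtopology intro!: continuous_intros)
    from continuous_map_compose[OF this cD] show ?thesis by (simp add: comp_def)
  qed
  have Dinj: "x = x' \<and> u = u'" if "D (x, u) = D (x', u')" "x \<in> OI" "x' \<in> OI" "u \<in> UI" "u' \<in> UI" for x x' u u'
    using inj_onD[OF open_embeddingD(2)[OF half_chart_dest(2)[OF D]] that(1)] that by auto
  \<comment> \<open>Whether chart rows run with or against \<open>rho\<close> does not depend on the
    height, by \<open>order_const\<close>; it is therefore tested at height \<open>1/2\<close>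
    only.\<close>
  define \<epsilon> where "\<epsilon> = (if rho (D (0, 1/2)) < rho (D (1/2, 1/2)) then 1 else -1::real)"
  have \<epsilon>: "\<epsilon> = 1 \<or> \<epsilon> = -1" by (simp add: \<epsilon>_def)
  have eOI: "\<epsilon> * x \<in> OI" if "x \<in> OI" for x using that \<epsilon> by auto
  have half: "(1/2::real) \<in> UI" "(0::real) \<in> OI" "(1/2::real) \<in> OI" "(-1/2::real) \<in> OI" by auto
  have Dne: "D (0, u) \<noteq> D (1/2, u)" if "u \<in> UI" for u using Dinj[of 0 u "1/2" u] that half by auto
  have tau12: "tau (D (1/2, u)) = tau (D (0, u))" "D (1/2, u) \<in> W" if "u \<in> UI" for u using DW[OF half(3) that] by auto
  have sgn: "\<exists>a\<in>OI. \<exists>b\<in>OI. a < b \<and> rho (D (\<epsilon> * a, u)) < rho (D (\<epsilon> * b, u))" if u: "u \<in> UI" for u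
  proof (cases "rho (D (0, 1/2)) < rho (D (1/2, 1/2))")
    case True
    have "rho (D (0, u)) < rho (D (1/2, u))"
      by (rule order_const[OF _ Dv[OF half(2)] Dv[OF half(3)] _ half(1) True u]) (use DW0 tau12 Dne in auto)
    then show ?thesis using True half by (intro bexI[of _ 0] bexI[of _ "1/2"]) (auto simp: \<epsilon>_def)
  next
    case False
    have "rho (D (0, 1/2)) \<noteq> rho (D (1/2, 1/2))"
      using rho_inj[OF DW0[OF half(1)] tau12(2)[OF half(1)] tau12(1)[OF half(1), symmetric]] Dne[OF half(1)] by blast
    then have lt: "rho (D (1/2, 1/2)) < rho (D (0, 1/2))" using False by auto
    have "rho (D (1/2, u)) < rho (D (0, u))"
      by (rule order_const[OF _ Dv[OF half(3)] Dv[OF half(2)] _ half(1) lt u]) (use DW0 tau12 Dne in fastforce)+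
    then show ?thesis using False half by (intro bexI[of _ 0] bexI[of _ "-1/2"]) (auto simp: \<epsilon>_def)
  qed
  have rmono: "rho (D (\<epsilon> * x, u)) < rho (D (\<epsilon> * x', u))" if u: "u \<in> UI" and x: "x \<in> OI" "x' \<in> OI" "x < x'" for u x x'
  proof -
    obtain a b where ab: "a \<in> OI" "b \<in> OI" "a < b" "rho (D (\<epsilon> * a, u)) < rho (D (\<epsilon> * b, u))" using sgn[OF u] by blast
    show ?thesis
    proof (rule rho_path_monotone[of OI "\<lambda>x. D (\<epsilon> * x, u)" "th u" a b x x', OF _ _ _ _ thU[OF u] ab x])
      have "continuous_map (top_of_set OI) (top_of_set (OI \<times> UI)) (\<lambda>x. (\<epsilon> * x, u))"
        using u eOI by (auto simp: continuous_map_in_subtopology intro!: continuous_intros)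
      from continuous_map_compose[OF this cD] show "continuous_map (top_of_set OI) Z (\<lambda>x. D (\<epsilon> * x, u))" by (simp add: comp_def)
      show "inj_on (\<lambda>x. D (\<epsilon> * x, u)) OI"
      proof (rule inj_onI)
        fix x y assume xy: "x \<in> OI" "y \<in> OI" "D (\<epsilon> * x, u) = D (\<epsilon> * y, u)"
        then have "\<epsilon> * x = \<epsilon> * y" using Dinj[OF xy(3) eOI[OF xy(1)] eOI[OF xy(2)] u u] by blast
        then show "x = y" using \<epsilon> by auto
      qed
      show "is_interval OI" by (simp add: is_interval_oo)
      show "D (\<epsilon> * x, u) \<in> W \<and> tau (D (\<epsilon> * x, u)) = th u" if "x \<in> OI" for x
        using DW[OF eOI[OF that] u] by (simp add: th_def)
    qed
  qed
  define B where "B q = C (\<epsilon> * fst q, n * d (snd q))" for q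
  have BD: "B (x, t) = D (\<epsilon> * x, d t)" for x t by (simp add: B_def D_def)
  have "end_form B t0 \<delta> C J n \<epsilon> d"
    unfolding end_form_def
  proof (intro conjI ballI)
    show "d t < 1" if "t \<in> Iv t0 \<delta>" for t using dt(1)[OF that] by simp
    show "0 \<le> d t" if "t \<in> Iv t0 \<delta>" for t using dt(1)[OF that] by simp
  qed (use C \<epsilon> dzero in \<open>auto simp: B_def\<close>)
  moreover have "box B t0 \<delta>"
    unfolding box_def
  proof (intro conjI ballI impI)
    have "continuous_map (top_of_set (OI \<times> Iv t0 \<delta>)) (top_of_set (OI \<times> {0..<1})) (\<lambda>q. (\<epsilon> * fst q, d (snd q)))"
      using eOI dt(1) unfolding continuous_map_in_subtopology
      by (force intro!: continuous_intros continuous_on_compose2[OF cd])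
    from continuous_map_compose[OF this half_chart_dest(1)[OF D]]
    show "continuous_map (top_of_set (OI \<times> Iv t0 \<delta>)) Z B" by (simp add: comp_def D_def B_def[abs_def])
    fix t assume t: "t \<in> Iv t0 \<delta> \<inter> UI"
    show "B (x, t) \<in> W" "tau (B (x, t)) = t" if "x \<in> OI" for x
      unfolding BD using DW[OF eOI[OF that], of "d t"] thd[of t] t by (auto simp: th_def)
    show "rho (B (x, t)) < rho (B (x', t))" if "x \<in> OI" "x' \<in> OI" "x < x'" for x x'
      unfolding BD using rmono thd(2)[of t] t that by blast
  next
    show "\<exists>C J n \<epsilon> d. end_form B t0 \<delta> C J n \<epsilon> d" using \<open>end_form B t0 \<delta> C J n \<epsilon> d\<close> by blast
  qed (use \<delta> t0 in auto)
  moreover have "t0 \<notin> UI" using t0 by auto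
  ultimately show ?thesis using that[of B t0 \<delta> \<epsilon> d h] ch hu dt h0 cd by blast
qed

end

section \<open>Coordinate changes between boxes\<close>

context cut_component
begin

definition nbd :: "real => real => real => real => real => (real \<times> real) set" where
  "nbd x0 t r t0 d = {q \<in> OI \<times> Iv t0 d. \<bar>fst q - x0\<bar> < r \<and> \<bar>snd q - t\<bar> < r}"

text \<open>Near \<open>(x0, t)\<close> the box \<open>B\<close> is read in \<open>B'\<close> by a
  map preserving leaf parameters, of which \<open>\<xi>\<close> is the first component. Continuity
  of \<open>\<xi>\<close> is required at the end heights too.\<close>

definition trans :: "(real \<times> real => 'a) => real => real => (real \<times> real => 'a) => real => real => real => real => real => bool" where
  "trans B t0 d B' t0' d' x0 t x' \<longleftrightarrow> (\<exists>r>0. \<exists>\<xi>. continuous_on (nbd x0 t r t0 d) \<xi> \<and> \<xi> (x0, t) = x' \<and>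
     (\<forall>q\<in>nbd x0 t r t0 d. \<xi> q \<in> OI \<and> snd q \<in> Iv t0' d' \<and> B q = B' (\<xi> q, snd q)))"

text \<open>Only the inner part \<open>[-1/2, 1/2]\<close> of \<open>B'\<close> counts, since the
  density of a box will be concentrated there. The ends are exempt: on a cut leaf two boxes may
  share points although they approach it from opposite sides.\<close>

definition apart :: "(real \<times> real => 'a) => real => real => (real \<times> real => 'a) => real => real => real => real => bool" where
  "apart B t0 d B' t0' d' x0 t \<longleftrightarrow> (\<exists>r>0. \<forall>q\<in>nbd x0 t r t0 d. snd q \<in> UI --> snd q \<in> Iv t0' d' -->
     (\<forall>x'\<in>{-1/2..1/2}. B q \<noteq> B' (x', snd q)))"

lemma nbd_sub: "nbd x0 t r t0 d \<subseteq> OI \<times> Iv t0 d" by (auto simp: nbd_def)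

lemma nbd_mono: "r \<le> r' ==> nbd x0 t r t0 d \<subseteq> nbd x0 t r' t0 d" by (auto simp: nbd_def)

lemma nbd_center: "x0 \<in> OI ==> t \<in> Iv t0 d ==> r > 0 ==> (x0, t) \<in> nbd x0 t r t0 d" by (auto simp: nbd_def)

lemma box_nbd:
  assumes B: "box B t0 d" and x0: "x0 \<in> OI" "t \<in> Iv t0 d" and N: "openin Z N" "B (x0, t) \<in> N"
  obtains r where "r > 0" "\<And>q. q \<in> nbd x0 t r t0 d ==> B q \<in> N"
proof -
  obtain r where r: "r > 0" "\<And>x s. (x, s) \<in> OI \<times> Iv t0 d ==> \<bar>x - x0\<bar> < r ==> \<bar>s - t\<bar> < r ==> B (x, s) \<in> N"
    using continuous_map_nbhd2[OF box_dest(5)[OF B], of x0 t N] x0 N by auto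
  show ?thesis
  proof (rule that[OF r(1)])
    fix q assume q: "q \<in> nbd x0 t r t0 d"
    obtain x s where xs: "q = (x, s)" by fastforce
    show "B q \<in> N" using r(2)[of x s] q unfolding xs nbd_def by auto
  qed
qed

lemma nbd_continuous: "box B t0 d ==> continuous_map (top_of_set (nbd x0 t r t0 d)) Z B"
  using continuous_map_from_subtopology_mono[OF box_dest(5) nbd_sub] by blast

lemma box_end_Sp:
  assumes B: "box B t0 \<delta>" and x: "x \<in> OI" and t: "t \<in> Iv t0 \<delta>" "t \<notin> UI"
  shows "B (x, t) \<in> \<Union>Sp"
proof -
  have tt: "t = t0" "t0 \<notin> UI" using box_end[OF B t] by auto
  obtain C J s \<epsilon> d where e: "end_form B t0 \<delta> C J s \<epsilon> d" using box_dest(10)[OF B tt(2)] by blast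
  have C: "cut_chart C J" using e unfolding end_form_def by blast
  have "d t = 0" "B (x, t) = C (\<epsilon> * x, s * d t)" using e t x tt unfolding end_form_def by blast+
  moreover have "\<epsilon> * x \<in> OI" using e x unfolding end_form_def by auto
  ultimately show ?thesis using cut_chart_dest(7)[OF C, of "\<epsilon> * x" 0] cut_chart_dest(3)[OF C] by simp
qed

text \<open>Both heights are the leaf parameter, so passing through the open embedding
  \<open>B'\<close> can change the first coordinate only.\<close>

lemma trans_interior:
  assumes B: "box B t0 d" and B': "box B' t0' d'" and x0: "x0 \<in> OI" and t: "t \<in> Iv t0 d" "t \<in> Iv t0' d'" "t \<in> UI"
    and x': "x' \<in> OI" "B (x0, t) = B' (x', t)"
  shows "trans B t0 d B' t0' d' x0 t x'"
proof -
  let ?A = "OI \<times> (Iv t0' d' \<inter> UI)"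
  have oe: "open_embedding Z ?A B'" by (rule box_open_embedding[OF B'])
  have "B (x0, t) \<in> B' ` ?A" unfolding x'(2) using x' t by (intro imageI) simp
  then obtain r0 where r0: "r0 > 0" "\<And>q. q \<in> nbd x0 t r0 t0 d ==> B q \<in> B' ` ?A"
    using box_nbd[OF B x0 t(1) open_embeddingD(4)[OF oe]] by blast
  define r where "r = min r0 (min t (1 - t))"
  have r: "r > 0" "r \<le> r0" "r \<le> t" "r \<le> 1 - t" using r0(1) t(3) by (auto simp: r_def)
  let ?N = "nbd x0 t r t0 d"
  have inr: "B q \<in> B' ` ?A" if "q \<in> ?N" for q using r0(2) nbd_mono[OF r(2)] that by blast
  let ?h = "\<lambda>q. inv_into ?A B' (B q)"
  have h: "continuous_on ?N ?h" "\<And>q. q \<in> ?N ==> ?h q \<in> ?A" "\<And>q. q \<in> ?N ==> B' (?h q) = B q"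
    using open_embedding_pull[OF oe nbd_continuous[OF B] inr] by auto
  have key: "fst (?h q) \<in> OI \<and> snd q \<in> Iv t0' d' \<and> B q = B' (fst (?h q), snd q)" if q: "q \<in> ?N" for q
  proof -
    obtain x u where xu: "?h q = (x, u)" "x \<in> OI" "u \<in> Iv t0' d'" "u \<in> UI" using h(2)[OF q] by blast
    obtain y s where ys: "q = (y, s)" by fastforce
    have s: "y \<in> OI" "s \<in> Iv t0 d" "s \<in> UI" using q r unfolding ys nbd_def by auto
    have "tau (B q) = s" using box_dest(7)[OF B s] ys by simp
    moreover have "tau (B q) = u" using h(3)[OF q] box_dest(7)[OF B' xu(2-4)] xu(1) by simp
    ultimately have "u = s" by simp
    then show ?thesis using xu h(3)[OF q] ys by simp
  qed
  have "(x0, t) \<in> ?N" by (rule nbd_center[OF x0 t(1) r(1)])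
  then have k0: "fst (?h (x0, t)) \<in> OI" "B (x0, t) = B' (fst (?h (x0, t)), t)" using key by auto
  then have "fst (?h (x0, t)) = x'" using box_inj[OF B' k0(1) x'(1) t(2,3)] x'(2) by simp
  moreover have "continuous_on ?N (\<lambda>q. fst (?h q))" using h(1) by (intro continuous_intros)
  ultimately show ?thesis unfolding trans_def using r(1) key by (intro exI[of _ r] conjI exI[of _ "\<lambda>q. fst (?h q)"]) auto
qed

text \<open>Over a short closed interval of heights the inner part of \<open>B'\<close> is compact,
  hence closed in the Hausdorff space \<open>Z\<close>, and a neighbourhood of
  \<open>B (x0, t)\<close> avoids it.\<close>

lemma apart_none:
  assumes B: "box B t0 d" and B': "box B' t0' d'" and x0: "x0 \<in> OI" and t: "t \<in> Iv t0 d" "t \<in> Iv t0' d'"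
    and none: "\<And>x'. x' \<in> {-1/2..1/2} ==> B (x0, t) \<noteq> B' (x', t)"
  shows "apart B t0 d B' t0' d' x0 t"
proof -
  \<comment> \<open>Small enough for the closed interval to stay in the height range of
    \<open>B'\<close> and, if \<open>t\<close> is interior, away from 0 and 1. The value 1 is a
    placeholder for the case that \<open>t\<close> is an end.\<close>
  define n where "n = min ((d' - \<bar>t - t0'\<bar>) / 2) (if t \<in> UI then min t (1 - t) / 2 else 1)"
  have tt: "\<bar>t - t0'\<bar> < d'" "t \<in> {0..1}" using t by (auto simp: Iv_def)
  have n: "n > 0" "n \<le> (d' - \<bar>t - t0'\<bar>) / 2"
  proof -
    show "n > 0" using tt by (auto simp: n_def)
    show "n \<le> (d' - \<bar>t - t0'\<bar>) / 2" unfolding n_def by (rule min.cobounded1)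
  qed
  have nU: "n \<le> t / 2" "n \<le> (1 - t) / 2" if "t \<in> UI"
  proof -
    have a: "n \<le> min t (1 - t) / 2" unfolding n_def if_P[OF that] by (rule min.cobounded2)
    have b: "min t (1 - t) \<le> t" "min t (1 - t) \<le> 1 - t" by auto
    show "n \<le> t / 2" by (rule order_trans[OF a divide_right_mono[OF b(1)]]) simp
    show "n \<le> (1 - t) / 2" by (rule order_trans[OF a divide_right_mono[OF b(2)]]) simp
  qed
  let ?I = "{0..1} \<inter> {t - n..t + n}"
  have II: "?I \<subseteq> Iv t0' d'"
  proof
    fix s assume s: "s \<in> ?I"
    then have "\<bar>s - t\<bar> \<le> n" by auto
    moreover have "2 * n \<le> d' - \<bar>t - t0'\<bar>" using n(2) by (simp add: field_simps)
    moreover have "\<bar>s - t0'\<bar> \<le> \<bar>s - t\<bar> + \<bar>t - t0'\<bar>" by simp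
    ultimately have "\<bar>s - t0'\<bar> < d'" using n(1) by argo
    then show "s \<in> Iv t0' d'" using s by (auto simp: Iv_def)
  qed
  have "compactin (top_of_set (OI \<times> Iv t0' d')) ({-1/2..1/2} \<times> ?I)"
    unfolding compactin_subtopology using II by (auto intro!: compact_Times compact_Int)
  then have "compactin Z (B' ` ({-1/2..1/2} \<times> ?I))" using image_compactin box_dest(5)[OF B'] by blast
  then have cl: "closedin Z (B' ` ({-1/2..1/2} \<times> ?I))" using haus compactin_imp_closedin by blast
  have "B (x0, t) \<notin> B' ` ({-1/2..1/2} \<times> ?I)"
  proof
    assume "B (x0, t) \<in> B' ` ({-1/2..1/2} \<times> ?I)"
    then obtain x' s where xs: "x' \<in> {-1/2..1/2}" "s \<in> ?I" "B (x0, t) = B' (x', s)" by blast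
    have sI: "s \<in> Iv t0' d'" using II xs(2) by blast
    have x'O: "x' \<in> OI" using xs(1) by auto
    have "s = t"
    proof (cases "t \<in> UI")
      case True
      then have sU: "s \<in> UI" using xs(2) nU n(1) by auto
      show ?thesis using box_dest(7)[OF B x0 t(1) True] box_dest(7)[OF B' x'O sI sU] xs(3) by simp
    next
      case False
      have "B' (x', s) \<in> \<Union>Sp" using box_end_Sp[OF B x0 t(1) False] xs(3) by simp
      then have "s \<notin> UI" using box_dest(6)[OF B' x'O sI] W_not_Sp by blast
      then show ?thesis using box_end(1)[OF B' sI] box_end(1)[OF B' t(2) False] by simp
    qed
    then show False using none xs by blast
  qed
  moreover have "B (x0, t) \<in> topspace Z" by (rule box_dest(9)[OF B x0 t(1)])
  ultimately obtain r0 where r0: "r0 > 0" "\<And>q. q \<in> nbd x0 t r0 t0 d ==> B q \<in> topspace Z - B' ` ({-1/2..1/2} \<times> ?I)"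
    using box_nbd[OF B x0 t(1), of "topspace Z - B' ` ({-1/2..1/2} \<times> ?I)"] cl by blast
  have "B q \<noteq> B' (x', snd q)" if q: "q \<in> nbd x0 t (min r0 n) t0 d" "x' \<in> {-1/2..1/2}" for q x'
  proof -
    have "snd q \<in> ?I" using q(1) by (auto simp: nbd_def Iv_def)
    then have "B' (x', snd q) \<in> B' ` ({-1/2..1/2} \<times> ?I)" using q(2) by blast
    moreover have "B q \<notin> B' ` ({-1/2..1/2} \<times> ?I)" using r0(2) subsetD[OF nbd_mono[OF min.cobounded1] q(1)] by blast
    ultimately show ?thesis by metis
  qed
  then show ?thesis unfolding apart_def using r0(1) n(1) by (intro exI[of _ "min r0 n"]) auto
qed

text \<open>\<open>H\<close> reads the box near its end in the chart \<open>C\<close>, and the sign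
  \<open>s\<close> records on which side of the cut leaf the regular leaves of the box lie.\<close>

definition end_trans :: "(real \<times> real => 'a) => real => real => real => (real \<times> real => 'a) => real set => real => real => real => (real \<times> real => real \<times> real) => bool" where
  "end_trans B t0 d x0 C J s x1 r H \<longleftrightarrow> r > 0 \<and> chart_side J s \<and> continuous_on (nbd x0 t0 r t0 d) H \<and> H (x0, t0) = (x1, 0) \<and>
     (\<forall>q\<in>nbd x0 t0 r t0 d. H q \<in> OI \<times> J \<and> B q = C (H q) \<and> (snd q \<noteq> t0 --> 0 < s * snd (H q)) \<and> (snd q = t0 --> snd (H q) = 0))"

lemma end_nbd_UI:
  assumes B: "box B t0 d" "t0 \<notin> UI" and s: "s \<in> Iv t0 d" "s \<noteq> t0"
  shows "s \<in> UI"
  using box_end[OF B(1) s(1)] s(2) by blast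

text \<open>The nearby part of the box off the cut leaf is connected and misses \<open>Sp\<close>,
  so in the chart it stays on one side. That whole side lies in \<open>W\<close>, being connected,
  disjoint from \<open>Sp\<close> and in contact with \<open>W\<close>.\<close>

lemma end_transition:
  assumes B: "box B t0 d" "t0 \<notin> UI" and x0: "x0 \<in> OI" and C: "cut_chart C J" and x1: "x1 \<in> OI" "B (x0, t0) = C (x1, 0)"
  obtains s r H where "end_trans B t0 d x0 C J s x1 r H" "\<And>x u. x \<in> OI ==> u \<in> UI ==> C (x, s * u) \<in> W"
proof -
  let ?A = "OI \<times> J"
  have oe: "open_embedding Z ?A C" by (rule cut_chart_dest(4)[OF C])
  have t0: "t0 \<in> Iv t0 d" "t0 = 0 \<or> t0 = 1" using box_dest(1,3,4)[OF B(1)] B(2) by (auto simp: Iv_def)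
  have "B (x0, t0) \<in> C ` ?A" unfolding x1(2) using x1 cut_chart_dest(3)[OF C] by (intro imageI) simp
  then obtain r where r: "r > 0" "\<And>q. q \<in> nbd x0 t0 r t0 d ==> B q \<in> C ` ?A"
    using box_nbd[OF B(1) x0 t0(1) open_embeddingD(4)[OF oe]] by blast
  let ?N = "nbd x0 t0 r t0 d"
  define H where "H q = inv_into ?A C (B q)" for q
  have H: "continuous_on ?N H" "\<And>q. q \<in> ?N ==> H q \<in> ?A" "\<And>q. q \<in> ?N ==> C (H q) = B q"
    unfolding H_def using open_embedding_pull[OF oe nbd_continuous[OF B(1)] r(2)] by auto
  have HSp: "B q \<in> \<Union>Sp \<longleftrightarrow> snd (H q) = 0" if q: "q \<in> ?N" for q
    using cut_chart_dest(7)[OF C, of "fst (H q)" "snd (H q)"] H(2)[OF q] H(3)[OF q] by (simp add: mem_Times_iff)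
  have "inv_into ?A C (C (x1, 0)) = (x1, 0)"
    using x1 cut_chart_dest(3)[OF C] by (intro inv_into_f_f open_embeddingD(2)[OF oe]) simp
  then have Hc: "H (x0, t0) = (x1, 0)" unfolding H_def x1(2) .
  have Hend: "snd (H q) = 0" if q: "q \<in> ?N" "snd q = t0" for q
  proof -
    have "B (fst q, t0) \<in> \<Union>Sp" using box_end_Sp[OF B(1) _ t0(1) B(2), of "fst q"] q by (auto simp: nbd_def)
    then show ?thesis using HSp[OF q(1)] q(2) by (metis prod.collapse)
  qed
  define N' where "N' = ({x0 - r<..<x0 + r} \<inter> OI) \<times> (UI \<inter> {t0 - min r d<..<t0 + min r d})"
  have N'N: "N' \<subseteq> ?N" by (auto simp: N'_def nbd_def Iv_def)
  have NN': "q \<in> N'" if q: "q \<in> ?N" "snd q \<noteq> t0" for q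
  proof -
    have "snd q \<in> UI" using end_nbd_UI[OF B, of "snd q"] q by (auto simp: nbd_def)
    then show ?thesis using q(1) by (auto simp: N'_def nbd_def Iv_def mem_Times_iff)
  qed
  have N'W: "B q \<in> W" if q: "q \<in> N'" for q
  proof -
    have "fst q \<in> OI" "snd q \<in> Iv t0 d" "snd q \<in> UI" using q by (auto simp: N'_def Iv_def)
    then show ?thesis using box_dest(6)[OF B(1), of "fst q" "snd q"] by simp
  qed
  have ne: "snd (H q) \<noteq> 0" if "q \<in> N'" for q
    using N'W[OF that] W_not_Sp HSp[of q] N'N that by blast
  \<comment> \<open>A sample point just inside the end; the factor \<open>1 - 2 * t0\<close> points
    inwards. Its chart height decides the sign for all of \<open>N'\<close>.\<close>
  define q0 where "q0 = (x0, t0 + (1 - 2 * t0) * (min (min r d) 1 / 2))"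
  have q0: "q0 \<in> N'" using r(1) box_dest(1,2)[OF B(1)] t0(2) x0 by (auto simp: q0_def N'_def)
  have conN': "connected N'"
    unfolding N'_def by (intro convex_connected convex_Times convex_Int) auto
  have cH: "continuous_on N' (\<lambda>q. snd (H q))" using continuous_on_subset[OF H(1) N'N] by (intro continuous_intros)
  define s where "s = sgn (snd (H q0))"
  have s: "s = 1 \<or> s = -1" "s * snd (H q0) > 0" "s * s = 1" using ne[OF q0] by (auto simp: s_def sgn_if)
  have pos: "0 < s * snd (H q)" if q: "q \<in> N'" for q
  proof (rule ccontr)
    assume "\<not> 0 < s * snd (H q)"
    then have "s * snd (H q) \<le> 0" by simp
    moreover have "connected ((\<lambda>q. s * snd (H q)) ` N')"
      by (rule connected_continuous_image[OF continuous_on_mult[OF continuous_on_const cH] conN'])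
    ultimately have "0 \<in> (\<lambda>q. s * snd (H q)) ` N'"
      using connectedD_interval[of "(\<lambda>q. s * snd (H q)) ` N'" "s * snd (H q)" "s * snd (H q0)" 0] s(2) q q0 by auto
    then obtain q' where "q' \<in> N'" "s * snd (H q') = 0" by force
    then show False using ne s(1) by auto
  qed
  have side: "chart_side J s"
  proof (cases "s = 1")
    case False
    then have "snd (H q0) < 0" using s by auto
    moreover have "snd (H q0) \<in> J" using H(2)[of q0] q0 N'N by (auto simp: mem_Times_iff)
    ultimately have "J \<noteq> {0..<1}" by auto
    then show ?thesis using False s(1) cut_chart_dest(2)[OF C] by (auto simp: chart_side_def)
  qed (simp add: chart_side_def)
  have et: "end_trans B t0 d x0 C J s x1 r H"
    unfolding end_trans_def using r(1) side H Hc Hend pos NN' by auto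
  have CW: "C (x, s * u) \<in> W" if xu: "x \<in> OI" "u \<in> UI" for x u
  proof -
    let ?S = "(\<lambda>p. C (fst p, s * snd p)) ` (OI \<times> UI)"
    have hc: "half_chart (\<lambda>p. C (fst p, s * snd p))" by (rule cut_chart_half[OF C side])
    have "connectedin Z ?S"
    proof (rule connectedin_continuous_map_image[OF half_chart_dest(1)[OF hc]])
      have "OI \<times> UI \<subseteq> OI \<times> {0..<1}" by auto
      moreover have "connected (OI \<times> UI)" by (intro convex_connected convex_Times) auto
      ultimately show "connectedin (top_of_set (OI \<times> {0..<1})) (OI \<times> UI)" by (simp add: connectedin_subtopology)
    qed
    moreover have "?S \<inter> \<Union>Sp = {}"
    proof -
      have "C (x, s * u) \<notin> \<Union>Sp" if "x \<in> OI" "u \<in> UI" for x u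
      proof -
        have "s * u \<in> J" using chart_side_mult[OF side cut_chart_dest(2)[OF C], of u] that(2) by auto
        moreover have "s * u \<noteq> 0" using that(2) s(1) by auto
        ultimately show ?thesis using cut_chart_dest(7)[OF C that(1)] by blast
      qed
      then show ?thesis by auto
    qed
    moreover have "?S \<inter> W \<noteq> {}"
    proof -
      have h: "H q0 \<in> OI \<times> J" "C (H q0) = B q0" using H(2,3)[of q0] q0 N'N by auto
      define u where "u = s * snd (H q0)"
      have "s * u = snd (H q0)" unfolding u_def using s(3) by (metis mult.assoc mult_1)
      moreover have "u \<in> UI" using pos[OF q0] h(1) cut_chart_dest(5)[OF C] s(1) by (auto simp: u_def mem_Times_iff subset_iff)
      ultimately have "B q0 \<in> ?S" using h by (intro image_eqI[of _ _ "(fst (H q0), u)"]) (auto simp: mem_Times_iff)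
      then show ?thesis using N'W[OF q0] by blast
    qed
    ultimately have "?S \<subseteq> W" by (rule W_max)
    then show ?thesis using xu by force
  qed
  show ?thesis by (rule that[OF et CW])
qed

text \<open>On one side of a chart, leaves determine heights by \<open>half_chart_inj\<close>. Hence
  the chart heights computed through \<open>B\<close> and through \<open>B'\<close> agree, and only
  the flip \<open>\<epsilon>\<close> of the rows remains.\<close>

lemma trans_end:
  assumes B: "box B t0 \<delta>" "t0 \<notin> UI" and B': "box B' t0 \<delta>'" and x0: "x0 \<in> OI"
    and e: "end_form B' t0 \<delta>' C J m \<epsilon> d" and et: "end_trans B t0 \<delta> x0 C J m x1 r H"
  shows "trans B t0 \<delta> B' t0 \<delta>' x0 t0 (\<epsilon> * x1)"
proof -
  have C: "cut_chart C J" and side: "chart_side J m" and \<epsilon>: "\<epsilon> = 1 \<or> \<epsilon> = -1"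
    and d: "\<And>t. t \<in> Iv t0 \<delta>' ==> 0 \<le> d t \<and> d t < 1 \<and> (d t = 0 \<longleftrightarrow> t = t0)"
    and B'C: "\<And>x t. x \<in> OI ==> t \<in> Iv t0 \<delta>' ==> B' (x, t) = C (\<epsilon> * x, m * d t)"
    using e unfolding end_form_def by blast+
  have r: "r > 0" and cH: "continuous_on (nbd x0 t0 r t0 \<delta>) H" and Hc: "H (x0, t0) = (x1, 0)"
    and H: "\<And>q. q \<in> nbd x0 t0 r t0 \<delta> ==> H q \<in> OI \<times> J \<and> B q = C (H q) \<and> (snd q \<noteq> t0 --> 0 < m * snd (H q)) \<and> (snd q = t0 --> snd (H q) = 0)"
    using et unfolding end_trans_def by blast+
  have m: "m = 1 \<or> m = -1" "m * m = 1" using side by (auto simp: chart_side_def)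
  have ee: "\<epsilon> * (\<epsilon> * x) = x" for x using \<epsilon> by auto
  have ss: "m * (m * x) = x" for x using m(1) by auto
  have eO: "\<epsilon> * x \<in> OI" if "x \<in> OI" for x using \<epsilon> that by auto
  define r2 where "r2 = min r \<delta>'"
  have r2: "r2 > 0" using r box_dest(1)[OF B'] by (simp add: r2_def)
  let ?N = "nbd x0 t0 r2 t0 \<delta>"
  have NN: "?N \<subseteq> nbd x0 t0 r t0 \<delta>" by (rule nbd_mono) (simp add: r2_def)
  define D where "D = (\<lambda>p. C (fst p, m * snd p))"
  have D: "half_chart D" unfolding D_def by (rule cut_chart_half[OF C side])
  have key: "\<epsilon> * fst (H q) \<in> OI \<and> snd q \<in> Iv t0 \<delta>' \<and> B q = B' (\<epsilon> * fst (H q), snd q)" if q: "q \<in> ?N" for q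
  proof -
    note Hq = H[OF subsetD[OF NN q]]
    have X: "fst (H q) \<in> OI" "snd (H q) \<in> J" using Hq by (auto simp: mem_Times_iff)
    have s: "snd q \<in> Iv t0 \<delta>'" using q by (auto simp: nbd_def Iv_def r2_def)
    have B'q: "B' (\<epsilon> * fst (H q), snd q) = C (fst (H q), m * d (snd q))"
      using B'C[OF eO[OF X(1)] s] ee by simp
    have "B q = C (fst (H q), m * d (snd q))"
    proof (cases "snd q = t0")
      case True
      then have "d (snd q) = 0" "snd (H q) = 0" using d[OF s] Hq by auto
      then show ?thesis using Hq by (metis mult_zero_right prod.collapse)
    next
      case False
      define u where "u = m * snd (H q)"
      have uU: "u \<in> UI" using Hq False X(2) cut_chart_dest(5)[OF C] m(1) by (auto simp: u_def subset_iff)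
      have dU: "d (snd q) \<in> UI" using d[OF s] False by auto
      have sI: "snd q \<in> Iv t0 \<delta>" "fst q \<in> OI" using q by (auto simp: nbd_def)
      have sU: "snd q \<in> UI" by (rule end_nbd_UI[OF B sI(1) False])
      have Bq: "B q = D (fst (H q), u)"
      proof -
        have "m * u = snd (H q)" unfolding u_def by (rule ss)
        then show ?thesis using Hq by (simp add: D_def)
      qed
      have B'D: "B' (\<epsilon> * fst (H q), snd q) = D (fst (H q), d (snd q))" using B'q by (simp add: D_def)
      have W1: "B q \<in> W" "tau (B q) = snd q" using box_dest(6,7)[OF B(1) sI(2,1) sU] by auto
      have W2: "B' (\<epsilon> * fst (H q), snd q) \<in> W" "tau (B' (\<epsilon> * fst (H q), snd q)) = snd q"
        using box_dest(6,7)[OF B' eO[OF X(1)] s sU] by auto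
      have "lf (D (fst (H q), u)) = lf (D (fst (H q), d (snd q)))"
        using tau_eq_iff[OF W1(1) W2(1)] W1(2) W2(2) Bq B'D by simp
      then have "lf (D (0, u)) = lf (D (0, d (snd q)))"
        using half_chart_dest(3)[OF D X(1) uU] half_chart_dest(3)[OF D X(1) dU] by simp
      then have "u = d (snd q)" using inj_onD[OF half_chart_inj[OF D]] uU dU by blast
      then show ?thesis using Bq by (simp add: D_def)
    qed
    then show ?thesis using eO[OF X(1)] s B'q by simp
  qed
  have "continuous_on ?N (\<lambda>q. \<epsilon> * fst (H q))" using continuous_on_subset[OF cH NN] by (intro continuous_intros)
  then show ?thesis unfolding trans_def using r2 key Hc
    by (intro exI[of _ r2] conjI exI[of _ "\<lambda>q. \<epsilon> * fst (H q)"]) auto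
qed

text \<open>The two boxes share a point of a cut leaf. Approaching it from the same side they differ
  by a coordinate change; approaching it from opposite sides they have no common points at equal
  interior heights nearby.\<close>

lemma trans_or_apart_end:
  assumes B: "box B t0 \<delta>" "t0 \<notin> UI" and B': "box B' t0 \<delta>'" and x0: "x0 \<in> OI" and x': "x' \<in> OI" "B (x0, t0) = B' (x', t0)"
  shows "trans B t0 \<delta> B' t0 \<delta>' x0 t0 x' \<or> apart B t0 \<delta> B' t0 \<delta>' x0 t0"
proof -
  obtain C J s \<epsilon> d where e: "end_form B' t0 \<delta>' C J s \<epsilon> d" using box_dest(10)[OF B' B(2)] by blast
  have C: "cut_chart C J" and side: "chart_side J s" and \<epsilon>: "\<epsilon> = 1 \<or> \<epsilon> = -1"
    and d: "\<And>t. t \<in> Iv t0 \<delta>' ==> 0 \<le> d t \<and> d t < 1 \<and> (d t = 0 \<longleftrightarrow> t = t0)"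
    and B'C: "\<And>x t. x \<in> OI ==> t \<in> Iv t0 \<delta>' ==> B' (x, t) = C (\<epsilon> * x, s * d t)"
    using e unfolding end_form_def by blast+
  have t0: "t0 \<in> Iv t0 \<delta>'" using box_dest(1,3)[OF B'] by (auto simp: Iv_def)
  have eO: "\<epsilon> * x \<in> OI" if "x \<in> OI" for x using \<epsilon> that by auto
  have BC: "B (x0, t0) = C (\<epsilon> * x', 0)" using x' B'C[OF x'(1) t0] d[OF t0] by simp
  obtain s' r H where et: "end_trans B t0 \<delta> x0 C J s' (\<epsilon> * x') r H"
    by (rule end_transition[OF B x0 C eO[OF x'(1)] BC])
  show ?thesis
  proof (cases "s' = s")
    case True
    have "\<epsilon> * (\<epsilon> * x') = x'" using \<epsilon> by auto
    then show ?thesis using trans_end[OF B B' x0 e] et True by metis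
  next
    case False
    have side': "chart_side J s'" using et unfolding end_trans_def by blast
    then have ss: "s' * s = -1" using False side by (auto simp: chart_side_def)
    have "apart B t0 \<delta> B' t0 \<delta>' x0 t0"
      unfolding apart_def
    proof (intro exI[of _ r] conjI ballI impI)
      show "r > 0" using et unfolding end_trans_def by blast
      fix q x'' assume q: "q \<in> nbd x0 t0 r t0 \<delta>" "snd q \<in> UI" "snd q \<in> Iv t0 \<delta>'" and x'': "x'' \<in> {-1/2..1/2::real}"
      show "B q \<noteq> B' (x'', snd q)"
      proof
        assume eq: "B q = B' (x'', snd q)"
        have x''O: "x'' \<in> OI" using x'' by auto
        have st: "snd q \<noteq> t0" using q(2) B(2) by blast
        have H: "H q \<in> OI \<times> J" "B q = C (H q)" "0 < s' * snd (H q)" using et q(1) st unfolding end_trans_def by blast+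
        have "s * d (snd q) \<in> J" using chart_side_mult[OF side cut_chart_dest(2)[OF C], of "d (snd q)"] d[OF q(3)] by simp
        then have "H q = (\<epsilon> * x'', s * d (snd q))"
          using inj_onD[OF open_embeddingD(2)[OF cut_chart_dest(4)[OF C]], of "H q" "(\<epsilon> * x'', s * d (snd q))"]
            H(1,2) eq B'C[OF x''O q(3)] eO[OF x''O] by simp
        then have "s' * snd (H q) = (s' * s) * d (snd q)" by simp
        then show False using H(3) ss d[OF q(3)] by simp
      qed
    qed
    then show ?thesis by blast
  qed
qed

lemma trans_or_apart:
  assumes B: "box B t0 d" and B': "box B' t0' d'" and x0: "x0 \<in> OI" and t: "t \<in> Iv t0 d" "t \<in> Iv t0' d'"
  shows "(\<exists>x'. trans B t0 d B' t0' d' x0 t x') \<or> apart B t0 d B' t0' d' x0 t"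
proof (cases "\<exists>x'\<in>{-1/2..1/2}. B (x0, t) = B' (x', t)")
  case True
  then obtain x' where x': "x' \<in> {-1/2..1/2}" "B (x0, t) = B' (x', t)" by blast
  then have xO: "x' \<in> OI" by auto
  show ?thesis
  proof (cases "t \<in> UI")
    case True
    then show ?thesis using trans_interior[OF B B' x0 t True xO x'(2)] by blast
  next
    case False
    then have tt: "t = t0" "t0 \<notin> UI" "t0' = t0" using box_end[OF B t(1)] box_end[OF B' t(2)] by auto
    have "B (x0, t0) = B' (x', t0)" using x'(2) tt(1) by simp
    moreover have "box B' t0 d'" using B' tt(3) by simp
    ultimately have "trans B t0 d B' t0 d' x0 t0 x' \<or> apart B t0 d B' t0 d' x0 t0"
      using trans_or_apart_end[OF B tt(2) _ x0 xO] by blast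
    then show ?thesis unfolding tt(1) tt(3) by blast
  qed
next
  case False
  then show ?thesis using apart_none[OF B B' x0 t] by blast
qed

end

section \<open>A countable family of boxes whose inner halves cover the piece\<close>

context cut_component
begin

definition end_data :: "(real \<times> real => 'a) => real set => real => (real \<times> real => 'a) => real => real => real => (real => real) => (real => real) => bool" where
  "end_data C J s B t0 \<delta> e d h \<longleftrightarrow> box B t0 \<delta> \<and> t0 \<notin> UI \<and> end_form B t0 \<delta> C J s e d \<and>
    continuous_on {0..<1/2} h \<and> (\<forall>u\<in>{0..<1/2}. h u \<in> Iv t0 \<delta> \<and> d (h u) = u) \<and>
    (\<forall>t\<in>Iv t0 \<delta>. d t \<in> {0..<1/2} \<and> h (d t) = t) \<and> h 0 = t0 \<and> continuous_on (Iv t0 \<delta>) d"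

lemma end_data_exists:
  assumes "cut_chart C J" "chart_side J s" "\<And>x u. x \<in> OI ==> u \<in> UI ==> C (x, s * u) \<in> W"
  shows "\<exists>B t0 \<delta> e d h. end_data C J s B t0 \<delta> e d h"
proof -
  have CW: "C (0, s * u) \<in> W" if "u \<in> UI" for u using assms(3)[of 0 u] that by simp
  show ?thesis
  proof (rule end_box_exists[OF assms(1,2) CW])
    fix B t0 \<delta> e d h
    assume "box B t0 \<delta>" "t0 \<notin> UI" "end_form B t0 \<delta> C J s e d"
    "continuous_on {0..<1/2} h" "\<And>u. u \<in> {0..<1/2} ==> h u \<in> Iv t0 \<delta> \<and> d (h u) = u"
    "\<And>t. t \<in> Iv t0 \<delta> ==> d t \<in> {0..<1/2} \<and> h (d t) = t" "h 0 = t0" "continuous_on (Iv t0 \<delta>) d"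
    then have "end_data C J s B t0 \<delta> e d h" unfolding end_data_def by simp
    then show ?thesis by blast
  qed
qed

text \<open>Chart and side alone determine the end of the leaf parameter and, up to a coordinate
  change, the box there. Hence a single end box per chart and side can take part in a countable
  cover.\<close>

lemma end_cover:
  assumes B: "box B t0 \<delta>" "t0 \<notin> UI" and x0: "x0 \<in> OI" and C: "cut_chart C J" and x1: "x1 \<in> OI" "B (x0, t0) = C (x1, 0)"
  obtains m where "chart_side J m" "\<And>x u. x \<in> OI ==> u \<in> UI ==> C (x, m * u) \<in> W"
    "\<And>B' t0' \<delta>' e d h. end_data C J m B' t0' \<delta>' e d h ==> t0' = t0 \<and> trans B t0 \<delta> B' t0 \<delta>' x0 t0 (e * x1)"
proof -
  obtain m r H where et: "end_trans B t0 \<delta> x0 C J m x1 r H" and CW: "\<And>x u. x \<in> OI ==> u \<in> UI ==> C (x, m * u) \<in> W"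
    using end_transition[OF B x0 C x1] by metis
  have side: "chart_side J m" and r: "r > 0" and cH: "continuous_on (nbd x0 t0 r t0 \<delta>) H" and Hc: "H (x0, t0) = (x1, 0)"
    and H: "\<And>q. q \<in> nbd x0 t0 r t0 \<delta> ==> H q \<in> OI \<times> J \<and> B q = C (H q) \<and> (snd q \<noteq> t0 --> 0 < m * snd (H q)) \<and> (snd q = t0 --> snd (H q) = 0)"
    using et unfolding end_trans_def by blast+
  have m: "m = 1 \<or> m = -1" using side by (auto simp: chart_side_def)
  have t0: "t0 \<in> Iv t0 \<delta>" "t0 = 0 \<or> t0 = 1" using box_dest(1,3,4)[OF B(1)] B(2) by (auto simp: Iv_def)
  have "t0' = t0 \<and> trans B t0 \<delta> B' t0 \<delta>' x0 t0 (e * x1)" if ed: "end_data C J m B' t0' \<delta>' e d h" for B' t0' \<delta>' e d h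
  proof -
    have B': "box B' t0' \<delta>'" "t0' \<notin> UI" and ef: "end_form B' t0' \<delta>' C J m e d" and ch: "continuous_on {0..<1/2} h"
      and h: "\<And>u. u \<in> {0..<1/2} ==> h u \<in> Iv t0' \<delta>' \<and> d (h u) = u" and h0: "h 0 = t0'"
      using ed unfolding end_data_def by blast+
    have t0': "t0' = 0 \<or> t0' = 1" using box_dest(3,4)[OF B'(1)] box_dest(1)[OF B'(1)] B'(2) by auto
    have e: "e = 1 \<or> e = -1" and dz: "\<And>t. t \<in> Iv t0' \<delta>' ==> d t = 0 \<longleftrightarrow> t = t0'"
      and B'C: "\<And>x t. x \<in> OI ==> t \<in> Iv t0' \<delta>' ==> B' (x, t) = C (e * x, m * d t)"
      using ef unfolding end_form_def by blast+
    have "t0' = t0"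
    proof (rule ccontr)
      assume ne: "t0' \<noteq> t0"
      have "(0::real) \<in> {0..<1/2}" by simp
      then obtain r1 where r1: "r1 > 0" "\<And>u. u \<in> {0..<1/2} ==> \<bar>u - 0\<bar> < r1 ==> \<bar>h u - h 0\<bar> < 1/2"
        using ch[unfolded continuous_on_iff dist_real_def, rule_format, of 0 "1/2"] by auto
      have cS: "continuous_on (nbd x0 t0 r t0 \<delta>) (\<lambda>q. snd (H q))" using cH by (intro continuous_intros)
      have ctr: "(x0, t0) \<in> nbd x0 t0 r t0 \<delta>" by (rule nbd_center[OF x0 t0(1) r])
      define e1 where "e1 = min r1 (1/2)"
      have e1: "e1 > 0" using r1(1) by (simp add: e1_def)
      obtain r2 where r2: "r2 > 0" "\<And>q. q \<in> nbd x0 t0 r t0 \<delta> ==> dist q (x0, t0) < r2 ==> \<bar>snd (H q) - snd (H (x0, t0))\<bar> < e1"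
        using cS[unfolded continuous_on_iff, rule_format, OF ctr e1] by (auto simp: dist_real_def)
      \<comment> \<open>A point at distance \<open>n < 1/2\<close> from the end \<open>t0\<close>
        has such a small chart height that its leaf parameter is also within \<open>1/2\<close> of
        \<open>t0'\<close>; but distinct ends are at distance 1.\<close>
      define n where "n = min (min r r2) (min \<delta> (1/2)) / 2"
      have n: "0 < n" "n < r" "n < r2" "n < \<delta>" "n < 1/2" using r r2(1) box_dest(1)[OF B(1)] by (auto simp: n_def)
      define s where "s = t0 + (1 - 2 * t0) * n"
      have s: "s \<in> Iv t0 \<delta>" "s \<in> UI" "s \<noteq> t0" "\<bar>s - t0\<bar> = n" using n t0(2) by (auto simp: s_def Iv_def)
      have q: "(x0, s) \<in> nbd x0 t0 r t0 \<delta>" using x0 s n r by (auto simp: nbd_def)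
      have "dist (x0, s) (x0, t0) < r2" using s(4) n by (simp add: dist_Pair_Pair dist_real_def)
      then have U: "\<bar>snd (H (x0, s))\<bar> < e1" using r2(2)[OF q] Hc by simp
      define u where "u = m * snd (H (x0, s))"
      have u: "0 < u" "u < r1" "u < 1/2" using H[OF q] s(3) U m by (auto simp: u_def e1_def)
      then have uI: "u \<in> {0..<1/2}" by auto
      have hU: "h u \<in> UI" using end_nbd_UI[OF B', of "h u"] h[OF uI] dz[of "h u"] u(1) by auto
      have X: "fst (H (x0, s)) \<in> OI" using H[OF q] by (auto simp: mem_Times_iff)
      then have X': "e * fst (H (x0, s)) \<in> OI" using e by auto
      have "m * u = snd (H (x0, s))" unfolding u_def using m by auto
      moreover have "e * (e * fst (H (x0, s))) = fst (H (x0, s))" using e by auto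
      moreover have "B' (e * fst (H (x0, s)), h u) = C (e * (e * fst (H (x0, s))), m * u)"
        using B'C[OF X'] h[OF uI] by metis
      ultimately have "B' (e * fst (H (x0, s)), h u) = C (H (x0, s))" by (metis prod.collapse)
      then have "B' (e * fst (H (x0, s)), h u) = B (x0, s)" using H[OF q] by simp
      then have "h u = s" using box_dest(7)[OF B'(1) X' _ hU] h[OF uI] box_dest(7)[OF B(1) x0 s(1,2)] by simp
      then have "\<bar>s - t0'\<bar> < 1/2" using r1(2)[OF uI] u h0 by simp
      then show False using s(4) n(5) ne t0(2) t0' by auto
    qed
    then show ?thesis using trans_end[OF B _ x0 _ et] B'(1) ef by simp
  qed
  then show ?thesis using that[OF side CW] by blast
qed

text \<open>The two bounds place every point in the inner half of a box, in both directions; there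
  the weight of the box is positive and its density does not vanish. At an end the point counts once
  for each side, which is why the covering is stated through \<open>trans\<close> and not through
  points of \<open>Z\<close>.\<close>

lemma box_family_exists:
  obtains Bk :: "nat => real \<times> real => 'a" and tk dk :: "nat => real" where
    "\<And>k. box (Bk k) (tk k) (dk k)"
    "\<And>B t0 \<delta> x0 t. box B t0 \<delta> ==> x0 \<in> OI ==> t \<in> Iv t0 \<delta> ==>
       \<exists>k x'. \<bar>t - tk k\<bar> < dk k / 2 \<and> \<bar>x'\<bar> < 1/2 \<and> trans B t0 \<delta> (Bk k) (tk k) (dk k) x0 t x'"
proof -
  have "\<exists>B \<delta>. box B (tau p) \<delta> \<and> B (0, tau p) = p" if "p \<in> W" for p using interior_box_exists[OF that] by metis
  then obtain Bi di where Bi: "\<And>p. p \<in> W ==> box (Bi p) (tau p) (di p) \<and> Bi p (0, tau p) = p" by metis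
  define Ni where "Ni p = Bi p ` ({-1/2<..<1/2} \<times> (UI \<inter> {tau p - di p / 2<..<tau p + di p / 2}))" for p
  have Ni: "openin Z (Ni p) \<and> p \<in> Ni p" if p: "p \<in> W" for p
  proof
    note b = conjunct1[OF Bi[OF p]]
    show "openin Z (Ni p)"
      unfolding Ni_def
    proof (rule open_embeddingD(3)[OF box_open_embedding[OF b]], rule open_subset)
      show "open ({-1/2<..<1/2::real} \<times> (UI \<inter> {tau p - di p / 2<..<tau p + di p / 2}))" by (intro open_Times open_Int) auto
      show "{-1/2<..<1/2} \<times> (UI \<inter> {tau p - di p / 2<..<tau p + di p / 2}) \<subseteq> OI \<times> (Iv (tau p) (di p) \<inter> UI)"
        using box_dest(1)[OF b] by (auto simp: Iv_def abs_if)
    qed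
    have "(0, tau p) \<in> {-1/2<..<1/2::real} \<times> (UI \<inter> {tau p - di p / 2<..<tau p + di p / 2})"
      using tau(1)[OF p] box_dest(1)[OF b] by auto
    then show "p \<in> Ni p" unfolding Ni_def using Bi[OF p] by (metis image_eqI)
  qed
  obtain D1 where D1: "countable D1" "D1 \<subseteq> W" "W \<subseteq> \<Union>(Ni ` D1)" using lindelof_cover[OF W_sub Ni] by blast
  have "\<exists>C J. cut_chart C J \<and> C (0, 0) = z" if "z \<in> \<Union>Sp" for z using cut_chart_exists[OF that] by metis
  then obtain Cz Jz where Cz: "\<And>z. z \<in> \<Union>Sp ==> cut_chart (Cz z) (Jz z) \<and> Cz z (0, 0) = z" by metis
  define Nz where "Nz z = Cz z ` ({-1/2<..<1/2} \<times> Jz z)" for z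
  have Nz: "openin Z (Nz z) \<and> z \<in> Nz z" if z: "z \<in> \<Union>Sp" for z
  proof
    note cc = conjunct1[OF Cz[OF z]]
    show "openin Z (Nz z)"
      unfolding Nz_def
    proof (rule open_embeddingD(3)[OF cut_chart_dest(4)[OF cc]])
      have "openin (top_of_set OI) {-1/2<..<1/2::real}" by (intro open_subset) auto
      then show "openin (top_of_set (OI \<times> Jz z)) ({-1/2<..<1/2} \<times> Jz z)"
        by (intro openin_Times) auto
    qed
    have "(0, 0) \<in> {-1/2<..<1/2::real} \<times> Jz z" using cut_chart_dest(3)[OF cc] by simp
    then show "z \<in> Nz z" unfolding Nz_def using Cz[OF z] by (metis image_eqI)
  qed
  have SpZ: "\<Union>Sp \<subseteq> topspace Z" using Sp_leaves leaf_sub by blast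
  obtain D2 where D2: "countable D2" "D2 \<subseteq> \<Union>Sp" "\<Union>Sp \<subseteq> \<Union>(Nz ` D2)" using lindelof_cover[OF SpZ Nz] by blast
  \<comment> \<open>One end box is taken for each chart of the countable cover and each of its sides
    that belongs to \<open>W\<close>; both sides may occur.\<close>
  define P where "P = {(z, m). z \<in> D2 \<and> chart_side (Jz z) m \<and> (\<forall>x\<in>OI. \<forall>u\<in>UI. Cz z (x, m * u) \<in> W)}"
  have "P \<subseteq> D2 \<times> {1, -1}" by (auto simp: P_def chart_side_def)
  then have cP: "countable P" using D2(1) by (meson countable_SIGMA countable_finite countable_subset finite.emptyI finite.insertI)
  have "\<exists>b. end_data (Cz (fst zs)) (Jz (fst zs)) (snd zs) (fst b) (fst (snd b)) (fst (snd (snd b))) (fst (snd (snd (snd b))))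
      (fst (snd (snd (snd (snd b))))) (snd (snd (snd (snd (snd b)))))" if "zs \<in> P" for zs
  proof -
    obtain z m where zs: "zs = (z, m)" "z \<in> D2" "chart_side (Jz z) m" "\<And>x u. x \<in> OI ==> u \<in> UI ==> Cz z (x, m * u) \<in> W"
      using \<open>zs \<in> P\<close> by (auto simp: P_def)
    have cc: "cut_chart (Cz z) (Jz z)" using Cz zs(2) D2(2) by blast
    obtain B t0 \<delta> e d h where "end_data (Cz z) (Jz z) m B t0 \<delta> e d h"
      using end_data_exists[OF cc zs(3,4)] by blast
    then show ?thesis unfolding zs(1) by (intro exI[of _ "(B, t0, \<delta>, e, d, h)"]) simp
  qed
  then obtain b where b: "\<And>zs. zs \<in> P ==> end_data (Cz (fst zs)) (Jz (fst zs)) (snd zs) (fst (b zs)) (fst (snd (b zs)))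
      (fst (snd (snd (b zs)))) (fst (snd (snd (snd (b zs))))) (fst (snd (snd (snd (snd (b zs)))))) (snd (snd (snd (snd (snd (b zs))))))"
    by metis
  define \<F> where "\<F> = (\<lambda>p. (Bi p, tau p, di p)) ` D1 \<union> (\<lambda>zs. (fst (b zs), fst (snd (b zs)), fst (snd (snd (b zs))))) ` P"
  have cF: "countable \<F>" unfolding \<F>_def using D1(1) cP by auto
  have "c (0, 1/2) \<in> W" using tau_c(2)[of 0 "1/2"] by simp
  then have "D1 \<noteq> {}" using D1(3) by blast
  then have neF: "\<F> \<noteq> {}" unfolding \<F>_def by blast
  have Fbox: "box (fst f) (fst (snd f)) (snd (snd f))" if "f \<in> \<F>" for f
  proof -
    have "box (fst (b zs)) (fst (snd (b zs))) (fst (snd (snd (b zs))))" if "zs \<in> P" for zs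
      using b[OF that] unfolding end_data_def by blast
    moreover have "box (Bi p) (tau p) (di p)" if "p \<in> D1" for p using Bi D1(2) that by blast
    ultimately show ?thesis using that unfolding \<F>_def by auto
  qed
  have cover: "\<exists>f\<in>\<F>. \<exists>x'. \<bar>t - fst (snd f)\<bar> < snd (snd f) / 2 \<and> \<bar>x'\<bar> < 1/2 \<and> trans B t0 \<delta> (fst f) (fst (snd f)) (snd (snd f)) x0 t x'"
    if B: "box B t0 \<delta>" and x0: "x0 \<in> OI" and t: "t \<in> Iv t0 \<delta>" for B t0 \<delta> x0 t
  proof (cases "t \<in> UI")
    case True
    have "B (x0, t) \<in> W" by (rule box_dest(6)[OF B x0 t True])
    then obtain p where p: "p \<in> D1" "B (x0, t) \<in> Ni p" using D1(3) by blast
    then obtain x' s where xs: "x' \<in> {-1/2<..<1/2}" "s \<in> UI" "s \<in> {tau p - di p / 2<..<tau p + di p / 2}" "B (x0, t) = Bi p (x', s)"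
      unfolding Ni_def by blast
    have bp: "box (Bi p) (tau p) (di p)" using Bi D1(2) p(1) by blast
    have x'O: "x' \<in> OI" using xs(1) by auto
    have "tau p - di p / 2 < s" "s < tau p + di p / 2" using xs(3) by simp_all
    then have sd: "\<bar>s - tau p\<bar> < di p / 2" unfolding abs_less_iff by argo
    have sI: "s \<in> Iv (tau p) (di p)" using sd xs(2) box_dest(1)[OF bp] by (auto simp: Iv_def)
    have "s = t" using box_dest(7)[OF bp x'O sI xs(2)] box_dest(7)[OF B x0 t True] xs(4) by simp
    have tI: "t \<in> Iv (tau p) (di p)" using sI \<open>s = t\<close> by simp
    have eq: "B (x0, t) = Bi p (x', t)" using xs(4) \<open>s = t\<close> by simp
    have "trans B t0 \<delta> (Bi p) (tau p) (di p) x0 t x'" by (rule trans_interior[OF B bp x0 t tI True x'O eq])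
    moreover have "\<bar>t - tau p\<bar> < di p / 2" "\<bar>x'\<bar> < 1/2" using sd \<open>s = t\<close> xs(1) by auto
    moreover have "(Bi p, tau p, di p) \<in> \<F>" unfolding \<F>_def using p(1) by blast
    ultimately show ?thesis by (intro bexI[of _ "(Bi p, tau p, di p)"] exI[of _ x']) auto
  next
    case False
    then have tt: "t = t0" "t0 \<notin> UI" using box_end[OF B t] by auto
    have "B (x0, t) \<in> \<Union>Sp" by (rule box_end_Sp[OF B x0 t False])
    then obtain z where z: "z \<in> D2" "B (x0, t) \<in> Nz z" using D2(3) by blast
    have cc: "cut_chart (Cz z) (Jz z)" using Cz z(1) D2(2) by blast
    obtain x1 u where xu: "x1 \<in> {-1/2<..<1/2}" "u \<in> Jz z" "B (x0, t) = Cz z (x1, u)" using z(2) unfolding Nz_def by blast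
    have x1O: "x1 \<in> OI" using xu(1) by auto
    have "u = 0" using cut_chart_dest(7)[OF cc x1O xu(2)] \<open>B (x0, t) \<in> \<Union>Sp\<close> xu(3) by simp
    then have eq: "B (x0, t0) = Cz z (x1, 0)" using xu(3) tt by simp
    obtain m where m: "chart_side (Jz z) m" "\<And>x u. x \<in> OI ==> u \<in> UI ==> Cz z (x, m * u) \<in> W"
      "\<And>B' t0' \<delta>' e d h. end_data (Cz z) (Jz z) m B' t0' \<delta>' e d h ==> t0' = t0 \<and> trans B t0 \<delta> B' t0 \<delta>' x0 t0 (e * x1)"
      using end_cover[OF B tt(2) x0 cc x1O eq] by metis
    have zP: "(z, m) \<in> P" using z(1) m(1,2) by (auto simp: P_def)
    obtain B' t0' \<delta>' e d h where bz: "b (z, m) = (B', t0', \<delta>', e, d, h)" by (metis prod.collapse)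
    have ed: "end_data (Cz z) (Jz z) m B' t0' \<delta>' e d h" using b[OF zP] bz by simp
    then have tr: "t0' = t0" "trans B t0 \<delta> B' t0 \<delta>' x0 t0 (e * x1)" using m(3) by blast+
    have "e = 1 \<or> e = -1" "box B' t0' \<delta>'" using ed unfolding end_data_def end_form_def by blast+
    then have "\<bar>e * x1\<bar> < 1/2" "0 < \<delta>'" using xu(1) box_dest(1) by auto
    moreover have "(B', t0', \<delta>') \<in> \<F>" unfolding \<F>_def using zP bz by (force intro!: image_eqI[of _ _ "(z, m)"])
    ultimately show ?thesis using tr tt by (intro bexI[of _ "(B', t0', \<delta>')"] exI[of _ "e * x1"]) auto
  qed
  let ?f = "from_nat_into \<F>"
  have rf: "range ?f = \<F>" using cF neF by (simp add: range_from_nat_into)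
  show ?thesis
  proof (rule that[of "\<lambda>k. fst (?f k)" "\<lambda>k. fst (snd (?f k))" "\<lambda>k. snd (snd (?f k))"])
    show "box (fst (?f k)) (fst (snd (?f k))) (snd (snd (?f k)))" for k using Fbox rf by blast
    fix B t0 \<delta> x0 t assume "box B t0 \<delta>" "x0 \<in> OI" "t \<in> Iv t0 \<delta>"
    from cover[OF this] obtain f x' where f: "f \<in> \<F>" "\<bar>t - fst (snd f)\<bar> < snd (snd f) / 2 \<and> \<bar>x'\<bar> < 1/2 \<and> trans B t0 \<delta> (fst f) (fst (snd f)) (snd (snd f)) x0 t x'"
      by blast
    then obtain k where "f = ?f k" using rf by blast
    then show "\<exists>k x'. \<bar>t - fst (snd (?f k))\<bar> < snd (snd (?f k)) / 2 \<and> \<bar>x'\<bar> < 1/2 \<and> trans B t0 \<delta> (fst (?f k)) (fst (snd (?f k))) (snd (snd (?f k))) x0 t x'"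
      using f(2) by blast
  qed
qed

end

section \<open>A density along the leaves of a piece\<close>

text \<open>The distribution function of the uniform density on \<open>[-1/2, 1/2]\<close>: the mass
  to the left of \<open>x\<close>.\<close>

definition chi :: "real => real" where "chi x = max 0 (min 1 (x + 1/2))"

lemma chi: "0 \<le> chi x" "chi x \<le> 1" "x \<le> -1/2 ==> chi x = 0" "1/2 \<le> x ==> chi x = 1" "x \<le> y ==> chi x \<le> chi y"
    "-1/2 < x ==> x < y ==> y < 1/2 ==> chi x < chi y"
  by (auto simp: chi_def)

lemma chi_cont: "continuous_on A f ==> continuous_on A (\<lambda>a. chi (f a))"
  unfolding chi_def by (intro continuous_intros)

lemma half_summable: assumes "\<And>k. 0 \<le> f k" "\<And>k. f k \<le> 1" shows "summable (\<lambda>k. (1/2)^k * f k :: real)"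
proof (rule summable_comparison_test)
  show "summable (\<lambda>k. (1/2::real)^k)" by (rule summable_geometric) simp
  show "\<exists>N. \<forall>n\<ge>N. norm ((1/2)^n * f n) \<le> (1/2)^n" using assms by (auto simp: abs_mult mult_left_le)
qed

lemma half_series_cont:
  fixes f :: "nat => 'b::topological_space => real"
  assumes "\<And>k. continuous_on A (f k)" "\<And>k a. a \<in> A ==> 0 \<le> f k a" "\<And>k a. a \<in> A ==> f k a \<le> 1"
  shows "continuous_on A (\<lambda>a. \<Sum>k. (1/2)^k * f k a)"
proof (rule uniform_limit_theorem)
  show "\<forall>\<^sub>F n in sequentially. continuous_on A (\<lambda>a. \<Sum>k<n. (1/2)^k * f k a)"
    using assms(1) by (intro always_eventually allI continuous_intros)
  show "uniform_limit A (\<lambda>n a. \<Sum>k<n. (1/2)^k * f k a) (\<lambda>a. \<Sum>k. (1/2)^k * f k a) sequentially"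
  proof (rule Weierstrass_m_test)
    show "norm ((1/2)^n * f n a) \<le> (1/2::real)^n" if "a \<in> A" for n a
      using assms(2,3)[OF that, of n] by (simp add: abs_mult mult_left_le)
    show "summable (\<lambda>k. (1/2::real)^k)" by (rule summable_geometric) simp
  qed
qed simp

lemma half_series_le:
  assumes "\<And>k. 0 \<le> f k" "\<And>k. f k \<le> g k" "\<And>k. g k \<le> 1"
  shows "(\<Sum>k. (1/2)^k * f k) \<le> (\<Sum>k. (1/2)^k * g k :: real)"
proof (rule suminf_le)
  show "(1/2)^k * f k \<le> (1/2)^k * g k" for k using assms(2) by (intro mult_left_mono) auto
  have "f k \<le> 1" for k using assms(2,3) order_trans by blast
  then show "summable (\<lambda>k. (1/2)^k * f k)" using assms(1) by (intro half_summable)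
  have "0 \<le> g k" for k using assms(1,2) order_trans by blast
  then show "summable (\<lambda>k. (1/2)^k * g k)" using assms(3) by (intro half_summable)
qed

lemma half_series_less:
  assumes "\<And>k. 0 \<le> f k" "\<And>k. f k \<le> g k" "\<And>k. g k \<le> 1" "f j < g j"
  shows "(\<Sum>k. (1/2)^k * f k) < (\<Sum>k. (1/2)^k * g k :: real)"
proof -
  have "f k \<le> 1" for k using assms(2,3) order_trans by blast
  then have sf: "summable (\<lambda>k. (1/2)^k * f k)" using assms(1) by (intro half_summable)
  have "0 \<le> g k" for k using assms(1,2) order_trans by blast
  then have sg: "summable (\<lambda>k. (1/2)^k * g k)" using assms(3) by (intro half_summable)
  have "0 < (\<Sum>k. (1/2)^k * g k - (1/2)^k * f k)"
  proof (rule suminf_pos2[where i = j])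
    show "summable (\<lambda>k. (1/2)^k * g k - (1/2)^k * f k)" by (rule summable_diff[OF sg sf])
    show "0 \<le> (1/2)^k * g k - (1/2)^k * f k" for k using assms(2) by (simp add: mult_left_mono)
    show "0 < (1/2)^j * g j - (1/2)^j * f j" using assms(4) by simp
  qed
  then show ?thesis using suminf_diff[OF sg sf] by simp
qed

lemma half_series_tail:
  assumes "\<And>k. 0 \<le> f k" "\<And>k. f k \<le> 1" "\<And>k. k < K ==> f k = 0"
  shows "(\<Sum>k. (1/2)^k * f k) \<le> 2 * (1/2::real)^K"
proof -
  have s: "summable (\<lambda>k. (1/2)^k * f k)" using assms by (intro half_summable)
  have "(\<Sum>k. (1/2)^k * f k) = (\<Sum>k. (1/2)^(k + K) * f (k + K)) + (\<Sum>k<K. (1/2)^k * f k)"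
    by (rule suminf_split_initial_segment[OF s])
  also have "(\<Sum>k<K. (1/2)^k * f k) = 0" using assms(3) by (intro sum.neutral) auto
  also have "(\<Sum>k. (1/2)^(k + K) * f (k + K)) \<le> (\<Sum>k. (1/2)^K * (1/2)^k)"
  proof (rule suminf_le)
    show "(1/2)^(k + K) * f (k + K) \<le> (1/2::real)^K * (1/2)^k" for k
      using assms(1,2)[of "k + K"] by (simp add: power_add mult_left_le mult.commute)
    show "summable (\<lambda>k. (1/2)^(k + K) * f (k + K))" using s by (subst summable_iff_shift)
    show "summable (\<lambda>k. (1/2::real)^K * (1/2)^k)" by (intro summable_mult summable_geometric) simp
  qed
  also have "(\<Sum>k. (1/2::real)^K * (1/2)^k) = 2 * (1/2)^K"
    by (subst suminf_mult) (auto simp: suminf_geometric summable_geometric)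
  finally show ?thesis by simp
qed

section \<open>Passing to the ends from interior leaf parameters\<close>

context cut_component
begin

lemma approach_UI:
  assumes B: "box B t0 \<delta>" and t: "t \<in> Iv t0 \<delta>" and d: "d > 0"
  obtains s where "s \<in> Iv t0 \<delta>" "s \<in> UI" "\<bar>s - t\<bar> < d"
proof (cases "t \<in> UI")
  case True
  then show ?thesis using that[of t] t d by simp
next
  case False
  then have tt: "t = t0" "t0 \<notin> UI" using box_end[OF B t] by auto
  then have t0: "t0 = 0 \<or> t0 = 1" using box_dest(1,3,4)[OF B] by auto
  define n where "n = min (min d \<delta>) 1 / 2"
  have n: "0 < n" "n < d" "n < \<delta>" "n < 1" using d box_dest(1)[OF B] by (auto simp: n_def)
  show ?thesis
    using that[of "t0 + (1 - 2 * t0) * n"] n t0 tt by (auto simp: Iv_def)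
qed

text \<open>Interior heights are dense in the height range of a box, so inequalities between
  continuous functions that hold on regular leaves persist on the cut leaf.\<close>

lemma lim_nonneg:
  assumes B: "box B t0 \<delta>" and t: "t \<in> Iv t0 \<delta>" and r: "r > 0"
    and F: "continuous_on {s \<in> Iv t0 \<delta>. \<bar>s - t\<bar> < r} F"
    and nn: "\<And>s. s \<in> Iv t0 \<delta> ==> s \<in> UI ==> \<bar>s - t\<bar> < r ==> (0::real) \<le> F s"
  shows "0 \<le> F t"
proof (rule ccontr)
  assume "\<not> 0 \<le> F t"
  then have "0 < - F t" by simp
  moreover have "t \<in> {s \<in> Iv t0 \<delta>. \<bar>s - t\<bar> < r}" using t r by simp
  ultimately obtain d where d: "d > 0" "\<And>s. s \<in> Iv t0 \<delta> ==> \<bar>s - t\<bar> < r ==> \<bar>s - t\<bar> < d ==> \<bar>F s - F t\<bar> < - F t"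
    using F unfolding continuous_on_iff dist_real_def by blast
  obtain s where s: "s \<in> Iv t0 \<delta>" "s \<in> UI" "\<bar>s - t\<bar> < min d r" using approach_UI[OF B t, of "min d r"] d(1) r by auto
  then have "\<bar>F s - F t\<bar> < - F t" "0 \<le> F s" using d(2)[of s] nn[of s] by auto
  then show False by linarith
qed

lemma lim_eq:
  assumes B: "box B t0 d" and t: "t \<in> Iv t0 d" and r: "r > 0"
    and F: "continuous_on {s \<in> Iv t0 d. \<bar>s - t\<bar> < r} F" "continuous_on {s \<in> Iv t0 d. \<bar>s - t\<bar> < r} G"
    and eq: "\<And>s. s \<in> Iv t0 d ==> s \<in> UI ==> \<bar>s - t\<bar> < r ==> F s = (G s :: real)"
  shows "F t = G t"
proof -
  have "0 \<le> F t - G t" by (rule lim_nonneg[OF B t r, of "\<lambda>s. F s - G s"]) (use F eq in \<open>auto intro!: continuous_intros\<close>)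
  moreover have "0 \<le> G t - F t" by (rule lim_nonneg[OF B t r, of "\<lambda>s. G s - F s"]) (use F eq in \<open>auto intro!: continuous_intros\<close>)
  ultimately show ?thesis by simp
qed

lemma nbd_slice_cont:
  assumes "continuous_on (nbd x0 t r t0 d) f" "x \<in> OI" "\<bar>x - x0\<bar> < r"
  shows "continuous_on {s \<in> Iv t0 d. \<bar>s - t\<bar> < r} (\<lambda>s. f (x, s))"
  by (intro continuous_on_compose2[OF assms(1)] continuous_intros) (use assms in \<open>auto simp: nbd_def\<close>)

lemma leaf_IVT:
  assumes B: "box B t0 d" and t: "t \<in> Iv t0 d" "t \<in> UI" and p: "p \<in> W" "tau p = t" and ab: "a \<in> OI" "b \<in> OI" "a < b"
    and lt: "rho (B (a, t)) < rho p" "rho p < rho (B (b, t))"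
  obtains x where "a < x" "x < b" "p = B (x, t)"
proof -
  have xO: "x \<in> OI" if "x \<in> {a..b}" for x using that ab by auto
  have "continuous_map (top_of_set {a..b}) (top_of_set (OI \<times> Iv t0 d)) (\<lambda>x. (x, t))"
    using xO t by (auto simp: continuous_map_in_subtopology intro!: continuous_intros)
  from continuous_map_compose[OF this box_dest(5)[OF B]]
  have "continuous_map (top_of_set {a..b}) Z (\<lambda>x. B (x, t))" by (simp add: comp_def)
  then have "continuous_on {a..b} (\<lambda>x. rho (B (x, t)))"
    by (rule rho_path_cont[OF _ _ t(2)]) (use box_dest(6,7)[OF B xO t] in auto)
  then obtain x where x: "a \<le> x" "x \<le> b" "rho (B (x, t)) = rho p"
    using IVT'[of "\<lambda>x. rho (B (x, t))" a "rho p" b] lt ab by auto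
  have "p = B (x, t)" using rho_inj[of "B (x, t)" p] box_dest(6,7)[OF B xO t, of x] x p by auto
  moreover have "x \<noteq> a" "x \<noteq> b" using x(3) lt by auto
  ultimately show ?thesis using that[of x] x by auto
qed

lemma box_mono_iff:
  assumes B: "box B t0 d" and t: "t \<in> Iv t0 d" "t \<in> UI" and x: "x \<in> OI" "x' \<in> OI"
  shows "rho (B (x, t)) < rho (B (x', t)) \<longleftrightarrow> x < x'"
  using box_dest(8)[OF B x t] box_dest(8)[OF B x(2,1) t] by (cases x x' rule: linorder_cases) auto

lemma box_inj_end:
  assumes B: "box B t0 \<delta>" and t: "t \<in> Iv t0 \<delta>" and x: "x \<in> OI" "x' \<in> OI" and eq: "B (x, t) = B (x', t)"
  shows "x = x'"
proof (cases "t \<in> UI")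
  case True
  then show ?thesis using box_inj[OF B x t True eq] by blast
next
  case False
  then have tt: "t = t0" "t0 \<notin> UI" using box_end[OF B t] by auto
  obtain C J s \<epsilon> d where e: "end_form B t0 \<delta> C J s \<epsilon> d" using box_dest(10)[OF B tt(2)] by blast
  have C: "cut_chart C J" and \<epsilon>: "\<epsilon> = 1 \<or> \<epsilon> = -1" and d0: "d t = 0"
    and BC: "B (x, t) = C (\<epsilon> * x, s * d t)" "B (x', t) = C (\<epsilon> * x', s * d t)"
    using e t tt x unfolding end_form_def by blast+
  have "(\<epsilon> * x, 0) = (\<epsilon> * x', 0::real)"
    by (rule inj_onD[OF open_embeddingD(2)[OF cut_chart_dest(4)[OF C]]])
      (use BC eq d0 \<epsilon> x cut_chart_dest(3)[OF C] in auto)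
  then show ?thesis using \<epsilon> by auto
qed

lemma box_row_cont:
  assumes B: "box B t0 d" and x: "x \<in> OI"
  shows "continuous_map (top_of_set (nbd x0 t r t0' d' \<inter> {q. snd q \<in> Iv t0 d})) Z (\<lambda>q. B (x, snd q))"
proof -
  have "continuous_map (top_of_set (nbd x0 t r t0' d' \<inter> {q. snd q \<in> Iv t0 d})) (top_of_set (OI \<times> Iv t0 d)) (\<lambda>q. (x, snd q))"
    using x by (auto simp: continuous_map_in_subtopology intro!: continuous_intros)
  from continuous_map_compose[OF this box_dest(5)[OF B]] show ?thesis by (simp add: comp_def)
qed

end

locale box_family = cut_component +
  fixes Bk :: "nat => real \<times> real => 'a" and tk dk :: "nat => real"
  assumes bx: "\<And>k. box (Bk k) (tk k) (dk k)"
    and cov: "\<And>B t0 d x0 t. box B t0 d ==> x0 \<in> OI ==> t \<in> Iv t0 d ==>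
       \<exists>k x'. \<bar>t - tk k\<bar> < dk k / 2 \<and> \<bar>x'\<bar> < 1/2 \<and> trans B t0 d (Bk k) (tk k) (dk k) x0 t x'"
begin

abbreviation Ik :: "nat => real set" where "Ik k \<equiv> Iv (tk k) (dk k)"

text \<open>A tent over the middle half of the height range, so that a box has lost its weight well
  before the heights at which it stops.\<close>

definition wt :: "nat => real => real" where "wt k t = max 0 (dk k / 2 - \<bar>t - tk k\<bar>)"

text \<open>The fraction of the unit mass of box \<open>k\<close> on the leaf of \<open>p\<close>
  that lies before \<open>p\<close>. Inside the box this is \<open>chi\<close> of the first
  coordinate; outside, the order relative to the centre of the row decides between 0 and 1.\<close>

definition pos :: "nat => 'a => real" where
  "pos k p = (if \<exists>x\<in>OI. p = Bk k (x, tau p) then chi (THE x. x \<in> OI \<and> p = Bk k (x, tau p))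
     else if rho p < rho (Bk k (0, tau p)) then 0 else 1)"

definition phi :: "nat => 'a => real" where "phi k p = wt k (tau p) * pos k p"

lemma wt: "0 \<le> wt k t" "wt k t \<le> 1" "\<bar>t - tk k\<bar> < dk k / 2 ==> 0 < wt k t" "t \<in> {0..1} ==> t \<notin> Ik k ==> wt k t = 0"
  using box_dest(1,2)[OF bx, of k] by (auto simp: wt_def Iv_def)

lemma wt_cont: "continuous_on A f ==> continuous_on A (\<lambda>a. wt k (f a))"
  unfolding wt_def by (intro continuous_intros)

lemma pos_on:
  assumes p: "p \<in> W" "tau p \<in> Ik k" "x \<in> OI" "p = Bk k (x, tau p)"
  shows "pos k p = chi x"
proof -
  have "(THE x. x \<in> OI \<and> p = Bk k (x, tau p)) = x"
  proof (rule the_equality)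
    fix y assume "y \<in> OI \<and> p = Bk k (y, tau p)"
    then show "y = x" using box_inj[OF bx _ p(3,2) tau(1)[OF p(1)]] p(4) by auto
  qed (use p in simp)
  then show ?thesis unfolding pos_def using p by auto
qed

lemma pos_range: "0 \<le> pos k p" "pos k p \<le> 1"
  by (auto simp: pos_def chi)

lemma phi_range: "0 \<le> phi k p" "phi k p \<le> wt k (tau p)"
  using pos_range[of k p] wt(1)[of k "tau p"] by (auto simp: phi_def mult_left_le)

lemma pos_low:
  assumes p: "p \<in> W" "tau p \<in> Ik k" "rho p \<le> rho (Bk k (-1/2, tau p))"
  shows "pos k p = 0"
proof (cases "\<exists>x\<in>OI. p = Bk k (x, tau p)")
  case True
  then obtain x where x: "x \<in> OI" "p = Bk k (x, tau p)" by blast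
  have "\<not> -1/2 < x" using box_dest(8)[OF bx _ x(1) p(2) tau(1)[OF p(1)], of "-1/2"] p(3) x(2) by auto
  then show ?thesis using pos_on[OF p(1,2) x] chi(3) by simp
next
  case False
  have "rho (Bk k (-1/2, tau p)) < rho (Bk k (0, tau p))" by (rule box_dest(8)[OF bx _ _ p(2) tau(1)[OF p(1)]]) auto
  then show ?thesis using False p(3) by (simp add: pos_def)
qed

lemma pos_high:
  assumes p: "p \<in> W" "tau p \<in> Ik k" "rho (Bk k (1/2, tau p)) \<le> rho p"
  shows "pos k p = 1"
proof (cases "\<exists>x\<in>OI. p = Bk k (x, tau p)")
  case True
  then obtain x where x: "x \<in> OI" "p = Bk k (x, tau p)" by blast
  have "\<not> x < 1/2" using box_dest(8)[OF bx x(1) _ p(2) tau(1)[OF p(1)], of "1/2"] p(3) x(2) by auto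
  then show ?thesis using pos_on[OF p(1,2) x] chi(4) by simp
next
  case False
  have "rho (Bk k (0, tau p)) < rho (Bk k (1/2, tau p))" by (rule box_dest(8)[OF bx _ _ p(2) tau(1)[OF p(1)]]) auto
  then show ?thesis using False p(3) by (auto simp: pos_def)
qed

lemma pos_mid:
  assumes p: "p \<in> W" "tau p \<in> Ik k" "rho (Bk k (-1/2, tau p)) < rho p" "rho p < rho (Bk k (1/2, tau p))"
  obtains x where "-1/2 < x" "x < 1/2" "p = Bk k (x, tau p)" "pos k p = chi x"
proof -
  have m: "(-1/2::real) \<in> OI" "(1/2::real) \<in> OI" "(-1/2::real) < 1/2" by auto
  obtain x where x: "-1/2 < x" "x < 1/2" "p = Bk k (x, tau p)"
    using leaf_IVT[OF bx p(2) tau(1)[OF p(1)] p(1) refl m p(3,4)] by blast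
  then have "x \<in> OI" by auto
  then show ?thesis using that[OF x] pos_on[OF p(1,2) _ x(3)] by blast
qed

lemma pos_mono:
  assumes p: "p \<in> W" "q \<in> W" "tau p = tau q" "tau p \<in> Ik k" "rho p \<le> rho q"
  shows "pos k p \<le> pos k q"
proof (cases "rho p \<le> rho (Bk k (-1/2, tau p)) \<or> rho (Bk k (1/2, tau q)) \<le> rho q")
  case True
  then show ?thesis using pos_low[OF p(1,4)] pos_high[OF p(2)] p(3,4) pos_range by auto
next
  case False
  then have 1: "rho (Bk k (-1/2, tau p)) < rho p" "rho q < rho (Bk k (1/2, tau q))" by auto
  obtain x where x: "-1/2 < x" "x < 1/2" "p = Bk k (x, tau p)" "pos k p = chi x"
    using pos_mid[OF p(1,4) 1(1)] 1(2) p(3,5) by auto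
  have qI: "tau q \<in> Ik k" using p(3,4) by simp
  have "rho (Bk k (-1/2, tau q)) < rho q" using 1(1) p(3,5) by simp
  then obtain y where y: "-1/2 < y" "y < 1/2" "q = Bk k (y, tau q)" "pos k q = chi y"
    using pos_mid[OF p(2) qI _ 1(2)] by blast
  have "x \<in> OI" "y \<in> OI" using x y by auto
  moreover have "\<not> rho (Bk k (y, tau p)) < rho (Bk k (x, tau p))" using x(3) y(3) p(3,5) by auto
  ultimately have "x \<le> y" using box_mono_iff[OF bx p(4) tau(1)[OF p(1)], of y x] by auto
  then show ?thesis using x y chi(5) by simp
qed

lemma phi_mono:
  assumes p: "p \<in> W" "q \<in> W" "tau p = tau q" "rho p \<le> rho q"
  shows "phi k p \<le> phi k q"
proof (cases "tau p \<in> Ik k")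
  case True
  then show ?thesis using pos_mono[OF p(1-3) True p(4)] wt(1) p(3) by (auto simp: phi_def intro!: mult_left_mono)
next
  case False
  then have "wt k (tau p) = 0" using wt(4)[OF _ False] tau(1)[OF p(1)] by auto
  then show ?thesis using p(3) by (simp add: phi_def)
qed

text \<open>If \<open>B\<close> and box \<open>k\<close> differ by a coordinate change, the function
  is the weight times \<open>chi\<close> of the new coordinate. If they are apart, the order
  relative to the inner part of box \<open>k\<close> cannot change on a connected set, so the value
  is constantly 0 or the full weight. Both expressions continue to the cut leaf.\<close>

lemma local_ext:
  assumes B: "box B t0 d" and x0: "x0 \<in> OI" and t: "t \<in> Iv t0 d"
  shows "\<exists>r>0. \<exists>e. continuous_on (nbd x0 t r t0 d) e \<and> (\<forall>q\<in>nbd x0 t r t0 d. snd q \<in> UI --> e q = phi k (B q))"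
proof (cases "\<bar>t - tk k\<bar> > dk k / 2")
  case True
  define r where "r = \<bar>t - tk k\<bar> - dk k / 2"
  have "0 = phi k (B q)" if q: "q \<in> nbd x0 t r t0 d" "snd q \<in> UI" for q
  proof -
    have "fst q \<in> OI" "snd q \<in> Iv t0 d" "\<bar>snd q - t\<bar> < r" using q by (auto simp: nbd_def)
    then have "tau (B q) = snd q" using box_dest(7)[OF B, of "fst q" "snd q"] q(2) by simp
    moreover have "wt k (snd q) = 0" using \<open>\<bar>snd q - t\<bar> < r\<close> by (auto simp: wt_def r_def)
    ultimately show ?thesis by (simp add: phi_def)
  qed
  then show ?thesis using True by (intro exI[of _ r] conjI exI[of _ "\<lambda>_. 0"]) (auto simp: r_def)
next
  \<comment> \<open>The tent occupies only half of the height range, so now \<open>t\<close> lies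
    strictly within the heights of box \<open>k\<close> and \<open>trans_or_apart\<close>
    applies.\<close>
  case False
  have dk0: "0 < dk k" by (rule box_dest(1)[OF bx])
  then have tI: "t \<in> Ik k" and td: "\<bar>t - tk k\<bar> < dk k" using False t by (auto simp: Iv_def)
  consider x' where "trans B t0 d (Bk k) (tk k) (dk k) x0 t x'" | "apart B t0 d (Bk k) (tk k) (dk k) x0 t"
    using trans_or_apart[OF B bx x0 t tI] by blast
  then show ?thesis
  proof cases
    case 1
    then obtain r \<xi> where r: "r > 0" "continuous_on (nbd x0 t r t0 d) \<xi>"
      "\<And>q. q \<in> nbd x0 t r t0 d ==> \<xi> q \<in> OI \<and> snd q \<in> Ik k \<and> B q = Bk k (\<xi> q, snd q)" unfolding trans_def by blast
    have "wt k (snd q) * chi (\<xi> q) = phi k (B q)" if q: "q \<in> nbd x0 t r t0 d" "snd q \<in> UI" for q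
    proof -
      have "fst q \<in> OI" "snd q \<in> Iv t0 d" using q by (auto simp: nbd_def)
      then have Wq: "B q \<in> W" "tau (B q) = snd q" using box_dest(6,7)[OF B, of "fst q" "snd q"] q(2) by auto
      then show ?thesis using pos_on[OF Wq(1), of k "\<xi> q"] r(3)[OF q(1)] by (simp add: phi_def)
    qed
    moreover have "continuous_on (nbd x0 t r t0 d) (\<lambda>q. wt k (snd q) * chi (\<xi> q))"
      by (intro continuous_intros wt_cont chi_cont r(2))
    ultimately show ?thesis using r(1) by (intro exI[of _ r] conjI exI[of _ "\<lambda>q. wt k (snd q) * chi (\<xi> q)"]) auto
  next
    case 2
    then obtain r0 where r0: "r0 > 0" "\<And>q x'. q \<in> nbd x0 t r0 t0 d ==> snd q \<in> UI ==> snd q \<in> Ik k ==> x' \<in> {-1/2..1/2} ==> B q \<noteq> Bk k (x', snd q)"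
      unfolding apart_def by blast
    define r where "r = min r0 (dk k - \<bar>t - tk k\<bar>)"
    have r: "r > 0" "r \<le> r0" "r \<le> dk k - \<bar>t - tk k\<bar>" using r0(1) td by (auto simp: r_def)
    let ?N = "nbd x0 t r t0 d"
    \<comment> \<open>The points of the neighbourhood at interior heights form a product of
      intervals. On this connected set the order relative to the left edge of the inner part of box
      \<open>k\<close> is constant.\<close>
    define N' where "N' = ({x0 - r<..<x0 + r} \<inter> OI) \<times> (UI \<inter> {t0 - d<..<t0 + d} \<inter> {t - r<..<t + r})"
    have N': "N' = {q \<in> ?N. snd q \<in> UI}" by (auto simp: N'_def nbd_def Iv_def mem_Times_iff abs_less_iff)
    have N'k: "snd q \<in> Ik k" if "q \<in> N'" for q
    proof -
      have 1: "\<bar>snd q - t\<bar> < r" "snd q \<in> UI" using that unfolding N' nbd_def by auto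
      have "\<bar>snd q - tk k\<bar> \<le> \<bar>snd q - t\<bar> + \<bar>t - tk k\<bar>" by simp
      then have "\<bar>snd q - tk k\<bar> < dk k" using 1(1) r(3) by linarith
      then show ?thesis using 1(2) by (auto simp: Iv_def)
    qed
    have N'B: "B q \<in> W" "tau (B q) = snd q" "snd q \<in> UI" "q \<in> nbd x0 t r0 t0 d" if "q \<in> N'" for q
    proof -
      have q: "fst q \<in> OI" "snd q \<in> Iv t0 d" "snd q \<in> UI" "q \<in> ?N" using that unfolding N' nbd_def by auto
      show "B q \<in> W" "tau (B q) = snd q" using box_dest(6,7)[OF B q(1-3)] by auto
      show "snd q \<in> UI" "q \<in> nbd x0 t r0 t0 d" using q nbd_mono[OF r(2)] by blast+
    qed
    have con: "connected N'" unfolding N'_def by (intro convex_connected convex_Times convex_Int) auto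
    have c1: "continuous_map (top_of_set N') Z B"
      by (rule continuous_map_from_subtopology_mono[OF nbd_continuous[OF B]]) (auto simp: N')
    have c2: "continuous_map (top_of_set N') Z (\<lambda>q. Bk k (-1/2, snd q))"
      by (rule continuous_map_from_subtopology_mono[OF box_row_cont[OF bx, of "-1/2" x0 t r t0 d k]]) (use N'k in \<open>auto simp: N'\<close>)
    have m: "(-1/2::real) \<in> OI" "(1/2::real) \<in> OI" by auto
    have row: "Bk k (-1/2, snd q) \<in> W" "tau (Bk k (-1/2, snd q)) = snd q" if "q \<in> N'" for q
      using box_dest(6,7)[OF bx m(1) N'k[OF that] N'B(3)[OF that]] by auto
    have ne: "B q \<noteq> Bk k (x', snd q)" if "q \<in> N'" "x' \<in> {-1/2..1/2}" for q x'
      using r0(2)[OF N'B(4,3)[OF that(1)] N'k[OF that(1)] that(2)] .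
    show ?thesis
    proof (cases "\<exists>q\<in>N'. rho (B q) < rho (Bk k (-1/2, snd q))")
      case True
      then obtain q0 where q0: "q0 \<in> N'" "rho (B q0) < rho (Bk k (-1/2, snd q0))" by blast
      have lt: "rho (B q) < rho (Bk k (-1/2, snd q))" if "q \<in> N'" for q
        by (rule order_const[OF con c1 c2 _ q0 that]) (use N'B row ne in auto)
      have "0 = phi k (B q)" if q: "q \<in> ?N" "snd q \<in> UI" for q
      proof -
        have qN: "q \<in> N'" using q N' by blast
        have "pos k (B q) = 0" by (rule pos_low) (use N'B[OF qN] N'k[OF qN] lt[OF qN] in auto)
        then show ?thesis by (simp add: phi_def)
      qed
      then show ?thesis using r(1) by (intro exI[of _ r] conjI exI[of _ "\<lambda>_. 0"]) auto
    next
      case False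
      have ge: "rho (Bk k (1/2, snd q)) \<le> rho (B q)" if q: "q \<in> N'" for q
      proof (rule ccontr)
        assume "\<not> ?thesis"
        then have hi: "rho (B q) < rho (Bk k (1/2, tau (B q)))" using N'B[OF q] by simp
        have "rho (B q) \<noteq> rho (Bk k (-1/2, snd q))"
          using rho_inj[OF N'B(1)[OF q] row(1)[OF q]] N'B(2)[OF q] row(2)[OF q] ne[OF q, of "-1/2"] by auto
        then have lo: "rho (Bk k (-1/2, tau (B q))) < rho (B q)" using False q N'B(2)[OF q] by force
        have tI': "tau (B q) \<in> Ik k" using N'B(2)[OF q] N'k[OF q] by simp
        obtain x where "-1/2 < x" "x < 1/2" "B q = Bk k (x, tau (B q))" using pos_mid[OF N'B(1)[OF q] tI' lo hi] by blast
        then show False using ne[OF q, of x] N'B(2)[OF q] by auto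
      qed
      have "wt k (snd q) = phi k (B q)" if q: "q \<in> ?N" "snd q \<in> UI" for q
      proof -
        have qN: "q \<in> N'" using q N' by blast
        have "pos k (B q) = 1" by (rule pos_high) (use N'B[OF qN] N'k[OF qN] ge[OF qN] in auto)
        then show ?thesis using N'B(2)[OF qN] by (simp add: phi_def)
      qed
      moreover have "continuous_on ?N (\<lambda>q. wt k (snd q))" by (intro wt_cont continuous_intros)
      ultimately show ?thesis using r(1) by (intro exI[of _ r] conjI exI[of _ "\<lambda>q. wt k (snd q)"]) auto
    qed
  qed
qed

definition is_ext :: "nat => (real \<times> real => 'a) => real => real => (real \<times> real => real) => bool" where
  "is_ext k B t0 d e \<longleftrightarrow> continuous_on (OI \<times> Iv t0 d) e \<and> (\<forall>x\<in>OI. \<forall>t\<in>Iv t0 d \<inter> UI. e (x, t) = phi k (B (x, t)))"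

text \<open>Local extensions agree at interior heights, where they are prescribed, and then at the
  ends by density; so they glue to one continuous function.\<close>

lemma ext_exists:
  assumes B: "box B t0 \<delta>"
  shows "\<exists>e. is_ext k B t0 \<delta> e"
proof -
  have "\<exists>r e. r > 0 \<and> continuous_on (nbd (fst q) (snd q) r t0 \<delta>) e \<and>
      (\<forall>q'\<in>nbd (fst q) (snd q) r t0 \<delta>. snd q' \<in> UI --> e q' = phi k (B q'))" if "q \<in> OI \<times> Iv t0 \<delta>" for q
    using local_ext[OF B, of "fst q" "snd q" k] that by (auto simp: mem_Times_iff)
  then obtain R e where Re: "\<And>q. q \<in> OI \<times> Iv t0 \<delta> ==> R q > 0 \<and> continuous_on (nbd (fst q) (snd q) (R q) t0 \<delta>) (e q) \<and>
      (\<forall>q'\<in>nbd (fst q) (snd q) (R q) t0 \<delta>. snd q' \<in> UI --> e q q' = phi k (B q'))" by metis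
  define f where "f q = e q q" for q
  have fe: "f q' = e q q'" if q: "q \<in> OI \<times> Iv t0 \<delta>" and q': "q' \<in> nbd (fst q) (snd q) (R q) t0 \<delta>" for q q'
  proof -
    have q'': "q' \<in> OI \<times> Iv t0 \<delta>" using q' nbd_sub by blast
    obtain x t where xt: "q' = (x, t)" by fastforce
    have xt': "x \<in> OI" "t \<in> Iv t0 \<delta>" using q'' xt by auto
    have d: "\<bar>x - fst q\<bar> < R q" "\<bar>t - snd q\<bar> < R q" using q' xt by (auto simp: nbd_def)
    define r where "r = min (R q') (R q - \<bar>t - snd q\<bar>)"
    have r: "r > 0" "r \<le> R q'" "r \<le> R q - \<bar>t - snd q\<bar>" using Re[OF q''] d by (auto simp: r_def)
    have "continuous_on {s \<in> Iv t0 \<delta>. \<bar>s - t\<bar> < R q'} (\<lambda>s. e q' (x, s))"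
      using nbd_slice_cont[of x t "R q'" t0 \<delta> "e q'" x] Re[OF q''] xt xt' by auto
    then have c1: "continuous_on {s \<in> Iv t0 \<delta>. \<bar>s - t\<bar> < r} (\<lambda>s. e q' (x, s))"
      by (rule continuous_on_subset) (use r in auto)
    have "continuous_on {s \<in> Iv t0 \<delta>. \<bar>s - snd q\<bar> < R q} (\<lambda>s. e q (x, s))"
      using nbd_slice_cont[of "fst q" "snd q" "R q" t0 \<delta> "e q" x] Re[OF q] xt' d by auto
    moreover have near: "\<bar>s - snd q\<bar> < R q" if "\<bar>s - t\<bar> < r" for s
    proof -
      have "\<bar>s - snd q\<bar> \<le> \<bar>s - t\<bar> + \<bar>t - snd q\<bar>" by simp
      then show ?thesis using that r(3) by linarith
    qed
    ultimately have c2: "continuous_on {s \<in> Iv t0 \<delta>. \<bar>s - t\<bar> < r} (\<lambda>s. e q (x, s))"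
      by (elim continuous_on_subset) auto
    have "e q' (x, t) = e q (x, t)"
    proof (rule lim_eq[OF B xt'(2) r(1) c1 c2])
      fix s assume s: "s \<in> Iv t0 \<delta>" "s \<in> UI" "\<bar>s - t\<bar> < r"
      have "(x, s) \<in> nbd (fst q') (snd q') (R q') t0 \<delta>" using s xt xt' r Re[OF q''] by (auto simp: nbd_def)
      moreover have "(x, s) \<in> nbd (fst q) (snd q) (R q) t0 \<delta>" using s xt' d near[OF s(3)] by (auto simp: nbd_def)
      ultimately show "e q' (x, s) = e q (x, s)" using Re[OF q''] Re[OF q] s(2) by auto
    qed
    then show ?thesis by (simp add: f_def xt)
  qed
  have "continuous_on (OI \<times> Iv t0 \<delta>) f"
    unfolding continuous_on_eq_continuous_within
  proof
    fix q assume q: "q \<in> OI \<times> Iv t0 \<delta>"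
    let ?N = "nbd (fst q) (snd q) (R q) t0 \<delta>"
    have "continuous_on ?N f" using Re[OF q] fe[OF q] by (metis (mono_tags, lifting) continuous_on_cong)
    moreover have qN: "q \<in> ?N" using nbd_center[of "fst q" "snd q" t0 \<delta> "R q"] q Re[OF q] by auto
    ultimately have "continuous (at q within ?N) f" by (simp add: continuous_on_eq_continuous_within)
    moreover have "at q within ?N = at q within OI \<times> Iv t0 \<delta>"
    proof (rule at_within_nhd[where S = "{fst q - R q<..<fst q + R q} \<times> {snd q - R q<..<snd q + R q}"])
      show "q \<in> {fst q - R q<..<fst q + R q} \<times> {snd q - R q<..<snd q + R q}"
        using Re[OF q] by (simp add: mem_Times_iff)
      show "?N \<inter> {fst q - R q<..<fst q + R q} \<times> {snd q - R q<..<snd q + R q} - {q} =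
        OI \<times> Iv t0 \<delta> \<inter> {fst q - R q<..<fst q + R q} \<times> {snd q - R q<..<snd q + R q} - {q}"
        by (auto simp: nbd_def mem_Times_iff abs_less_iff)
    qed (simp add: open_Times)
    ultimately show "continuous (at q within OI \<times> Iv t0 \<delta>) f" by simp
  qed
  moreover have "f (x, t) = phi k (B (x, t))" if "x \<in> OI" "t \<in> Iv t0 \<delta> \<inter> UI" for x t
    using Re[of "(x, t)"] nbd_center[of x t t0 \<delta>] that by (auto simp: f_def)
  ultimately show ?thesis unfolding is_ext_def by blast
qed

end

section \<open>The strip coordinate\<close>

context ribboned_surface
begin

text \<open>\<open>g\<close> lifts the side \<open>s\<close> of a chart to the strip, openly and
  with the central plaque on the boundary of the strip. A lift is recorded because \<open>q\<close>
  alone does not tell the two sides of a cut leaf apart.\<close>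

definition side_param :: "(real \<times> real) set => (real \<times> real => 'a) => (real \<times> real => 'a) => real => (real \<times> real => real \<times> real) => bool" where
  "side_param S q C s g \<longleftrightarrow> continuous_on (OI \<times> {0..<1/2}) g \<and>
     (\<forall>D. openin (top_of_set (OI \<times> {0..<1/2})) D --> openin (top_of_set (UNIV \<times> {0..1})) (g ` D)) \<and>
     (\<forall>x\<in>OI. \<forall>u\<in>{0..<1/2}. g (x, u) \<in> S \<and> q (g (x, u)) = C (x, s * u) \<and> (snd (g (x, u)) \<in> UI \<longleftrightarrow> 0 < u))"

text \<open>All that the gluing needs to know about a strip. The last two clauses match its boundary
  with chart sides: every side contained in \<open>W\<close> has a lift, and every boundary point
  lies on such a lift.\<close>

definition strip_param :: "'a set => (real \<times> real) set => (real \<times> real => 'a) => bool" where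
  "strip_param W S q \<longleftrightarrow> UNIV \<times> UI \<subseteq> S \<and> S \<subseteq> UNIV \<times> {0..1} \<and> openin (top_of_set (UNIV \<times> {0..1})) S \<and>
     continuous_map (top_of_set S) Z q \<and> inj_on q (UNIV \<times> UI) \<and> q ` (UNIV \<times> UI) = W \<and>
     (\<forall>t\<in>UI. q ` (UNIV \<times> {t}) \<in> \<Delta>) \<and>
     (\<forall>C J m. cut_chart C J --> chart_side J m --> (\<forall>x\<in>OI. \<forall>u\<in>UI. C (x, m * u) \<in> W) --> (\<exists>g. side_param S q C m g)) \<and>
     (\<forall>s\<in>S. snd s \<notin> UI --> q s \<in> \<Union>Sp \<and> (\<exists>C J m g x0. cut_chart C J \<and> chart_side J m \<and>
        (\<forall>x\<in>OI. \<forall>u\<in>UI. C (x, m * u) \<in> W) \<and> side_param S q C m g \<and> x0 \<in> OI \<and> s = g (x0, 0)))"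

end

lemma ln_ratio_less:
  assumes "0 < e" "e < e'" "e' < (M::real)"
  shows "ln e - ln (M - e) < ln e' - ln (M - e')"
proof -
  have "ln e < ln e'" "ln (M - e') < ln (M - e)" using assms by simp_all
  then show ?thesis by linarith
qed

lemma ln_ratio_onto:
  assumes "0 < (M::real)"
  obtains e where "0 < e" "e < M" "ln e - ln (M - e) = y"
proof -
  \<comment> \<open>The inverse of the logit, that is the logistic function, scaled to the interval
    \<open>(0, M)\<close>.\<close>
  let ?e = "M * exp y / (1 + exp y)"
  have p: "0 < 1 + exp y" by (simp add: add_pos_pos)
  have d: "M - ?e = M / (1 + exp y)" using p by (simp add: field_simps)
  have "0 < ?e" "0 < M - ?e" unfolding d using assms p by simp_all
  moreover have "ln ?e - ln (M - ?e) = y"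
    unfolding d using assms p by (simp add: ln_div ln_mult)
  ultimately show ?thesis using that[of ?e] by simp
qed

section \<open>The mass before a point, and the strip it defines\<close>

context box_family
begin

definition ext :: "nat => (real \<times> real => 'a) => real => real => real \<times> real => real" where
  "ext k B t0 d = (SOME e. is_ext k B t0 d e)"

lemma ext:
  assumes "box B t0 d"
  shows "continuous_on (OI \<times> Iv t0 d) (ext k B t0 d)"
    "\<And>x t. x \<in> OI ==> t \<in> Iv t0 d ==> t \<in> UI ==> ext k B t0 d (x, t) = phi k (B (x, t))"
proof -
  have "is_ext k B t0 d (ext k B t0 d)" unfolding ext_def using ext_exists[OF assms] by (rule someI_ex)
  then show "continuous_on (OI \<times> Iv t0 d) (ext k B t0 d)"
    "\<And>x t. x \<in> OI ==> t \<in> Iv t0 d ==> t \<in> UI ==> ext k B t0 d (x, t) = phi k (B (x, t))"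
    unfolding is_ext_def by blast+
qed

lemma ext_col_cont:
  assumes B: "box B t0 d" and f: "continuous_on A f" "\<And>s. s \<in> A ==> f s \<in> OI" "A \<subseteq> Iv t0 d"
  shows "continuous_on A (\<lambda>s. ext k B t0 d (f s, s))"
  by (intro continuous_on_compose2[OF ext(1)[OF B]] continuous_intros f(1)) (use f in auto)

lemma ext_range:
  assumes B: "box B t0 d" and x: "x \<in> OI" and t: "t \<in> Iv t0 d"
  shows "0 \<le> ext k B t0 d (x, t)" "ext k B t0 d (x, t) \<le> wt k t"
proof -
  let ?A = "{s \<in> Iv t0 d. \<bar>s - t\<bar> < 1}"
  have A: "?A \<subseteq> Iv t0 d" by auto
  have c: "continuous_on ?A (\<lambda>s. ext k B t0 d (x, s))" using ext_col_cont[OF B continuous_on_const _ A] x by blast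
  show "0 \<le> ext k B t0 d (x, t)"
    by (rule lim_nonneg[OF B t _ c]) (use ext(2)[OF B x] phi_range(1) in auto)
  have "0 \<le> wt k t - ext k B t0 d (x, t)"
  proof (rule lim_nonneg[OF B t zero_less_one, of "\<lambda>s. wt k s - ext k B t0 d (x, s)"])
    show "continuous_on ?A (\<lambda>s. wt k s - ext k B t0 d (x, s))" by (intro continuous_intros wt_cont c)
    show "0 \<le> wt k s - ext k B t0 d (x, s)" if "s \<in> Iv t0 d" "s \<in> UI" for s
      using ext(2)[OF B x that] phi_range(2)[of k "B (x, s)"] box_dest(7)[OF B x that] by simp
  qed
  then show "ext k B t0 d (x, t) \<le> wt k t" by simp
qed

lemma ext_mono:
  assumes B: "box B t0 d" and x: "x \<in> OI" "x' \<in> OI" "x \<le> x'" and t: "t \<in> Iv t0 d"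
  shows "ext k B t0 d (x, t) \<le> ext k B t0 d (x', t)"
proof -
  let ?A = "{s \<in> Iv t0 d. \<bar>s - t\<bar> < 1}"
  have A: "?A \<subseteq> Iv t0 d" by auto
  have "0 \<le> ext k B t0 d (x', t) - ext k B t0 d (x, t)"
  proof (rule lim_nonneg[OF B t zero_less_one, of "\<lambda>s. ext k B t0 d (x', s) - ext k B t0 d (x, s)"])
    show "continuous_on ?A (\<lambda>s. ext k B t0 d (x', s) - ext k B t0 d (x, s))"
      using ext_col_cont[OF B continuous_on_const _ A] x by (intro continuous_intros) blast+
    show "0 \<le> ext k B t0 d (x', s) - ext k B t0 d (x, s)" if s: "s \<in> Iv t0 d" "s \<in> UI" for s
    proof -
      have "rho (B (x, s)) \<le> rho (B (x', s))" using box_dest(8)[OF B x(1,2) s] x(3) by (cases "x = x'") auto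
      then have "phi k (B (x, s)) \<le> phi k (B (x', s))"
        by (intro phi_mono) (use box_dest(6,7)[OF B x(1) s] box_dest(6,7)[OF B x(2) s] in auto)
      then show ?thesis using ext(2)[OF B x(1) s] ext(2)[OF B x(2) s] by simp
    qed
  qed
  then show ?thesis by simp
qed

text \<open>At interior heights both extensions are \<open>phi\<close> at the same point of
  \<open>W\<close>; continuity of \<open>\<xi>\<close> carries the identity to the end.\<close>

lemma ext_trans:
  assumes B: "box B t0 d" and B': "box B' t0' d'" and tr: "trans B t0 d B' t0' d' x0 t x'"
  obtains r \<xi> where "r > 0" "continuous_on (nbd x0 t r t0 d) \<xi>" "\<xi> (x0, t) = x'"
    "\<And>q. q \<in> nbd x0 t r t0 d ==> \<xi> q \<in> OI \<and> snd q \<in> Iv t0' d' \<and> B q = B' (\<xi> q, snd q)"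
    "\<And>q k. q \<in> nbd x0 t r t0 d ==> ext k B t0 d q = ext k B' t0' d' (\<xi> q, snd q)"
proof -
  obtain r \<xi> where r: "r > 0" "continuous_on (nbd x0 t r t0 d) \<xi>" "\<xi> (x0, t) = x'"
    "\<And>q. q \<in> nbd x0 t r t0 d ==> \<xi> q \<in> OI \<and> snd q \<in> Iv t0' d' \<and> B q = B' (\<xi> q, snd q)"
    using tr unfolding trans_def by blast
  have "ext k B t0 d q = ext k B' t0' d' (\<xi> q, snd q)" if q: "q \<in> nbd x0 t r t0 d" for q k
  proof -
    obtain x s where xs: "q = (x, s)" by fastforce
    have xs': "x \<in> OI" "s \<in> Iv t0 d" "\<bar>x - x0\<bar> < r" "\<bar>s - t\<bar> < r" using q xs by (auto simp: nbd_def)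
    define r' where "r' = r - \<bar>s - t\<bar>"
    have r': "r' > 0" using xs' by (simp add: r'_def)
    let ?A = "{s' \<in> Iv t0 d. \<bar>s' - s\<bar> < r'}"
    have near: "(x, s') \<in> nbd x0 t r t0 d" if "s' \<in> Iv t0 d" "\<bar>s' - s\<bar> < r'" for s'
    proof -
      have "\<bar>s' - t\<bar> \<le> \<bar>s' - s\<bar> + \<bar>s - t\<bar>" by simp
      then have "\<bar>s' - t\<bar> < r" using that(2) by (simp add: r'_def)
      then show ?thesis using xs' that by (simp add: nbd_def)
    qed
    have A: "?A \<subseteq> Iv t0 d" by auto
    have "ext k B t0 d (x, s) = ext k B' t0' d' (\<xi> (x, s), s)"
    proof (rule lim_eq[OF B xs'(2) r'])
      show "continuous_on ?A (\<lambda>s. ext k B t0 d (x, s))" using ext_col_cont[OF B continuous_on_const _ A] xs'(1) by blast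
      have "continuous_on ?A (\<lambda>s. \<xi> (x, s))"
        by (intro continuous_on_compose2[OF r(2)] continuous_intros) (use near in auto)
      then show "continuous_on ?A (\<lambda>s. ext k B' t0' d' (\<xi> (x, s), s))"
        by (rule ext_col_cont[OF B']) (use r(4) near in fastforce)+
      fix s' assume s': "s' \<in> Iv t0 d" "s' \<in> UI" "\<bar>s' - s\<bar> < r'"
      have x': "\<xi> (x, s') \<in> OI" "s' \<in> Iv t0' d'" "B (x, s') = B' (\<xi> (x, s'), s')" using r(4)[OF near[OF s'(1,3)]] by auto
      show "ext k B t0 d (x, s') = ext k B' t0' d' (\<xi> (x, s'), s')"
        using ext(2)[OF B xs'(1) s'(1,2)] ext(2)[OF B' x'(1,2) s'(2)] x'(3) by simp
    qed
    then show ?thesis by (simp add: xs)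
  qed
  then show ?thesis using that[OF r] by blast
qed

lemma ext_self:
  assumes x: "x \<in> OI" and t: "t \<in> Ik k"
  shows "ext k (Bk k) (tk k) (dk k) (x, t) = wt k t * chi x"
proof (rule lim_eq[OF bx t zero_less_one, of "\<lambda>s. ext k (Bk k) (tk k) (dk k) (x, s)" "\<lambda>s. wt k s * chi x"])
  have A: "{s \<in> Ik k. \<bar>s - t\<bar> < 1} \<subseteq> Ik k" by auto
  show "continuous_on {s \<in> Ik k. \<bar>s - t\<bar> < 1} (\<lambda>s. ext k (Bk k) (tk k) (dk k) (x, s))"
    using ext_col_cont[OF bx continuous_on_const _ A] x by blast
  show "continuous_on {s \<in> Ik k. \<bar>s - t\<bar> < 1} (\<lambda>s. wt k s * chi x)" by (intro continuous_intros wt_cont)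
  fix s assume s: "s \<in> Ik k" "s \<in> UI"
  have "Bk k (x, s) \<in> W" "tau (Bk k (x, s)) = s" using box_dest(6,7)[OF bx x s] by auto
  then show "ext k (Bk k) (tk k) (dk k) (x, s) = wt k s * chi x"
    using ext(2)[OF bx x s] pos_on[of "Bk k (x, s)" k x] s x by (simp add: phi_def)
qed

text \<open>Some box of the family contains the point in its inner half. There the weight is
  positive and \<open>chi\<close> is strictly increasing, so already this one summand grows.\<close>

lemma ext_strict:
  assumes B: "box B t0 \<delta>" and x: "x \<in> OI" "x' \<in> OI" "x < x'" and t: "t \<in> Iv t0 \<delta>"
  shows "\<exists>k. ext k B t0 \<delta> (x, t) < ext k B t0 \<delta> (x', t)"
proof -
  obtain k x1 where k: "\<bar>t - tk k\<bar> < dk k / 2" "\<bar>x1\<bar> < 1/2" "trans B t0 \<delta> (Bk k) (tk k) (dk k) x t x1"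
    using cov[OF B x(1) t] by blast
  obtain r \<xi> where r: "r > 0" "continuous_on (nbd x t r t0 \<delta>) \<xi>" "\<xi> (x, t) = x1"
    "\<And>q. q \<in> nbd x t r t0 \<delta> ==> \<xi> q \<in> OI \<and> snd q \<in> Ik k \<and> B q = Bk k (\<xi> q, snd q)"
    "\<And>q j. q \<in> nbd x t r t0 \<delta> ==> ext j B t0 \<delta> q = ext j (Bk k) (tk k) (dk k) (\<xi> q, snd q)"
    using ext_trans[OF B bx k(3)] by metis
  have form: "ext k B t0 \<delta> q = wt k (snd q) * chi (\<xi> q)" if "q \<in> nbd x t r t0 \<delta>" for q
    using r(5)[OF that] ext_self[of "\<xi> q" "snd q" k] r(4)[OF that] by simp
  have xt: "(x, t) \<in> nbd x t r t0 \<delta>" by (rule nbd_center[OF x(1) t r(1)])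
  have e: "1/2 - x1 > 0" using k(2) by linarith
  obtain d where d: "d > 0" "\<And>q. q \<in> nbd x t r t0 \<delta> ==> dist q (x, t) < d ==> \<bar>\<xi> q - \<xi> (x, t)\<bar> < 1/2 - x1"
    using r(2)[unfolded continuous_on_iff, rule_format, OF xt e] by (auto simp: dist_real_def)
  \<comment> \<open>A point after \<open>x\<close> so close that \<open>\<xi>\<close> stays below
    \<open>1/2\<close>, within the range where \<open>chi\<close> is strictly increasing; beyond it,
    monotonicity is enough.\<close>
  define y where "y = x + min (min d r) (x' - x) / 2"
  have y: "x < y" "y < x'" "\<bar>y - x\<bar> < d" "\<bar>y - x\<bar> < r" using d(1) r(1) x(3) by (auto simp: y_def min_def field_simps)
  have yO: "y \<in> OI" using y x by auto
  have yt: "(y, t) \<in> nbd x t r t0 \<delta>" using yO t y r(1) by (simp add: nbd_def)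
  have "dist (y, t) (x, t) < d" using y by (simp add: dist_Pair_Pair dist_real_def)
  then have yhalf: "\<xi> (y, t) < 1/2" using d(2)[OF yt] r(3) by linarith
  have "0 \<le> \<xi> (y, t) - \<xi> (x, t)"
  proof (rule lim_nonneg[OF B t r(1), of "\<lambda>s. \<xi> (y, s) - \<xi> (x, s)"])
    show "continuous_on {s \<in> Iv t0 \<delta>. \<bar>s - t\<bar> < r} (\<lambda>s. \<xi> (y, s) - \<xi> (x, s))"
      using nbd_slice_cont[OF r(2) yO y(4)] nbd_slice_cont[OF r(2) x(1)] r(1) by (intro continuous_intros) auto
    fix s assume s: "s \<in> Iv t0 \<delta>" "s \<in> UI" "\<bar>s - t\<bar> < r"
    have n: "(x, s) \<in> nbd x t r t0 \<delta>" "(y, s) \<in> nbd x t r t0 \<delta>" using s x(1) yO y r(1) by (simp_all add: nbd_def)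
    have "rho (B (x, s)) < rho (B (y, s))" by (rule box_dest(8)[OF B x(1) yO s(1,2) y(1)])
    then have "\<xi> (x, s) < \<xi> (y, s)"
      using box_mono_iff[OF bx _ s(2), of k "\<xi> (x, s)" "\<xi> (y, s)"] r(4)[OF n(1)] r(4)[OF n(2)] by simp
    then show "0 \<le> \<xi> (y, s) - \<xi> (x, s)" by simp
  qed
  moreover have "\<xi> (y, t) \<noteq> \<xi> (x, t)"
  proof
    assume "\<xi> (y, t) = \<xi> (x, t)"
    then have "B (y, t) = B (x, t)" using r(4)[OF xt] r(4)[OF yt] by simp
    then show False using box_inj_end[OF B t yO x(1)] y by simp
  qed
  ultimately have "chi (\<xi> (x, t)) < chi (\<xi> (y, t))" using yhalf k(2) r(3) by (intro chi(6)) auto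
  then have "ext k B t0 \<delta> (x, t) < ext k B t0 \<delta> (y, t)" using form[OF xt] form[OF yt] wt(3)[OF k(1)] by simp
  also have "\<dots> \<le> ext k B t0 \<delta> (x', t)" using ext_mono[OF B yO x(2) _ t] y by simp
  finally show ?thesis by blast
qed

text \<open>The mass before a point, in box coordinates and up to the ends; \<open>gm\<close> is the
  same quantity on \<open>W\<close>, where no box is involved. Both are kept because on a cut leaf
  the mass depends on the side of approach and is not a function on \<open>Z\<close>.\<close>

definition E :: "(real \<times> real => 'a) => real => real => real \<times> real => real" where
  "E B t0 d q = (\<Sum>k. (1/2)^k * ext k B t0 d q)"

definition mass :: "real => real" where "mass t = (\<Sum>k. (1/2)^k * wt k t)"

definition gm :: "'a => real" where "gm p = (\<Sum>k. (1/2)^k * phi k p)"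

lemma mass_cont: "continuous_on A f ==> continuous_on A (\<lambda>a. mass (f a))"
  unfolding mass_def by (rule half_series_cont) (auto simp: wt intro!: wt_cont)

lemma ext_le1: "box B t0 d ==> x \<in> OI ==> t \<in> Iv t0 d ==> ext k B t0 d (x, t) \<le> 1"
  using ext_range(2) wt(2) order_trans by blast

lemma E_cont: assumes B: "box B t0 d" shows "continuous_on (OI \<times> Iv t0 d) (E B t0 d)"
proof -
  have "continuous_on (OI \<times> Iv t0 d) (\<lambda>q. \<Sum>k. (1/2)^k * ext k B t0 d q)"
    by (rule half_series_cont) (use ext(1)[OF B] ext_range(1)[OF B] ext_le1[OF B] in auto)
  then show ?thesis by (simp add: E_def[abs_def])
qed

lemma E_less:
  assumes B: "box B t0 d" and x: "x \<in> OI" "x' \<in> OI" "x < x'" and t: "t \<in> Iv t0 d"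
  shows "E B t0 d (x, t) < E B t0 d (x', t)"
proof -
  obtain j where j: "ext j B t0 d (x, t) < ext j B t0 d (x', t)" using ext_strict[OF B x t] by blast
  show ?thesis unfolding E_def
    by (rule half_series_less[where j = j]) (use j ext_range(1)[OF B x(1) t] ext_mono[OF B x(1,2) _ t] x(3) ext_le1[OF B x(2) t] in auto)
qed

text \<open>The weak bounds hold termwise. They become strict by moving halfway towards either edge
  of the row, which changes the mass strictly.\<close>

lemma E_bounds:
  assumes B: "box B t0 d" and x: "x \<in> OI" and t: "t \<in> Iv t0 d"
  shows "0 < E B t0 d (x, t)" "E B t0 d (x, t) < mass t"
proof -
  have ge: "0 \<le> E B t0 d (y, t)" if "y \<in> OI" for y
    unfolding E_def by (intro suminf_nonneg half_summable) (use ext_range(1)[OF B that t] ext_le1[OF B that t] in auto)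
  have le: "E B t0 d (y, t) \<le> mass t" if "y \<in> OI" for y
    unfolding E_def mass_def by (rule half_series_le) (use ext_range[OF B that t] wt(2) in auto)
  have l: "(x - 1) / 2 \<in> OI" "(x - 1) / 2 < x" "(x + 1) / 2 \<in> OI" "x < (x + 1) / 2" using x by auto
  show "0 < E B t0 d (x, t)" using E_less[OF B l(1) x l(2) t] ge[OF l(1)] by simp
  show "E B t0 d (x, t) < mass t" using E_less[OF B x l(3,4) t] le[OF l(3)] by simp
qed

lemma E_gm:
  assumes B: "box B t0 d" and x: "x \<in> OI" and t: "t \<in> Iv t0 d" "t \<in> UI"
  shows "E B t0 d (x, t) = gm (B (x, t))"
  unfolding E_def gm_def using ext(2)[OF B x t] by simp

lemma E_trans:
  assumes B: "box B t0 d" and B': "box B' t0' d'" and tr: "trans B t0 d B' t0' d' x0 t x'"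
    and x0: "x0 \<in> OI" and t: "t \<in> Iv t0 d"
  shows "E B t0 d (x0, t) = E B' t0' d' (x', t)" "x' \<in> OI" "t \<in> Iv t0' d'"
proof -
  obtain r \<xi> where r: "r > 0" "\<xi> (x0, t) = x'"
    "\<And>q. q \<in> nbd x0 t r t0 d ==> \<xi> q \<in> OI \<and> snd q \<in> Iv t0' d' \<and> B q = B' (\<xi> q, snd q)"
    "\<And>q k. q \<in> nbd x0 t r t0 d ==> ext k B t0 d q = ext k B' t0' d' (\<xi> q, snd q)"
    using ext_trans[OF B B' tr] by metis
  have c: "(x0, t) \<in> nbd x0 t r t0 d" by (rule nbd_center[OF x0 t r(1)])
  have "ext k B t0 d (x0, t) = ext k B' t0' d' (x', t)" for k using r(4)[OF c, of k] r(2) by simp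
  then show "E B t0 d (x0, t) = E B' t0' d' (x', t)" by (simp add: E_def)
  show "x' \<in> OI" "t \<in> Iv t0' d'" using r(3)[OF c] r(2) by auto
qed

lemma gm_bounds: assumes p: "p \<in> W" shows "0 < gm p" "gm p < mass (tau p)"
proof -
  obtain B d where B: "box B (tau p) d" "B (0, tau p) = p" using interior_box_exists[OF p] by blast
  have t: "tau p \<in> Iv (tau p) d" "tau p \<in> UI" using box_dest(1,3)[OF B(1)] tau(1)[OF p] by (auto simp: Iv_def)
  show "0 < gm p" "gm p < mass (tau p)" using E_bounds[OF B(1) _ t(1), of 0] E_gm[OF B(1) _ t, of 0] B(2) by auto
qed

text \<open>Monotonicity of the summands gives only a weak inequality. Strictness is gained inside a
  box around \<open>p\<close>, at a point after \<open>p\<close> but not after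
  \<open>q\<close>.\<close>

lemma gm_less:
  assumes p: "p \<in> W" "q \<in> W" "tau p = tau q" "rho p < rho q"
  shows "gm p < gm q"
proof -
  obtain B d where B: "box B (tau p) d" "B (0, tau p) = p" using interior_box_exists[OF p(1)] by blast
  have t: "tau p \<in> Iv (tau p) d" "tau p \<in> UI" using box_dest(1,3)[OF B(1)] tau(1)[OF p(1)] by (auto simp: Iv_def)
  have O: "(0::real) \<in> OI" "(1/2::real) \<in> OI" "(0::real) < 1/2" by auto
  have ex: "\<exists>x\<in>OI. 0 < x \<and> rho (B (x, tau p)) \<le> rho q"
  proof (cases "rho (B (1/2, tau p)) \<le> rho q")
    case False
    then have lt: "rho (B (0, tau p)) < rho q" "rho q < rho (B (1/2, tau p))" using p(4) B(2) by auto
    obtain x where x: "0 < x" "x < 1/2" "q = B (x, tau p)"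
      using leaf_IVT[OF B(1) t p(2) p(3)[symmetric] O lt] by blast
    then have "x \<in> OI" by auto
    then show ?thesis using x by (intro bexI[of _ x]) auto
  qed (use O in blast)
  then obtain x where x: "x \<in> OI" "0 < x" "rho (B (x, tau p)) \<le> rho q" by blast
  have bW: "B (x, tau p) \<in> W" "tau (B (x, tau p)) = tau p" using box_dest(6,7)[OF B(1) x(1) t] by auto
  have "gm p < gm (B (x, tau p))"
    using E_less[OF B(1) O(1) x(1,2) t(1)] E_gm[OF B(1) O(1) t] E_gm[OF B(1) x(1) t] B(2) by simp
  also have "\<dots> \<le> gm q"
    unfolding gm_def
  proof (rule half_series_le)
    show "0 \<le> phi k (B (x, tau p))" "phi k q \<le> 1" for k
      using phi_range[of k] wt(2)[of k "tau q"] order_trans by blast+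
    show "phi k (B (x, tau p)) \<le> phi k q" for k using phi_mono[OF bW(1) p(2)] bW(2) p(3) x(3) by simp
  qed
  finally show ?thesis .
qed

text \<open>Far out on a leaf the first \<open>K\<close> boxes lie entirely on one side, and all
  others together carry at most \<open>2 * (1/2)^K\<close>. So the mass before a point comes
  arbitrarily close to 0 and to the total, and the intermediate value theorem applies.\<close>

lemma gm_onto:
  assumes t: "t \<in> UI" and e: "0 < e" "e < mass t"
  obtains p where "p \<in> W" "tau p = t" "gm p = e"
proof -
  obtain d \<kappa> where tr: "trivialization t d \<kappa>" using trivialization_exists[OF t] by blast
  have tI: "t \<in> {t - d<..<t + d}" using tr by (simp add: trivialization_def)
  have \<kappa>: "\<kappa> (y, t) \<in> W" "tau (\<kappa> (y, t)) = t" for y using tr tI unfolding trivialization_def by blast+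
  have onto: "\<exists>y. p = \<kappa> (y, t)" if "p \<in> W" "tau p = t" for p using tr tI that unfolding trivialization_def by blast
  have mono: "rho (\<kappa> (y, t)) < rho (\<kappa> (y', t))" if "y < y'" for y y' using tr tI that unfolding trivialization_def by blast
  have mono': "rho (\<kappa> (y, t)) \<le> rho (\<kappa> (y', t))" if "y \<le> y'" for y y' using mono[of y y'] that by (cases "y = y'") auto
  define h where "h y = gm (\<kappa> (y, t))" for y
  \<comment> \<open>Continuity at \<open>y\<close> is read off the box obtained by centring the
    trivialization at \<open>y\<close>, where the mass is the continuous function
    \<open>E\<close>.\<close>
  have ch: "continuous_on UNIV h"
    unfolding continuous_on_eq_continuous_within
  proof
    fix y
    let ?B = "\<lambda>q. \<kappa> (y + fst q, snd q)"
    have B: "box ?B t d" by (rule trivialization_box[OF t tr])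
    have tv: "t \<in> Iv t d" using box_dest(1,3)[OF B] by (auto simp: Iv_def)
    have "continuous_on {y - 1<..<y + 1} (\<lambda>z. E ?B t d (z - y, t))"
      by (intro continuous_on_compose2[OF E_cont[OF B]] continuous_intros) (use tv in auto)
    moreover have "E ?B t d (z - y, t) = h z" if "z \<in> {y - 1<..<y + 1}" for z
      using E_gm[OF B _ tv t, of "z - y"] that by (simp add: h_def)
    ultimately have "continuous_on {y - 1<..<y + 1} h" by (metis (no_types, lifting) continuous_on_cong)
    then have "isCont h y" by (simp add: continuous_on_eq_continuous_at)
    then show "continuous (at y within UNIV) h" by simp
  qed
  have hmono: "h y \<le> h y'" if "y \<le> y'" for y y'
    using gm_less[OF \<kappa>(1) \<kappa>(1), of y y'] \<kappa>(2) mono[of y y'] that by (cases "y = y'") (auto simp: h_def)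
  have small: "\<exists>K. 2 * (1/2::real)^K < r" if "r > 0" for r
  proof -
    have "\<exists>K. (1/2::real)^K < r / 2" using that by (intro real_arch_pow_inv) auto
    then show ?thesis by (simp add: field_simps)
  qed
  have O: "(-1/2::real) \<in> OI" "(1/2::real) \<in> OI" by auto
  have "\<exists>y. \<forall>k. t \<in> Ik k --> k < K --> rho (\<kappa> (y, t)) \<le> rho (Bk k (-1/2, t))" for K
  proof (induction K)
    case (Suc K)
    then obtain y where y: "\<And>k. t \<in> Ik k ==> k < K ==> rho (\<kappa> (y, t)) \<le> rho (Bk k (-1/2, t))" by blast
    show ?case
    proof (cases "t \<in> Ik K")
      case True
      then obtain y' where y': "Bk K (-1/2, t) = \<kappa> (y', t)" using onto box_dest(6,7)[OF bx O(1) True t] by blast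
      have "rho (\<kappa> (min y y', t)) \<le> rho (Bk k (-1/2, t))" if "t \<in> Ik k" "k < Suc K" for k
        using that y[OF that(1)] mono'[of "min y y'" y] mono'[of "min y y'" y'] y' by (cases "k = K") (auto intro: order_trans)
      then show ?thesis by blast
    next
      case False
      then show ?thesis using y by (metis less_Suc_eq)
    qed
  qed simp
  moreover have "\<exists>y. \<forall>k. t \<in> Ik k --> k < K --> rho (Bk k (1/2, t)) \<le> rho (\<kappa> (y, t))" for K
  proof (induction K)
    case (Suc K)
    then obtain y where y: "\<And>k. t \<in> Ik k ==> k < K ==> rho (Bk k (1/2, t)) \<le> rho (\<kappa> (y, t))" by blast
    show ?case
    proof (cases "t \<in> Ik K")
      case True
      then obtain y' where y': "Bk K (1/2, t) = \<kappa> (y', t)" using onto box_dest(6,7)[OF bx O(2) True t] by blast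
      have "rho (Bk k (1/2, t)) \<le> rho (\<kappa> (max y y', t))" if "t \<in> Ik k" "k < Suc K" for k
        using that y[OF that(1)] mono'[of y "max y y'"] mono'[of y' "max y y'"] y' by (cases "k = K") (auto intro: order_trans)
      then show ?thesis by blast
    next
      case False
      then show ?thesis using y by (metis less_Suc_eq)
    qed
  qed simp
  ultimately have lim: "\<exists>y. \<forall>k. t \<in> Ik k --> k < K --> rho (\<kappa> (y, t)) \<le> rho (Bk k (-1/2, t))"
     "\<exists>y. \<forall>k. t \<in> Ik k --> k < K --> rho (Bk k (1/2, t)) \<le> rho (\<kappa> (y, t))" for K by blast+
  have t01: "t \<in> {0..1}" using t by auto
  have "\<exists>y. h y \<le> e"
  proof -
    obtain K where K: "2 * (1/2::real)^K < e" using small[OF e(1)] by blast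
    obtain y where y: "\<And>k. t \<in> Ik k ==> k < K ==> rho (\<kappa> (y, t)) \<le> rho (Bk k (-1/2, t))" using lim(1) by blast
    have "phi k (\<kappa> (y, t)) = 0" if "k < K" for k
    proof (cases "t \<in> Ik k")
      case True
      then show ?thesis using pos_low[OF \<kappa>(1), of y k] \<kappa>(2) y[OF True that] by (simp add: phi_def)
    qed (use wt(4)[OF t01] \<kappa>(2) in \<open>simp add: phi_def\<close>)
    then have "h y \<le> 2 * (1/2)^K" unfolding h_def gm_def
      by (intro half_series_tail) (use phi_range order_trans[OF phi_range(2) wt(2)] in auto)
    then show ?thesis using K by (intro exI[of _ y]) simp
  qed
  then obtain y1 where y1: "h y1 \<le> e" by blast
  have "\<exists>y. e \<le> h y"
  proof -
    obtain K where K: "2 * (1/2::real)^K < mass t - e" using small[of "mass t - e"] e(2) by auto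
    obtain y where y: "\<And>k. t \<in> Ik k ==> k < K ==> rho (Bk k (1/2, t)) \<le> rho (\<kappa> (y, t))" using lim(2) by blast
    have z: "wt k t - phi k (\<kappa> (y, t)) = 0" if "k < K" for k
    proof (cases "t \<in> Ik k")
      case True
      then show ?thesis using pos_high[OF \<kappa>(1), of y k] \<kappa>(2) y[OF True that] by (simp add: phi_def)
    qed (use wt(4)[OF t01] \<kappa>(2) in \<open>simp add: phi_def\<close>)
    have r: "0 \<le> phi k (\<kappa> (y, t))" "phi k (\<kappa> (y, t)) \<le> wt k t" for k using phi_range[of k "\<kappa> (y, t)"] \<kappa>(2) by auto
    have s: "summable (\<lambda>k. (1/2)^k * wt k t)" "summable (\<lambda>k. (1/2)^k * phi k (\<kappa> (y, t)))"
      using wt r order_trans[OF r(2) wt(2)] by (auto intro!: half_summable)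
    have "mass t - h y = (\<Sum>k. (1/2)^k * (wt k t - phi k (\<kappa> (y, t))))"
      unfolding mass_def h_def gm_def suminf_diff[OF s] by (simp add: right_diff_distrib)
    also have "\<dots> \<le> 2 * (1/2)^K"
    proof (rule half_series_tail)
      show "0 \<le> wt k t - phi k (\<kappa> (y, t))" "wt k t - phi k (\<kappa> (y, t)) \<le> 1" for k using r[of k] wt(2)[of k t] by simp_all
    qed (rule z)
    finally show ?thesis using K by (intro exI[of _ y]) simp
  qed
  then obtain y2 where y2: "e \<le> h y2" by blast
  have "\<exists>y. h y = e"
  proof (cases "y1 \<le> y2")
    case True
    then show ?thesis using IVT'[of h y1 e y2] y1 y2 continuous_on_subset[OF ch, of "{y1..y2}"] by auto
  next
    case False
    then have "h y2 \<le> h y1" using hmono by simp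
    then show ?thesis using y1 y2 by (intro exI[of _ y1]) simp
  qed
  then show ?thesis using that \<kappa> unfolding h_def by blast
qed

definition G :: "(real \<times> real => 'a) => real => real => real \<times> real => real \<times> real" where
  "G B t0 d q = (ln (E B t0 d q) - ln (mass (snd q) - E B t0 d q), snd q)"

lemma G_fst_cont: assumes B: "box B t0 d" shows "continuous_on (OI \<times> Iv t0 d) (\<lambda>q. ln (E B t0 d q) - ln (mass (snd q) - E B t0 d q))"
proof -
  have b: "E B t0 d q \<noteq> 0" "mass (snd q) - E B t0 d q \<noteq> 0" if "q \<in> OI \<times> Iv t0 d" for q
    using E_bounds[OF B, of "fst q" "snd q"] that by (auto simp: mem_Times_iff)
  show ?thesis by (intro continuous_intros E_cont[OF B] mass_cont) (use b in auto)
qed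

lemma G_cont: "box B t0 d ==> continuous_on (OI \<times> Iv t0 d) (G B t0 d)"
  unfolding G_def[abs_def] by (intro continuous_intros G_fst_cont)

lemma G_open:
  assumes B: "box B t0 d" and D: "openin (top_of_set (OI \<times> Iv t0 d)) D"
  shows "openin (top_of_set (UNIV \<times> {0..1})) (G B t0 d ` D)"
proof -
  have "openin (top_of_set (UNIV \<times> Iv t0 d)) ((\<lambda>p. (ln (E B t0 d p) - ln (mass (snd p) - E B t0 d p), snd p)) ` D)"
  proof (rule fibrewise_increasing_open[OF _ _ G_fst_cont[OF B] _ D])
    fix x y t assume x: "x \<in> OI" "y \<in> OI" "t \<in> Iv t0 d" "x < y"
    have "E B t0 d (x, t) < E B t0 d (y, t)" by (rule E_less[OF B x(1,2,4,3)])
    then show "ln (E B t0 d (x, t)) - ln (mass (snd (x, t)) - E B t0 d (x, t)) < ln (E B t0 d (y, t)) - ln (mass (snd (y, t)) - E B t0 d (y, t))"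
      using ln_ratio_less E_bounds[OF B x(1,3)] E_bounds[OF B x(2,3)] by simp
  qed (auto simp: is_interval_oo)
  moreover have "openin (top_of_set (UNIV \<times> {0..1})) (UNIV \<times> Iv t0 d)" using Iv_open by (intro openin_Times) auto
  ultimately show ?thesis unfolding G_def[abs_def] using openin_trans by blast
qed

lemma G_eq_interior:
  assumes B: "box B t0 d" "x \<in> OI" "t \<in> Iv t0 d" "t \<in> UI" and B': "box B' t0' d'" "x' \<in> OI" "t' \<in> Iv t0' d'"
    and eq: "G B t0 d (x, t) = G B' t0' d' (x', t')"
  shows "B (x, t) = B' (x', t')"
proof -
  have tt: "t' = t" using eq by (simp add: G_def)
  have b': "t \<in> Iv t0' d'" using B'(3) tt by simp
  have W1: "B (x, t) \<in> W" "tau (B (x, t)) = t" using box_dest(6,7)[OF B] by auto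
  have W2: "B' (x', t) \<in> W" "tau (B' (x', t)) = t" using box_dest(6,7)[OF B'(1,2) b' B(4)] by auto
  have E1: "E B t0 d (x, t) = gm (B (x, t))" "E B' t0' d' (x', t) = gm (B' (x', t))"
    using E_gm[OF B] E_gm[OF B'(1,2) b' B(4)] by auto
  have "\<not> gm (B (x, t)) < gm (B' (x', t))" "\<not> gm (B' (x', t)) < gm (B (x, t))"
    using eq tt E1 ln_ratio_less[of "gm (B (x, t))" "gm (B' (x', t))" "mass t"] ln_ratio_less[of "gm (B' (x', t))" "gm (B (x, t))" "mass t"]
      gm_bounds[OF W1(1)] gm_bounds[OF W2(1)] W1(2) W2(2) by (auto simp: G_def)
  then have "\<not> rho (B (x, t)) < rho (B' (x', t))" "\<not> rho (B' (x', t)) < rho (B (x, t))"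
    using gm_less[OF W1(1) W2(1)] gm_less[OF W2(1) W1(1)] W1(2) W2(2) by auto
  then have "rho (B (x, t)) = rho (B' (x', t))" by simp
  then show ?thesis using rho_inj[OF W1(1) W2(1)] W1(2) W2(2) tt by simp
qed

text \<open>Injectivity on \<open>W\<close> says nothing about a cut leaf. If the two points
  differed, disjoint neighbourhoods of them would give two open sets of the strip sharing this
  point, hence sharing points at interior heights, where \<open>G_eq_interior\<close> yields a
  contradiction.\<close>

lemma G_eq:
  assumes B: "box B t0 d" "x \<in> OI" "t \<in> Iv t0 d" and B': "box B' t0' d'" "x' \<in> OI" "t' \<in> Iv t0' d'"
    and eq: "G B t0 d (x, t) = G B' t0' d' (x', t')"
  shows "B (x, t) = B' (x', t')"
proof (rule ccontr)
  assume ne: "B (x, t) \<noteq> B' (x', t')"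
  have "B (x, t) \<in> topspace Z" "B' (x', t') \<in> topspace Z" using box_dest(9)[OF B] box_dest(9)[OF B'] by auto
  then obtain N N' where N: "openin Z N" "openin Z N'" "B (x, t) \<in> N" "B' (x', t') \<in> N'" "disjnt N N'"
    using haus ne unfolding Hausdorff_space_def by metis
  let ?D = "{q \<in> OI \<times> Iv t0 d. B q \<in> N}" and ?D' = "{q \<in> OI \<times> Iv t0' d'. B' q \<in> N'}"
  have D: "openin (top_of_set (OI \<times> Iv t0 d)) ?D" "openin (top_of_set (OI \<times> Iv t0' d')) ?D'"
    using openin_continuous_map_preimage[OF box_dest(5)[OF B(1)] N(1)] openin_continuous_map_preimage[OF box_dest(5)[OF B'(1)] N(2)] by auto
  define U where "U = G B t0 d ` ?D \<inter> G B' t0' d' ` ?D'"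
  have U: "openin (top_of_set (UNIV \<times> {0..1})) U" unfolding U_def
    by (intro openin_Int G_open[OF B(1) D(1)] G_open[OF B'(1) D(2)])
  define s where "s = G B t0 d (x, t)"
  have "(x, t) \<in> ?D" "(x', t') \<in> ?D'" using B B' N by auto
  then have "s \<in> U" unfolding U_def s_def using eq by blast
  then obtain e where e: "e > 0" "\<And>w. w \<in> UNIV \<times> {0..1} ==> dist w s < e ==> w \<in> U"
    using U unfolding openin_euclidean_subtopology_iff by blast
  obtain t'' where t'': "t'' \<in> Iv t0 d" "t'' \<in> UI" "\<bar>t'' - t\<bar> < e" using approach_UI[OF B(1,3) e(1)] by blast
  have "dist (fst s, t'') s < e" using t''(3) by (simp add: s_def G_def dist_Pair_Pair dist_real_def)
  then have "(fst s, t'') \<in> U" using e(2) t''(2) by auto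
  then obtain q q' where q: "q \<in> ?D" "q' \<in> ?D'" "G B t0 d q = (fst s, t'')" "G B' t0' d' q' = (fst s, t'')"
    unfolding U_def by force
  obtain y u y' u' where yu: "q = (y, u)" "q' = (y', u')" by fastforce
  have u: "u = t''" using q(3) by (simp add: G_def yu)
  have "B (y, u) = B' (y', u')"
    by (rule G_eq_interior[OF B(1) _ _ _ B'(1)]) (use q yu u t'' in auto)
  then show False using q(1,2) yu N(5) by (auto simp: disjnt_def)
qed

definition S :: "(real \<times> real) set" where
  "S = {G B t0 d q | B t0 d q. box B t0 d \<and> q \<in> OI \<times> Iv t0 d}"

text \<open>Well defined by \<open>G_eq\<close>: the choice of the box is forgotten, and a boundary
  point of the strip takes its image from any box that reaches it.\<close>

definition quo :: "real \<times> real => 'a" where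
  "quo s = (SOME z. \<exists>B t0 d x t. box B t0 d \<and> x \<in> OI \<and> t \<in> Iv t0 d \<and> s = G B t0 d (x, t) \<and> z = B (x, t))"

lemma quo_G:
  assumes "box B t0 d" "x \<in> OI" "t \<in> Iv t0 d"
  shows "quo (G B t0 d (x, t)) = B (x, t)"
  unfolding quo_def
proof (rule some_equality)
  fix z assume "\<exists>B' t0' d' x' t'. box B' t0' d' \<and> x' \<in> OI \<and> t' \<in> Iv t0' d' \<and> G B t0 d (x, t) = G B' t0' d' (x', t') \<and> z = B' (x', t')"
  then show "z = B (x, t)" using G_eq[OF assms] by metis
qed (use assms in blast)

lemma S_cases:
  assumes "s \<in> S"
  obtains B t0 d x t where "box B t0 d" "x \<in> OI" "t \<in> Iv t0 d" "s = G B t0 d (x, t)" "quo s = B (x, t)" "snd s = t"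
proof -
  obtain B t0 d x t where b: "box B t0 d" "x \<in> OI" "t \<in> Iv t0 d" "s = G B t0 d (x, t)" using assms unfolding S_def by blast
  show ?thesis by (rule that[OF b]) (use quo_G[OF b(1-3)] b(4) in \<open>auto simp: G_def\<close>)
qed

lemma quo_cont: "continuous_map (top_of_set S) Z quo"
  unfolding continuous_map_def
proof (intro conjI allI impI)
  show "quo \<in> topspace (top_of_set S) \<rightarrow> topspace Z"
  proof
    fix s assume "s \<in> topspace (top_of_set S)"
    then have "s \<in> S" by simp
    then show "quo s \<in> topspace Z" by (rule S_cases) (use box_dest(9) in auto)
  qed
  fix N assume N: "openin Z N"
  have "openin (top_of_set S) {s \<in> S. quo s \<in> N}"
  proof (subst openin_subopen, clarify)
    fix a b assume s: "(a, b) \<in> S" "quo (a, b) \<in> N"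
    obtain B t0 d x t where b: "box B t0 d" "x \<in> OI" "t \<in> Iv t0 d" "(a, b) = G B t0 d (x, t)" "quo (a, b) = B (x, t)"
      using S_cases[OF s(1)] by metis
    let ?D = "{q \<in> OI \<times> Iv t0 d. B q \<in> N}"
    have "openin (top_of_set (OI \<times> Iv t0 d)) ?D" using openin_continuous_map_preimage[OF box_dest(5)[OF b(1)] N] by auto
    then have o: "openin (top_of_set (UNIV \<times> {0..1})) (G B t0 d ` ?D)" by (rule G_open[OF b(1)])
    have sub: "G B t0 d ` ?D \<subseteq> S" unfolding S_def using b(1) by blast
    have SU: "S \<subseteq> UNIV \<times> {0..1}" by (auto simp: S_def G_def Iv_def)
    have "openin (top_of_set S) (G B t0 d ` ?D)" using openin_subset_trans[OF o sub SU] .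
    moreover have "(a, b) \<in> G B t0 d ` ?D" using b s by auto
    moreover have "G B t0 d ` ?D \<subseteq> {s \<in> S. quo s \<in> N}" using sub quo_G[OF b(1)] by auto
    ultimately show "\<exists>T. openin (top_of_set S) T \<and> (a, b) \<in> T \<and> T \<subseteq> {s \<in> S. quo s \<in> N}" by blast
  qed
  then show "openin (top_of_set S) {x \<in> topspace (top_of_set S). quo x \<in> N}" by simp
qed

lemma quo_interior:
  assumes p: "p \<in> W"
  shows "(ln (gm p) - ln (mass (tau p) - gm p), tau p) \<in> S" "quo (ln (gm p) - ln (mass (tau p) - gm p), tau p) = p"
proof -
  obtain B d where B: "box B (tau p) d" "B (0, tau p) = p" using interior_box_exists[OF p] by blast
  have t: "tau p \<in> Iv (tau p) d" "tau p \<in> UI" using box_dest(1,3)[OF B(1)] tau(1)[OF p] by (auto simp: Iv_def)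
  have O: "(0::real) \<in> OI" by simp
  have e: "G B (tau p) d (0, tau p) = (ln (gm p) - ln (mass (tau p) - gm p), tau p)"
    using E_gm[OF B(1) O t] B(2) by (simp add: G_def)
  show "quo (ln (gm p) - ln (mass (tau p) - gm p), tau p) = p" unfolding e[symmetric] using quo_G[OF B(1) O t(1)] B(2) by simp
  show "(ln (gm p) - ln (mass (tau p) - gm p), tau p) \<in> S" unfolding e[symmetric] S_def using B(1) O t(1) by blast
qed

lemma quo_point:
  assumes t: "t \<in> UI"
  shows "(y, t) \<in> S" "quo (y, t) \<in> W" "tau (quo (y, t)) = t"
proof -
  have "0 < mass t" using gm_bounds[OF tau_c(2)[of 0 t]] tau_c(1)[of 0 t] t by auto
  then obtain e where e: "0 < e" "e < mass t" "ln e - ln (mass t - e) = y" using ln_ratio_onto by metis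
  obtain p where p: "p \<in> W" "tau p = t" "gm p = e" using gm_onto[OF t e(1,2)] by blast
  then have "(y, t) = (ln (gm p) - ln (mass (tau p) - gm p), tau p)" using e(3) by simp
  then show "(y, t) \<in> S" "quo (y, t) \<in> W" "tau (quo (y, t)) = t" using quo_interior[OF p(1)] p by simp_all
qed

text \<open>An end box is the chart side up to a flip of the rows and a change of height; both are
  undone before \<open>G\<close> is applied.\<close>

lemma side_param_of_end_data:
  assumes ed: "end_data C J s B t0 \<delta> e d h"
  shows "side_param S quo C s (\<lambda>p. G B t0 \<delta> (e * fst p, h (snd p)))"
proof -
  have B: "box B t0 \<delta>" "t0 \<notin> UI" and ef: "end_form B t0 \<delta> C J s e d" and ch: "continuous_on {0..<1/2} h"
    and h: "\<And>u. u \<in> {0..<1/2} ==> h u \<in> Iv t0 \<delta> \<and> d (h u) = u" and h0: "h 0 = t0"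
    and dt: "\<And>t. t \<in> Iv t0 \<delta> ==> d t \<in> {0..<1/2} \<and> h (d t) = t" and cd: "continuous_on (Iv t0 \<delta>) d"
    using ed unfolding end_data_def by blast+
  have e: "e = 1 \<or> e = -1" and BC: "\<And>x t. x \<in> OI ==> t \<in> Iv t0 \<delta> ==> B (x, t) = C (e * x, s * d t)"
    and dz: "\<And>t. t \<in> Iv t0 \<delta> ==> d t = 0 \<longleftrightarrow> t = t0"
    using ef unfolding end_form_def by blast+
  have eO: "e * x \<in> OI" if "x \<in> OI" for x using that e by auto
  have ee: "e * (e * x) = x" for x using e by auto
  let ?\<psi> = "\<lambda>p::real\<times>real. (e * fst p, h (snd p))" and ?\<psi>' = "\<lambda>p::real\<times>real. (e * fst p, d (snd p))"
  let ?A = "OI \<times> {0..<1/2::real}"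
  have c1: "continuous_on ?A ?\<psi>" by (intro continuous_intros continuous_on_compose2[OF ch]) auto
  have hom: "homeomorphism ?A (OI \<times> Iv t0 \<delta>) ?\<psi> ?\<psi>'"
  proof (rule homeomorphismI)
    show "continuous_on (OI \<times> Iv t0 \<delta>) ?\<psi>'" by (intro continuous_intros continuous_on_compose2[OF cd]) auto
    show "?\<psi> ` ?A \<subseteq> OI \<times> Iv t0 \<delta>" "?\<psi>' ` (OI \<times> Iv t0 \<delta>) \<subseteq> ?A" using eO h dt by auto
    show "?\<psi>' (?\<psi> p) = p" if "p \<in> ?A" for p using h[of "snd p"] ee[of "fst p"] that by (simp add: mem_Times_iff prod_eq_iff)
    show "?\<psi> (?\<psi>' p) = p" if "p \<in> OI \<times> Iv t0 \<delta>" for p using dt[of "snd p"] ee[of "fst p"] that by (simp add: mem_Times_iff prod_eq_iff)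
  qed (rule c1)
  show ?thesis
    unfolding side_param_def
  proof (intro conjI allI impI ballI)
    show "continuous_on ?A (\<lambda>p. G B t0 \<delta> (?\<psi> p))"
      by (rule continuous_on_compose2[OF G_cont[OF B(1)] c1]) (use eO h in auto)
    show "openin (top_of_set (UNIV \<times> {0..1})) ((\<lambda>p. G B t0 \<delta> (?\<psi> p)) ` D)" if "openin (top_of_set ?A) D" for D
    proof -
      have "openin (top_of_set (OI \<times> Iv t0 \<delta>)) (?\<psi> ` D)" using homeomorphism_imp_open_map[OF hom that] .
      from G_open[OF B(1) this] show ?thesis by (simp add: image_image)
    qed
    fix x u :: real assume xu: "x \<in> OI" "u \<in> {0..<1/2}"
    have t: "h u \<in> Iv t0 \<delta>" "d (h u) = u" using h[OF xu(2)] by auto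
    show "G B t0 \<delta> (e * fst (x, u), h (snd (x, u))) \<in> S"
    proof -
      have "(e * x, h u) \<in> OI \<times> Iv t0 \<delta>" using eO[OF xu(1)] t(1) by blast
      then show ?thesis unfolding S_def fst_conv snd_conv using B(1) by blast
    qed
    have "quo (G B t0 \<delta> (e * x, h u)) = C (e * (e * x), s * u)"
      using quo_G[OF B(1) eO[OF xu(1)] t(1)] BC[OF eO[OF xu(1)] t(1)] t(2) by simp
    then show "quo (G B t0 \<delta> (e * fst (x, u), h (snd (x, u)))) = C (x, s * u)" by (simp add: ee)
    have "h u \<in> UI \<longleftrightarrow> 0 < u"
    proof
      assume "h u \<in> UI"
      then have "h u \<noteq> t0" using B(2) by blast
      then show "0 < u" using dz[OF t(1)] t(2) xu(2) by auto
    next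
      assume "0 < u"
      then have "h u \<noteq> t0" using dz[OF t(1)] t(2) by auto
      then show "h u \<in> UI" by (rule end_nbd_UI[OF B t(1)])
    qed
    then show "snd (G B t0 \<delta> (e * fst (x, u), h (snd (x, u)))) \<in> UI \<longleftrightarrow> 0 < u" by (simp add: G_def)
  qed
qed

lemma strip_param_quo: "strip_param W S quo"
  unfolding strip_param_def
proof (intro conjI ballI allI impI)
  show sub1: "UNIV \<times> UI \<subseteq> S" using quo_point(1) by auto
  show SU: "S \<subseteq> UNIV \<times> {0..1}" by (auto simp: S_def G_def Iv_def)
  show "openin (top_of_set (UNIV \<times> {0..1})) S"
  proof (subst openin_subopen, clarify)
    fix a b assume "(a, b) \<in> S"
    then obtain B t0 \<delta> x t where b: "box B t0 \<delta>" "x \<in> OI" "t \<in> Iv t0 \<delta>" "(a, b) = G B t0 \<delta> (x, t)" using S_cases by metis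
    have "openin (top_of_set (UNIV \<times> {0..1})) (G B t0 \<delta> ` (OI \<times> Iv t0 \<delta>))" by (rule G_open[OF b(1)]) simp
    moreover have "G B t0 \<delta> ` (OI \<times> Iv t0 \<delta>) \<subseteq> S" unfolding S_def using b(1) by blast
    ultimately show "\<exists>T. openin (top_of_set (UNIV \<times> {0..1})) T \<and> (a, b) \<in> T \<and> T \<subseteq> S" using b by blast
  qed
  show "continuous_map (top_of_set S) Z quo" by (rule quo_cont)
  have unq: "s = (ln (gm (quo s)) - ln (mass (tau (quo s)) - gm (quo s)), tau (quo s))" if s: "s \<in> UNIV \<times> UI" for s
  proof -
    have "s \<in> S" using s sub1 by blast
    then obtain B t0 \<delta> x t where b: "box B t0 \<delta>" "x \<in> OI" "t \<in> Iv t0 \<delta>" "s = G B t0 \<delta> (x, t)" "quo s = B (x, t)" "snd s = t"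
      using S_cases by metis
    have t: "t \<in> UI" using s b(6) by auto
    have ts: "tau (B (x, t)) = t" using box_dest(7)[OF b(1-3) t] .
    have "s = (ln (gm (B (x, t))) - ln (mass t - gm (B (x, t))), t)"
      using b(4) E_gm[OF b(1-3) t] by (simp add: G_def)
    then show ?thesis unfolding b(5) ts .
  qed
  show "inj_on quo (UNIV \<times> UI)"
  proof (rule inj_onI)
    fix s s' assume s: "s \<in> UNIV \<times> UI" "s' \<in> UNIV \<times> UI" "quo s = quo s'"
    have "s = (ln (gm (quo s')) - ln (mass (tau (quo s')) - gm (quo s')), tau (quo s'))" using unq[OF s(1)] unfolding s(3) .
    then show "s = s'" using unq[OF s(2)] by simp
  qed
  show "quo ` (UNIV \<times> UI) = W"
  proof (intro equalityI subsetI)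
    fix p assume p: "p \<in> W"
    then show "p \<in> quo ` (UNIV \<times> UI)"
      using quo_interior(2)[OF p] tau(1)[OF p] by (intro image_eqI[of _ _ "(ln (gm p) - ln (mass (tau p) - gm p), tau p)"]) auto
  qed (use quo_point(2) in auto)
  show "quo ` (UNIV \<times> {t}) \<in> \<Delta>" if t: "t \<in> UI" for t
  proof -
    have "quo ` (UNIV \<times> {t}) = lf (c (0, t))"
    proof (intro equalityI subsetI)
      fix p assume "p \<in> quo ` (UNIV \<times> {t})"
      then have p: "p \<in> W" "tau p = t" using quo_point(2,3)[OF t] by auto
      then show "p \<in> lf (c (0, t))" using tau(2)[OF p(1)] lf_in(2)[of p] W_sub by auto
    next
      fix p assume p: "p \<in> lf (c (0, t))"
      have l: "lf (c (0, t)) \<in> \<Delta>" using lf_in(1) c_top[OF t, of 0] by simp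
      have "p \<in> topspace Z" "lf p = lf (c (0, t))" using lf_eq[OF l p] leaf_sub[OF l] p by auto
      then have pW: "p \<in> W" "tau p = t" using tauI[OF _ t] by auto
      then show "p \<in> quo ` (UNIV \<times> {t})"
        using quo_interior(2)[OF pW(1)] by (intro image_eqI[of _ _ "(ln (gm p) - ln (mass (tau p) - gm p), tau p)"]) auto
    qed
    then show ?thesis using lf_in(1) c_top[OF t, of 0] by simp
  qed
  show "\<exists>g. side_param S quo C m g" if C: "cut_chart C J" "chart_side J m" "\<forall>x\<in>OI. \<forall>u\<in>UI. C (x, m * u) \<in> W" for C J m
  proof -
    obtain B t0 \<delta> e d h where "end_data C J m B t0 \<delta> e d h" using end_data_exists[OF C(1,2)] C(3) by blast
    then show ?thesis using side_param_of_end_data by blast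
  qed
  fix s assume s: "s \<in> S" "snd s \<notin> UI"
  obtain B t0 \<delta> x t where b: "box B t0 \<delta>" "x \<in> OI" "t \<in> Iv t0 \<delta>" "s = G B t0 \<delta> (x, t)" "quo s = B (x, t)" "snd s = t"
    using S_cases[OF s(1)] by metis
  have tU: "t \<notin> UI" using s(2) b(6) by simp
  have tt: "t = t0" "t0 \<notin> UI" using box_end[OF b(1,3) tU] by auto
  show "quo s \<in> \<Union>Sp" unfolding b(5) by (rule box_end_Sp[OF b(1-3) tU])
  obtain C J m' e' d' where ef: "end_form B t0 \<delta> C J m' e' d'" using box_dest(10)[OF b(1) tt(2)] by blast
  have C: "cut_chart C J" and e': "e' = 1 \<or> e' = -1" and Bx: "B (x, t0) = C (e' * x, m' * d' t0)" and d0: "d' t0 = 0"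
    using ef b(2,3) tt(1) unfolding end_form_def by blast+
  have x1: "e' * x \<in> OI" using e' b(2) by auto
  have eq: "B (x, t0) = C (e' * x, 0)" using Bx d0 by simp
  \<comment> \<open>The given box comes without an inverse of its height change. It is therefore
    compared with an end box for the same chart, which takes the same value of \<open>G\<close> at
    this point by \<open>E_trans\<close>.\<close>
  obtain m where m: "chart_side J m" "\<And>x u. x \<in> OI ==> u \<in> UI ==> C (x, m * u) \<in> W"
    "\<And>B' t0' \<delta>'' e d h. end_data C J m B' t0' \<delta>'' e d h ==> t0' = t0 \<and> trans B t0 \<delta> B' t0 \<delta>'' x t0 (e * (e' * x))"
    using end_cover[OF b(1) tt(2) b(2) C x1 eq] by metis
  obtain B' t0' \<delta>'' e d h where ed: "end_data C J m B' t0' \<delta>'' e d h" using end_data_exists[OF C m(1,2)] by blast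
  then have tr: "t0' = t0" "trans B t0 \<delta> B' t0 \<delta>'' x t0 (e * (e' * x))" using m(3) by blast+
  have B': "box B' t0 \<delta>''" "h 0 = t0" using ed tr(1) unfolding end_data_def by blast+
  have "E B t0 \<delta> (x, t0) = E B' t0 \<delta>'' (e * (e' * x), t0)"
    using E_trans(1)[OF b(1) B'(1) tr(2) b(2)] b(3) tt(1) by simp
  then have "s = G B' t0' \<delta>'' (e * fst (e' * x, 0::real), h (snd (e' * x, 0)))"
    unfolding b(4) G_def using tt(1) B'(2) tr(1) by simp
  then show "\<exists>C J m g x0. cut_chart C J \<and> chart_side J m \<and> (\<forall>x\<in>OI. \<forall>u\<in>UI. C (x, m * u) \<in> W) \<and> side_param S quo C m g \<and> x0 \<in> OI \<and> s = g (x0, 0)"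
    using C m(1,2) side_param_of_end_data[OF ed] x1 by blast
qed

end

theorem (in cut_component) strip_param_exists: "\<exists>S q. strip_param W S q"
proof -
  obtain Bk :: "nat => real \<times> real => 'a" and tk dk where fam: "\<And>k. box (Bk k) (tk k) (dk k)"
    "\<And>B t0 d x0 t. box B t0 d ==> x0 \<in> OI ==> t \<in> Iv t0 d ==>
       \<exists>k x'. \<bar>t - tk k\<bar> < dk k / 2 \<and> \<bar>x'\<bar> < 1/2 \<and> trans B t0 d (Bk k) (tk k) (dk k) x0 t x'"
    using box_family_exists by metis
  interpret bf: box_family Z \<Delta> Bd Sp c Bk tk dk by unfold_locales (fact fam)+
  show ?thesis using bf.strip_param_quo by blast
qed

section \<open>Boundary intervals of the strips\<close>

locale cut_surface = ribboned_surface +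
  assumes comps: "\<And>W. W \<in> connected_components_of (subtopology Z (topspace Z - \<Union>Sp)) ==> \<exists>c. rib c \<and> ribsat c = W"
begin

definition WW :: "'a set set" where "WW = connected_components_of (subtopology Z (topspace Z - \<Union>Sp))"

lemma WW_strip: assumes "W \<in> WW" shows "\<exists>S q. strip_param W S q"
proof -
  obtain c where c: "rib c" "ribsat c = W" using comps assms unfolding WW_def by blast
  interpret cc: cut_component Z \<Delta> Bd Sp c
    by unfold_locales (use c assms in \<open>simp_all add: WW_def\<close>)
  show ?thesis using cc.strip_param_exists c(2) unfolding cc.W_def by simp
qed

lemma WW: assumes "W \<in> WW"
  shows "W \<subseteq> topspace Z" "W \<inter> \<Union>Sp = {}" "openin Z W" "W \<noteq> {}"
    "\<And>S. connectedin Z S ==> S \<inter> \<Union>Sp = {} ==> S \<inter> W \<noteq> {} ==> S \<subseteq> W"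
proof -
  have "W \<subseteq> topspace Z - \<Union>Sp" using connected_components_of_subset assms unfolding WW_def by fastforce
  then show "W \<subseteq> topspace Z" "W \<inter> \<Union>Sp = {}" by blast+
  show "openin Z W" using component_leaf_open(2)[OF Sp_leaves Sp_lf] assms unfolding WW_def by blast
  show "W \<noteq> {}" using nonempty_connected_components_of assms unfolding WW_def by blast
  fix S assume S: "connectedin Z S" "S \<inter> \<Union>Sp = {}" "S \<inter> W \<noteq> {}"
  then have "connectedin (subtopology Z (topspace Z - \<Union>Sp)) S"
    using connectedin_subset_topspace[OF S(1)] by (auto simp: connectedin_subtopology)
  then show "S \<subseteq> W" using connected_components_of_maximal[of W] assms S(3) unfolding WW_def disjnt_def by blast
qed

lemma WW_disjoint: "W \<in> WW ==> W' \<in> WW ==> p \<in> W ==> p \<in> W' ==> W = W'"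
  using pairwise_disjoint_connected_components_of[of "subtopology Z (topspace Z - \<Union>Sp)"]
  unfolding WW_def pairwise_def disjnt_def by blast

lemma WW_cover: "p \<in> topspace Z ==> p \<notin> \<Union>Sp ==> \<exists>W\<in>WW. p \<in> W"
  using Union_connected_components_of[of "subtopology Z (topspace Z - \<Union>Sp)"] unfolding WW_def by auto

lemma WW_countable: "countable WW"
proof -
  have "\<exists>W. W \<in> WW \<and> p \<in> W" if "p \<in> topspace Z - \<Union>Sp" for p using WW_cover that by blast
  then obtain N where N: "\<And>p. p \<in> topspace Z - \<Union>Sp ==> N p \<in> WW \<and> p \<in> N p" by metis
  have sub: "topspace Z - \<Union>Sp \<subseteq> topspace Z" by blast
  have "openin Z (N p) \<and> p \<in> N p" if "p \<in> topspace Z - \<Union>Sp" for p using N[OF that] WW(3) by blast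
  then obtain D where D: "countable D" "D \<subseteq> topspace Z - \<Union>Sp" "topspace Z - \<Union>Sp \<subseteq> \<Union>(N ` D)" using lindelof_cover[OF sub] by metis
  have "WW \<subseteq> N ` D"
  proof
    fix W assume W: "W \<in> WW"
    then obtain w where w: "w \<in> W" using WW(4) by blast
    then have "w \<in> topspace Z - \<Union>Sp" using WW(1,2)[OF W] by blast
    then obtain d where d: "d \<in> D" "w \<in> N d" using D(3) by blast
    then have "W = N d" using WW_disjoint[OF W _ w] N D(2) by blast
    then show "W \<in> N ` D" using d by blast
  qed
  then show ?thesis using countable_subset[OF _ countable_image[OF D(1)]] by blast
qed

lemma Sp_countable: "countable Sp"
proof -
  have "\<exists>V. openin Z V \<and> z \<in> V \<and> finite {U \<in> Sp. U \<inter> V \<noteq> {}}" if "z \<in> topspace Z" for z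
    using Sp_lf that unfolding locally_finite_in_def by blast
  then obtain V where V: "\<And>z. z \<in> topspace Z ==> openin Z (V z) \<and> z \<in> V z \<and> finite {U \<in> Sp. U \<inter> V z \<noteq> {}}" by metis
  have "openin Z (V z) \<and> z \<in> V z" if "z \<in> topspace Z" for z using V[OF that] by blast
  then obtain D where D: "countable D" "D \<subseteq> topspace Z" "topspace Z \<subseteq> \<Union>(V ` D)" using lindelof_cover[OF subset_refl] by metis
  have "Sp \<subseteq> (\<Union>d\<in>D. {U \<in> Sp. U \<inter> V d \<noteq> {}})"
  proof
    fix w assume w: "w \<in> Sp"
    then obtain z where "z \<in> w" "z \<in> topspace Z" using leaf_ne leaf_sub Sp_leaves by blast
    then show "w \<in> (\<Union>d\<in>D. {U \<in> Sp. U \<inter> V d \<noteq> {}})" using D(3) w by blast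
  qed
  moreover have "countable (\<Union>d\<in>D. {U \<in> Sp. U \<inter> V d \<noteq> {}})"
    using D V by (intro countable_UN) (auto intro!: countable_finite)
  ultimately show ?thesis using countable_subset by blast
qed

definition Lam :: "nat set" where "Lam = to_nat_on WW ` WW"
definition Wn :: "nat => 'a set" where "Wn i = inv_into WW (to_nat_on WW) i"
definition SS :: "nat => (real \<times> real) set" where "SS i = fst (SOME p. strip_param (Wn i) (fst p) (snd p))"
definition qq :: "nat => real \<times> real => 'a" where "qq i = snd (SOME p. strip_param (Wn i) (fst p) (snd p))"

lemma Wn: "i \<in> Lam ==> Wn i \<in> WW" "W \<in> WW ==> \<exists>i\<in>Lam. Wn i = W" "i \<in> Lam ==> j \<in> Lam ==> Wn i = Wn j ==> i = j"
proof -
  have inj: "inj_on (to_nat_on WW) WW" using WW_countable by (rule inj_on_to_nat_on)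
  show "i \<in> Lam ==> Wn i \<in> WW" unfolding Lam_def Wn_def by (rule inv_into_into)
  show "W \<in> WW ==> \<exists>i\<in>Lam. Wn i = W" unfolding Lam_def Wn_def using inj by (metis imageI inv_into_f_f)
  show "i \<in> Lam ==> j \<in> Lam ==> Wn i = Wn j ==> i = j" unfolding Lam_def Wn_def by (metis f_inv_into_f)
qed

lemma Wn_disjoint: "i \<in> Lam ==> j \<in> Lam ==> p \<in> Wn i ==> p \<in> Wn j ==> i = j"
  using WW_disjoint[OF Wn(1) Wn(1)] Wn(3) by blast

lemma sp: assumes "i \<in> Lam" shows "strip_param (Wn i) (SS i) (qq i)"
proof -
  have "\<exists>p. strip_param (Wn i) (fst p) (snd p)" using WW_strip[OF Wn(1)[OF assms]] by (metis fst_conv snd_conv)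
  then show ?thesis unfolding SS_def qq_def by (rule someI_ex)
qed

lemma sp_dest:
  assumes "i \<in> Lam"
  shows "UNIV \<times> UI \<subseteq> SS i" "SS i \<subseteq> UNIV \<times> {0..1}" "openin (top_of_set (UNIV \<times> {0..1})) (SS i)"
    "continuous_map (top_of_set (SS i)) Z (qq i)" "inj_on (qq i) (UNIV \<times> UI)" "qq i ` (UNIV \<times> UI) = Wn i"
    "\<And>t. t\<in>UI ==> qq i ` (UNIV \<times> {t}) \<in> \<Delta>"
proof -
  note p = sp[OF assms, unfolded strip_param_def]
  show "UNIV \<times> UI \<subseteq> SS i" "SS i \<subseteq> UNIV \<times> {0..1}" "openin (top_of_set (UNIV \<times> {0..1})) (SS i)"
    "continuous_map (top_of_set (SS i)) Z (qq i)" "inj_on (qq i) (UNIV \<times> UI)" "qq i ` (UNIV \<times> UI) = Wn i"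
    by (rule p[THEN conjunct1] p[THEN conjunct2, THEN conjunct1] p[THEN conjunct2, THEN conjunct2, THEN conjunct1]
      p[THEN conjunct2, THEN conjunct2, THEN conjunct2, THEN conjunct1] p[THEN conjunct2, THEN conjunct2, THEN conjunct2, THEN conjunct2, THEN conjunct1]
      p[THEN conjunct2, THEN conjunct2, THEN conjunct2, THEN conjunct2, THEN conjunct2, THEN conjunct1])+
  have "\<forall>t\<in>UI. qq i ` (UNIV \<times> {t}) \<in> \<Delta>" using p by (elim conjE) assumption
  then show "qq i ` (UNIV \<times> {t}) \<in> \<Delta>" if "t\<in>UI" for t using that by (rule bspec)
qed

definition sided :: "(real \<times> real => 'a) => real set => real => nat => (real \<times> real => real \<times> real) => bool" where
  "sided C J s i g \<longleftrightarrow> cut_chart C J \<and> chart_side J s \<and> i \<in> Lam \<and> (\<forall>x\<in>OI. \<forall>u\<in>UI. C (x, s * u) \<in> Wn i) \<and>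
     side_param (SS i) (qq i) C s g"

text \<open>A chart side without the central plaque is connected and misses \<open>Sp\<close>, so it
  lies in a single piece, whose strip then carries a lift.\<close>

lemma sided_exists:
  assumes C: "cut_chart C J" and s: "chart_side J s"
  obtains i g where "sided C J s i g"
proof -
  let ?S = "(\<lambda>p. C (fst p, s * snd p)) ` (OI \<times> UI)"
  have hc: "half_chart (\<lambda>p. C (fst p, s * snd p))" by (rule cut_chart_half[OF C s])
  have con: "connectedin Z ?S"
  proof (rule connectedin_continuous_map_image[OF half_chart_dest(1)[OF hc]])
    have "OI \<times> UI \<subseteq> OI \<times> {0..<1}" by auto
    moreover have "connected (OI \<times> UI)" by (intro convex_connected convex_Times) auto
    ultimately show "connectedin (top_of_set (OI \<times> {0..<1})) (OI \<times> UI)" by (metis connectedin_subtopology connectedin_iff_connected)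
  qed
  have s1: "s = 1 \<or> s = -1" using s by (auto simp: chart_side_def)
  have pt: "C (x, s * u) \<notin> \<Union>Sp" "C (x, s * u) \<in> topspace Z" if "x \<in> OI" "u \<in> UI" for x u
  proof -
    have J: "s * u \<in> J" using chart_side_mult[OF s cut_chart_dest(2)[OF C], of u] that(2) by auto
    moreover have "s * u \<noteq> 0" using that(2) s1 by auto
    ultimately show "C (x, s * u) \<notin> \<Union>Sp" using cut_chart_dest(7)[OF C that(1)] by blast
    show "C (x, s * u) \<in> topspace Z" by (rule cut_chart_dest(6)[OF C that(1) J])
  qed
  then have disj: "?S \<inter> \<Union>Sp = {}" by auto
  have "(0::real) \<in> OI" "(1/2::real) \<in> UI" by auto
  then obtain W where W: "W \<in> WW" "C (0, s * (1/2)) \<in> W" using WW_cover[OF pt(2,1), of 0 "1/2"] by metis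
  have "C (0, s * (1/2)) \<in> ?S" by (rule image_eqI[of _ _ "(0, 1/2)"]) auto
  then have "?S \<inter> W \<noteq> {}" using W(2) by blast
  then have sub: "?S \<subseteq> W" by (rule WW(5)[OF W(1) con disj])
  obtain i where i: "i \<in> Lam" "Wn i = W" using Wn(2)[OF W(1)] by blast
  have CW: "\<forall>x\<in>OI. \<forall>u\<in>UI. C (x, s * u) \<in> Wn i" using sub i(2) by force
  have "\<forall>C J s. cut_chart C J --> chart_side J s --> (\<forall>x\<in>OI. \<forall>u\<in>UI. C (x, s * u) \<in> Wn i) --> (\<exists>g. side_param (SS i) (qq i) C s g)"
    using sp[OF i(1)] unfolding strip_param_def by (elim conjE) assumption
  then obtain g where "side_param (SS i) (qq i) C s g" using C s CW by metis
  then show ?thesis using that C s i(1) CW unfolding sided_def by blast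
qed

lemma sided_dest:
  assumes "sided C J s i g"
  shows "cut_chart C J" "chart_side J s" "i \<in> Lam" "\<And>x u. x \<in> OI ==> u \<in> UI ==> C (x, s * u) \<in> Wn i"
    "continuous_on (OI \<times> {0..<1/2}) g"
    "\<And>D. openin (top_of_set (OI \<times> {0..<1/2})) D ==> openin (top_of_set (UNIV \<times> {0..1})) (g ` D)"
    "\<And>x u. x \<in> OI ==> u \<in> {0..<1/2} ==> g (x, u) \<in> SS i"
    "\<And>x u. x \<in> OI ==> u \<in> {0..<1/2} ==> qq i (g (x, u)) = C (x, s * u)"
    "\<And>x u. x \<in> OI ==> u \<in> {0..<1/2} ==> snd (g (x, u)) \<in> UI \<longleftrightarrow> 0 < u"
  using assms unfolding sided_def side_param_def by (simp_all del: mem_Collect_eq)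

lemma sp_bdry:
  assumes "i \<in> Lam" "s \<in> SS i" "snd s \<notin> UI"
  shows "qq i s \<in> \<Union>Sp \<and> (\<exists>C J m g x0. cut_chart C J \<and> chart_side J m \<and> (\<forall>x\<in>OI. \<forall>u\<in>UI. C (x, m * u) \<in> Wn i) \<and>
      side_param (SS i) (qq i) C m g \<and> x0 \<in> OI \<and> s = g (x0, 0))"
proof -
  have "\<forall>s\<in>SS i. snd s \<notin> UI --> qq i s \<in> \<Union>Sp \<and> (\<exists>C J m g x0. cut_chart C J \<and> chart_side J m \<and> (\<forall>x\<in>OI. \<forall>u\<in>UI. C (x, m * u) \<in> Wn i) \<and>
      side_param (SS i) (qq i) C m g \<and> x0 \<in> OI \<and> s = g (x0, 0))"
    using sp[OF assms(1)] unfolding strip_param_def by (elim conjE) assumption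
  from bspec[OF this assms(2)] show ?thesis using assms(3) by (rule mp)
qed

lemma bdry_sided:
  assumes i: "i \<in> Lam" and s: "s \<in> SS i" "snd s \<notin> UI"
  obtains C J m g x0 where "sided C J m i g" "x0 \<in> OI" "s = g (x0, 0)"
proof -
  have "\<exists>C J m g x0. cut_chart C J \<and> chart_side J m \<and> (\<forall>x\<in>OI. \<forall>u\<in>UI. C (x, m * u) \<in> Wn i) \<and>
      side_param (SS i) (qq i) C m g \<and> x0 \<in> OI \<and> s = g (x0, 0)"
    by (rule sp_bdry[OF i s, THEN conjunct2])
  then show ?thesis using that i unfolding sided_def by metis
qed

lemma bdry_Sp:
  assumes "i \<in> Lam" "s \<in> SS i" "snd s \<notin> UI"
  shows "qq i s \<in> \<Union>Sp"
  by (rule sp_bdry[OF assms, THEN conjunct1])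

lemma interior_Wn: "i \<in> Lam ==> snd s \<in> UI ==> qq i s \<in> Wn i"
  using sp_dest(6)[of i] by (metis UNIV_I image_eqI mem_Times_iff)

lemma interior_inj: "i \<in> Lam ==> snd s \<in> UI ==> snd s' \<in> UI ==> qq i s = qq i s' ==> s = s'"
  using inj_onD[OF sp_dest(5)[of i], of s s'] by (simp add: mem_Times_iff)

text \<open>The boundary point over a point of a cut leaf depends on the side of approach and not on
  the chart. A short segment leaving the leaf is followed in the second chart, where it stays on one
  side; at interior heights both lifts have the same image and \<open>qq i\<close> is injective, so
  they agree, and so do their limits.\<close>

lemma side_match:
  assumes C': "cut_chart C' J'" and s: "sided C J m i g" and x: "x0 \<in> OI" "x0' \<in> OI" "C (x0, 0) = C' (x0', 0)"
  obtains m' where "chart_side J' m'" "\<And>i' g'. sided C' J' m' i' g' ==> i' = i \<and> g' (x0', 0) = g (x0, 0)"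
proof -
  note C = sided_dest[OF s]
  let ?A = "OI \<times> J'"
  have oe: "open_embedding Z ?A C'" by (rule cut_chart_dest(4)[OF C'])
  have hc: "half_chart (\<lambda>p. C (fst p, m * snd p))" by (rule cut_chart_half[OF C(1,2)])
  have "continuous_map (top_of_set {0..<1}) (top_of_set (OI \<times> {0..<1})) (\<lambda>u. (x0, u))"
    using x by (auto simp: continuous_map_in_subtopology intro!: continuous_intros)
  from continuous_map_compose[OF this half_chart_dest(1)[OF hc]]
  have line: "continuous_map (top_of_set {0..<1}) Z (\<lambda>u. C (x0, m * u))" by (simp add: comp_def)
  have "C (x0, m * 0) \<in> C' ` ?A" using x cut_chart_dest(3)[OF C'] by auto
  then obtain r0 where r0: "r0 > 0" "\<And>u. u \<in> {0..<1} ==> dist u 0 < r0 ==> C (x0, m * u) \<in> C' ` ?A"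
    using continuous_map_nbhd[OF line _ open_embeddingD(4)[OF oe], of 0] by auto
  define r where "r = min r0 (1/2)"
  have r: "r > 0" "r \<le> r0" "r \<le> 1/2" using r0(1) by (auto simp: r_def)
  have rsub: "{0..<r} \<subseteq> {0..<1}" using r by auto
  define H where "H u = inv_into ?A C' (C (x0, m * u))" for u
  have inA: "C (x0, m * u) \<in> C' ` ?A" if "u \<in> {0..<r}" for u using r0(2)[of u] that r by auto
  have H: "continuous_on {0..<r} H" "\<And>u. u \<in> {0..<r} ==> H u \<in> ?A" "\<And>u. u \<in> {0..<r} ==> C' (H u) = C (x0, m * u)"
    unfolding H_def using open_embedding_pull[OF oe continuous_map_from_subtopology_mono[OF line rsub] inA] by auto
  have H0: "H 0 = (x0', 0)"
    unfolding H_def mult_zero_right x(3) using x cut_chart_dest(3)[OF C'] by (intro inv_into_f_f open_embeddingD(2)[OF oe]) simp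
  have Cn: "C (x0, m * u) \<in> Wn i" "C (x0, m * u) \<notin> \<Union>Sp" if "u \<in> {0<..<r}" for u
  proof -
    show w: "C (x0, m * u) \<in> Wn i" using C(4)[OF x(1), of u] that r by auto
    then show "C (x0, m * u) \<notin> \<Union>Sp" using WW(2)[OF Wn(1)[OF C(3)]] by blast
  qed
  have ne: "snd (H u) \<noteq> 0" if "u \<in> {0<..<r}" for u
  proof
    assume z: "snd (H u) = 0"
    have u: "u \<in> {0..<r}" using that by auto
    have "C' (fst (H u), snd (H u)) \<in> \<Union>Sp" using cut_chart_dest(7)[OF C', of "fst (H u)" "snd (H u)"] H(2)[OF u] z by (auto simp: mem_Times_iff)
    then show False using H(3)[OF u] Cn(2)[OF that] by simp
  qed
  define u0 where "u0 = r/2"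
  have u0: "u0 \<in> {0<..<r}" using r by (simp add: u0_def)
  define m' where "m' = sgn (snd (H u0))"
  have m': "m' = 1 \<or> m' = -1" "m' * snd (H u0) > 0" using ne[OF u0] by (auto simp: m'_def sgn_if)
  have cH: "continuous_on {0<..<r} (\<lambda>u. m' * snd (H u))"
    by (intro continuous_intros continuous_on_subset[OF H(1)]) auto
  have pos: "0 < m' * snd (H u)" if u: "u \<in> {0<..<r}" for u
  proof (rule ccontr)
    assume "\<not> 0 < m' * snd (H u)"
    moreover have "connected ((\<lambda>u. m' * snd (H u)) ` {0<..<r})" by (rule connected_continuous_image[OF cH]) simp
    ultimately have "0 \<in> (\<lambda>u. m' * snd (H u)) ` {0<..<r}"
      using connectedD_interval[of "(\<lambda>u. m' * snd (H u)) ` {0<..<r}" "m' * snd (H u)" "m' * snd (H u0)" 0] m'(2) u u0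
      by (metis (no_types, lifting) imageI less_imp_le not_le)
    then obtain v where "v \<in> {0<..<r}" "m' * snd (H v) = 0" by force
    then show False using ne m'(1) by auto
  qed
  have side: "chart_side J' m'"
  proof (cases "m' = 1")
    case False
    then have "snd (H u0) < 0" using m' by auto
    moreover have "snd (H u0) \<in> J'" using H(2)[of u0] u0 by (auto simp: mem_Times_iff)
    ultimately have "J' \<noteq> {0..<1}" by auto
    then show ?thesis using False m'(1) cut_chart_dest(2)[OF C'] by (auto simp: chart_side_def)
  qed (simp add: chart_side_def)
  have "i' = i \<and> g' (x0', 0) = g (x0, 0)" if s': "sided C' J' m' i' g'" for i' g'
  proof -
    note D = sided_dest[OF s']
    define K where "K u = (fst (H u), m' * snd (H u))" for u
    have ss: "m' * (m' * a) = a" for a using m'(1) by auto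
    have CK: "C' (fst (K u), m' * snd (K u)) = C (x0, m * u)" if "u \<in> {0..<r}" for u
      using H(3)[OF that] by (simp add: K_def ss)
    have K0: "K 0 = (x0', 0)" by (simp add: K_def H0)
    have KO: "fst (K u) \<in> OI" "\<bar>snd (K u)\<bar> < 1" if "u \<in> {0..<r}" for u
    proof -
      show "fst (K u) \<in> OI" using H(2)[OF that] by (auto simp: K_def mem_Times_iff)
      have "snd (H u) \<in> OI" using H(2)[OF that] cut_chart_dest(5)[OF C'] by (auto simp: mem_Times_iff)
      then show "\<bar>snd (K u)\<bar> < 1" using m'(1) by (auto simp: K_def)
    qed
    have cK: "continuous_on {0..<r} K" unfolding K_def by (intro continuous_intros H(1))
    have zr: "(0::real) \<in> {0..<r}" using r by simp
    obtain e where e: "e > 0" "\<And>u. u \<in> {0..<r} ==> \<bar>u\<bar> < e ==> snd (K u) < 1/2"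
    proof -
      have "continuous_on {0..<r} (\<lambda>u. snd (K u))" using cK by (intro continuous_intros)
      then obtain e where e: "e > 0" "\<And>u. u \<in> {0..<r} ==> dist u 0 < e ==> dist (snd (K u)) (snd (K 0)) < 1/2"
        using zr unfolding continuous_on_iff by (metis half_gt_zero zero_less_one)
      show ?thesis
      proof (rule that[OF e(1)])
        fix u assume "u \<in> {0..<r}" "\<bar>u\<bar> < e"
        then show "snd (K u) < 1/2" using e(2)[of u] K0 by (auto simp: dist_real_def)
      qed
    qed
    define r2 where "r2 = min r e"
    have r2: "r2 > 0" "r2 \<le> r" "r2 \<le> e" "r2 \<le> 1/2" using r e(1) by (auto simp: r2_def)
    have Kin: "K u \<in> OI \<times> {0..<1/2}" "u > 0 ==> snd (K u) > 0" if u: "u \<in> {0..<r2}" for u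
    proof -
      have ur: "u \<in> {0..<r}" "\<bar>u\<bar> < e" using u r2 by auto
      have nn: "0 < snd (K u)" if "u > 0" using pos[of u] that ur by (simp add: K_def)
      moreover have "snd (K 0) = 0" by (simp add: K0)
      ultimately have "0 \<le> snd (K u)" using ur(1) by (cases "u = 0") auto
      then show "K u \<in> OI \<times> {0..<1/2}" using KO(1)[OF ur(1)] e(2)[OF ur] by (simp add: mem_Times_iff)
      show "u > 0 ==> snd (K u) > 0" by (rule nn)
    qed
    have ii: "i' = i"
    proof -
      define u where "u = r2 / 2"
      have u: "u \<in> {0..<r2}" "u > 0" "u \<in> {0<..<r}" "u \<in> {0..<r}" using r2 by (auto simp: u_def)
      have ku: "snd (K u) \<in> UI" using Kin(2)[OF u(1,2)] KO(2)[OF u(4)] by auto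
      have "C' (fst (K u), m' * snd (K u)) \<in> Wn i'" by (rule D(4)[OF KO(1)[OF u(4)] ku])
      then show ?thesis using CK[OF u(4)] Cn(1)[OF u(3)] Wn_disjoint[OF D(3) C(3)] by simp
    qed
    have gg: "g' (K u) = g (x0, u)" if u: "u \<in> {0<..<r2}" for u
    proof -
      have u': "u \<in> {0..<r2}" "u > 0" "u \<in> {0..<r}" "u \<in> {0..<1/2}" using u r2 by auto
      have k: "fst (K u) \<in> OI" "snd (K u) \<in> {0..<1/2}" "0 < snd (K u)" using Kin[OF u'(1)] u'(2) by (auto simp: mem_Times_iff)
      have "qq i (g' (K u)) = C' (fst (K u), m' * snd (K u))" using D(8)[OF k(1,2)] ii by simp
      also have "\<dots> = qq i (g (x0, u))" using CK[OF u'(3)] C(8)[OF x(1) u'(4)] by simp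
      finally have "qq i (g' (K u)) = qq i (g (x0, u))" .
      moreover have "snd (g' (K u)) \<in> UI" using D(9)[OF k(1,2)] k(3) by simp
      moreover have "snd (g (x0, u)) \<in> UI" using C(9)[OF x(1) u'(4)] u'(2) by simp
      ultimately show ?thesis using interior_inj[OF C(3)] by blast
    qed
    have r2sub: "{0..<r2} \<subseteq> {0..<r}" using r2 by auto
    have c1: "continuous_on {0..<r2} (\<lambda>u. g' (K u))"
      by (rule continuous_on_compose2[OF D(5) continuous_on_subset[OF cK r2sub]]) (use Kin(1) in blast)
    have c2: "continuous_on {0..<r2} (\<lambda>u. g (x0, u))"
      by (intro continuous_on_compose2[OF C(5)] continuous_intros) (use x r2 in auto)
    have "g' (K 0) = g (x0, 0)"
    proof (rule ccontr)
      assume "g' (K 0) \<noteq> g (x0, 0)"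
      then have d: "0 < dist (g' (K 0)) (g (x0, 0))" by simp
      have z2: "(0::real) \<in> {0..<r2}" using r2 by simp
      have "continuous_on {0..<r2} (\<lambda>u. dist (g' (K u)) (g (x0, u)))" using c1 c2 by (intro continuous_intros)
      then obtain e' where e': "e' > 0" "\<And>u. u \<in> {0..<r2} ==> dist u 0 < e' ==>
          dist (dist (g' (K u)) (g (x0, u))) (dist (g' (K 0)) (g (x0, 0))) < dist (g' (K 0)) (g (x0, 0))"
        using z2 d unfolding continuous_on_iff by meson
      define u where "u = min r2 e' / 2"
      have u: "u \<in> {0..<r2}" "dist u 0 < e'" "u \<in> {0<..<r2}" using r2(1) e'(1) by (auto simp: u_def)
      show False using e'(2)[OF u(1,2)] gg[OF u(3)] by (simp add: dist_real_def)
    qed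
    then show ?thesis using ii K0 by simp
  qed
  then show ?thesis using that[OF side] by blast
qed

text \<open>Replaces the chart by which the strip describes its boundary point by any prescribed
  chart around the image point.\<close>

lemma bdry_point:
  assumes i: "i \<in> Lam" and s: "s \<in> SS i" "snd s \<notin> UI" and C': "cut_chart C' J'" and x: "x0' \<in> OI" "qq i s = C' (x0', 0)"
  obtains m' g' where "sided C' J' m' i g'" "g' (x0', 0) = s"
proof -
  obtain C J m g x0 where sd: "sided C J m i g" "x0 \<in> OI" "s = g (x0, 0)" using bdry_sided[OF i s] by blast
  have "C (x0, 0) = C' (x0', 0)" using sided_dest(8)[OF sd(1,2), of 0] sd(3) x(2) by simp
  then obtain m' where m': "chart_side J' m'" "\<And>i' g'. sided C' J' m' i' g' ==> i' = i \<and> g' (x0', 0) = g (x0, 0)"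
    using side_match[OF C' sd(1,2) x(1)] by metis
  obtain i' g' where s': "sided C' J' m' i' g'" using sided_exists[OF C' m'(1)] by blast
  then have "i' = i" "g' (x0', 0) = s" using m'(2) sd(3) by auto
  then show ?thesis using that s' by blast
qed

lemma SS_lo_hi: assumes "i \<in> Lam" shows "strip_lo (SS i) = 0" "strip_hi (SS i) = 1"
proof -
  have s1: "UI \<subseteq> snd ` SS i" using sp_dest(1)[OF assms] by force
  have s2: "snd ` SS i \<subseteq> {0..1}" using sp_dest(2)[OF assms] by force
  have "Inf (snd ` SS i) \<le> Inf UI" using s1 s2 by (intro cInf_superset_mono) (auto intro: bdd_below_mono[OF bdd_below_Icc[of 0 1]])
  moreover have "0 \<le> Inf (snd ` SS i)" using s1 s2 by (intro cInf_greatest) (force, auto)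
  ultimately show "strip_lo (SS i) = 0" unfolding strip_lo_def by simp
  have "Sup UI \<le> Sup (snd ` SS i)" using s1 s2 by (intro cSup_subset_mono) (auto intro: bdd_above_mono[OF bdd_above_Icc[of 0 1]])
  moreover have "Sup (snd ` SS i) \<le> 1" using s1 s2 by (intro cSup_least) (force, auto)
  ultimately show "strip_hi (SS i) = 1" unfolding strip_hi_def by simp
qed

lemma SS_boundary: assumes "i \<in> Lam" shows "strip_boundary (SS i) = {s \<in> SS i. snd s \<notin> UI}"
  unfolding strip_boundary_def SS_lo_hi[OF assms] using sp_dest(2)[OF assms] by force

definition bint :: "nat => (real \<times> real) set set" where "bint i = boundary_intervals (SS i)"

lemma bint:
  assumes i: "i \<in> Lam" and I: "I \<in> bint i"
  shows "I \<subseteq> SS i" "\<And>s. s \<in> I ==> snd s \<notin> UI" "I \<noteq> {}" "connected I"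
    "\<And>A. connected A ==> A \<subseteq> SS i ==> (\<And>s. s \<in> A ==> snd s \<notin> UI) ==> A \<inter> I \<noteq> {} ==> A \<subseteq> I"
proof -
  have I': "I \<in> connected_components_of (top_of_set (strip_boundary (SS i)))" using I by (simp add: bint_def boundary_intervals_def)
  have sub: "I \<subseteq> strip_boundary (SS i)" using connected_components_of_subset[OF I'] by simp
  then show "I \<subseteq> SS i" "\<And>s. s \<in> I ==> snd s \<notin> UI" unfolding SS_boundary[OF i] by blast+
  show "I \<noteq> {}" using nonempty_connected_components_of[OF I'] .
  show "connected I" using connectedin_connected_components_of[OF I'] by (simp add: connectedin_subtopology)
  fix A assume A: "connected A" "A \<subseteq> SS i" "\<And>s. s \<in> A ==> snd s \<notin> UI" "A \<inter> I \<noteq> {}"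
  have "connectedin (top_of_set (strip_boundary (SS i))) A"
    using A(1,2,3) unfolding SS_boundary[OF i] by (auto simp: connectedin_subtopology)
  then show "A \<subseteq> I" using connected_components_of_maximal[OF I'] A(4) by (auto simp: disjnt_def)
qed

lemma bint_exists:
  assumes i: "i \<in> Lam" and s: "s \<in> SS i" "snd s \<notin> UI"
  obtains I where "I \<in> bint i" "s \<in> I"
proof -
  have "s \<in> topspace (top_of_set (strip_boundary (SS i)))" using s unfolding SS_boundary[OF i] by simp
  then have "s \<in> \<Union>(connected_components_of (top_of_set (strip_boundary (SS i))))" unfolding Union_connected_components_of .
  then show ?thesis using that unfolding bint_def boundary_intervals_def by blast
qed

lemma bint_unique: "i \<in> Lam ==> I \<in> bint i ==> I' \<in> bint i ==> s \<in> I ==> s \<in> I' ==> I = I'"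
  using pairwise_disjoint_connected_components_of[of "top_of_set (strip_boundary (SS i))"]
  unfolding bint_def boundary_intervals_def pairwise_def disjnt_def by blast

lemma side_line_in_bint:
  assumes sd: "sided C J m i g" and I: "I \<in> bint i" and x0: "x0 \<in> OI" "g (x0, 0) \<in> I" and x: "x \<in> OI"
  shows "g (x, 0) \<in> I"
proof -
  note D = sided_dest[OF sd]
  have u0: "(0::real) \<in> {0..<1/2}" by simp
  have "continuous_on OI (\<lambda>x. g (x, 0))" by (intro continuous_on_compose2[OF D(5)] continuous_intros) auto
  then have "connected ((\<lambda>x. g (x, 0)) ` OI)" by (rule connected_continuous_image) simp
  moreover have "(\<lambda>x. g (x, 0)) ` OI \<subseteq> SS i" using D(7)[OF _ u0] by auto
  moreover have "snd s \<notin> UI" if "s \<in> (\<lambda>x. g (x, 0)) ` OI" for s using that D(9)[OF _ u0] by auto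
  ultimately have "(\<lambda>x. g (x, 0)) ` OI \<subseteq> I" using bint(5)[OF D(3) I] x0 by blast
  then show ?thesis using x by blast
qed

lemma side_nbhd:
  assumes sd: "sided C J m i g" and A: "openin (top_of_set OI) A"
  shows "openin (top_of_set (UNIV \<times> {0..1})) (g ` (A \<times> {0..<1/2}))"
    "s \<in> g ` (A \<times> {0..<1/2}) ==> snd s \<notin> UI ==> \<exists>x\<in>A. s = g (x, 0) \<and> qq i s = C (x, 0)"
proof -
  note D = sided_dest[OF sd]
  show "openin (top_of_set (UNIV \<times> {0..1})) (g ` (A \<times> {0..<1/2}))" using A by (intro D(6) openin_Times) auto
  have AO: "A \<subseteq> OI" using A openin_imp_subset by blast
  assume s: "s \<in> g ` (A \<times> {0..<1/2})" "snd s \<notin> UI"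
  then obtain x u where xu: "x \<in> A" "u \<in> {0..<1/2}" "s = g (x, u)" by blast
  have xO: "x \<in> OI" using xu(1) AO by blast
  have "u = 0" using D(9)[OF xO xu(2)] xu s(2) by auto
  then show "\<exists>x\<in>A. s = g (x, 0) \<and> qq i s = C (x, 0)" using xu D(8)[OF xO xu(2)] by auto
qed

lemma cut_chart_row: "cut_chart C J ==> x \<in> OI ==> lf (C (x, 0)) = lf (C (0, 0))"
  using fchart_dest(4)[OF cut_chart_dest(1)] cut_chart_dest(3) by blast

text \<open>A lifted chart row stays in one leaf, so the leaf is locally constant along the boundary
  interval, which is connected.\<close>

lemma bint_lf_const:
  assumes i: "i \<in> Lam" and I: "I \<in> bint i" and s: "s \<in> I" "s' \<in> I"
  shows "lf (qq i s) = lf (qq i s')"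
proof (rule ccontr)
  assume ne: "lf (qq i s) \<noteq> lf (qq i s')"
  have loc: "\<exists>T. openin (top_of_set I) T \<and> a \<in> T \<and> (\<forall>b\<in>T. lf (qq i b) = lf (qq i a))" if a: "a \<in> I" for a
  proof -
    have aS: "a \<in> SS i" "snd a \<notin> UI" using bint(1,2)[OF i I] a by blast+
    obtain C J m g x0 where sd: "sided C J m i g" "x0 \<in> OI" "a = g (x0, 0)" using bdry_sided[OF i aS] by blast
    let ?N = "g ` (OI \<times> {0..<1/2})"
    have oN: "openin (top_of_set (UNIV \<times> {0..1})) ?N" by (rule side_nbhd(1)[OF sd(1)]) simp
    have row: "lf (qq i b) = lf (C (0, 0))" if b: "b \<in> I" "b \<in> ?N" for b
    proof -
      have "snd b \<notin> UI" using bint(2)[OF i I b(1)] .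
      then obtain x where "x \<in> OI" "qq i b = C (x, 0)" using side_nbhd(2)[OF sd(1) _ b(2)] by auto
      then show ?thesis using cut_chart_row[OF sided_dest(1)[OF sd(1)]] by metis
    qed
    have "a \<in> ?N" using sd(2,3) by auto
    moreover have "I \<subseteq> UNIV \<times> {0..1}" using bint(1)[OF i I] sp_dest(2)[OF i] by blast
    moreover have "openin (top_of_set I) (I \<inter> ?N)"
    proof -
      obtain T where T: "open T" "?N = (UNIV \<times> {0..1}) \<inter> T" using oN unfolding openin_open by blast
      have "I \<inter> ?N = I \<inter> T" using \<open>I \<subseteq> UNIV \<times> {0..1}\<close> unfolding T(2) by blast
      then show ?thesis using T(1) by (simp only: openin_open_Int)
    qed
    moreover have "\<forall>b\<in>I \<inter> ?N. lf (qq i b) = lf (qq i a)" using row[OF a \<open>a \<in> ?N\<close>] row by (metis IntE)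
    ultimately show ?thesis using a by (metis IntI)
  qed
  define A where "A = {b \<in> I. lf (qq i b) = lf (qq i s)}"
  have "openin (top_of_set I) A"
  proof (subst openin_subopen, intro ballI)
    fix a assume a: "a \<in> A"
    then obtain T where T: "openin (top_of_set I) T" "a \<in> T" "\<forall>b\<in>T. lf (qq i b) = lf (qq i a)" using loc unfolding A_def by blast
    then have "T \<subseteq> A" using a openin_imp_subset unfolding A_def by force
    then show "\<exists>T. openin (top_of_set I) T \<and> a \<in> T \<and> T \<subseteq> A" using T by blast
  qed
  moreover have "openin (top_of_set I) (I - A)"
  proof (subst openin_subopen, intro ballI)
    fix a assume a: "a \<in> I - A"
    then obtain T where T: "openin (top_of_set I) T" "a \<in> T" "\<forall>b\<in>T. lf (qq i b) = lf (qq i a)" using loc by blast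
    have "lf (qq i a) \<noteq> lf (qq i s)" using a unfolding A_def by simp
    then have "T \<subseteq> I - A" using T(3) openin_imp_subset[OF T(1)] unfolding A_def by fastforce
    then show "\<exists>T. openin (top_of_set I) T \<and> a \<in> T \<and> T \<subseteq> I - A" using T by blast
  qed
  moreover have "s \<in> A" "s' \<in> I - A" using s ne[symmetric] by (simp_all add: A_def)
  then have "A \<noteq> {}" "I - A \<noteq> {}" "I \<subseteq> A \<union> (I - A)" "A \<inter> (I - A) = {}" by blast+
  ultimately show False using bint(4)[OF i I] unfolding connected_openin by blast
qed

lemma qq_top: "i \<in> Lam ==> s \<in> SS i ==> qq i s \<in> topspace Z"
  using continuous_map_image_subset_topspace[OF sp_dest(4)] by auto

lemma bint_height:
  assumes i: "i \<in> Lam" and I: "I \<in> bint i"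
  obtains e where "\<And>s. s \<in> I ==> snd s = e" "e \<in> {0..1}" "e \<notin> UI"
proof -
  obtain s0 where s0: "s0 \<in> I" using bint(3)[OF i I] by blast
  have h: "snd s = 0 \<or> snd s = 1" if "s \<in> I" for s
    using bint(1,2)[OF i I] sp_dest(2)[OF i] that by force
  have "connected (snd ` I)" by (intro connected_continuous_image continuous_intros bint(4)[OF i I])
  have "snd s = snd s0" if s: "s \<in> I" for s
  proof (rule ccontr)
    assume "snd s \<noteq> snd s0"
    then have "(0::real) \<in> snd ` I" "1 \<in> snd ` I" using h[OF s] h[OF s0] s s0 by force+
    then have "1/2 \<in> snd ` I" using connectedD_interval[OF \<open>connected (snd ` I)\<close>, of 0 1 "1/2"] by auto
    then show False using h by force
  qed
  then show ?thesis using that[of "snd s0"] h[OF s0] by auto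
qed

text \<open>A boundary interval is at first known only to project locally injectively. As its leaf
  is a line, a global coordinate of the leaf turns the projection into a real function on an
  interval, for which local injectivity is enough.\<close>

lemma bint_inj:
  assumes i: "i \<in> Lam" and I: "I \<in> bint i"
  shows "inj_on (qq i) I"
proof -
  obtain e where e: "\<And>s. s \<in> I ==> snd s = e" "e \<in> {0..1}" "e \<notin> UI" using bint_height[OF i I] by blast
  obtain s0 where s0: "s0 \<in> I" using bint(3)[OF i I] by blast
  define l where "l = lf (qq i s0)"
  have qt: "qq i s \<in> topspace Z" if "s \<in> I" for s using qq_top[OF i] bint(1)[OF i I] that by blast
  have l: "l \<in> \<Delta>" unfolding l_def by (rule lf_in(1)[OF qt[OF s0]])
  have ql: "qq i s \<in> l" if "s \<in> I" for s
    using lf_in(2)[OF qt[OF that]] bint_lf_const[OF i I that s0] unfolding l_def by simp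
  obtain f h where fh: "homeomorphic_maps (subtopology Z l) euclideanreal f h"
    using leaf_line[OF l] unfolding homeomorphic_space_def by blast
  then have f: "continuous_map (subtopology Z l) euclideanreal f" by (simp add: homeomorphic_maps_def)
  have finj: "inj_on f l"
    using homeomorphic_imp_injective_map[OF homeomorphic_maps_imp_map[OF fh]] leaf_sub[OF l] by (simp add: Int_absorb1)
  define Y where "Y = fst ` I"
  have YI: "y \<in> Y \<longleftrightarrow> (y, e) \<in> I" for y
  proof
    assume "y \<in> Y"
    then obtain s where "s \<in> I" "y = fst s" unfolding Y_def by blast
    then show "(y, e) \<in> I" using e(1)[of s] by (metis prod.collapse)
  qed (force simp: Y_def)
  have "connected Y" unfolding Y_def by (intro connected_continuous_image continuous_intros bint(4)[OF i I])
  then have Yint: "is_interval Y" by (simp add: is_interval_connected_1)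
  define \<phi> where "\<phi> y = f (qq i (y, e))" for y
  have "continuous_on Y \<phi>"
  proof -
    have "continuous_map (top_of_set Y) (top_of_set (SS i)) (\<lambda>y. (y, e))"
      using YI bint(1)[OF i I] by (auto simp: continuous_map_in_subtopology intro!: continuous_intros)
    from continuous_map_compose[OF this sp_dest(4)[OF i]]
    have "continuous_map (top_of_set Y) (subtopology Z l) (\<lambda>y. qq i (y, e))"
      unfolding continuous_map_in_subtopology using ql YI by (auto simp: comp_def)
    from continuous_map_compose[OF this f] show ?thesis by (simp add: comp_def \<phi>_def[abs_def])
  qed
  moreover have "\<exists>r>0. inj_on \<phi> {y' \<in> Y. \<bar>y' - y\<bar> < r}" if y: "y \<in> Y" for y
  proof -
    have a: "(y, e) \<in> I" using y YI by blast
    have aS: "(y, e) \<in> SS i" "snd (y, e) \<notin> UI" using bint(1,2)[OF i I] a by blast+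
    obtain C J m g x0 where sd: "sided C J m i g" "x0 \<in> OI" "(y, e) = g (x0, 0)" using bdry_sided[OF i aS] by blast
    let ?N = "g ` (OI \<times> {0..<1/2})"
    have "openin (top_of_set (UNIV \<times> {0..1})) ?N" by (rule side_nbhd(1)[OF sd(1)]) simp
    moreover have "(y, e) \<in> ?N" using sd(2,3) by auto
    ultimately obtain r where r: "r > 0" "\<And>w. w \<in> UNIV \<times> {0..1} ==> dist w (y, e) < r ==> w \<in> ?N"
      unfolding openin_euclidean_subtopology_iff by blast
    have "inj_on \<phi> {y' \<in> Y. \<bar>y' - y\<bar> < r}"
    proof (rule inj_onI)
      fix y1 y2 assume y12: "y1 \<in> {y' \<in> Y. \<bar>y' - y\<bar> < r}" "y2 \<in> {y' \<in> Y. \<bar>y' - y\<bar> < r}" "\<phi> y1 = \<phi> y2"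
      have pt: "\<exists>x\<in>OI. (y', e) = g (x, 0) \<and> qq i (y', e) = C (x, 0)" if "y' \<in> {y' \<in> Y. \<bar>y' - y\<bar> < r}" for y'
      proof -
        have "dist (y', e) (y, e) < r" using that by (simp add: dist_Pair_Pair dist_real_def)
        then have "(y', e) \<in> ?N" using r(2) e(2) by auto
        then show ?thesis using side_nbhd(2)[OF sd(1), of OI "(y', e)"] e(3) by auto
      qed
      obtain x1 where x1: "x1 \<in> OI" "(y1, e) = g (x1, 0)" "qq i (y1, e) = C (x1, 0)" using pt[OF y12(1)] by blast
      obtain x2 where x2: "x2 \<in> OI" "(y2, e) = g (x2, 0)" "qq i (y2, e) = C (x2, 0)" using pt[OF y12(2)] by blast
      have "qq i (y1, e) \<in> l" "qq i (y2, e) \<in> l" using ql YI y12 by auto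
      then have eqC: "C (x1, 0) = C (x2, 0)" using inj_onD[OF finj] y12(3) x1(3) x2(3) by (simp add: \<phi>_def)
      have C: "cut_chart C J" by (rule sided_dest(1)[OF sd(1)])
      have "(x1, 0) = (x2, 0::real)"
        using inj_onD[OF open_embeddingD(2)[OF cut_chart_dest(4)[OF C]] eqC] x1(1) x2(1) cut_chart_dest(3)[OF C] by simp
      then show "y1 = y2" using x1(2) x2(2) by (metis fst_conv)
    qed
    then show ?thesis using r(1) by blast
  qed
  ultimately have inj\<phi>: "inj_on \<phi> Y" by (rule locally_inj_imp_inj[OF Yint])
  show ?thesis
  proof (rule inj_onI)
    fix s s' assume s: "s \<in> I" "s' \<in> I" "qq i s = qq i s'"
    have ss: "s = (fst s, e)" "s' = (fst s', e)" using e(1)[OF s(1)] e(1)[OF s(2)] by (auto simp: prod_eq_iff)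
    have "\<phi> (fst s) = \<phi> (fst s')" using s(3) ss by (simp add: \<phi>_def)
    moreover have "fst s \<in> Y" "fst s' \<in> Y" using s by (auto simp: Y_def)
    ultimately have "fst s = fst s'" using inj_onD[OF inj\<phi>] by blast
    then show "s = s'" using ss by metis
  qed
qed

text \<open>The chart meets \<open>Sp\<close> only in its central plaque, so the trace on the leaf
  of a small open set of the chart is exactly a piece of the row that lifts to the interval.\<close>

lemma bint_open_map:
  assumes i: "i \<in> Lam" and I: "I \<in> bint i" and w: "w \<in> Sp" "qq i ` I \<subseteq> w" and D: "openin (top_of_set I) D"
  shows "openin (subtopology Z w) (qq i ` D)"
proof (subst openin_subopen, intro ballI)
  fix z assume "z \<in> qq i ` D"
  then obtain s where s: "s \<in> D" "z = qq i s" by blast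
  have sI: "s \<in> I" using s(1) D openin_imp_subset by blast
  have sS: "s \<in> SS i" "snd s \<notin> UI" using bint(1,2)[OF i I] sI by blast+
  obtain C J m g x0 where sd: "sided C J m i g" "x0 \<in> OI" "s = g (x0, 0)" using bdry_sided[OF i sS] by blast
  have C: "cut_chart C J" by (rule sided_dest(1)[OF sd(1)])
  have u0: "(0::real) \<in> {0..<1/2}" by simp
  have gI: "g (x, 0) \<in> I" if "x \<in> OI" for x using side_line_in_bint[OF sd(1) I sd(2) _ that] sI sd(3) by simp
  obtain D' where D': "open D'" "D = I \<inter> D'" using D by (auto simp: openin_open)
  define A where "A = {x \<in> OI. g (x, 0) \<in> D'}"
  have cg: "continuous_on OI (\<lambda>x. g (x, 0))" by (intro continuous_on_compose2[OF sided_dest(5)[OF sd(1)]] continuous_intros) auto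
  have A: "openin (top_of_set OI) A" unfolding A_def using continuous_openin_preimage_gen[OF cg D'(1)] by (simp add: vimage_def Int_def)
  have "openin Z (C ` (A \<times> J))" using A by (intro open_embeddingD(3)[OF cut_chart_dest(4)[OF C]] openin_Times) auto
  then have o: "openin (subtopology Z w) (C ` (A \<times> J) \<inter> w)" by (rule openin_subtopology_Int)
  have "C ` (A \<times> J) \<inter> w \<subseteq> qq i ` D"
  proof
    fix p assume p: "p \<in> C ` (A \<times> J) \<inter> w"
    then obtain x t where xt: "x \<in> A" "t \<in> J" "p = C (x, t)" by blast
    have xO: "x \<in> OI" using xt(1) by (simp add: A_def)
    have "t = 0" using cut_chart_dest(7)[OF C xO xt(2)] p w(1) unfolding xt(3) by blast
    then have "p = qq i (g (x, 0))" using sided_dest(8)[OF sd(1) xO u0] xt(3) by simp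
    moreover have "g (x, 0) \<in> D" unfolding D'(2) using gI[OF xO] xt(1) by (simp add: A_def)
    ultimately show "p \<in> qq i ` D" by blast
  qed
  moreover have "z \<in> C ` (A \<times> J) \<inter> w"
  proof -
    have "x0 \<in> A" using s(1) sd(2,3) unfolding D'(2) A_def by simp
    moreover have "z = C (x0, 0)" using s(2) sd(3) sided_dest(8)[OF sd(1,2) u0] by simp
    ultimately show ?thesis using s w(2) sI cut_chart_dest(3)[OF C] by blast
  qed
  ultimately show "\<exists>T. openin (subtopology Z w) T \<and> z \<in> T \<and> T \<subseteq> qq i ` D" using o by blast
qed

text \<open>The image is open and closed in the connected leaf. It is closed because a plaque
  meeting it lies in it: a boundary point over one point of the plaque singles out a side of the
  chart, and the lift of the whole row on that side stays in the interval.\<close>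

lemma bint_leaf:
  assumes i: "i \<in> Lam" and I: "I \<in> bint i" and s: "s \<in> I"
  shows "lf (qq i s) \<in> Sp" "qq i ` I = lf (qq i s)"
proof -
  have sS: "s \<in> SS i" "snd s \<notin> UI" using bint(1,2)[OF i I] s by blast+
  have qt: "qq i s' \<in> topspace Z" if "s' \<in> I" for s' using qq_top[OF i] bint(1)[OF i I] that by blast
  define w where "w = lf (qq i s)"
  have w\<Delta>: "w \<in> \<Delta>" unfolding w_def by (rule lf_in(1)[OF qt[OF s]])
  obtain w' where "w' \<in> Sp" "qq i s \<in> w'" using bdry_Sp[OF i sS] by blast
  then have "w = w'" unfolding w_def using lf_eq[of w' "qq i s"] Sp_leaves by blast
  then have w: "w \<in> Sp" using \<open>w' \<in> Sp\<close> by simp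
  then show "lf (qq i s) \<in> Sp" by (simp add: w_def)
  have sub: "qq i ` I \<subseteq> w"
  proof clarify
    fix a b assume ab: "(a, b) \<in> I"
    then show "qq i (a, b) \<in> w" using lf_in(2)[OF qt[OF ab]] bint_lf_const[OF i I ab s] unfolding w_def by simp
  qed
  have o1: "openin (subtopology Z w) (qq i ` I)" by (rule bint_open_map[OF i I w sub]) simp
  have o2: "openin (subtopology Z w) (w - qq i ` I)"
  proof (subst openin_subopen, intro ballI)
    fix z assume z: "z \<in> w - qq i ` I"
    then have "z \<in> \<Union>Sp" using w by blast
    then obtain C J where C: "cut_chart C J" "C (0, 0) = z" using cut_chart_exists by metis
    obtain N where N: "openin Z N" "N \<inter> lf (C (0, 0)) = C ` (OI \<times> {0})"
      using plaque_openin_leaf[OF cut_chart_dest(1,3)[OF C(1)]] by blast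
    have lz: "lf (C (0, 0)) = w" unfolding C(2) using lf_eq[OF w\<Delta>] z by blast
    have "N \<inter> w \<subseteq> w - qq i ` I"
    proof
      fix p assume p: "p \<in> N \<inter> w"
      then obtain x where x: "x \<in> OI" "p = C (x, 0)" using N(2) lz by blast
      have "p \<notin> qq i ` I"
      proof
        assume "p \<in> qq i ` I"
        then obtain a where a: "a \<in> I" "qq i a = C (x, 0)" unfolding x(2) by (metis imageE)
        have aS: "a \<in> SS i" "snd a \<notin> UI" using bint(1,2)[OF i I] a(1) by blast+
        obtain m' g' where g': "sided C J m' i g'" "g' (x, 0) = a" using bdry_point[OF i aS C(1) x(1) a(2)] by blast
        have O: "(0::real) \<in> OI" "(0::real) \<in> {0..<1/2}" by auto
        have "g' (0, 0) \<in> I" using side_line_in_bint[OF g'(1) I x(1) _ O(1)] g'(2) a(1) by simp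
        moreover have "qq i (g' (0, 0)) = z" using sided_dest(8)[OF g'(1) O] C(2) by simp
        ultimately show False using z by blast
      qed
      then show "p \<in> w - qq i ` I" using p by blast
    qed
    moreover have "z \<in> N \<inter> w"
    proof -
      have "z \<in> C ` (OI \<times> {0})" using C(2) by force
      then show ?thesis using N(2) lz by blast
    qed
    ultimately show "\<exists>T. openin (subtopology Z w) T \<and> z \<in> T \<and> T \<subseteq> w - qq i ` I"
      using openin_subtopology_Int[OF N(1), of w] by metis
  qed
  have "topspace (subtopology Z w) = w" using leaf_sub[OF w\<Delta>] by auto
  then have "closedin (subtopology Z w) (qq i ` I)" unfolding closedin_def using o2 sub by simp
  moreover have "connected_space (subtopology Z w)" using leaf_conn[OF w\<Delta>] connectedin_def by blast
  ultimately have "qq i ` I = {} \<or> qq i ` I = topspace (subtopology Z w)" using o1 connected_space_clopen_in by blast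
  then show "qq i ` I = lf (qq i s)" using s \<open>topspace (subtopology Z w) = w\<close> unfolding w_def by blast
qed

end

section \<open>The striped atlas\<close>

context cut_surface
begin

definition QQ :: "nat \<times> (real \<times> real) => 'a" where "QQ p = qq (fst p) (snd p)"

lemma QQ_pair [simp]: "QQ (i, s) = qq i s" by (simp add: QQ_def)

lemma QQ_image [simp]: "QQ ` ({i} \<times> A) = qq i ` A" by (force simp: QQ_def)

lemma top_strips: "topspace (strips_union Lam SS) = Sigma Lam SS"
  by (simp add: strips_union_def o_def)

lemma openin_strips:
  "openin (strips_union Lam SS) U \<longleftrightarrow> U \<subseteq> Sigma Lam SS \<and> (\<forall>i\<in>Lam. openin (top_of_set (SS i)) {s. (i, s) \<in> U})"
  by (simp add: strips_union_def openin_sum_topology o_def)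

lemma QQ_preimage: "i \<in> Lam ==> {s. (i, s) \<in> {p \<in> Sigma Lam SS. QQ p \<in> U}} = {s \<in> SS i. qq i s \<in> U}"
  by auto

lemma QQ_continuous: "continuous_map (strips_union Lam SS) Z QQ"
  unfolding continuous_map_def top_strips
proof (intro conjI allI impI)
  show "QQ \<in> Sigma Lam SS \<rightarrow> topspace Z" using qq_top by auto
  fix U assume U: "openin Z U"
  have "openin (top_of_set (SS i)) {s \<in> SS i. qq i s \<in> U}" if "i \<in> Lam" for i
    using openin_continuous_map_preimage[OF sp_dest(4)[OF that] U] by simp
  then show "openin (strips_union Lam SS) {p \<in> Sigma Lam SS. QQ p \<in> U}"
    unfolding openin_strips using QQ_preimage by auto
qed

lemma qq_open_embedding: assumes "i \<in> Lam" shows "open_embedding Z (UNIV \<times> UI) (qq i)"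
proof (rule regular_open_embedding)
  show "open (UNIV \<times> UI :: (real \<times> real) set)" by (simp add: open_Times)
  show "continuous_map (top_of_set (UNIV \<times> UI)) Z (qq i)"
    by (rule continuous_map_from_subtopology_mono[OF sp_dest(4,1)[OF assms]])
  show "inj_on (qq i) (UNIV \<times> UI)" by (rule sp_dest(5)[OF assms])
  fix b :: "real \<times> real" assume "b \<in> UNIV \<times> UI"
  then have w: "qq i b \<in> Wn i" using interior_Wn[OF assms, of b] by auto
  then have "qq i b \<in> lf (qq i b)" using lf_in(2) WW(1)[OF Wn(1)[OF assms]] by blast
  then show "lf (qq i b) \<notin> Sp" using w WW(2)[OF Wn(1)[OF assms]] by blast
qed

text \<open>At a point of a cut leaf the hypothesis yields a half neighbourhood on every existing
  side of a chart, and together these form a neighbourhood in the surface.\<close>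

lemma QQ_open:
  assumes U: "U \<subseteq> topspace Z" and o: "\<And>i. i \<in> Lam ==> openin (top_of_set (SS i)) {s \<in> SS i. qq i s \<in> U}"
  shows "openin Z U"
proof (subst openin_subopen, intro ballI)
  fix z assume z: "z \<in> U"
  show "\<exists>T. openin Z T \<and> z \<in> T \<and> T \<subseteq> U"
  proof (cases "z \<in> \<Union>Sp")
    case False
    then obtain W where W: "W \<in> WW" "z \<in> W" using WW_cover z U by blast
    then obtain i where i: "i \<in> Lam" "Wn i = W" using Wn(2) by blast
    let ?D = "(UNIV \<times> UI) \<inter> {s \<in> SS i. qq i s \<in> U}"
    obtain T where T: "open T" "{s \<in> SS i. qq i s \<in> U} = SS i \<inter> T" using o[OF i(1)] unfolding openin_open by blast
    have "?D = (UNIV \<times> UI) \<inter> T" using sp_dest(1)[OF i(1)] unfolding T(2) by blast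
    then have "openin (top_of_set (UNIV \<times> UI)) ?D" using T(1) by (simp only: openin_open_Int)
    then have "openin Z (qq i ` ?D)" by (rule open_embeddingD(3)[OF qq_open_embedding[OF i(1)]])
    moreover have "z \<in> qq i ` ?D"
    proof -
      obtain s where s: "s \<in> UNIV \<times> UI" "z = qq i s" using sp_dest(6)[OF i(1)] i(2) W(2) by blast
      then show ?thesis using z sp_dest(1)[OF i(1)] by blast
    qed
    moreover have "qq i ` ?D \<subseteq> U" by blast
    ultimately show ?thesis by blast
  next
    case True
    then obtain C J where C: "cut_chart C J" "C (0, 0) = z" using cut_chart_exists by metis
    have near: "\<exists>r>0. r \<le> 1 \<and> (\<forall>x u. \<bar>x\<bar> < r --> 0 \<le> u --> u < r --> C (x, m * u) \<in> U)" if m: "chart_side J m" for m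
    proof -
      obtain i g where sd: "sided C J m i g" using sided_exists[OF C(1) m] by blast
      note D = sided_dest[OF sd]
      have O: "(0::real) \<in> OI" "(0::real) \<in> {0..<1/2}" by auto
      have "g (0, 0) \<in> {s \<in> SS i. qq i s \<in> U}" using D(7,8)[OF O] C(2) z by simp
      then obtain e where e: "e > 0" "\<And>s. s \<in> SS i ==> dist s (g (0, 0)) < e ==> qq i s \<in> U"
        using o[OF D(3)] unfolding openin_euclidean_subtopology_iff by blast
      have "(0, 0) \<in> OI \<times> {0..<1/2::real}" by auto
      then obtain d where d: "d > 0" "\<And>p. p \<in> OI \<times> {0..<1/2} ==> dist p (0, 0) < d ==> dist (g p) (g (0, 0)) < e"
        using D(5) e(1) unfolding continuous_on_iff by meson
      define r where "r = min (d / 2) (1/2)"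
      have r: "r > 0" "r \<le> d / 2" "r \<le> 1/2" using d(1) by (auto simp: r_def)
      have "C (x, m * u) \<in> U" if "\<bar>x\<bar> < r" "0 \<le> u" "u < r" for x u
      proof -
        have xu: "x \<in> OI" "u \<in> {0..<1/2}" using that r by auto
        have "dist (x, u) (0, 0) \<le> \<bar>x\<bar> + \<bar>u\<bar>" using dist_pair_le[of x u 0 0] by simp
        then have "dist (x, u) (0, 0) < d" using that r by linarith
        then have "dist (g (x, u)) (g (0, 0)) < e" using d(2) xu by blast
        then show ?thesis using e(2)[OF D(7)[OF xu]] D(8)[OF xu] by simp
      qed
      then show ?thesis using r by (intro exI[of _ r]) auto
    qed
    have "chart_side J 1" by (simp add: chart_side_def)
    then obtain r1 where r1: "r1 > 0" "r1 \<le> 1" "\<And>x u. \<bar>x\<bar> < r1 ==> 0 \<le> u ==> u < r1 ==> C (x, 1 * u) \<in> U" using near by blast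
    obtain r where r: "r > 0" "r \<le> 1" "\<And>x t. \<bar>x\<bar> < r ==> t \<in> J ==> \<bar>t\<bar> < r ==> C (x, t) \<in> U"
    proof (cases "J = OI")
      case False
      then have "J = {0..<1}" using cut_chart_dest(2)[OF C(1)] by blast
      then show thesis using that[of r1] r1(1,2) r1(3) by fastforce
    next
      case True
      then have "chart_side J (-1)" by (simp add: chart_side_def)
      then obtain r2 where r2: "r2 > 0" "r2 \<le> 1" "\<And>x u. \<bar>x\<bar> < r2 ==> 0 \<le> u ==> u < r2 ==> C (x, (-1) * u) \<in> U" using near by blast
      have "C (x, t) \<in> U" if "\<bar>x\<bar> < min r1 r2" "\<bar>t\<bar> < min r1 r2" for x t
      proof (cases "0 \<le> t")
        case True
        then have "C (x, 1 * t) \<in> U" using that by (intro r1(3)) auto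
        then show ?thesis by simp
      next
        case False
        then have "C (x, (-1) * (- t)) \<in> U" using that by (intro r2(3)) auto
        then show ?thesis by simp
      qed
      then show thesis using that[of "min r1 r2"] r1(1,2) r2(1,2) by auto
    qed
    let ?A = "(OI \<times> J) \<inter> ({-r<..<r} \<times> {-r<..<r})"
    have "openin (top_of_set (OI \<times> J)) ?A" by (intro openin_open_Int open_Times) auto
    then have "openin Z (C ` ?A)" by (rule open_embeddingD(3)[OF cut_chart_dest(4)[OF C(1)]])
    moreover have "z \<in> C ` ?A" using C(2) r(1) cut_chart_dest(3)[OF C(1)] by (intro image_eqI[of _ _ "(0, 0)"]) auto
    moreover have "C ` ?A \<subseteq> U" using r(3) by auto
    ultimately show ?thesis by blast
  qed
qed

lemma leaf_of_Sp: "w \<in> Sp ==> z \<in> w ==> lf z = w" using lf_eq Sp_leaves by blast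

lemma QQ_onto: assumes z: "z \<in> topspace Z" shows "z \<in> QQ ` Sigma Lam SS"
proof (cases "z \<in> \<Union>Sp")
  case False
  then obtain W where W: "W \<in> WW" "z \<in> W" using WW_cover z by blast
  then obtain i where i: "i \<in> Lam" "Wn i = W" using Wn(2) by blast
  obtain s where s: "s \<in> UNIV \<times> UI" "z = qq i s" using sp_dest(6)[OF i(1)] i(2) W(2) by blast
  then have "s \<in> SS i" using sp_dest(1)[OF i(1)] by blast
  then show ?thesis using i(1) s(2) by (intro image_eqI[of _ _ "(i, s)"]) auto
next
  case True
  then obtain C J where C: "cut_chart C J" "C (0, 0) = z" using cut_chart_exists by metis
  have "chart_side J 1" by (simp add: chart_side_def)
  then obtain i g where sd: "sided C J 1 i g" using sided_exists[OF C(1)] by blast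
  have O: "(0::real) \<in> OI" "(0::real) \<in> {0..<1/2}" by auto
  show ?thesis using sided_dest(3)[OF sd] sided_dest(7,8)[OF sd O] C(2) by (intro image_eqI[of _ _ "(i, g (0, 0))"]) auto
qed

lemma QQ_quotient: "quotient_map (strips_union Lam SS) Z QQ"
  unfolding quotient_map_def top_strips
proof (intro conjI allI impI)
  show "QQ ` Sigma Lam SS = topspace Z" using QQ_onto qq_top by auto
  fix U assume U: "U \<subseteq> topspace Z"
  show "openin (strips_union Lam SS) {p \<in> Sigma Lam SS. QQ p \<in> U} = openin Z U"
  proof
    assume "openin (strips_union Lam SS) {p \<in> Sigma Lam SS. QQ p \<in> U}"
    then have "\<forall>i\<in>Lam. openin (top_of_set (SS i)) {s. (i, s) \<in> {p \<in> Sigma Lam SS. QQ p \<in> U}}"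
      unfolding openin_strips by blast
    then have "openin (top_of_set (SS i)) {s \<in> SS i. qq i s \<in> U}" if "i \<in> Lam" for i
      using that unfolding QQ_preimage[OF that, symmetric] by (rule bspec)
    then show "openin Z U" by (rule QQ_open[OF U])
  next
    assume "openin Z U"
    then show "openin (strips_union Lam SS) {p \<in> Sigma Lam SS. QQ p \<in> U}"
      using openin_continuous_map_preimage[OF QQ_continuous] top_strips by simp
  qed
qed

definition ABI :: "(nat \<times> (real \<times> real)) set set" where "ABI = all_boundary_intervals Lam SS"

lemma ABI: "A \<in> ABI \<longleftrightarrow> (\<exists>i I. i \<in> Lam \<and> I \<in> bint i \<and> A = {i} \<times> I)"
  unfolding ABI_def all_boundary_intervals_def bint_def by blast

lemma ABI_leaf: assumes "A \<in> ABI" "p \<in> A" shows "lf (QQ p) \<in> Sp" "QQ ` A = lf (QQ p)" "inj_on QQ A"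
proof -
  obtain i I where A: "i \<in> Lam" "I \<in> bint i" "A = {i} \<times> I" using assms(1) ABI by blast
  obtain s where s: "s \<in> I" "p = (i, s)" using A assms(2) by blast
  show "lf (QQ p) \<in> Sp" "QQ ` A = lf (QQ p)" unfolding A(3) s(2) QQ_image QQ_pair by (rule bint_leaf[OF A(1,2) s(1)])+
  show "inj_on QQ A" using bint_inj[OF A(1,2)] unfolding A(3) inj_on_def by auto
qed

lemma ABI_nonempty: "A \<in> ABI ==> A \<noteq> {}" using ABI bint(3) by auto

lemma ABI_unique: "A \<in> ABI ==> B \<in> ABI ==> p \<in> A ==> p \<in> B ==> A = B"
  unfolding ABI using bint_unique by blast

lemma sided_interval:
  assumes "sided C J s i g"
  obtains A where "A \<in> ABI" "(i, g (0, 0)) \<in> A" "QQ ` A = lf (C (0, 0))"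
proof -
  have O: "(0::real) \<in> OI" "(0::real) \<in> {0..<1/2}" by auto
  note D = sided_dest[OF assms]
  have i: "i \<in> Lam" by (rule D(3))
  have "g (0, 0) \<in> SS i" "snd (g (0, 0)) \<notin> UI" using D(7,9)[OF O] by simp_all
  then obtain I where I: "I \<in> bint i" "g (0, 0) \<in> I" using bint_exists[OF i] by blast
  have A: "{i} \<times> I \<in> ABI" "(i, g (0, 0)) \<in> {i} \<times> I" using i I ABI by auto
  moreover have "QQ (i, g (0, 0)) = C (0, 0)" using D(8)[OF O] by simp
  ultimately show ?thesis using that ABI_leaf(2)[OF A] by metis
qed

text \<open>The sides of a chart at one point of the leaf contribute one interval each, and by
  \<open>side_match\<close> every interval over the leaf arises in this way. A half disc has a
  single side, and then \<open>A = B\<close>.\<close>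

lemma leaf_intervals:
  assumes w: "w \<in> Sp"
  obtains A B where "A \<in> ABI" "B \<in> ABI" "\<And>D. D \<in> ABI ==> QQ ` D = w \<longleftrightarrow> D = A \<or> D = B"
proof -
  obtain z where z: "z \<in> w" using leaf_ne Sp_leaves w by blast
  obtain C J where C: "cut_chart C J" "C (0, 0) = z" using cut_chart_exists z w by (metis UnionI)
  have lz: "lf (C (0, 0)) = w" unfolding C(2) by (rule leaf_of_Sp[OF w z])
  have O: "(0::real) \<in> OI" by auto
  have s1: "chart_side J 1" by (simp add: chart_side_def)
  obtain i g where sd: "sided C J 1 i g" using sided_exists[OF C(1) s1] by blast
  obtain A where A: "A \<in> ABI" "(i, g (0, 0)) \<in> A" "QQ ` A = w" using sided_interval[OF sd] lz by metis
  have over: "\<exists>m. chart_side J m \<and> (\<forall>j g'. sided C J m j g' --> (j, g' (0, 0)) \<in> D)" if D: "D \<in> ABI" "QQ ` D = w" for D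
  proof -
    obtain j K where K: "j \<in> Lam" "K \<in> bint j" "D = {j} \<times> K" using D(1) ABI by blast
    obtain a where a: "a \<in> K" "qq j a = C (0, 0)" using D(2) z C(2) unfolding K(3) QQ_image by (metis imageE)
    have aS: "a \<in> SS j" "snd a \<notin> UI" using bint(1,2)[OF K(1,2)] a(1) by blast+
    obtain C' J' m' g' x0 where s: "sided C' J' m' j g'" "x0 \<in> OI" "a = g' (x0, 0)" using bdry_sided[OF K(1) aS] by blast
    have "C' (x0, 0) = C (0, 0)" using sided_dest(8)[OF s(1,2), of 0] s(3) a(2) by simp
    then obtain m where "chart_side J m" "\<And>j' h. sided C J m j' h ==> j' = j \<and> h (0, 0) = a"
      using side_match[OF C(1) s(1,2) O] s(3) by metis
    then show ?thesis using a(1) K(3) by blast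
  qed
  show ?thesis
  proof (cases "J = OI")
    case True
    then have s2: "chart_side J (-1)" by (simp add: chart_side_def)
    obtain i' h where sd': "sided C J (-1) i' h" using sided_exists[OF C(1) s2] by blast
    obtain B where B: "B \<in> ABI" "(i', h (0, 0)) \<in> B" "QQ ` B = w" using sided_interval[OF sd'] lz by metis
    show ?thesis
    proof (rule that[OF A(1) B(1)])
      fix D assume D: "D \<in> ABI"
      show "QQ ` D = w \<longleftrightarrow> D = A \<or> D = B"
      proof
        assume "QQ ` D = w"
        then obtain m where s: "chart_side J m" "\<And>j g'. sided C J m j g' ==> (j, g' (0, 0)) \<in> D" using over[OF D] by blast
        have "m = 1 \<or> m = -1" using s(1) unfolding chart_side_def by blast
        then show "D = A \<or> D = B"
        proof
          assume "m = 1"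
          then have "(i, g (0, 0)) \<in> D" using s(2) sd by simp
          then show ?thesis using ABI_unique[OF D A(1)] A(2) by blast
        next
          assume "m = -1"
          then have "(i', h (0, 0)) \<in> D" using s(2) sd' by simp
          then show ?thesis using ABI_unique[OF D B(1)] B(2) by blast
        qed
      qed (use A(3) B(3) in auto)
    qed
  next
    case False
    show ?thesis
    proof (rule that[OF A(1) A(1)])
      fix D assume D: "D \<in> ABI"
      show "QQ ` D = w \<longleftrightarrow> D = A \<or> D = A"
      proof
        assume "QQ ` D = w"
        then obtain m where s: "chart_side J m" "\<And>j g'. sided C J m j g' ==> (j, g' (0, 0)) \<in> D" using over[OF D] by blast
        have "m = 1" using s(1) False unfolding chart_side_def by blast
        then have "(i, g (0, 0)) \<in> D" using s(2) sd by simp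
        then show "D = A \<or> D = A" using ABI_unique[OF D A(1)] A(2) by blast
      qed (use A(3) in auto)
    qed
  qed
qed

lemma QQ_interval_embedding:
  assumes A: "A \<in> ABI" "w \<in> Sp" "QQ ` A = w"
  shows "embedding_map (subtopology (strips_union Lam SS) A) Z QQ"
proof -
  obtain i I where iI: "i \<in> Lam" "I \<in> bint i" "A = {i} \<times> I" using A(1) ABI by blast
  have sub: "A \<subseteq> Sigma Lam SS" using iI bint(1)[OF iI(1,2)] by auto
  have top: "topspace (subtopology (strips_union Lam SS) A) = A" using sub top_strips by auto
  have "homeomorphic_map (subtopology (strips_union Lam SS) A) (subtopology Z w) QQ"
  proof (rule bijective_open_imp_homeomorphic_map)
    show "continuous_map (subtopology (strips_union Lam SS) A) (subtopology Z w) QQ"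
      using continuous_map_from_subtopology[OF QQ_continuous, of A] A(3) sub
      by (auto simp: continuous_map_in_subtopology top_strips)
    show "open_map (subtopology (strips_union Lam SS) A) (subtopology Z w) QQ"
      unfolding open_map_def
    proof (intro allI impI)
      fix U assume "openin (subtopology (strips_union Lam SS) A) U"
      then obtain T where T: "openin (strips_union Lam SS) T" "U = T \<inter> A" unfolding openin_subtopology by blast
      have "openin (top_of_set (SS i)) {s. (i, s) \<in> T}" using T(1) iI(1) unfolding openin_strips by blast
      then obtain T' where T': "open T'" "{s. (i, s) \<in> T} = SS i \<inter> T'" unfolding openin_open by blast
      have "U = {i} \<times> (I \<inter> {s. (i, s) \<in> T})" unfolding T(2) iI(3) by auto
      also have "I \<inter> {s. (i, s) \<in> T} = I \<inter> T'" unfolding T'(2) using bint(1)[OF iI(1,2)] by blast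
      finally have "QQ ` U = qq i ` (I \<inter> T')" by simp
      moreover have "openin (subtopology Z w) (qq i ` (I \<inter> T'))"
        by (rule bint_open_map[OF iI(1,2) A(2)]) (use A(3) iI(3) T'(1) in \<open>auto simp: openin_open_Int\<close>)
      ultimately show "openin (subtopology Z w) (QQ ` U)" by simp
    qed
    have "topspace (subtopology Z w) = w" using leaf_sub Sp_leaves A(2) by auto
    then show "QQ ` topspace (subtopology (strips_union Lam SS) A) = topspace (subtopology Z w)" unfolding top using A(3) by simp
    show "inj_on QQ (topspace (subtopology (strips_union Lam SS) A))"
      unfolding top using ABI_nonempty[OF A(1)] ABI_leaf(3)[OF A(1)] by blast
  qed
  then show ?thesis unfolding embedding_map_def top A(3) .
qed

lemma boundary_interval: assumes "i \<in> Lam" "s \<in> SS i" "snd s \<notin> UI" obtains A where "A \<in> ABI" "(i, s) \<in> A"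
  using bint_exists[OF assms] ABI assms(1) that by (metis SigmaI singletonI)

lemma QQ_inj:
  assumes p: "(i, s) \<in> Sigma Lam SS" "(j, s') \<in> Sigma Lam SS" "QQ (i, s) = QQ (j, s')" "snd s \<in> UI"
  shows "(i, s) = (j, s')"
proof -
  have ij: "i \<in> Lam" "s \<in> SS i" "j \<in> Lam" "s' \<in> SS j" using p by auto
  have w: "qq i s \<in> Wn i" by (rule interior_Wn[OF ij(1) p(4)])
  have "snd s' \<in> UI"
  proof (rule ccontr)
    assume "snd s' \<notin> UI"
    from bdry_Sp[OF ij(3,4) this] have "qq i s \<in> \<Union>Sp" using p(3) by simp
    then show False using w WW(2)[OF Wn(1)[OF ij(1)]] by blast
  qed
  moreover from this have "i = j" using Wn_disjoint[OF ij(1,3) w] interior_Wn[OF ij(3), of s'] p(3) by simp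
  ultimately show ?thesis using interior_inj[OF ij(1) p(4)] p(3) by simp
qed

lemma canonical_SS: "i \<in> Lam ==> canonical_foliation (SS i) = {UNIV \<times> {t} | t. t \<in> UI} \<union> bint i"
  unfolding canonical_foliation_def bint_def by (simp add: SS_lo_hi)

lemma QQ_foliation: "atlas_foliation Lam SS QQ = \<Delta>"
proof (intro equalityI subsetI)
  fix l assume "l \<in> atlas_foliation Lam SS QQ"
  then obtain i L where i: "i \<in> Lam" "L \<in> canonical_foliation (SS i)" "l = QQ ` ({i} \<times> L)" unfolding atlas_foliation_def by blast
  have w: "l = qq i ` L" using i(3) by simp
  show "l \<in> \<Delta>"
  proof (cases "L \<in> bint i")
    case True
    then obtain s where "s \<in> L" using bint(3)[OF i(1)] by blast
    then show ?thesis using bint_leaf[OF i(1) True] w Sp_leaves by (metis subsetD)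
  next
    case False
    then show ?thesis using i(2) sp_dest(7)[OF i(1)] unfolding canonical_SS[OF i(1)] w by blast
  qed
next
  fix l assume l: "l \<in> \<Delta>"
  obtain z where z: "z \<in> l" using leaf_ne l by blast
  have zt: "z \<in> topspace Z" using leaf_sub[OF l] z by blast
  show "l \<in> atlas_foliation Lam SS QQ"
  proof (cases "l \<in> Sp")
    case True
    then obtain A where A: "A \<in> ABI" "QQ ` A = l" using leaf_intervals by metis
    then obtain i I where i: "i \<in> Lam" "I \<in> bint i" "A = {i} \<times> I" using ABI by blast
    have "I \<in> canonical_foliation (SS i)" unfolding canonical_SS[OF i(1)] using i(2) by blast
    then show ?thesis unfolding atlas_foliation_def using i(1) A(2) i(3) by blast
  next
    case False
    have "z \<notin> \<Union>Sp" using leaf_of_Sp lf_eq[OF l z] False by (metis UnionE)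
    then obtain W where W: "W \<in> WW" "z \<in> W" using WW_cover zt by blast
    then obtain i where i: "i \<in> Lam" "Wn i = W" using Wn(2) by blast
    obtain s where s: "s \<in> UNIV \<times> UI" "z = qq i s" using sp_dest(6)[OF i(1)] i(2) W(2) by blast
    have t: "snd s \<in> UI" using s(1) by auto
    have L: "qq i ` (UNIV \<times> {snd s}) \<in> \<Delta>" by (rule sp_dest(7)[OF i(1) t])
    have "z \<in> qq i ` (UNIV \<times> {snd s})" unfolding s(2) by (rule imageI) (simp add: mem_Times_iff)
    then have "l = qq i ` (UNIV \<times> {snd s})" using lf_eq[OF L] lf_eq[OF l z] by metis
    moreover have "UNIV \<times> {snd s} \<in> canonical_foliation (SS i)" unfolding canonical_SS[OF i(1)] using t by blast
    ultimately show ?thesis unfolding atlas_foliation_def using i(1) QQ_image[of i "UNIV \<times> {snd s}"] by blast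
  qed
qed

theorem striped_surface: "striped_surface Z \<Delta>"
proof -
  have "\<forall>w\<in>Sp. \<exists>A B. A \<in> ABI \<and> B \<in> ABI \<and> (\<forall>D\<in>ABI. QQ ` D = w \<longleftrightarrow> D = A \<or> D = B)"
  proof
    fix w assume "w \<in> Sp"
    then show "\<exists>A B. A \<in> ABI \<and> B \<in> ABI \<and> (\<forall>D\<in>ABI. QQ ` D = w \<longleftrightarrow> D = A \<or> D = B)"
      by (rule leaf_intervals) (intro exI conjI ballI)
  qed
  then obtain A :: "'a set => _" and B where AB: "\<And>w. w \<in> Sp ==> A w \<in> ABI" "\<And>w. w \<in> Sp ==> B w \<in> ABI"
    "\<And>w D. w \<in> Sp ==> D \<in> ABI ==> QQ ` D = w \<longleftrightarrow> D = A w \<or> D = B w" by metis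
  have im: "QQ ` A w = w" "QQ ` B w = w" if "w \<in> Sp" for w using AB that by blast+
  \<comment> \<open>A leaf with a single interval is not glued and keeps it as a free boundary
    interval of the atlas; the others are numbered through \<open>to_nat_on\<close>.\<close>
  define \<Gamma> where "\<Gamma> = to_nat_on Sp ` {w \<in> Sp. A w \<noteq> B w}"
  define l where "l = inv_into Sp (to_nat_on Sp)"
  have l: "l (to_nat_on Sp w) = w" if "w \<in> Sp" for w
    unfolding l_def using inj_on_to_nat_on[OF Sp_countable] that by (rule inv_into_f_f)
  have l\<Gamma>: "l \<gamma> \<in> Sp" "A (l \<gamma>) \<noteq> B (l \<gamma>)" "to_nat_on Sp (l \<gamma>) = \<gamma>" if "\<gamma> \<in> \<Gamma>" for \<gamma>
    using that l unfolding \<Gamma>_def by auto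
  have linj: "\<gamma> = \<gamma>'" if "\<gamma> \<in> \<Gamma>" "\<gamma>' \<in> \<Gamma>" "l \<gamma> = l \<gamma>'" for \<gamma> \<gamma>' using l\<Gamma>(3)[OF that(1)] l\<Gamma>(3)[OF that(2)] that(3) by argo
  have "striped_atlas Z Lam SS QQ \<Gamma> (\<lambda>\<gamma>. A (l \<gamma>)) (\<lambda>\<gamma>. B (l \<gamma>))"
    unfolding striped_atlas_def
  proof (intro conjI ballI)
    show "strip (SS i)" if "i \<in> Lam" for i
      unfolding strip_def using sp_dest(1-3)[OF that] by (intro exI[of _ 0] exI[of _ 1]) simp
    show "quotient_map (strips_union Lam SS) Z QQ" by (rule QQ_quotient)
    show "A (l \<gamma>) \<in> all_boundary_intervals Lam SS" "B (l \<gamma>) \<in> all_boundary_intervals Lam SS" if "\<gamma> \<in> \<Gamma>" for \<gamma>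
      using AB(1,2)[OF l\<Gamma>(1)[OF that]] unfolding ABI_def by blast+
    show "inj_on (\<lambda>\<gamma>. A (l \<gamma>)) \<Gamma>" "inj_on (\<lambda>\<gamma>. B (l \<gamma>)) \<Gamma>"
    proof -
      have "l \<gamma> = l \<gamma>'" if g: "\<gamma> \<in> \<Gamma>" "\<gamma>' \<in> \<Gamma>" "A (l \<gamma>) = A (l \<gamma>') \<or> B (l \<gamma>) = B (l \<gamma>')" for \<gamma> \<gamma>'
        using im[OF l\<Gamma>(1)[OF g(1)]] im[OF l\<Gamma>(1)[OF g(2)]] g(3) by metis
      then show "inj_on (\<lambda>\<gamma>. A (l \<gamma>)) \<Gamma>" "inj_on (\<lambda>\<gamma>. B (l \<gamma>)) \<Gamma>" by (auto intro!: inj_onI linj)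
    qed
    show "(\<lambda>\<gamma>. A (l \<gamma>)) ` \<Gamma> \<inter> (\<lambda>\<gamma>. B (l \<gamma>)) ` \<Gamma> = {}"
    proof (rule ccontr)
      assume "(\<lambda>\<gamma>. A (l \<gamma>)) ` \<Gamma> \<inter> (\<lambda>\<gamma>. B (l \<gamma>)) ` \<Gamma> \<noteq> {}"
      then obtain \<gamma> \<gamma>' where g: "\<gamma> \<in> \<Gamma>" "\<gamma>' \<in> \<Gamma>" "A (l \<gamma>) = B (l \<gamma>')" by blast
      then have "l \<gamma> = l \<gamma>'" using im(1)[OF l\<Gamma>(1)[OF g(1)]] im(2)[OF l\<Gamma>(1)[OF g(2)]] by metis
      then show False using l\<Gamma>(2)[OF g(1)] g(3) by simp
    qed
    show "inj_on QQ (topspace (strips_union Lam SS) - (\<Union>\<gamma>\<in>\<Gamma>. A (l \<gamma>) \<union> B (l \<gamma>)))"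
    proof (rule inj_onI)
      fix p p' assume p: "p \<in> topspace (strips_union Lam SS) - (\<Union>\<gamma>\<in>\<Gamma>. A (l \<gamma>) \<union> B (l \<gamma>))"
        "p' \<in> topspace (strips_union Lam SS) - (\<Union>\<gamma>\<in>\<Gamma>. A (l \<gamma>) \<union> B (l \<gamma>))" "QQ p = QQ p'"
      obtain i s where ps: "p = (i, s)" by (cases p)
      obtain j s' where js: "p' = (j, s')" by (cases p')
      have m: "(i, s) \<in> Sigma Lam SS" "(j, s') \<in> Sigma Lam SS" using p ps js top_strips by auto
      then have m': "i \<in> Lam" "s \<in> SS i" "j \<in> Lam" "s' \<in> SS j" by auto
      have e: "QQ (i, s) = QQ (j, s')" using p(3) ps js by simp
      show "p = p'"
      proof (cases "snd s \<in> UI \<or> snd s' \<in> UI")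
        case True
        then show ?thesis using QQ_inj[OF m e] QQ_inj[OF m(2,1) e[symmetric]] ps js by metis
      next
        \<comment> \<open>Both points lie on boundary intervals over one cut leaf. Since they avoid
          all glued intervals, that leaf has a single interval, on which \<open>QQ\<close> is
          injective.\<close>
        case False
        obtain D where D: "D \<in> ABI" "(i, s) \<in> D" using boundary_interval[OF m'(1,2)] False by blast
        obtain D' where D': "D' \<in> ABI" "(j, s') \<in> D'" using boundary_interval[OF m'(3,4)] False by blast
        define w where "w = lf (QQ (i, s))"
        have w: "w \<in> Sp" "QQ ` D = w" "QQ ` D' = w" unfolding w_def by (fact ABI_leaf(1,2)[OF D] ABI_leaf(2)[OF D', folded e])+
        have "A w = B w"
        proof (rule ccontr)
          assume "A w \<noteq> B w"
          then have "to_nat_on Sp w \<in> \<Gamma>" unfolding \<Gamma>_def using w(1) by blast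
          moreover have "p \<in> A (l (to_nat_on Sp w)) \<union> B (l (to_nat_on Sp w))"
            using AB(3)[OF w(1) D(1)] w(2) D(2) ps l[OF w(1)] by auto
          ultimately show False using p(1) by blast
        qed
        then have "D = D'" using AB(3)[OF w(1) D(1)] AB(3)[OF w(1) D'(1)] w(2,3) by simp
        then show ?thesis using inj_onD[OF ABI_leaf(3)[OF D] e] D(2) D'(2) ps js by simp
      qed
    qed
    show "QQ ` A (l \<gamma>) = QQ ` B (l \<gamma>)" "closedin Z (QQ ` A (l \<gamma>))" "closedin Z (QQ ` B (l \<gamma>))"
      "embedding_map (subtopology (strips_union Lam SS) (A (l \<gamma>))) Z QQ"
      "embedding_map (subtopology (strips_union Lam SS) (B (l \<gamma>))) Z QQ" if "\<gamma> \<in> \<Gamma>" for \<gamma>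
    proof -
      note g = l\<Gamma>(1)[OF that]
      have "l \<gamma> \<in> \<Delta>" using g Sp_leaves by blast
      then show "QQ ` A (l \<gamma>) = QQ ` B (l \<gamma>)" "closedin Z (QQ ` A (l \<gamma>))" "closedin Z (QQ ` B (l \<gamma>))"
        using im[OF g] leaf_closed by simp_all
      show "embedding_map (subtopology (strips_union Lam SS) (A (l \<gamma>))) Z QQ" "embedding_map (subtopology (strips_union Lam SS) (B (l \<gamma>))) Z QQ"
        by (rule QQ_interval_embedding[OF _ g]; fact AB(1,2)[OF g] im[OF g])+
    qed
  qed
  then show ?thesis unfolding striped_surface_def using QQ_foliation by blast
qed

end

section \<open>From the foliation to the atlas\<close>

lemma homeomorphic_maps_open_embedding:
  assumes "homeomorphic_maps (subtopology Z U) (top_of_set A) h g" "openin Z U"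
  shows "open_embedding Z A g" "g ` A = U"
proof -
  have U: "topspace (subtopology Z U) = U" using openin_subset[OF assms(2)] by auto
  have m: "homeomorphic_map (top_of_set A) (subtopology Z U) g" using assms(1) by (simp add: homeomorphic_maps_map)
  show im: "g ` A = U" using homeomorphic_imp_surjective_map[OF m] U by simp
  have "openin Z (g ` B)" if "openin (top_of_set A) B" for B
    using homeomorphic_imp_open_map[OF m] that assms(2) unfolding open_map_def by (metis openin_trans_full)
  then show "open_embedding Z A g"
    using homeomorphic_imp_continuous_map[OF m] homeomorphic_imp_injective_map[OF m]
    unfolding open_embedding_def by (auto simp: continuous_map_in_subtopology)
qed

lemma open_embedding_manifold_interior:
  assumes C: "open_embedding Z A C" and A: "open A" "a \<in> A"
  shows "C a \<in> manifold_interior Z"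
proof -
  have "subtopology Z (C ` A) homeomorphic_space top_of_set A"
    using open_embedding_homeomorphic_map[OF C] homeomorphic_map_imp_homeomorphic_space homeomorphic_space_sym by blast
  then show ?thesis unfolding manifold_interior_def
    using open_embeddingD(4)[OF C] A openin_subset[OF open_embeddingD(4)[OF C]] by blast
qed

text \<open>If the point also had a planar chart, invariance of domain would produce an open subset
  of the plane that lies in the half disc and contains a point of its edge.\<close>

lemma half_disc_manifold_boundary:
  assumes C: "open_embedding Z (OI \<times> {0..<1}) C" and x0: "x0 \<in> OI"
  shows "C (x0, 0) \<in> manifold_boundary Z"
proof -
  let ?A = "OI \<times> {0..<1::real}"
  have top: "C (x0, 0) \<in> topspace Z" using openin_subset[OF open_embeddingD(4)[OF C]] x0 by force
  have "C (x0, 0) \<notin> manifold_interior Z"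
  proof
    assume "C (x0, 0) \<in> manifold_interior Z"
    then obtain U V where UV: "openin Z U" "C (x0, 0) \<in> U" "open (V :: (real \<times> real) set)"
      "subtopology Z U homeomorphic_space top_of_set V" unfolding manifold_interior_def by blast
    then obtain h g where hg: "homeomorphic_maps (subtopology Z U) (top_of_set V) h g" unfolding homeomorphic_space_def by blast
    note g = homeomorphic_maps_open_embedding[OF hg UV(1)]
    define V' where "V' = {v \<in> V. g v \<in> C ` ?A}"
    have "openin (top_of_set V) V'"
      unfolding V'_def using openin_continuous_map_preimage[OF open_embeddingD(1)[OF g(1)] open_embeddingD(4)[OF C]] by simp
    then have V': "open V'" using UV(3) openin_open_trans by blast
    have cg: "continuous_map (top_of_set V') Z g"
      by (rule continuous_map_from_subtopology_mono[OF open_embeddingD(1)[OF g(1)]]) (auto simp: V'_def)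
    have inC: "g v \<in> C ` ?A" if "v \<in> V'" for v using that by (simp add: V'_def)
    define f where "f v = inv_into ?A C (g v)" for v
    have f: "continuous_on V' f" "\<And>v. v \<in> V' ==> f v \<in> ?A" "\<And>v. v \<in> V' ==> C (f v) = g v"
      unfolding f_def using open_embedding_pull[OF C cg inC] by auto
    have "inj_on f V'"
    proof (rule inj_onI)
      fix v w assume vw: "v \<in> V'" "w \<in> V'" "f v = f w"
      then have "g v = g w" using f(3) by metis
      then show "v = w" using inj_onD[OF open_embeddingD(2)[OF g(1)]] vw by (simp add: V'_def)
    qed
    then have o: "open (f ` V')" using invariance_of_domain f(1) V' by blast
    have A0: "(x0, 0) \<in> ?A" using x0 by simp
    obtain v where v: "v \<in> V" "g v = C (x0, 0)" using g(2) UV(2) by (metis imageE)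
    then have vV: "v \<in> V'" using A0 by (auto simp: V'_def)
    have "f v = (x0, 0)" using inj_onD[OF open_embeddingD(2)[OF C]] f(2,3)[OF vV] v(2) A0 by metis
    then have "(x0, 0) \<in> f ` V'" using vV by (metis imageI)
    then obtain e where e: "e > 0" "ball (x0, 0) e \<subseteq> f ` V'" using o open_contains_ball by blast
    have "dist (x0, 0) (x0, - e / 2) < e" using e(1) by (simp add: dist_Pair_Pair dist_real_def)
    then have "(x0, - e / 2) \<in> f ` V'" using e(2) by auto
    moreover have "f ` V' \<subseteq> ?A" using f(2) by (rule image_subsetI)
    ultimately have "(x0, - e / 2) \<in> ?A" by (rule rev_subsetD)
    then show False using e(1) by auto
  qed
  then show ?thesis unfolding manifold_boundary_def using top by blast
qed

text \<open>A leaf homeomorphic to the line in its subspace topology is locally connected, so the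
  plaques, being components of its trace on \<open>U\<close>, are open in it. This gives the
  isolation clause of \<open>fchart\<close>.\<close>

lemma foliation_fchart:
  assumes disj: "pairwise disjnt \<Delta>" and line: "\<And>w. w \<in> \<Delta> ==> subtopology Z w homeomorphic_space euclideanreal"
    and U: "openin Z U" and h: "homeomorphic_map (subtopology Z U) (top_of_set (OI \<times> J)) h"
    and part: "(\<lambda>C. h ` C) ` induced_partition Z \<Delta> U = {OI \<times> {t} | t. t \<in> J}"
  obtains C where "fchart Z \<Delta> C J" "C ` (OI \<times> J) = U"
proof -
  obtain C where hC: "homeomorphic_maps (subtopology Z U) (top_of_set (OI \<times> J)) h C" using h homeomorphic_map_maps by blast
  note C = homeomorphic_maps_open_embedding[OF hC U]
  have Ch: "C (h z) = z" if "z \<in> U" for z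
    using hC that openin_subset[OF U] unfolding homeomorphic_maps_def by auto
  have plaque: "\<exists>w\<in>\<Delta>. C ` (OI \<times> {t}) \<in> connected_components_of (subtopology Z (w \<inter> U))" if "t \<in> J" for t
  proof -
    have "OI \<times> {t} \<in> (\<lambda>C. h ` C) ` induced_partition Z \<Delta> U" unfolding part using that by blast
    then obtain P w where P: "w \<in> \<Delta>" "P \<in> connected_components_of (subtopology Z (w \<inter> U))" "h ` P = OI \<times> {t}"
      unfolding induced_partition_def by force
    have "P \<subseteq> U" using connected_components_of_subset[OF P(2)] by auto
    then have "C ` h ` P = P" using Ch by (force simp: image_image)
    then show ?thesis using P by auto
  qed
  then obtain L where L: "\<And>t. t \<in> J ==> L t \<in> \<Delta>"
    "\<And>t. t \<in> J ==> C ` (OI \<times> {t}) \<in> connected_components_of (subtopology Z (L t \<inter> U))" by metis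
  have inL: "C (x, t) \<in> L t" if "x \<in> OI" "t \<in> J" for x t
    using connected_components_of_subset[OF L(2)[OF that(2)]] that by auto
  have lL: "leaf_of \<Delta> (C (x, t)) = L t" if "x \<in> OI" "t \<in> J" for x t
    by (rule leaf_of_eq[OF disj L(1)[OF that(2)] inL[OF that]])
  have O: "(0::real) \<in> OI" by simp
  have "fchart Z \<Delta> C J"
    unfolding fchart_def
  proof (intro conjI ballI)
    show "open_embedding Z (OI \<times> J) C" by (rule C(1))
    show "leaf_of \<Delta> (C (x, t)) = leaf_of \<Delta> (C (0, t))" if "x \<in> OI" "t \<in> J" for x t unfolding lL[OF that] lL[OF O that(2)] ..
    fix t0 assume t0: "t0 \<in> J"
    let ?w = "L t0"
    have lc: "locally_connected_space (subtopology Z ?w)"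
      using homeomorphic_locally_connected_space[OF line[OF L(1)[OF t0]]] locally_connected_space_euclideanreal by blast
    have oU: "openin (subtopology Z ?w) (U \<inter> ?w)" using U by (rule openin_subtopology_Int)
    have eq: "subtopology (subtopology Z ?w) (U \<inter> ?w) = subtopology Z (?w \<inter> U)" by (simp add: subtopology_subtopology Int_ac)
    have "openin (subtopology Z (?w \<inter> U)) (C ` (OI \<times> {t0}))"
      using openin_connected_components_of_locally_connected_space[OF locally_connected_space_open_subset[OF lc oU]] L(2)[OF t0] unfolding eq by blast
    then have "openin (subtopology Z ?w) (C ` (OI \<times> {t0}))" using openin_trans_full[OF _ oU] unfolding eq by blast
    then obtain N where N: "openin Z N" "C ` (OI \<times> {t0}) = N \<inter> ?w" unfolding openin_subtopology by blast
    have C0: "C (0, t0) \<in> N" using N(2) O by auto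
    obtain r where r: "r > 0" "\<And>x t. (x, t) \<in> OI \<times> J ==> \<bar>x - 0\<bar> < r ==> \<bar>t - t0\<bar> < r ==> C (x, t) \<in> N"
      using continuous_map_nbhd2[OF open_embeddingD(1)[OF C(1)] _ N(1) C0] O t0 by auto
    show "\<exists>d>0. \<forall>t\<in>J. t \<noteq> t0 --> \<bar>t - t0\<bar> < d --> leaf_of \<Delta> (C (0, t)) \<noteq> leaf_of \<Delta> (C (0, t0))"
    proof (intro exI[of _ r] conjI ballI impI notI)
      fix t assume t: "t \<in> J" "t \<noteq> t0" "\<bar>t - t0\<bar> < r" "leaf_of \<Delta> (C (0, t)) = leaf_of \<Delta> (C (0, t0))"
      have "C (0, t) \<in> ?w" using inL[OF O t(1)] t(4) unfolding lL[OF O t(1)] lL[OF O t0] by simp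
      moreover have "C (0, t) \<in> N" using r(2)[of 0 t] r(1) t by simp
      ultimately obtain x where x: "x \<in> OI" "C (0, t) = C (x, t0)" using N(2) by blast
      then have "(0, t) = (x, t0)" using inj_onD[OF open_embeddingD(2)[OF C(1)] x(2)] t(1) t0 by simp
      then show False using t(2) by simp
    qed (rule r(1))
  qed
  then show ?thesis using that C(2) by blast
qed

text \<open>A half disc becomes a full disc at points off its edge and is merely rescaled at points
  on it. Thus the shape of a centred chart distinguishes interior from boundary points.\<close>

lemma fchart_recenter:
  assumes C: "fchart Z \<Delta> C J" and J: "J = OI \<or> J = {0..<1}" and x0: "x0 \<in> OI" and t0: "t0 \<in> J"
  obtains C' J' where "J' = OI \<or> (J' = {0..<1} \<and> J = {0..<1})" "fchart Z \<Delta> C' J'" "C' (0, 0) = C (x0, t0)"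
proof (cases "J = {0..<1} \<and> t0 = 0")
  case True
  define r where "r = 1 - \<bar>x0\<bar>"
  have r: "0 < r" "r \<le> 1" "{x0 - r<..<x0 + r} \<subseteq> OI" using x0 by (auto simp: r_def abs_if)
  have "(\<lambda>t. 0 + r * t) ` {0..<1} = {0..<1} \<inter> {..<r}" unfolding affine_image(2)[OF r(1)] using r(2) by auto
  then have "openin (top_of_set J) ((\<lambda>t. 0 + r * t) ` {0..<1})" using True by (simp add: openin_open_Int)
  from fchart_affine[OF C r(1,3) this] show ?thesis using that[of "{0..<1}" "\<lambda>p. C (x0 + r * fst p, 0 + r * snd p)"] True by simp
next
  case False
  define r where "r = min (1 - \<bar>x0\<bar>) (if J = OI then 1 - \<bar>t0\<bar> else min t0 (1 - t0))"
  have r: "0 < r" "{x0 - r<..<x0 + r} \<subseteq> OI" "{t0 - r<..<t0 + r} \<subseteq> J"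
  proof -
    have "0 < 1 - \<bar>x0\<bar>" using x0 by auto
    moreover have "0 < (if J = OI then 1 - \<bar>t0\<bar> else min t0 (1 - t0))" using J t0 False by auto
    ultimately show "0 < r" by (simp add: r_def)
    have "r \<le> 1 - \<bar>x0\<bar>" by (simp add: r_def)
    then show "{x0 - r<..<x0 + r} \<subseteq> OI" by (auto simp: abs_if split: if_splits)
    have "r \<le> 1 - \<bar>t0\<bar>" if "J = OI" using that by (simp add: r_def)
    moreover have "r \<le> t0" "r \<le> 1 - t0" if "J \<noteq> OI" using that by (simp_all add: r_def)
    ultimately show "{t0 - r<..<t0 + r} \<subseteq> J" using J by (cases "J = OI") (auto simp: abs_if split: if_splits)
  qed
  note affine_image(1)[OF r(1), of t0]
  moreover have "openin (top_of_set J) {t0 - r<..<t0 + r}" using r(3) by (simp add: open_subset)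
  ultimately have "openin (top_of_set J) ((\<lambda>t. t0 + r * t) ` OI)" by simp
  from fchart_affine[OF C r(1,2) this] show ?thesis using that[of OI "\<lambda>p. C (x0 + r * fst p, t0 + r * snd p)"] by simp
qed

lemma foliation_foliated_surface:
  assumes "surface_with_boundary Z" and fol: "foliation Z \<Delta>"
    and leaves: "\<forall>w\<in>\<Delta>. subtopology Z w homeomorphic_space euclideanreal \<and> closedin Z w"
  shows "foliated_surface Z \<Delta> (manifold_boundary Z)"
proof
  show "Hausdorff_space Z" "second_countable Z" using assms(1) by (auto simp: surface_with_boundary_def)
  show "\<Union>\<Delta> = topspace Z" and disj: "pairwise disjnt \<Delta>" and "\<And>w. w \<in> \<Delta> ==> w \<noteq> {}" "\<And>w. w \<in> \<Delta> ==> connectedin Z w"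
    using fol by (simp_all add: foliation_def)
  show "\<And>w. w \<in> \<Delta> ==> closedin Z w" and line: "\<And>w. w \<in> \<Delta> ==> subtopology Z w homeomorphic_space euclideanreal"
    using leaves by blast+
  fix z assume z: "z \<in> topspace Z"
  have "\<exists>U h J. openin Z U \<and> z \<in> U \<and> (J = OI \<or> J = {0..<1}) \<and> homeomorphic_map (subtopology Z U) (top_of_set (OI \<times> J)) h \<and>
      (\<lambda>C. h ` C) ` induced_partition Z \<Delta> U = {OI \<times> {t} | t. t \<in> J}"
    using fol z unfolding foliation_def by (elim conjE) (erule bspec)
  then obtain U h J where U: "openin Z U" "z \<in> U" "J = OI \<or> J = {0..<1}" "homeomorphic_map (subtopology Z U) (top_of_set (OI \<times> J)) h"
      "(\<lambda>C. h ` C) ` induced_partition Z \<Delta> U = {OI \<times> {t} | t. t \<in> J}"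
    by (elim exE conjE) (rule that)
  obtain C where C: "fchart Z \<Delta> C J" "C ` (OI \<times> J) = U" using foliation_fchart[OF disj line U(1,4,5)] by blast
  obtain x0 t0 where xt: "x0 \<in> OI" "t0 \<in> J" "C (x0, t0) = z" using C(2) U(2) by blast
  obtain C' J' where C': "J' = OI \<or> J' = {0..<1}" "fchart Z \<Delta> C' J'" "C' (0, 0) = z"
    using fchart_recenter[OF C(1) U(3) xt(1,2)] xt(3) by metis
  have oe: "open_embedding Z (OI \<times> J') C'" using C'(2) by (simp add: fchart_def)
  have O: "(0::real) \<in> OI" by simp
  have "z \<notin> manifold_boundary Z" if "J' = OI"
    using open_embedding_manifold_interior[OF oe, of "(0, 0)"] that C'(3) by (auto simp: manifold_boundary_def open_Times)
  moreover have "z \<in> manifold_boundary Z" if "J' = {0..<1}"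
    using half_disc_manifold_boundary[OF _ O, of Z C'] oe that C'(3) by simp
  ultimately show "\<exists>C J. (z \<notin> manifold_boundary Z \<and> J = OI \<or> z \<in> manifold_boundary Z \<and> J = {0..<1}) \<and> fchart Z \<Delta> C J \<and> C (0, 0) = z"
    using C' by blast
qed

lemma locally_finite_in_Un:
  assumes "locally_finite_in X \<A>" "locally_finite_in X \<B>"
  shows "locally_finite_in X (\<A> \<union> \<B>)"
  unfolding locally_finite_in_def
proof (intro conjI ballI)
  show "\<Union>(\<A> \<union> \<B>) \<subseteq> topspace X" using assms by (auto simp: locally_finite_in_def)
  fix x assume "x \<in> topspace X"
  then obtain V W where V: "openin X V" "x \<in> V" "finite {U \<in> \<A>. U \<inter> V \<noteq> {}}"
    and W: "openin X W" "x \<in> W" "finite {U \<in> \<B>. U \<inter> W \<noteq> {}}"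
    using assms unfolding locally_finite_in_def by meson
  have "{U \<in> \<A> \<union> \<B>. U \<inter> (V \<inter> W) \<noteq> {}} \<subseteq> {U \<in> \<A>. U \<inter> V \<noteq> {}} \<union> {U \<in> \<B>. U \<inter> W \<noteq> {}}" by blast
  then have "finite {U \<in> \<A> \<union> \<B>. U \<inter> (V \<inter> W) \<noteq> {}}" using V(3) W(3) by (rule finite_subset[OF _ finite_UnI])
  then show "\<exists>V. openin X V \<and> x \<in> V \<and> finite {U \<in> \<A> \<union> \<B>. U \<inter> V \<noteq> {}}"
    using openin_Int[OF V(1) W(1)] V(2) W(2) by (intro exI[of _ "V \<inter> W"] conjI IntI)
qed

text \<open>Off its central plaque a chart restricts to an embedding of an open planar set, so it
  can touch the boundary only along that plaque and meets at most one boundary leaf.\<close>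

lemma (in foliated_surface) boundary_leaves_locally_finite:
  assumes Bd: "Bd = manifold_boundary Z"
  shows "locally_finite_in Z {l \<in> \<Delta>. l \<subseteq> Bd}"
  unfolding locally_finite_in_def
proof (intro conjI ballI)
  show "\<Union>{l \<in> \<Delta>. l \<subseteq> Bd} \<subseteq> topspace Z" using leaf_sub by blast
  fix z assume "z \<in> topspace Z"
  then obtain C J where CJ: "J = OI \<or> J = {0..<1}" "fchart Z \<Delta> C J" "C (0, 0) = z" using charts by metis
  have J0: "0 \<in> J" using CJ(1) by auto
  have oe: "open_embedding Z (OI \<times> J) C" using CJ(2) by (simp add: fchart_def)
  have b: "t = 0" if xt: "x \<in> OI" "t \<in> J" "C (x, t) \<in> Bd" for x t
  proof (rule ccontr)
    assume "t \<noteq> 0"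
    let ?J = "J - {0}"
    have "{0..<1} - {0} = UI" by auto
    moreover have "open (OI - {0})" by (intro open_delete) simp
    ultimately have J: "open ?J" using CJ(1) by (metis open_greaterThanLessThan)
    have "openin (top_of_set J) ?J" by (rule open_subset[OF _ J]) blast
    then have "openin (top_of_set (OI \<times> J)) (OI \<times> ?J)" by (intro openin_Times) simp_all
    then have "C (x, t) \<in> manifold_interior Z"
      using open_embedding_manifold_interior[OF open_embedding_subset[OF oe]] J xt(1,2) \<open>t \<noteq> 0\<close> by (simp add: open_Times)
    then show False using xt(3) unfolding Bd manifold_boundary_def by simp
  qed
  have "{l \<in> {l \<in> \<Delta>. l \<subseteq> Bd}. l \<inter> C ` (OI \<times> J) \<noteq> {}} \<subseteq> {lf z}"
  proof
    fix l assume "l \<in> {l \<in> {l \<in> \<Delta>. l \<subseteq> Bd}. l \<inter> C ` (OI \<times> J) \<noteq> {}}"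
    then obtain x t where w: "l \<in> \<Delta>" "l \<subseteq> Bd" "x \<in> OI" "t \<in> J" "C (x, t) \<in> l" by blast
    then have t: "t = 0" using b by blast
    have "lf (C (x, t)) = lf z" using fchart_dest(4)[OF CJ(2) w(3) J0] unfolding t CJ(3) .
    then show "l \<in> {lf z}" using lf_eq[OF w(1,5)] by simp
  qed
  then have "finite {l \<in> {l \<in> \<Delta>. l \<subseteq> Bd}. l \<inter> C ` (OI \<times> J) \<noteq> {}}" by (rule finite_subset) simp
  moreover have "z \<in> C ` (OI \<times> J)" using CJ(3) J0 by (intro image_eqI[of _ _ "(0, 0)"]) auto
  ultimately show "\<exists>V. openin Z V \<and> z \<in> V \<and> finite {l \<in> {l \<in> \<Delta>. l \<subseteq> Bd}. l \<inter> V \<noteq> {}}"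
    using open_embeddingD(4)[OF oe] by blast
qed

text \<open>The neighbourhood \<open>U\<close> need not be open, so its interior \<open>P\<close> is
  used, which is again saturated. The image of \<open>P\<close> contains a small disc around the
  origin and by saturation all lines of height below \<open>d\<close>; their preimages are whole
  leaves. Slabs are closed in \<open>Z\<close> because they are closed in the closure of
  \<open>U\<close>.\<close>

lemma (in foliated_surface) regular_ribbon:
  fixes h :: "'a => real \<times> real"
  assumes U: "U \<subseteq> topspace Z" "saturated \<Delta> U" "w \<subseteq> Z interior_of U"
    and h: "homeomorphic_map (subtopology Z (Z closure_of U)) (top_of_set (UNIV \<times> {-1..1})) h"
    and hU: "h ` U = UNIV \<times> {-1<..<1}"
    and part: "(\<lambda>C. h ` C) ` induced_partition Z \<Delta> (Z closure_of U) = {UNIV \<times> {t} | t. t \<in> {-1..1}}"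
    and hw: "h ` w = UNIV \<times> {0}"
  shows "\<exists>k. ribbon Z \<Delta> k \<and> k ` (UNIV \<times> {0}) = w"
proof -
  let ?K = "Z closure_of U" and ?S = "UNIV \<times> {-1..1} :: (real \<times> real) set"
  define P where "P = Z interior_of U"
  have P: "openin Z P" "saturated \<Delta> P" "P \<subseteq> U" "w \<subseteq> P"
    unfolding P_def using saturated_interior[OF U(2)] interior_of_subset[of Z U] U(3) by simp_all
  have UK: "U \<subseteq> ?K" by (rule closure_of_subset[OF U(1)])
  have Kt: "?K \<subseteq> topspace Z" by (rule closure_of_subset_topspace)
  obtain g where hg: "homeomorphic_maps (subtopology Z ?K) (top_of_set ?S) h g" using h homeomorphic_map_maps by blast
  have gh: "g (h z) = z" if "z \<in> ?K" for z using hg that Kt unfolding homeomorphic_maps_def by auto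
  have "h ` P \<subseteq> UNIV \<times> {-1<..<1}" unfolding hU[symmetric] using P(3) by (rule image_mono)
  then have hP: "h ` P \<subseteq> ?S" by force
  have "homeomorphic_maps (subtopology (subtopology Z ?K) P) (subtopology (top_of_set ?S) (h ` P)) h g"
  proof (rule homeomorphic_maps_subtopologies[OF hg])
    have "topspace (subtopology Z ?K) \<inter> P = P" using P(3) UK Kt by auto
    then show "h ` (topspace (subtopology Z ?K) \<inter> P) = topspace (top_of_set ?S) \<inter> h ` P" using hP by auto
  qed
  moreover have "subtopology (subtopology Z ?K) P = subtopology Z P" using P(3) UK by (simp add: subtopology_subtopology inf.absorb2)
  moreover have "subtopology (top_of_set ?S) (h ` P) = top_of_set (h ` P)" using hP by (simp add: subtopology_subtopology inf.absorb2)
  ultimately have hP': "homeomorphic_maps (subtopology Z P) (top_of_set (h ` P)) h g" by simp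
  note g = homeomorphic_maps_open_embedding[OF hP' P(1)]
  have "openin (subtopology Z ?K) P" using P(1,3) UK by (metis inf.absorb1 order_trans openin_subtopology_Int)
  then have "openin (top_of_set ?S) (h ` P)" using homeomorphic_imp_open_map[OF h] unfolding open_map_def by blast
  moreover have "(0, 0) \<in> h ` P" using hw P(4) by blast
  ultimately obtain e where e: "e > 0" "\<And>p. p \<in> ?S ==> dist p (0, 0) < e ==> p \<in> h ` P"
    unfolding openin_euclidean_subtopology_iff by blast
  define d where "d = min e 1"
  have d: "0 < d" "d \<le> e" "d \<le> 1" using e(1) by (auto simp: d_def)
  have row: "g ` (UNIV \<times> {t}) \<in> \<Delta>" "UNIV \<times> {t} \<subseteq> h ` P" if t: "\<bar>t\<bar> < d" for t
  proof -
    have tS: "t \<in> {-1..1}" using t d by auto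
    have "dist (0::real, t) (0, 0) < e" using t d by (simp add: dist_Pair_Pair)
    then have t0: "(0, t) \<in> h ` P" using e(2) tS by blast
    have "UNIV \<times> {t} \<in> (\<lambda>C. h ` C) ` induced_partition Z \<Delta> ?K" unfolding part using tS by blast
    then obtain D w' where D: "w' \<in> \<Delta>" "D \<in> connected_components_of (subtopology Z (w' \<inter> ?K))" "h ` D = UNIV \<times> {t}"
      unfolding induced_partition_def by force
    have DK: "D \<subseteq> w' \<inter> ?K" using connected_components_of_subset[OF D(2)] by auto
    have "(0, t) \<in> h ` D" unfolding D(3) by simp
    then obtain z where z: "z \<in> D" "h z = (0, t)" by (metis imageE)
    obtain z' where z': "z' \<in> P" "h z' = (0, t)" using t0 by (metis imageE)
    have "z = z'" using gh[of z] gh[of z'] z z' DK P(3) UK by (metis IntD2 subsetD)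
    then have wP: "w' \<subseteq> P" using P(2) D(1) z' z DK unfolding saturated_def by blast
    then have "w' \<inter> ?K = w'" using P(3) UK by blast
    moreover have "connected_space (subtopology Z w')" using leaf_conn[OF D(1)] connectedin_def by blast
    moreover have "topspace (subtopology Z w') = w'" using leaf_sub[OF D(1)] by auto
    ultimately have "D = w'" using D(2) connected_components_of_connected_space[of "subtopology Z w'"] by (auto split: if_splits)
    moreover have "g ` (UNIV \<times> {t}) = D" unfolding D(3)[symmetric] using gh DK by (force simp: image_image)
    ultimately show "g ` (UNIV \<times> {t}) \<in> \<Delta>" using D(1) by simp
    show "UNIV \<times> {t} \<subseteq> h ` P" unfolding D(3)[symmetric] \<open>D = w'\<close> using wP by (rule image_mono)
  qed
  define k where "k p = g (fst p, d * snd p)" for p :: "real \<times> real"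
  have im: "(\<lambda>p. (fst p, d * snd p)) ` (UNIV \<times> A) = UNIV \<times> (\<lambda>t. d * t) ` A" for A :: "real set" by force
  have kim: "k ` (UNIV \<times> A) = g ` (UNIV \<times> (\<lambda>t. d * t) ` A)" for A unfolding im[symmetric] k_def by (simp add: image_image)
  have dOI: "(\<lambda>t. d * t) ` OI = {-d<..<d}" by (rule scale_image_OI[OF d(1)])
  have "ribbon Z \<Delta> k"
    unfolding ribbon_def
  proof (intro conjI ballI allI impI)
    have "homeomorphism (UNIV \<times> OI) ((\<lambda>p. (fst p, d * snd p)) ` (UNIV \<times> OI)) (\<lambda>p. (fst p, d * snd p)) (\<lambda>p. (fst p, snd p / d))"
      unfolding homeomorphism_def using d(1) by (auto intro!: continuous_intros simp: image_image)
    moreover have "openin (top_of_set (h ` P)) ((\<lambda>p. (fst p, d * snd p)) ` (UNIV \<times> OI))"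
      unfolding im dOI
    proof (rule open_subset)
      show "UNIV \<times> {-d<..<d} \<subseteq> h ` P" using row(2) by force
    qed (simp add: open_Times)
    ultimately show "open_embedding Z (UNIV \<times> OI) k"
      unfolding k_def by (rule open_embedding_reparam[OF g(1)])
    show "k ` (UNIV \<times> {t}) \<in> \<Delta>" if "t \<in> OI" for t
    proof -
      have "d * t \<in> {-d<..<d}" using dOI that by blast
      then show ?thesis unfolding kim using row(1)[of "d * t"] by auto
    qed
    fix a b :: real assume ab: "-1 < a" "b < 1"
    have "(\<lambda>t. d * t) ` {a..b} = {d * a..d * b}" using d(1) by simp
    then have e: "k ` (UNIV \<times> {a..b}) = g ` (UNIV \<times> {d * a..d * b})" by (simp only: kim)
    have "{d * a..d * b} \<subseteq> {-1..1}"
    proof (cases "a \<le> b")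
      case True
      have "\<bar>d * t\<bar> \<le> 1" if "\<bar>t\<bar> \<le> 1" for t unfolding abs_mult using d that by (simp add: mult_le_one)
      moreover have "\<bar>a\<bar> \<le> 1" "\<bar>b\<bar> \<le> 1" using ab True by auto
      ultimately have "\<bar>d * a\<bar> \<le> 1" "\<bar>d * b\<bar> \<le> 1" by blast+
      then show ?thesis by auto
    qed (use d in auto)
    then have "closedin (top_of_set ?S) (UNIV \<times> {d * a..d * b})" by (intro closed_subset closed_Times) auto
    then have "closedin (subtopology Z ?K) (g ` (UNIV \<times> {d * a..d * b}))"
      using homeomorphic_imp_closed_map[of "top_of_set ?S" "subtopology Z ?K" g] hg unfolding homeomorphic_maps_map closed_map_def by blast
    then show "closedin Z (k ` (UNIV \<times> {a..b}))" unfolding e using closedin_trans_full closedin_closure_of by blast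
  qed
  moreover have "k ` (UNIV \<times> {0}) = w"
  proof -
    have "w \<subseteq> ?K" using P UK by blast
    then have "g ` h ` w = w" using gh by (force simp: image_image)
    then show ?thesis unfolding kim using hw by simp
  qed
  ultimately show ?thesis by blast
qed

text \<open>The pieces were found with respect to \<open>Sp\<close>, but the strips are built with
  \<open>\<Sigma>\<close> in its place. The ribs are ribs for the larger family too, because each
  lies in a component avoiding \<open>\<Sigma>\<close>.\<close>

lemma (in ribboned_surface) striped: "striped_surface Z \<Delta>"
proof -
  obtain \<Sigma> where \<Sigma>: "\<Sigma> \<subseteq> \<Delta>" "locally_finite_in Z \<Sigma>" "Sp \<subseteq> \<Sigma>"
    "\<And>W. W \<in> connected_components_of (subtopology Z (topspace Z - \<Union>\<Sigma>)) ==> \<exists>c. rib c \<and> ribsat c = W"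
    using cut_leaves_exist by metis
  interpret s: ribboned_surface Z \<Delta> Bd \<Sigma> by (rule ribboned_surface_larger[OF \<Sigma>(1-3)])
  interpret s: cut_surface Z \<Delta> Bd \<Sigma>
  proof
    fix W assume W: "W \<in> connected_components_of (subtopology Z (topspace Z - \<Union>\<Sigma>))"
    then obtain c where c: "rib c" "ribsat c = W" using \<Sigma>(4) by blast
    have WS: "W \<inter> \<Union>\<Sigma> = {}" using connected_components_of_subset[OF W] by auto
    have "lf (c (0, t)) \<notin> \<Sigma>" if t: "t \<in> UI" for t
    proof -
      have "openin Z (c ` (OI \<times> UI))" using c(1) open_embeddingD(4) unfolding rib_def by blast
      then have ct: "c ` (OI \<times> UI) \<subseteq> topspace Z" by (rule openin_subset)
      moreover have m: "c (0, t) \<in> c ` (OI \<times> UI)" using t by simp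
      ultimately have "c (0, t) \<in> W" using sub_sat[OF ct] c(2) unfolding ribsat_def by blast
      then have "c (0, t) \<notin> \<Union>\<Sigma>" using WS by blast
      moreover have "c (0, t) \<in> lf (c (0, t))" using lf_in(2) ct m by blast
      ultimately show ?thesis by blast
    qed
    then have "s.rib c" using c(1) unfolding rib_def s.rib_def by blast
    moreover have "s.ribsat c = W" using c(2) unfolding ribsat_def s.ribsat_def .
    ultimately show "\<exists>c. s.rib c \<and> s.ribsat c = W" by blast
  qed
  show ?thesis by (rule s.striped_surface)
qed

lemma (in ribboned_surface) boundary_cross_section:
  assumes Bd: "Bd = manifold_boundary Z" and w: "w \<in> \<Delta>" "w \<subseteq> Bd"
  shows "admits_cross_section Z \<Delta> w"
proof -
  obtain z where z: "z \<in> w" using leaf_ne[OF w(1)] by blast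
  then have zB: "z \<in> Bd" "z \<in> \<Union>Sp" using w Bd_Sp by auto
  obtain C where C: "cut_chart C {0..<1}" "C (0, 0) = z" using cut_chart_exists[OF zB(2)] zB(1) by metis
  have hc: "half_chart C" using cut_chart_half[OF C(1), of 1] by (simp add: chart_side_def)
  define \<gamma> where "\<gamma> t = C (0, t)" for t
  have cont: "continuous_map (top_of_set {0..<1}) Z \<gamma>" using half_chart_line[OF hc] by (simp add: \<gamma>_def[abs_def])
  \<comment> \<open>The starting point lies on a leaf of \<open>Sp\<close> and no other point of the
    arc does; between positive parameters \<open>half_chart_inj\<close> applies.\<close>
  have ne: "lf (\<gamma> s) \<noteq> lf (\<gamma> t)" if "s < t" "s \<in> {0..<1}" "t \<in> {0..<1}" for s t
  proof (cases "s = 0")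
    case True
    then show ?thesis using half_chart_dest(4)[OF hc, of t] half_chart_dest(5)[OF hc] that unfolding \<gamma>_def by auto
  next
    case False
    then show ?thesis using inj_onD[OF half_chart_inj[OF hc], of s t] that unfolding \<gamma>_def by auto
  qed
  have "cross_section Z \<Delta> {0..<1} \<gamma>"
    unfolding cross_section_def
  proof (intro conjI ballI impI notI)
    show "\<exists>a b. a < b \<and> ({0..<1} = {a..<b} \<and> \<gamma> a \<in> manifold_boundary Z \<or> {0..<1} = {a<..<b})"
      using zB(1) C(2) unfolding Bd by (intro exI[of _ 0] exI[of _ 1]) (simp add: \<gamma>_def)
    show "continuous_map (top_of_set {0..<1}) Z \<gamma>" by (rule cont)
    fix s t assume st: "s \<in> {0..<1::real}" "t \<in> {0..<1}" "s \<noteq> t" "\<exists>w\<in>\<Delta>. \<gamma> s \<in> w \<and> \<gamma> t \<in> w"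
    then have "lf (\<gamma> s) = lf (\<gamma> t)" using lf_eq by metis
    then show False using ne[of s t] ne[of t s] st(1-3) by (metis linorder_neqE_linordered_idom)
  qed
  moreover have "z \<in> \<gamma> ` {0..<1}" using C(2) by (intro image_eqI[of _ _ 0]) (auto simp: \<gamma>_def)
  ultimately show ?thesis unfolding admits_cross_section_def using z by blast
qed

theorem theorem4p2:
  fixes Z :: "'a topology" and \<Delta> :: "'a set set"
  assumes "surface_with_boundary Z"
    and "foliation Z \<Delta>"
    and "\<forall>C\<in>connected_components_of (subtopology Z (manifold_boundary Z)). C \<in> \<Delta>"
    and "\<forall>\<omega>\<in>\<Delta>. subtopology Z \<omega> homeomorphic_space euclideanreal \<and> closedin Z \<omega>"
    and "locally_finite_in Z (singular_leaves Z \<Delta>)"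
    and "\<forall>\<omega>\<in>\<Delta>. \<omega> \<subseteq> manifold_interior Z \<longrightarrow> admits_cross_section Z \<Delta> \<omega>"
  shows "(\<forall>\<omega>\<in>\<Delta>. \<omega> \<subseteq> manifold_boundary Z \<longrightarrow> admits_cross_section Z \<Delta> \<omega>) \<and>
         striped_surface Z \<Delta>"
proof -
  let ?B = "manifold_boundary Z"
  \<comment> \<open>Boundary leaves are included even when they are regular: then ribbons are needed
    at interior leaves only, and every half disc is centred on a leaf of the family.\<close>
  let ?Sp = "singular_leaves Z \<Delta> \<union> {\<omega> \<in> \<Delta>. \<omega> \<subseteq> ?B}"
  interpret foliated_surface Z \<Delta> ?B by (rule foliation_foliated_surface[OF assms(1,2,4)])
  have Sp: "?Sp \<subseteq> \<Delta>" by (auto simp: singular_leaves_def)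
  have lf: "locally_finite_in Z ?Sp"
    by (rule locally_finite_in_Un[OF assms(5) boundary_leaves_locally_finite[OF refl]])
  interpret ribboned_surface Z \<Delta> ?B ?Sp
  proof
    show "?Sp \<subseteq> \<Delta>" by (rule Sp)
    show "locally_finite_in Z ?Sp" by (rule lf)
    show "?B \<subseteq> \<Union>?Sp"
    proof
      fix z assume z: "z \<in> ?B"
      then have "z \<in> topspace (subtopology Z ?B)" by (auto simp: manifold_boundary_def)
      then obtain D where D: "D \<in> connected_components_of (subtopology Z ?B)" "z \<in> D"
        unfolding Union_connected_components_of[symmetric] by blast
      then have "D \<in> \<Delta>" "D \<subseteq> ?B" using assms(3) connected_components_of_subset[OF D(1)] by auto
      then show "z \<in> \<Union>?Sp" using D(2) by blast
    qed
    fix \<omega> assume \<omega>: "\<omega> \<in> \<Delta> - ?Sp"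
    then have reg: "regular_leaf Z \<Delta> \<omega>" "\<not> \<omega> \<subseteq> ?B" by (auto simp: singular_leaves_def)
    have "\<exists>U (h :: 'a => real \<times> real). U \<subseteq> topspace Z \<and> saturated \<Delta> U \<and> \<omega> \<subseteq> Z interior_of U \<and>
      homeomorphic_map (subtopology Z (Z closure_of U)) (top_of_set (UNIV \<times> {-1..1})) h \<and> h ` U = UNIV \<times> {-1<..<1} \<and>
      (\<lambda>C. h ` C) ` induced_partition Z \<Delta> (Z closure_of U) = {UNIV \<times> {t} | t. t \<in> {-1..1}} \<and> h ` \<omega> = UNIV \<times> {0}"
      using reg(1) unfolding regular_leaf_def using reg(2) by argo
    then obtain U and h :: "'a => real \<times> real" where U: "U \<subseteq> topspace Z" "saturated \<Delta> U" "\<omega> \<subseteq> Z interior_of U"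
      "homeomorphic_map (subtopology Z (Z closure_of U)) (top_of_set (UNIV \<times> {-1..1})) h" "h ` U = UNIV \<times> {-1<..<1}"
      "(\<lambda>C. h ` C) ` induced_partition Z \<Delta> (Z closure_of U) = {UNIV \<times> {t} | t. t \<in> {-1..1}}" "h ` \<omega> = UNIV \<times> {0}"
      by (elim exE conjE) (rule that)
    obtain k where "ribbon Z \<Delta> k" "k ` (UNIV \<times> {0}) = \<omega>" using regular_ribbon[OF U] by blast
    then show "\<exists>k. ribbon Z (\<Delta> - ?Sp) k \<and> k ` (UNIV \<times> {0}) = \<omega>" by (rule ribbon_shrink[OF Sp lf \<omega>])
  qed
  show ?thesis by (intro conjI ballI impI boundary_cross_section[OF refl] striped)
qed

end
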